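(* Let $k$ be a field, $n\ge 1$ an integer, $R=k\langle x_0,\ldots,x_n\rangle$ the free algebra graded by $\deg x_i=1$, and $\mathsf{coh}\,\mathbb{X}^n:=\mathsf{qgr}\,R$. Then: (1) There are no indecomposable objects in $\mathsf{coh}\,\mathbb{X}^n$, hence no simple objects, and therefore no noetherian objects other than $0$. (2) Every short exact sequence in $\mathsf{coh}\,\mathbb{X}^n$ splits. (3) Every object in $\mathsf{coh}\,\mathbb{X}^n$ is isomorphic to a finite direct sum of various $\mathcal{O}(i)$'s ($i\in\mathbb{Z}$) with finite multiplicities. (4) If $\mathcal{F},\mathcal{G}\in\mathsf{coh}\,\mathbb{X}^n$ are non-zero, then $\dim_k\operatorname{Hom}(\mathcal{F},\mathcal{G})=\infty$. (5) The Grothendieck group of the abelian category $\mathsf{coh}\,\mathbb{X}^n$ is isomorphic to $\mathbb{Z}\big[\frac{1}{n+1}\big]$ as an additive group.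
   Context: $\mathsf{Gr}\,R$ is the category of $\mathbb{Z}$-graded left $R$-modules with degree-preserving homomorphisms; $\mathsf{Fdim}\,R$ is its full subcategory of direct limits (unions) of finite-dimensional graded modules; $\mathsf{QGr}\,R:=\mathsf{Gr}\,R/\mathsf{Fdim}\,R$ with quotient functor $\pi^*$. $\mathsf{gr}\,R$ is the abelian category of finitely presented graded left $R$-modules, $\mathsf{fdim}\,R=\mathsf{Fdim}\,R\cap\mathsf{gr}\,R$, and $\mathsf{qgr}\,R:=\mathsf{gr}\,R/\mathsf{fdim}\,R$, identified with the full subcategory of finitely presented objects of $\mathsf{QGr}\,R$. $\mathcal{O}:=\pi^*R$. The twist $M\mapsto M(i)$ on $\mathsf{Gr}\,R$, $M(i)_j:=M_{i+j}$ with the same $R$-action, induces a twist $\mathcal{F}\mapsto\mathcal{F}(i)$ on $\mathsf{QGr}\,R$; $\mathcal{O}(i)=\pi^*(R(i))$. Indecomposable objects are non-zero by convention. *)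

theory Defs
  imports
    "HOL-Library.Poly_Mapping"
    "HOL-Library.FuncSet"
    "HOL-Algebra.Module"
    "HOL-Algebra.AbelCoset"
    "HOL-Algebra.Generated_Groups"
    "HOL-Algebra.Free_Abelian_Groups"
begin

section \<open>Linear categories\<close>

text \<open>
  A category enriched in \<open>'k\<close>-modules. \<open>Comp C X Y Z g f\<close> is the composite of
  \<open>f : X \<rightarrow> Y\<close> and \<open>g : Y \<rightarrow> Z\<close>. Of the record \<open>Hom C X Y\<close> only the carrier, \<open>zero\<close>,
  \<open>add\<close> and \<open>smult\<close> are meaningful.
\<close>

record ('k, 'o, 'a) lincat =
  Ob :: "'o set"
  Hom :: "'o \<Rightarrow> 'o \<Rightarrow> ('k, 'a) module"
  Ident :: "'o \<Rightarrow> 'a"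
  Comp :: "'o \<Rightarrow> 'o \<Rightarrow> 'o \<Rightarrow> 'a \<Rightarrow> 'a \<Rightarrow> 'a"

definition mor :: "('k, 'o, 'a) lincat \<Rightarrow> 'o \<Rightarrow> 'o \<Rightarrow> 'a set" where
  "mor C X Y = carrier (Hom C X Y)"

definition is_zero_object :: "('k, 'o, 'a) lincat \<Rightarrow> 'o \<Rightarrow> bool" where
  "is_zero_object C Z \<longleftrightarrow> Z \<in> Ob C \<and>
     (\<forall>X \<in> Ob C. (\<exists>!f. f \<in> mor C X Z) \<and> (\<exists>!f. f \<in> mor C Z X))"

definition is_monic :: "('k, 'o, 'a) lincat \<Rightarrow> 'o \<Rightarrow> 'o \<Rightarrow> 'a \<Rightarrow> bool" where
  "is_monic C X Y f \<longleftrightarrow> f \<in> mor C X Y \<and>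
     (\<forall>T \<in> Ob C. \<forall>u \<in> mor C T X. \<forall>v \<in> mor C T X.
        Comp C T X Y f u = Comp C T X Y f v \<longrightarrow> u = v)"

definition is_isomorphism :: "('k, 'o, 'a) lincat \<Rightarrow> 'o \<Rightarrow> 'o \<Rightarrow> 'a \<Rightarrow> bool" where
  "is_isomorphism C X Y f \<longleftrightarrow> f \<in> mor C X Y \<and>
     (\<exists>g \<in> mor C Y X. Comp C X Y X g f = Ident C X \<and> Comp C Y X Y f g = Ident C Y)"

definition isomorphic :: "('k, 'o, 'a) lincat \<Rightarrow> 'o \<Rightarrow> 'o \<Rightarrow> bool" where
  "isomorphic C X Y \<longleftrightarrow> (\<exists>f. is_isomorphism C X Y f)"

definition is_kernel :: "('k, 'o, 'a) lincat \<Rightarrow> 'o \<Rightarrow> 'o \<Rightarrow> 'o \<Rightarrow> 'a \<Rightarrow> 'a \<Rightarrow> bool" where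
  "is_kernel C K X Y i f \<longleftrightarrow>
     i \<in> mor C K X \<and> f \<in> mor C X Y \<and> Comp C K X Y f i = \<zero>\<^bsub>Hom C K Y\<^esub> \<and>
     (\<forall>T \<in> Ob C. \<forall>u \<in> mor C T X. Comp C T X Y f u = \<zero>\<^bsub>Hom C T Y\<^esub> \<longrightarrow>
        (\<exists>!v. v \<in> mor C T K \<and> Comp C T K X i v = u))"

definition is_cokernel :: "('k, 'o, 'a) lincat \<Rightarrow> 'o \<Rightarrow> 'o \<Rightarrow> 'o \<Rightarrow> 'a \<Rightarrow> 'a \<Rightarrow> bool" where
  "is_cokernel C X Y Q f q \<longleftrightarrow>
     f \<in> mor C X Y \<and> q \<in> mor C Y Q \<and> Comp C X Y Q q f = \<zero>\<^bsub>Hom C X Q\<^esub> \<and>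
     (\<forall>T \<in> Ob C. \<forall>u \<in> mor C Y T. Comp C X Y T u f = \<zero>\<^bsub>Hom C X T\<^esub> \<longrightarrow>
        (\<exists>!v. v \<in> mor C Q T \<and> Comp C Y Q T v q = u))"

definition short_exact :: "('k, 'o, 'a) lincat \<Rightarrow> 'o \<Rightarrow> 'o \<Rightarrow> 'o \<Rightarrow> 'a \<Rightarrow> 'a \<Rightarrow> bool" where
  "short_exact C X Y Z f g \<longleftrightarrow> X \<in> Ob C \<and> Y \<in> Ob C \<and> Z \<in> Ob C \<and>
     is_kernel C X Y Z f g \<and> is_cokernel C X Y Z f g"

definition splits :: "('k, 'o, 'a) lincat \<Rightarrow> 'o \<Rightarrow> 'o \<Rightarrow> 'o \<Rightarrow> 'a \<Rightarrow> 'a \<Rightarrow> bool" where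
  "splits C X Y Z f g \<longleftrightarrow>
     (\<exists>r \<in> mor C Y X. \<exists>s \<in> mor C Z Y.
        Comp C X Y X r f = Ident C X \<and> Comp C Z Y Z g s = Ident C Z \<and>
        Comp C Y X Y f r \<oplus>\<^bsub>Hom C Y Y\<^esub> Comp C Y Z Y s g = Ident C Y)"

text \<open>\<open>X\<close> is a biproduct of the objects in the list \<open>Ys\<close>; for \<open>Ys = []\<close>, a zero object.\<close>

definition is_direct_sum :: "('k, 'o, 'a) lincat \<Rightarrow> 'o list \<Rightarrow> 'o \<Rightarrow> bool" where
  "is_direct_sum C Ys X \<longleftrightarrow> X \<in> Ob C \<and> set Ys \<subseteq> Ob C \<and>
     (\<exists>\<iota> p. (\<forall>i < length Ys. \<iota> i \<in> mor C (Ys ! i) X \<and> p i \<in> mor C X (Ys ! i)) \<and>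
        (\<forall>i < length Ys. \<forall>j < length Ys.
           Comp C (Ys ! i) X (Ys ! j) (p j) (\<iota> i) =
             (if i = j then Ident C (Ys ! i) else \<zero>\<^bsub>Hom C (Ys ! i) (Ys ! j)\<^esub>)) \<and>
        finsum (Hom C X X) (\<lambda>i. Comp C X (Ys ! i) X (\<iota> i) (p i)) {..<length Ys} = Ident C X)"

definition indecomposable :: "('k, 'o, 'a) lincat \<Rightarrow> 'o \<Rightarrow> bool" where
  "indecomposable C X \<longleftrightarrow> X \<in> Ob C \<and> \<not> is_zero_object C X \<and>
     (\<forall>Y Z. is_direct_sum C [Y, Z] X \<longrightarrow> is_zero_object C Y \<or> is_zero_object C Z)"

definition simple_object :: "('k, 'o, 'a) lincat \<Rightarrow> 'o \<Rightarrow> bool" where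
  "simple_object C X \<longleftrightarrow> X \<in> Ob C \<and> \<not> is_zero_object C X \<and>
     (\<forall>Y \<in> Ob C. \<forall>f. is_monic C Y X f \<longrightarrow> is_zero_object C Y \<or> is_isomorphism C Y X f)"

text \<open>Inclusion of subobjects of \<open>X\<close>, each represented by a monomorphism into \<open>X\<close>.\<close>

definition subobject_le ::
    "('k, 'o, 'a) lincat \<Rightarrow> 'o \<Rightarrow> 'o \<times> 'a \<Rightarrow> 'o \<times> 'a \<Rightarrow> bool" where
  "subobject_le C X = (\<lambda>(Y, f) (Z, g). \<exists>h \<in> mor C Y Z. Comp C Y Z X g h = f)"

definition noetherian_object :: "('k, 'o, 'a) lincat \<Rightarrow> 'o \<Rightarrow> bool" where
  "noetherian_object C X \<longleftrightarrow> X \<in> Ob C \<and>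
     (\<forall>U :: nat \<Rightarrow> 'o \<times> 'a.
        (\<forall>i. fst (U i) \<in> Ob C \<and> is_monic C (fst (U i)) X (snd (U i)) \<and>
             subobject_le C X (U i) (U (Suc i))) \<longrightarrow>
        (\<exists>N. \<forall>i \<ge> N. subobject_le C X (U (Suc i)) (U i)))"

text \<open>
  The Grothendieck group, generated by all objects. Isomorphic objects \<open>X, Y\<close> have the same class
  because of the exact sequences \<open>0 \<rightarrow> X \<rightarrow> Y \<rightarrow> 0 \<rightarrow> 0\<close>.
\<close>

definition grothendieck_group :: "('k, 'o, 'a) lincat \<Rightarrow> ('o \<Rightarrow>\<^sub>0 int) set monoid" where
  "grothendieck_group C =
     free_Abelian_group (Ob C) Mod
       generate (free_Abelian_group (Ob C))
         {frag_of Y - frag_of X - frag_of Z | X Y Z f g. short_exact C X Y Z f g}"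


section \<open>Quotient of an abelian category by a Serre subcategory\<close>

text \<open>
  The quotient of \<open>C\<close> by the Serre subcategory on the objects \<open>S\<close>, realised as the category of
  (right) fractions that inverts the morphisms with kernel and cokernel in \<open>S\<close>. It has the same
  objects as \<open>C\<close>, so that the quotient functor is the identity on objects. A morphism from \<open>X\<close> to
  \<open>Y\<close> is a class of roofs \<open>X \<leftarrow> W \<rightarrow> Y\<close> whose left leg is inverted.
\<close>

definition inverted :: "('k, 'o, 'a) lincat \<Rightarrow> 'o set \<Rightarrow> 'o \<Rightarrow> 'o \<Rightarrow> 'a \<Rightarrow> bool" where
  "inverted C S X Y s \<longleftrightarrow> s \<in> mor C X Y \<and>
     (\<exists>K \<in> S. \<exists>i. is_kernel C K X Y i s) \<and> (\<exists>Q \<in> S. \<exists>q. is_cokernel C X Y Q s q)"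

type_synonym ('o, 'a) roof = "'o \<times> 'a \<times> 'a"

definition roofs :: "('k, 'o, 'a) lincat \<Rightarrow> 'o set \<Rightarrow> 'o \<Rightarrow> 'o \<Rightarrow> ('o, 'a) roof set" where
  "roofs C S X Y = {(W, s, f). W \<in> Ob C \<and> inverted C S W X s \<and> f \<in> mor C W Y}"

definition roof_rel ::
    "('k, 'o, 'a) lincat \<Rightarrow> 'o set \<Rightarrow> 'o \<Rightarrow> 'o \<Rightarrow> (('o, 'a) roof \<times> ('o, 'a) roof) set" where
  "roof_rel C S X Y =
     {((W, s, f), (W', s', f')).
        (W, s, f) \<in> roofs C S X Y \<and> (W', s', f') \<in> roofs C S X Y \<and>
        (\<exists>V \<in> Ob C. \<exists>u \<in> mor C V W. \<exists>u' \<in> mor C V W'.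
           Comp C V W X s u = Comp C V W' X s' u' \<and>
           Comp C V W Y f u = Comp C V W' Y f' u' \<and>
           inverted C S V X (Comp C V W X s u))}"

text \<open>
  The operations below are defined on classes by closing the results for all suitable
  representatives under the equivalence. In the sum, the two roofs are brought to a common left leg.
\<close>

definition roof_hom ::
    "('k, 'o, 'a) lincat \<Rightarrow> 'o set \<Rightarrow> 'o \<Rightarrow> 'o \<Rightarrow> ('k, ('o, 'a) roof set) module" where
  "roof_hom C S X Y =
     \<lparr>carrier = roofs C S X Y // roof_rel C S X Y,
      monoid.mult = undefined,
      monoid.one = undefined,
      ring.zero = roof_rel C S X Y `` {(X, Ident C X, \<zero>\<^bsub>Hom C X Y\<^esub>)},
      ring.add = (\<lambda>F G. roof_rel C S X Y ``
               {(W, s, f \<oplus>\<^bsub>Hom C W Y\<^esub> g) | W s f g. (W, s, f) \<in> F \<and> (W, s, g) \<in> G}),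
      smult = (\<lambda>c F. roof_rel C S X Y ``
               {(W, s, c \<odot>\<^bsub>Hom C W Y\<^esub> f) | W s f. (W, s, f) \<in> F})\<rparr>"

text \<open>
  For \<open>X \<leftarrow> W \<rightarrow> Y\<close> and \<open>Y \<leftarrow> V \<rightarrow> Z\<close> choose \<open>W \<leftarrow> U \<rightarrow> V\<close> with inverted left leg such that the
  square over \<open>Y\<close> commutes; the composite is \<open>X \<leftarrow> U \<rightarrow> Z\<close>.
\<close>

definition roof_comp ::
    "('k, 'o, 'a) lincat \<Rightarrow> 'o set \<Rightarrow> 'o \<Rightarrow> 'o \<Rightarrow> 'o \<Rightarrow>
     ('o, 'a) roof set \<Rightarrow> ('o, 'a) roof set \<Rightarrow> ('o, 'a) roof set" where
  "roof_comp C S X Y Z G F =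
     roof_rel C S X Z ``
       {(U, Comp C U W X s u, Comp C U V Z g v) | U u v W s f V t g.
          (W, s, f) \<in> F \<and> (V, t, g) \<in> G \<and> U \<in> Ob C \<and>
          inverted C S U W u \<and> v \<in> mor C U V \<and> Comp C U W Y f u = Comp C U V Y t v}"

definition serre_quotient ::
    "('k, 'o, 'a) lincat \<Rightarrow> 'o set \<Rightarrow> ('k, 'o, ('o, 'a) roof set) lincat" where
  "serre_quotient C S =
     \<lparr>Ob = Ob C,
      Hom = roof_hom C S,
      Ident = (\<lambda>X. roof_rel C S X X `` {(X, Ident C X, Ident C X)}),
      Comp = roof_comp C S\<rparr>"


section \<open>The free algebra\<close>

datatype 'x fword = Word (letters: "'x list")

instantiation fword :: (type) monoid_add
begin

definition zero_fword :: "'a fword" where "zero_fword = Word []"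

definition plus_fword :: "'a fword \<Rightarrow> 'a fword \<Rightarrow> 'a fword" where
  "plus_fword v w = Word (letters v @ letters w)"

instance
  by standard (simp_all add: zero_fword_def plus_fword_def)

end

text \<open>
  The free associative algebra over \<open>'k\<close> on non-commuting variables indexed by \<open>'x\<close>: the
  convolution algebra of the monoid of words. With \<open>'x\<close> of cardinality \<open>n + 1\<close> this is
  \<open>k\<langle>x\<^sub>0, \<dots>, x\<^sub>n\<rangle>\<close>.
\<close>

type_synonym ('x, 'k) free_algebra = "'x fword \<Rightarrow>\<^sub>0 'k"

definition scalar :: "'k::field \<Rightarrow> ('x, 'k) free_algebra" where
  "scalar c = Poly_Mapping.single 0 c"

definition homogeneous :: "int \<Rightarrow> ('x, 'k::field) free_algebra set" where
  "homogeneous d = {f. \<forall>w \<in> Poly_Mapping.keys f. int (length (letters w)) = d}"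


section \<open>Graded modules over the free algebra\<close>

record ('r, 'm) gmodule = "('r, 'm) module" +
  grade :: "int \<Rightarrow> 'm set"

locale graded_module = abelian_group M
  for M :: "(('x, 'k::field) free_algebra, 'm) gmodule" (structure) +
  assumes smult_closed: "x \<in> carrier M \<Longrightarrow> a \<odot> x \<in> carrier M"
    and smult_l_distr: "x \<in> carrier M \<Longrightarrow> (a + b) \<odot> x = a \<odot> x \<oplus> b \<odot> x"
    and smult_r_distr: "x \<in> carrier M \<Longrightarrow> y \<in> carrier M \<Longrightarrow> a \<odot> (x \<oplus> y) = a \<odot> x \<oplus> a \<odot> y"
    and smult_assoc: "x \<in> carrier M \<Longrightarrow> (a * b) \<odot> x = a \<odot> (b \<odot> x)"
    and smult_one: "x \<in> carrier M \<Longrightarrow> 1 \<odot> x = x"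
    and grade_subgroup: "additive_subgroup (grade M i) M"
    and grade_decomposition: "x \<in> carrier M \<Longrightarrow>
      \<exists>!c :: int \<Rightarrow> 'm. (\<forall>i. c i \<in> grade M i) \<and> finite {i. c i \<noteq> \<zero>} \<and>
        x = (\<Oplus>i \<in> {i. c i \<noteq> \<zero>}. c i)"
    and smult_grade: "a \<in> homogeneous i \<Longrightarrow> x \<in> grade M j \<Longrightarrow> a \<odot> x \<in> grade M (i + j)"

definition graded_hom ::
    "(('x, 'k::field) free_algebra, 'm) gmodule \<Rightarrow> (('x, 'k) free_algebra, 'l) gmodule \<Rightarrow>
     ('m \<Rightarrow> 'l) set" where
  "graded_hom M N = {f \<in> carrier M \<rightarrow>\<^sub>E carrier N.
     (\<forall>x \<in> carrier M. \<forall>y \<in> carrier M. f (x \<oplus>\<^bsub>M\<^esub> y) = f x \<oplus>\<^bsub>N\<^esub> f y) \<and>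
     (\<forall>a. \<forall>x \<in> carrier M. f (a \<odot>\<^bsub>M\<^esub> x) = a \<odot>\<^bsub>N\<^esub> f x) \<and>
     (\<forall>i. f ` grade M i \<subseteq> grade N i)}"

definition regular_module :: "(('x, 'k::field) free_algebra, ('x, 'k) free_algebra) gmodule" where
  "regular_module =
     \<lparr>carrier = UNIV, monoid.mult = undefined, monoid.one = undefined,
      ring.zero = 0, ring.add = (+), smult = (*), grade = homogeneous\<rparr>"

definition twist :: "int \<Rightarrow> ('r, 'm) gmodule \<Rightarrow> ('r, 'm) gmodule" where
  "twist i M = M\<lparr>grade := (\<lambda>j. grade M (i + j))\<rparr>"

text \<open>The direct sum of the twists \<open>R(e)\<close> for \<open>e\<close> in the list \<open>es\<close>.\<close>

definition free_graded_module ::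
    "int list \<Rightarrow> (('x, 'k::field) free_algebra, nat \<Rightarrow> ('x, 'k) free_algebra) gmodule" where
  "free_graded_module es =
     \<lparr>carrier = {v. \<forall>i \<ge> length es. v i = 0},
      monoid.mult = undefined,
      monoid.one = undefined,
      ring.zero = (\<lambda>i. 0),
      ring.add = (\<lambda>v w i. v i + w i),
      smult = (\<lambda>a v i. a * v i),
      grade = (\<lambda>j. {v. (\<forall>i < length es. v i \<in> grade (twist (es ! i) regular_module) j) \<and>
                       (\<forall>i \<ge> length es. v i = 0)})\<rparr>"

definition finitely_presented :: "(('x, 'k::field) free_algebra, 'm) gmodule \<Rightarrow> bool" where
  "finitely_presented M \<longleftrightarrow>
     (\<exists>es es'. \<exists>\<phi> \<in> graded_hom (free_graded_module es') (free_graded_module es).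
        \<exists>\<psi> \<in> graded_hom (free_graded_module es) M.
          \<psi> ` carrier (free_graded_module es) = carrier M \<and>
          {v \<in> carrier (free_graded_module es). \<psi> v = \<zero>\<^bsub>M\<^esub>} =
            \<phi> ` carrier (free_graded_module es'))"

definition finite_dimensional :: "('k::field, 'm) module \<Rightarrow> bool" where
  "finite_dimensional V \<longleftrightarrow>
     (\<exists>B \<subseteq> carrier V. finite B \<and>
        (\<forall>x \<in> carrier V. \<exists>c :: 'm \<Rightarrow> 'k. x = (\<Oplus>\<^bsub>V\<^esub>b \<in> B. c b \<odot>\<^bsub>V\<^esub> b)))"

definition underlying_space ::
    "(('x, 'k::field) free_algebra, 'm) gmodule \<Rightarrow> ('k, 'm) module" where
  "underlying_space M =
     \<lparr>carrier = carrier M, monoid.mult = undefined, monoid.one = undefined,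
      ring.zero = \<zero>\<^bsub>M\<^esub>, ring.add = ring.add M, smult = (\<lambda>c. smult M (scalar c))\<rparr>"

definition restrict_to :: "('r, 'm) gmodule \<Rightarrow> 'm set \<Rightarrow> ('r, 'm) gmodule" where
  "restrict_to M N = M\<lparr>carrier := N, grade := (\<lambda>i. grade M i \<inter> N)\<rparr>"

definition Fdim :: "(('x, 'k::field) free_algebra, 'm) gmodule set" where
  "Fdim = {M. graded_module M \<and>
     carrier M = \<Union>{N. N \<subseteq> carrier M \<and> graded_module (restrict_to M N) \<and>
                      finite_dimensional (underlying_space (restrict_to M N))}}"


section \<open>The categories gr and qgr\<close>

text \<open>
  The type \<open>'m\<close> plays the role of a universe: the modules are carried by subsets of \<open>'m\<close>. As soon as
  the free algebra itself injects into \<open>'m\<close>, every finitely presented graded module is isomorphic to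
  one of this form, since its cardinality is at most that of the free algebra.
\<close>

definition gr ::
    "('k::field, (('x, 'k) free_algebra, 'm) gmodule, 'm \<Rightarrow> 'm) lincat" where
  "gr =
     \<lparr>Ob = {M. graded_module M \<and> finitely_presented M},
      Hom = (\<lambda>M N.
        \<lparr>carrier = graded_hom M N,
         monoid.mult = undefined,
         monoid.one = undefined,
         ring.zero = (\<lambda>x \<in> carrier M. \<zero>\<^bsub>N\<^esub>),
         ring.add = (\<lambda>f g. \<lambda>x \<in> carrier M. f x \<oplus>\<^bsub>N\<^esub> g x),
         smult = (\<lambda>c f. \<lambda>x \<in> carrier M. scalar c \<odot>\<^bsub>N\<^esub> f x)\<rparr>),
      Ident = (\<lambda>M. \<lambda>x \<in> carrier M. x),
      Comp = (\<lambda>M N P g f. compose (carrier M) g f)\<rparr>"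

definition fdim :: "(('x, 'k::field) free_algebra, 'm) gmodule set" where
  "fdim = Fdim \<inter> Ob gr"

type_synonym ('x, 'k, 'm) qgr_cat =
  "('k, (('x, 'k) free_algebra, 'm) gmodule,
    ((('x, 'k) free_algebra, 'm) gmodule, 'm \<Rightarrow> 'm) roof set) lincat"

definition qgr :: "('x, 'k::field, 'm) qgr_cat" where
  "qgr = serre_quotient gr fdim"

text \<open>The isomorphic copy of \<open>M\<close> whose carrier is the image of \<open>M\<close> under the injection \<open>\<iota>\<close>.\<close>

definition transport :: "('l \<Rightarrow> 'm) \<Rightarrow> ('r, 'l) gmodule \<Rightarrow> ('r, 'm) gmodule" where
  "transport \<iota> M =
     (let \<rho> = inv_into (carrier M) \<iota> in
      \<lparr>carrier = \<iota> ` carrier M,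
       monoid.mult = undefined,
       monoid.one = undefined,
       ring.zero = \<iota> \<zero>\<^bsub>M\<^esub>,
       ring.add = (\<lambda>x y. \<iota> (\<rho> x \<oplus>\<^bsub>M\<^esub> \<rho> y)),
       smult = (\<lambda>a x. \<iota> (a \<odot>\<^bsub>M\<^esub> \<rho> x)),
       grade = (\<lambda>i. \<iota> ` grade M i)\<rparr>)"

text \<open>The object \<open>\<O>(i) = \<pi>\<^sup>*(R(i))\<close>; the quotient functor \<open>\<pi>\<^sup>*\<close> does nothing on objects.\<close>

definition twisted_sheaf ::
    "(('x, 'k::field) free_algebra \<Rightarrow> 'm) \<Rightarrow> int \<Rightarrow> (('x, 'k) free_algebra, 'm) gmodule" where
  "twisted_sheaf \<iota> i = twist i (transport \<iota> regular_module)"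

text \<open>The additive group of \<open>\<int>[1/m]\<close>.\<close>

definition int_localized_at :: "nat \<Rightarrow> rat monoid" where
  "int_localized_at m =
     \<lparr>carrier = {of_int a / of_nat m ^ j | (a :: int) (j :: nat). True},
      monoid.mult = (+), one = 0\<rparr>"

end

theory Submission
  imports Defs "HOL-Library.Function_Algebras" "HOL.Vector_Spaces"
begin

text \<open>
  Let \<open>r = n + 1\<close>. If \<open>M\<close> is finitely presented, then for all large \<open>d\<close> multiplication by the
  variables identifies \<open>r\<close> copies of \<open>M\<^sub>d\<close> with \<open>M\<^sub>d\<^sub>+\<^sub>1\<close>, so that the truncation \<open>M\<^sub>\<ge>\<^sub>d\<close> is free on
  a basis of \<open>M\<^sub>d\<close>, and a homomorphism from it is a linear map on \<open>M\<^sub>d\<close>. A morphism with finite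
  dimensional kernel and cokernel is bijective in high degrees, and the inclusion of \<open>M\<^sub>\<ge>\<^sub>d\<close> in \<open>M\<close>
  is inverted. Hence a morphism \<open>M \<rightarrow> N\<close> of the quotient category is a germ, for \<open>d \<rightarrow> \<infinity>\<close>, of matrices
  \<open>M\<^sub>d \<rightarrow> N\<^sub>d\<close>, where every matrix at a large degree \<open>d\<close> occurs and determines the germ, and where
  the dimensions satisfy \<open>dim M\<^sub>d\<^sub>+\<^sub>1 = r dim M\<^sub>d\<close>.

  The theorem is then linear algebra. Matrices are von Neumann regular, so exact sequences split. An
  object of dimension \<open>a\<close> in degree \<open>d\<close> is a sum of \<open>a\<close> copies of \<open>\<O>(-d)\<close>; as \<open>a\<close> grows with \<open>d\<close>, every
  non-zero object is a sum of two non-zero objects, and the spaces of morphisms are infinite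
  dimensional. The class of \<open>M\<close> in the Grothendieck group is determined by the number
  \<open>dim M\<^sub>d / r\<^sup>d\<close>, which does not depend on \<open>d\<close> and takes all non-negative values in \<open>\<int>[1/r]\<close>.
\<close>

section \<open>The free algebra\<close>

text \<open>Stability rests on the fact that a non-empty word has exactly one first letter: the part
  of \<open>R\<close> in positive degrees is the direct sum of the \<open>x_a R\<close>. This
  settles free modules. For a finite presentation the first letters are stripped from the
  coefficients of a relation, which is possible above the degrees of all generators and relations.
  Two obstacles shape the rest. Morphisms are classes of roofs, and the kernels and cokernels of an
  inverted map are given by their universal properties inside \<open>gr\<close> only. What they say
  about elements is extracted by probing them with two test objects, a twist of \<open>R\<close> and
  the quotient by the image. Moreover, all objects must be carried by the one type
  \<open>'m\<close>, so every module that the proof constructs has to be realised there. The linear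
  algebra takes place in an abstract category whose morphisms have matrices in all large degrees. An
  identity between finitely many morphisms is checked in one common degree. That a matrix in degree
  \<open>d\<close> is determined by its germ is again stability: an element of degree at least
  \<open>d\<close> that is killed by all variables is zero.\<close>

definition xvar :: "'x \<Rightarrow> ('x, 'k::field) free_algebra" where
  "xvar a = Poly_Mapping.single (Word [a]) 1"

text \<open>Reads off the words that begin with \<open>a\<close> and deletes that letter: the left
  inverse of multiplication by \<open>xvar a\<close> that kills \<open>xvar b * p\<close> for every
  other variable \<open>b\<close>.\<close>

definition strip :: "'x \<Rightarrow> ('x, 'k::field) free_algebra \<Rightarrow> ('x, 'k) free_algebra" where
  "strip a p = Poly_Mapping.map_key (\<lambda>w. Word (a # letters w)) p"

definition hcomp :: "int \<Rightarrow> ('x, 'k::field) free_algebra \<Rightarrow> ('x, 'k) free_algebra" where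
  "hcomp i p = Poly_Mapping.mapp (\<lambda>w c. if int (length (letters w)) = i then c else 0) p"

lemma Word_plus [simp]: "Word u + Word v = Word (u @ v)"
  by (simp add: plus_fword_def)

lemma letters_plus [simp]: "letters (u + v) = letters u @ letters v"
  by (simp add: plus_fword_def)

lemma letters_zero [simp]: "letters 0 = []"
  by (simp add: zero_fword_def)

lemma Word_Nil: "Word [] = 0"
  by (simp add: zero_fword_def)

lemma lookup_strip: "Poly_Mapping.lookup (strip a p) w = Poly_Mapping.lookup p (Word (a # letters w))"
proof -
  have "inj (\<lambda>w. Word (a # letters w))"
    by (auto simp: inj_def fword.expand)
  then show ?thesis
    by (simp add: strip_def map_key.rep_eq)
qed

lemma lookup_hcomp: "Poly_Mapping.lookup (hcomp i p) w = (if int (length (letters w)) = i then Poly_Mapping.lookup p w else 0)"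
  by (simp add: hcomp_def lookup_mapp when_def in_keys_iff)

lemma sum_single_keys:
  "finite A \<Longrightarrow> Poly_Mapping.keys p \<subseteq> A \<Longrightarrow> (\<Sum>w\<in>A. Poly_Mapping.single w (Poly_Mapping.lookup p w)) = (p :: 'a \<Rightarrow>\<^sub>0 'b::comm_monoid_add)"
  by (rule poly_mapping_eqI) (auto simp: lookup_sum lookup_single when_def in_keys_iff)

text \<open>A monomial arises from a scalar by prepending letters, and monomials span. Statements
  about all of \<open>R\<close> thereby reduce to scalars and variables, both of which are
  homogeneous.\<close>

lemma free_algebra_induct [case_names zero add scalar xvar]:
  fixes p :: "('x, 'k::field) free_algebra"
  assumes "P 0" "\<And>p q. P p \<Longrightarrow> P q \<Longrightarrow> P (p + q)" "\<And>c. P (scalar c)" "\<And>a p. P p \<Longrightarrow> P (xvar a * p)"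
  shows "P p"
proof -
  have s: "P (Poly_Mapping.single (Word l) c)" for l c
  proof (induction l)
    case Nil then show ?case using assms(3)[of c] by (simp add: scalar_def Word_Nil)
  next
    case (Cons a l)
    have "xvar a * Poly_Mapping.single (Word l) c = Poly_Mapping.single (Word (a # l)) c"
      by (simp add: xvar_def mult_single)
    then show ?case using assms(4)[OF Cons, of a] by simp
  qed
  have "P (\<Sum>w\<in>A. Poly_Mapping.single w (Poly_Mapping.lookup p w))" if "finite A" for A
    using that
  proof induction
    case (insert w A)
    have "P (Poly_Mapping.single w (Poly_Mapping.lookup p w))" using s[of "letters w"] by simp
    then show ?case using insert assms(2) by simp
  qed (simp add: assms(1))
  from this[of "Poly_Mapping.keys p"] show ?thesis
    by (simp add: sum_single_keys)
qed

lemma lookup_single_mult: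
  fixes p :: "('x, 'k::field) free_algebra"
  shows "Poly_Mapping.lookup (Poly_Mapping.single v c * p) w =
    (\<Sum>u\<in>Poly_Mapping.keys p. (c * Poly_Mapping.lookup p u when v + u = w))"
proof -
  have "Poly_Mapping.single v c * p =
      Poly_Mapping.single v c * (\<Sum>u\<in>Poly_Mapping.keys p. Poly_Mapping.single u (Poly_Mapping.lookup p u))"
    by (simp add: sum_single_keys)
  then show ?thesis by (simp add: sum_distrib_left mult_single lookup_sum lookup_single)
qed

lemma lookup_xvar_mult: "Poly_Mapping.lookup (xvar a * p) w =
    (case letters w of [] \<Rightarrow> 0 | b # u \<Rightarrow> if a = b then Poly_Mapping.lookup p (Word u) else 0)"
proof (cases w)
  case (Word l)
  show ?thesis
  proof (cases l)
    case Nil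
    then show ?thesis
      by (auto simp: Word xvar_def lookup_single_mult when_def plus_fword_def intro!: sum.neutral)
  next
    case (Cons b u)
    have "(Word [a] + v = Word (b # u)) = (a = b \<and> v = Word u)" for v
      by (cases v) auto
    then show ?thesis
      by (auto simp: Word Cons xvar_def lookup_single_mult when_def in_keys_iff)
  qed
qed

lemma strip_xvar_mult: "strip a (xvar b * p) = (if a = b then p else 0)"
  by (rule poly_mapping_eqI) (auto simp: lookup_strip lookup_xvar_mult)

lemma strip_add: "strip a (p + q) = strip a p + strip a q"
  by (rule poly_mapping_eqI) (auto simp: lookup_strip lookup_add)

lemma strip_zero [simp]: "strip a 0 = 0"
  by (rule poly_mapping_eqI) (auto simp: lookup_strip)

lemma strip_sum: "strip a (sum f A) = (\<Sum>i\<in>A. strip a (f i))"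
  by (induction A rule: infinite_finite_induct) (auto simp: strip_add)

lemma strip_sum_xvar:
  "strip b (\<Sum>a\<in>UNIV. xvar a * (f (a::'x::finite) :: ('x, 'k::field) free_algebra)) = f b"
  by (simp add: strip_sum strip_xvar_mult)

lemma scalar_add: "scalar (a + b) = scalar a + scalar b"
  by (simp add: scalar_def single_add)
lemma scalar_uminus: "scalar (- a) = - scalar a"
  by (simp add: scalar_def single_uminus)
lemma scalar_zero [simp]: "scalar 0 = 0"
  by (simp add: scalar_def)
lemma scalar_one [simp]: "scalar 1 = 1"
  by (simp add: scalar_def)
lemma scalar_mult: "scalar (a * b) = scalar a * scalar b"
  by (simp add: scalar_def mult_single)

lemma scalar_commute: "scalar c * p = p * scalar c"
proof (induction p rule: free_algebra_induct)
  case (xvar a p)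
  have "scalar c * xvar a = xvar a * scalar c"
    by (simp add: scalar_def xvar_def mult_single)
  then have "scalar c * (xvar a * p) = xvar a * (scalar c * p)"
    by (simp flip: mult.assoc)
  then show ?case using xvar by (simp add: mult.assoc)
qed (auto simp: distrib_left distrib_right scalar_def mult_single mult.commute)

lemma homogeneousI: "(\<And>w. Poly_Mapping.lookup p w \<noteq> 0 \<Longrightarrow> int (length (letters w)) = d) \<Longrightarrow> p \<in> homogeneous d"
  by (auto simp: homogeneous_def in_keys_iff)

lemma homogeneousD: "p \<in> homogeneous d \<Longrightarrow> Poly_Mapping.lookup p w \<noteq> 0 \<Longrightarrow> int (length (letters w)) = d"
  by (auto simp: homogeneous_def in_keys_iff)

lemma homogeneous_zero [simp]: "0 \<in> homogeneous d"
  by (simp add: homogeneous_def)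

lemma homogeneous_add: "p \<in> homogeneous d \<Longrightarrow> q \<in> homogeneous d \<Longrightarrow> p + q \<in> homogeneous d"
  using keys_add[of p q] by (auto simp: homogeneous_def)

lemma homogeneous_uminus: "p \<in> homogeneous d \<Longrightarrow> - p \<in> homogeneous d"
  by (rule homogeneousI) (auto dest: homogeneousD)

lemma homogeneous_mult: "p \<in> homogeneous d \<Longrightarrow> q \<in> homogeneous e \<Longrightarrow> p * q \<in> homogeneous (d + e)"
  using keys_mult[of p q] by (fastforce simp: homogeneous_def)

lemma homogeneous_scalar [simp]: "scalar c \<in> homogeneous 0"
  by (auto simp: homogeneous_def scalar_def)

lemma homogeneous_one [simp]: "1 \<in> homogeneous 0"
  using homogeneous_scalar[of 1] by simp

lemma homogeneous_xvar [simp]: "xvar a \<in> homogeneous 1"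
  by (auto simp: homogeneous_def xvar_def)

lemma homogeneous_neg: "p \<in> homogeneous d \<Longrightarrow> d < 0 \<Longrightarrow> p = 0"
  by (rule poly_mapping_eqI) (fastforce dest: homogeneousD)

lemma homogeneous_0_scalar: "p \<in> homogeneous 0 \<Longrightarrow> p = scalar (Poly_Mapping.lookup p 0)"
proof (rule poly_mapping_eqI)
  fix w assume "p \<in> homogeneous 0"
  show "Poly_Mapping.lookup p w = Poly_Mapping.lookup (scalar (Poly_Mapping.lookup p 0)) w"
  proof (cases "w = 0")
    case False
    then have "letters w \<noteq> []" by (metis fword.collapse Word_Nil)
    then have "Poly_Mapping.lookup p w = 0" using \<open>p \<in> homogeneous 0\<close> homogeneousD by fastforce
    then show ?thesis using False by (simp add: scalar_def lookup_single)
  qed (simp add: scalar_def)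
qed

lemma homogeneous_strip: "p \<in> homogeneous d \<Longrightarrow> strip a p \<in> homogeneous (d - 1)"
  by (rule homogeneousI) (auto simp: lookup_strip dest!: homogeneousD)

text \<open>Every word of positive length has one first letter. The bound on \<open>d\<close>
  excludes the empty word, the only word that stripping loses.\<close>

lemma sum_xvar_strip:
  fixes p :: "('x::finite, 'k::field) free_algebra"
  assumes "p \<in> homogeneous d" "d \<ge> 1"
  shows "(\<Sum>a\<in>UNIV. xvar a * strip a p) = p"
proof (rule poly_mapping_eqI)
  fix w
  show "Poly_Mapping.lookup (\<Sum>a\<in>UNIV. xvar a * strip a p) w = Poly_Mapping.lookup p w"
  proof (cases "letters w")
    case Nil
    then have "Poly_Mapping.lookup p w = 0" using assms homogeneousD[OF assms(1), of w] by force
    then show ?thesis using Nil by (simp add: lookup_sum lookup_xvar_mult)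
  next
    case (Cons b u)
    then have "Word (b # u) = w" by (metis fword.collapse)
    then show ?thesis using Cons by (simp add: lookup_sum lookup_xvar_mult lookup_strip)
  qed
qed

lemma homogeneous_hcomp: "hcomp i p \<in> homogeneous i"
  by (rule homogeneousI) (auto simp: lookup_hcomp split: if_splits)

lemma hcomp_add: "hcomp i (p + q) = hcomp i p + hcomp i q"
  by (rule poly_mapping_eqI) (auto simp: lookup_hcomp lookup_add)

lemma hcomp_zero [simp]: "hcomp i 0 = 0"
  by (rule poly_mapping_eqI) (auto simp: lookup_hcomp)

lemma hcomp_homogeneous: "p \<in> homogeneous j \<Longrightarrow> hcomp i p = (if i = j then p else 0)"
  by (rule poly_mapping_eqI) (auto simp: lookup_hcomp dest: homogeneousD)

lemma finite_hcomp: "finite {i. hcomp i p \<noteq> 0}"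
proof (rule finite_subset)
  show "{i. hcomp i p \<noteq> 0} \<subseteq> (\<lambda>w. int (length (letters w))) ` Poly_Mapping.keys p"
  proof
    fix i assume "i \<in> {i. hcomp i p \<noteq> 0}"
    then have "hcomp i p \<noteq> 0" by simp
    then obtain w where "Poly_Mapping.lookup (hcomp i p) w \<noteq> 0" unfolding poly_mapping_eq_iff fun_eq_iff by auto
    then show "i \<in> (\<lambda>w. int (length (letters w))) ` Poly_Mapping.keys p"
      by (auto simp: lookup_hcomp in_keys_iff split: if_splits)
  qed
qed simp

lemma sum_hcomp: "finite A \<Longrightarrow> {i. hcomp i p \<noteq> 0} \<subseteq> A \<Longrightarrow> (\<Sum>i\<in>A. hcomp i p) = p"
proof (rule poly_mapping_eqI)
  fix w assume A: "finite A" "{i. hcomp i p \<noteq> 0} \<subseteq> A"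
  have "int (length (letters w)) \<in> A" if "Poly_Mapping.lookup p w \<noteq> 0"
  proof -
    have "Poly_Mapping.lookup (hcomp (int (length (letters w))) p) w \<noteq> 0" using that by (simp add: lookup_hcomp)
    then have "hcomp (int (length (letters w))) p \<noteq> 0" by auto
    then show ?thesis using A by auto
  qed
  then show "Poly_Mapping.lookup (\<Sum>i\<in>A. hcomp i p) w = Poly_Mapping.lookup p w"
    using A(1) by (auto simp: lookup_sum lookup_hcomp)
qed

section \<open>Graded modules\<close>

text \<open>The axiom \<open>grade_decomposition\<close> makes the description unique for
  \<open>x\<close> in the carrier; elsewhere the value is unspecified.\<close>

definition component :: "(('x, 'k::field) free_algebra, 'm) gmodule \<Rightarrow> 'm \<Rightarrow> int \<Rightarrow> 'm" where
  "component M x = (THE c. (\<forall>i. c i \<in> grade M i) \<and> finite {i. c i \<noteq> \<zero>\<^bsub>M\<^esub>} \<and>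
        x = (\<Oplus>\<^bsub>M\<^esub>i \<in> {i. c i \<noteq> \<zero>\<^bsub>M\<^esub>}. c i))"

context graded_module
begin

lemma smult_r_zero [simp]: "a \<odot> \<zero> = \<zero>"
proof -
  have "a \<odot> \<zero> = a \<odot> \<zero> \<oplus> a \<odot> \<zero>" using smult_r_distr[of \<zero> \<zero> a] by simp
  then show ?thesis using smult_closed[of \<zero> a] add.r_cancel_one' by simp
qed

lemma smult_l_zero [simp]: "x \<in> carrier M \<Longrightarrow> 0 \<odot> x = \<zero>"
proof -
  assume x: "x \<in> carrier M"
  have "0 \<odot> x = 0 \<odot> x \<oplus> 0 \<odot> x" using smult_l_distr[of x 0 0] x by simp
  then show ?thesis using smult_closed[of x 0] x add.r_cancel_one' by simp
qed

lemma smult_l_minus: "x \<in> carrier M \<Longrightarrow> (- a) \<odot> x = \<ominus> (a \<odot> x)"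
proof -
  assume x: "x \<in> carrier M"
  have "(- a) \<odot> x \<oplus> a \<odot> x = \<zero>" using smult_l_distr[of x "- a" a] x by simp
  then show ?thesis using smult_closed x by (simp add: minus_equality)
qed

lemma diff_zero_iff: "x \<in> carrier M \<Longrightarrow> y \<in> carrier M \<Longrightarrow> x \<ominus> y = \<zero> \<longleftrightarrow> x = y"
  by (metis a_inv_closed a_minus_def minus_equality minus_minus r_neg)

lemma smult_r_minus: "x \<in> carrier M \<Longrightarrow> a \<odot> (\<ominus> x) = \<ominus> (a \<odot> x)"
proof -
  assume x: "x \<in> carrier M"
  have "a \<odot> (\<ominus> x) \<oplus> a \<odot> x = \<zero>" using smult_r_distr[of "\<ominus> x" x a] x by (simp add: l_neg)
  then show ?thesis using smult_closed x by (simp add: minus_equality)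
qed

lemma smult_r_finsum: "f \<in> A \<rightarrow> carrier M \<Longrightarrow> a \<odot> finsum M f A = (\<Oplus>i\<in>A. a \<odot> f i)"
  by (induction A rule: infinite_finite_induct)
     (auto simp: smult_r_distr finsum_closed smult_closed Pi_def finsum_insert)

lemma smult_l_sum: "x \<in> carrier M \<Longrightarrow> (sum f A) \<odot> x = (\<Oplus>i\<in>A. f i \<odot> x)"
  by (induction A rule: infinite_finite_induct)
     (auto simp: smult_l_distr finsum_closed smult_closed Pi_def finsum_insert)

lemma grade_carrier: "x \<in> grade M i \<Longrightarrow> x \<in> carrier M"
  using additive_subgroup.a_subset[OF grade_subgroup] by blast

lemma grade_zero [simp]: "\<zero> \<in> grade M i"
  using additive_subgroup.zero_closed[OF grade_subgroup] .

lemma grade_add: "x \<in> grade M i \<Longrightarrow> y \<in> grade M i \<Longrightarrow> x \<oplus> y \<in> grade M i"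
  using additive_subgroup.a_closed[OF grade_subgroup] .

lemma grade_a_inv: "x \<in> grade M i \<Longrightarrow> \<ominus> x \<in> grade M i"
  using additive_subgroup.a_inv_closed[OF grade_subgroup] .

lemma grade_minus: "x \<in> grade M i \<Longrightarrow> y \<in> grade M i \<Longrightarrow> x \<ominus> y \<in> grade M i"
  by (simp add: a_minus_def grade_add grade_a_inv)

lemma grade_finsum: "(\<And>j. j \<in> A \<Longrightarrow> f j \<in> grade M i) \<Longrightarrow> finsum M f A \<in> grade M i"
proof (induction A rule: infinite_finite_induct)
  case (insert x A)
  have "f \<in> insert x A \<rightarrow> carrier M" using insert.prems grade_carrier by blast
  then show ?case using insert by (simp add: finsum_insert grade_add Pi_def)
qed auto

lemma grade_scalar: "x \<in> grade M i \<Longrightarrow> scalar c \<odot> x \<in> grade M i"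
  using smult_grade[OF homogeneous_scalar, of x i c] by simp

lemma grade_xvar: "x \<in> grade M i \<Longrightarrow> xvar a \<odot> x \<in> grade M (i + 1)"
  using smult_grade[OF homogeneous_xvar, of x i a] by (simp add: add.commute)

lemma smult_scalar_scalar: "x \<in> carrier M \<Longrightarrow> scalar b \<odot> (scalar c \<odot> x) = scalar (b * c) \<odot> x"
  by (simp add: scalar_mult smult_assoc)

lemma smult_scalar_commute: "x \<in> carrier M \<Longrightarrow> scalar b \<odot> (p \<odot> x) = p \<odot> (scalar b \<odot> x)"
  by (metis scalar_commute smult_assoc)

lemma component_props:
  assumes "x \<in> carrier M"
  shows component_grade: "component M x i \<in> grade M i"
    and component_finite: "finite {i. component M x i \<noteq> \<zero>}"
    and component_sum0: "(\<Oplus>i \<in> {i. component M x i \<noteq> \<zero>}. component M x i) = x"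
  using theI'[OF grade_decomposition[OF assms], folded component_def] by auto

lemma component_carrier: "x \<in> carrier M \<Longrightarrow> component M x i \<in> carrier M"
  using component_grade grade_carrier by blast

lemma finsum_support:
  assumes "finite A" "\<And>i. c i \<in> carrier M" "\<And>i. i \<notin> A \<Longrightarrow> c i = \<zero>"
  shows "(\<Oplus>i \<in> {i. c i \<noteq> \<zero>}. c i) = (\<Oplus>i \<in> A. c i)"
  by (rule add.finprod_mono_neutral_cong_left) (use assms in auto)

lemma component_sum: "x \<in> carrier M \<Longrightarrow> finite A \<Longrightarrow> {i. component M x i \<noteq> \<zero>} \<subseteq> A \<Longrightarrow> (\<Oplus>i\<in>A. component M x i) = x"
  using finsum_support[of A "component M x", symmetric] component_sum0[of x] component_carrier by auto

text \<open>The tool for computing components: to find those of \<open>x\<close> it suffices to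
  exhibit a homogeneous family with sum \<open>x\<close>.\<close>

lemma component_unique:
  assumes "finite A" "\<And>i. c i \<in> grade M i" "\<And>i. i \<notin> A \<Longrightarrow> c i = \<zero>"
  shows "component M (\<Oplus>i\<in>A. c i) = c"
proof -
  let ?x = "\<Oplus>i\<in>A. c i"
  have x: "?x \<in> carrier M" using assms grade_carrier by (auto intro!: finsum_closed)
  have 1: "(\<forall>i. c i \<in> grade M i) \<and> finite {i. c i \<noteq> \<zero>} \<and> ?x = (\<Oplus>i \<in> {i. c i \<noteq> \<zero>}. c i)"
    using assms finsum_support[of A c, symmetric] grade_carrier
    by (auto intro: finite_subset[of _ A])
  show ?thesis
    unfolding component_def by (rule the1_equality[OF grade_decomposition[OF x]]) (rule 1)
qed

lemma component_homogeneous: "x \<in> grade M j \<Longrightarrow> component M x = (\<lambda>i. if i = j then x else \<zero>)"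
  using component_unique[of "{j}" "\<lambda>i. if i = j then x else \<zero>"] grade_carrier[of x j]
  by (auto simp: finsum_insert)

lemma component_zero [simp]: "component M \<zero> i = \<zero>"
  using component_homogeneous[OF grade_zero, of 0] by (cases "i = 0") auto

lemma component_add:
  assumes "x \<in> carrier M" "y \<in> carrier M"
  shows "component M (x \<oplus> y) i = component M x i \<oplus> component M y i"
proof -
  let ?A = "{i. component M x i \<noteq> \<zero>} \<union> {i. component M y i \<noteq> \<zero>}"
  have "(\<Oplus>i\<in>?A. component M x i \<oplus> component M y i) = x \<oplus> y"
    using assms by (subst finsum_addf) (auto simp: component_sum component_finite component_carrier)
  moreover have "component M (\<Oplus>i\<in>?A. component M x i \<oplus> component M y i) = (\<lambda>i. component M x i \<oplus> component M y i)"
    by (rule component_unique) (use assms in \<open>auto simp: component_finite component_grade grade_add\<close>)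
  ultimately show ?thesis by simp
qed

lemma component_finsum:
  assumes "\<And>j. j \<in> A \<Longrightarrow> f j \<in> carrier M"
  shows "component M (finsum M f A) i = (\<Oplus>j\<in>A. component M (f j) i)"
  using assms by (induction A rule: infinite_finite_induct)
    (auto simp: finsum_insert component_add component_carrier Pi_def finsum_closed)

lemma component_smult:
  assumes "x \<in> carrier M" "a \<in> homogeneous e"
  shows "component M (a \<odot> x) i = a \<odot> component M x (i - e)"
proof -
  let ?A = "{i. component M x i \<noteq> \<zero>}" and ?c = "\<lambda>i. a \<odot> component M x (i - e)"
  have inj: "inj_on (\<lambda>i. i + e) ?A" by (auto simp: inj_on_def)
  have "(\<Oplus>i\<in>(\<lambda>i. i + e) ` ?A. ?c i) = (\<Oplus>i\<in>?A. a \<odot> component M x i)"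
    by (subst finsum_reindex[OF _ inj]) (use assms in \<open>auto simp: smult_closed component_carrier\<close>)
  also have "\<dots> = a \<odot> x"
    using assms by (subst smult_r_finsum[symmetric]) (auto simp: component_carrier component_sum0)
  finally have 1: "(\<Oplus>i\<in>(\<lambda>i. i + e) ` ?A. ?c i) = a \<odot> x" .
  have "component M (\<Oplus>i\<in>(\<lambda>i. i + e) ` ?A. ?c i) = ?c"
  proof (rule component_unique)
    fix i
    show "?c i \<in> grade M i"
      using smult_grade[OF assms(2) component_grade[OF assms(1)], of "i - e"] by simp
    assume "i \<notin> (\<lambda>i. i + e) ` ?A"
    then have "i - e \<notin> ?A" by (metis diff_add_cancel imageI)
    then show "?c i = \<zero>" by simp
  qed (use component_finite assms in auto)
  then show ?thesis using 1 by simp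
qed

lemma component_minus:
  "x \<in> carrier M \<Longrightarrow> component M (\<ominus> x) i = \<ominus> component M x i"
  using component_smult[OF _ homogeneous_scalar, of x "-1" i]
  by (simp add: scalar_uminus smult_l_minus smult_one component_carrier)

end

text \<open>The projections \<open>p i\<close> replace the uniqueness clause of the decomposition:
  being additive and correct on homogeneous elements, \<open>p i\<close> recovers the
  \<open>i\<close>-th term of any homogeneous sum. Inverses in a graded piece come from
  multiplication by \<open>-1\<close>, which has degree 0.\<close>

lemma graded_moduleI:
  fixes M :: "(('x, 'k::field) free_algebra, 'm) gmodule" (structure)
  assumes "abelian_group M"
    and "\<And>x a. x \<in> carrier M \<Longrightarrow> a \<odot> x \<in> carrier M"
    and "\<And>x a b. x \<in> carrier M \<Longrightarrow> (a + b) \<odot> x = a \<odot> x \<oplus> b \<odot> x"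
    and "\<And>x y a. x \<in> carrier M \<Longrightarrow> y \<in> carrier M \<Longrightarrow> a \<odot> (x \<oplus> y) = a \<odot> x \<oplus> a \<odot> y"
    and "\<And>x a b. x \<in> carrier M \<Longrightarrow> (a * b) \<odot> x = a \<odot> (b \<odot> x)"
    and "\<And>x. x \<in> carrier M \<Longrightarrow> 1 \<odot> x = x"
    and gc: "\<And>i. grade M i \<subseteq> carrier M"
    and gz: "\<And>i. \<zero> \<in> grade M i"
    and ga: "\<And>i x y. x \<in> grade M i \<Longrightarrow> y \<in> grade M i \<Longrightarrow> x \<oplus> y \<in> grade M i"
    and gs: "\<And>i j a x. a \<in> homogeneous i \<Longrightarrow> x \<in> grade M j \<Longrightarrow> a \<odot> x \<in> grade M (i + j)"
    and p: "\<And>i x. x \<in> carrier M \<Longrightarrow> p i x \<in> grade M i"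
    and pf: "\<And>x. x \<in> carrier M \<Longrightarrow> finite {i. p i x \<noteq> \<zero>}"
    and ps: "\<And>x. x \<in> carrier M \<Longrightarrow> (\<Oplus>i \<in> {i. p i x \<noteq> \<zero>}. p i x) = x"
    and pa: "\<And>i x y. x \<in> carrier M \<Longrightarrow> y \<in> carrier M \<Longrightarrow> p i (x \<oplus> y) = p i x \<oplus> p i y"
    and ph: "\<And>i j x. x \<in> grade M j \<Longrightarrow> p i x = (if i = j then x else \<zero>)"
  shows "graded_module M"
proof -
  interpret abelian_group M by fact
  have inv: "\<ominus> x \<in> grade M i" if "x \<in> grade M i" for x i
  proof -
    have xc: "x \<in> carrier M" using that gc by auto
    have z: "0 \<odot> x = \<zero>"
    proof -
      have "0 \<odot> x = 0 \<odot> x \<oplus> 0 \<odot> x" using assms(3)[OF xc, of 0 0] by simp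
      then show ?thesis using assms(2)[OF xc, of 0] add.r_cancel_one' by simp
    qed
    have "(- 1) \<odot> x \<oplus> x = \<zero>"
      using assms(3)[OF xc, of "-1" 1] assms(6)[OF xc] z by simp
    then have "\<ominus> x = (- 1) \<odot> x" using xc assms(2) by (simp add: minus_equality)
    then show ?thesis using gs[OF homogeneous_uminus[OF homogeneous_one] that] by simp
  qed
  show ?thesis
  proof (rule graded_module.intro[OF assms(1)], rule graded_module_axioms.intro)
    fix i show "additive_subgroup (grade M i) M"
      using gc gz ga inv by (auto simp: additive_subgroup_def subgroup_def a_inv_def[symmetric])
  next
    fix x assume x: "x \<in> carrier M"
    show "\<exists>!c. (\<forall>i. c i \<in> grade M i) \<and> finite {i. c i \<noteq> \<zero>} \<and>
        x = (\<Oplus>i \<in> {i. c i \<noteq> \<zero>}. c i)"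
    proof (rule ex1I[of _ "\<lambda>i. p i x"])
      fix c assume c: "(\<forall>i. c i \<in> grade M i) \<and> finite {i. c i \<noteq> \<zero>} \<and>
        x = (\<Oplus>i \<in> {i. c i \<noteq> \<zero>}. c i)"
      have pfin: "p i (finsum M c A) = (if i \<in> A then c i else \<zero>)" if "finite A" for A i
        using that
      proof induction
        case empty
        then show ?case using ph[OF gz, of i i] by simp
      next
        case (insert j A)
        have cc: "\<And>k. c k \<in> carrier M" using c gc by auto
        have "p i (finsum M c (insert j A)) = p i (c j) \<oplus> p i (finsum M c A)"
          using insert cc by (subst finsum_insert) (auto simp: pa finsum_closed)
        then show ?case using insert ph[of "c j" j i] c cc by auto
      qed
      show "c = (\<lambda>i. p i x)"
        using pfin[of "{i. c i \<noteq> \<zero>}"] c by auto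
    qed (use x p pf ps in auto)
  qed (use assms in auto)
qed

lemma graded_homI:
  assumes "\<And>x. x \<in> carrier M \<Longrightarrow> f x \<in> carrier N"
    and "f \<in> extensional (carrier M)"
    and "\<And>x y. x \<in> carrier M \<Longrightarrow> y \<in> carrier M \<Longrightarrow> f (x \<oplus>\<^bsub>M\<^esub> y) = f x \<oplus>\<^bsub>N\<^esub> f y"
    and "\<And>a x. x \<in> carrier M \<Longrightarrow> f (a \<odot>\<^bsub>M\<^esub> x) = a \<odot>\<^bsub>N\<^esub> f x"
    and "\<And>i x. x \<in> grade M i \<Longrightarrow> f x \<in> grade N i"
  shows "f \<in> graded_hom M N"
  using assms by (auto simp: graded_hom_def PiE_def)

lemma graded_homD:
  assumes "f \<in> graded_hom M N"
  shows hom_carrier: "x \<in> carrier M \<Longrightarrow> f x \<in> carrier N"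
    and hom_ext: "f \<in> extensional (carrier M)"
    and hom_add: "x \<in> carrier M \<Longrightarrow> y \<in> carrier M \<Longrightarrow> f (x \<oplus>\<^bsub>M\<^esub> y) = f x \<oplus>\<^bsub>N\<^esub> f y"
    and hom_smult: "x \<in> carrier M \<Longrightarrow> f (a \<odot>\<^bsub>M\<^esub> x) = a \<odot>\<^bsub>N\<^esub> f x"
    and hom_grade: "x \<in> grade M i \<Longrightarrow> f x \<in> grade N i"
  using assms by (auto simp: graded_hom_def PiE_def image_subset_iff)

lemma hom_eqI:
  assumes "f \<in> graded_hom M N" "g \<in> graded_hom M N'" "\<And>x. x \<in> carrier M \<Longrightarrow> f x = g x"
  shows "f = g"
  using assms by (meson extensionalityI hom_ext)

lemma hom_compose:
  assumes "f \<in> graded_hom M N" "g \<in> graded_hom N P" "graded_module M"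
  shows "compose (carrier M) g f \<in> graded_hom M P"
proof -
  interpret graded_module M by fact
  show ?thesis
    by (rule graded_homI)
      (use assms in \<open>auto simp: compose_eq hom_carrier hom_add hom_smult hom_grade grade_carrier smult_closed\<close>)
qed

locale hom_setup = M: graded_module M + N: graded_module N
  for M :: "(('x, 'k::field) free_algebra, 'm) gmodule"
  and N :: "(('x, 'k) free_algebra, 'n) gmodule" +
  fixes f assumes f: "f \<in> graded_hom M N"
begin

lemma f_zero [simp]: "f \<zero>\<^bsub>M\<^esub> = \<zero>\<^bsub>N\<^esub>"
  using hom_smult[OF f M.zero_closed, of 0] hom_carrier[OF f M.zero_closed] by simp

lemma f_minus: "x \<in> carrier M \<Longrightarrow> f (\<ominus>\<^bsub>M\<^esub> x) = \<ominus>\<^bsub>N\<^esub> f x"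
  using hom_smult[OF f, of x "-1"] hom_carrier[OF f, of x]
  by (simp add: M.smult_l_minus M.smult_one N.smult_l_minus N.smult_one)

lemma f_diff: "x \<in> carrier M \<Longrightarrow> y \<in> carrier M \<Longrightarrow> f (x \<ominus>\<^bsub>M\<^esub> y) = f x \<ominus>\<^bsub>N\<^esub> f y"
  by (simp add: a_minus_def hom_add[OF f] f_minus)

lemma f_finsum: "(\<And>i. i \<in> A \<Longrightarrow> g i \<in> carrier M) \<Longrightarrow> f (finsum M g A) = (\<Oplus>\<^bsub>N\<^esub>i\<in>A. f (g i))"
  by (induction A rule: infinite_finite_induct)
     (auto simp: hom_add[OF f] hom_carrier[OF f] M.finsum_insert N.finsum_insert Pi_def M.finsum_closed)

lemma f_cp:
  assumes "x \<in> carrier M" shows "component N (f x) i = f (component M x i)"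
proof -
  let ?A = "{i. component M x i \<noteq> \<zero>\<^bsub>M\<^esub>}"
  have "f x = (\<Oplus>\<^bsub>N\<^esub>i\<in>?A. f (component M x i))"
    using f_finsum[of ?A "component M x"] M.component_carrier M.component_sum0 assms by simp
  moreover have "component N (\<Oplus>\<^bsub>N\<^esub>i\<in>?A. f (component M x i)) = (\<lambda>i. f (component M x i))"
    by (rule N.component_unique) (use assms in \<open>auto simp: M.component_finite M.component_grade hom_grade[OF f]\<close>)
  ultimately show ?thesis by simp
qed

text \<open>A homomorphism commutes with components, so the \<open>i\<close>-th component of an
  arbitrary preimage is a homogeneous preimage.\<close>

lemma image_grade:
  assumes "y \<in> grade N i" "y \<in> f ` carrier M"
  shows "\<exists>x \<in> grade M i. f x = y"
proof -
  obtain x where x: "x \<in> carrier M" "f x = y" using assms by auto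
  then show ?thesis using f_cp[of x i] N.component_homogeneous[OF assms(1)] M.component_grade by auto
qed

end

text \<open>Transport of structure along a surjection \<open>p\<close>. The last hypothesis says
  that the kernel of \<open>p\<close> is graded, which is what makes components on \<open>N\<close>
  well defined. It serves both for quotients and for isomorphic copies.\<close>

lemma graded_module_image:
  fixes M :: "(('x, 'k::field) free_algebra, 'm) gmodule" and N :: "(('x, 'k) free_algebra, 'n) gmodule"
  assumes "graded_module M"
    and c: "carrier N = p ` carrier M"
    and z: "\<zero>\<^bsub>N\<^esub> = p \<zero>\<^bsub>M\<^esub>"
    and a: "\<And>x y. x \<in> carrier M \<Longrightarrow> y \<in> carrier M \<Longrightarrow> p x \<oplus>\<^bsub>N\<^esub> p y = p (x \<oplus>\<^bsub>M\<^esub> y)"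
    and s: "\<And>a x. x \<in> carrier M \<Longrightarrow> a \<odot>\<^bsub>N\<^esub> p x = p (a \<odot>\<^bsub>M\<^esub> x)"
    and g: "\<And>i. grade N i = p ` grade M i"
    and k: "\<And>x i. x \<in> carrier M \<Longrightarrow> p x = \<zero>\<^bsub>N\<^esub> \<Longrightarrow> p (component M x i) = \<zero>\<^bsub>N\<^esub>"
  shows "graded_module N"
proof -
  interpret M: graded_module M by fact
  have ab: "abelian_group N"
  proof (rule abelian_groupI)
    fix x assume "x \<in> carrier N"
    then obtain u where u: "u \<in> carrier M" "x = p u" using c by auto
    then have "p (\<ominus>\<^bsub>M\<^esub> u) \<oplus>\<^bsub>N\<^esub> x = \<zero>\<^bsub>N\<^esub>" by (simp add: a M.l_neg z)
    then show "\<exists>y\<in>carrier N. y \<oplus>\<^bsub>N\<^esub> x = \<zero>\<^bsub>N\<^esub>" using u c by auto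
  qed (auto simp: c a z M.a_ac)
  interpret N: abelian_group N by fact
  have fs: "p (finsum M f A) = (\<Oplus>\<^bsub>N\<^esub>i\<in>A. p (f i))" if "\<And>i. f i \<in> carrier M" for f and A :: "int set"
    using that by (induction A rule: infinite_finite_induct)
      (auto simp: M.finsum_insert N.finsum_insert c z a[symmetric] Pi_def M.finsum_closed)
  define r where "r y = (SOME x. x \<in> carrier M \<and> p x = y)" for y
  have r: "r y \<in> carrier M" "p (r y) = y" if "y \<in> carrier N" for y
  proof -
    have "\<exists>x. x \<in> carrier M \<and> p x = y" using that c by auto
    from someI_ex[OF this] show "r y \<in> carrier M" "p (r y) = y" unfolding r_def by auto
  qed
  \<comment> \<open>Two preimages differ by an element of the kernel, all of whose components are
    again in the kernel; so the choice of \<open>r\<close> does not matter.\<close>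
  have pcp: "p (component M x i) = p (component M y i)" if "x \<in> carrier M" "y \<in> carrier M" "p x = p y" for x y i
  proof -
    have "p (x \<ominus>\<^bsub>M\<^esub> y) = \<zero>\<^bsub>N\<^esub>"
    proof -
      have "p (x \<ominus>\<^bsub>M\<^esub> y) = p x \<oplus>\<^bsub>N\<^esub> p (\<ominus>\<^bsub>M\<^esub> y)" using that(1,2) by (simp add: a_minus_def a)
      also have "\<dots> = p (y \<oplus>\<^bsub>M\<^esub> \<ominus>\<^bsub>M\<^esub> y)" by (metis a that M.a_inv_closed)
      finally show ?thesis using that by (simp add: M.r_neg z)
    qed
    then have 1: "p (component M (x \<ominus>\<^bsub>M\<^esub> y) i) = \<zero>\<^bsub>N\<^esub>" using that k by simp
    have "component M x i = component M (x \<ominus>\<^bsub>M\<^esub> y) i \<oplus>\<^bsub>M\<^esub> component M y i"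
      using that by (simp add: a_minus_def M.component_add M.component_minus M.component_carrier M.a_assoc M.l_neg)
    then have "p (component M x i) = p (component M (x \<ominus>\<^bsub>M\<^esub> y) i) \<oplus>\<^bsub>N\<^esub> p (component M y i)"
      using that by (simp add: a M.component_carrier)
    then show ?thesis using 1 that c by (simp add: M.component_carrier)
  qed
  show ?thesis
  proof (rule graded_moduleI[where p = "\<lambda>i y. p (component M (r y) i)"])
    fix x assume x: "x \<in> carrier N"
    have fin: "finite {i. component M (r x) i \<noteq> \<zero>\<^bsub>M\<^esub>}" using M.component_finite r x by blast
    have sub: "{i. p (component M (r x) i) \<noteq> \<zero>\<^bsub>N\<^esub>} \<subseteq> {i. component M (r x) i \<noteq> \<zero>\<^bsub>M\<^esub>}" using z by auto
    show "finite {i. p (component M (r x) i) \<noteq> \<zero>\<^bsub>N\<^esub>}" using finite_subset[OF sub fin] .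
    have "(\<Oplus>\<^bsub>N\<^esub>i\<in>{i. p (component M (r x) i) \<noteq> \<zero>\<^bsub>N\<^esub>}. p (component M (r x) i))
        = (\<Oplus>\<^bsub>N\<^esub>i\<in>{i. component M (r x) i \<noteq> \<zero>\<^bsub>M\<^esub>}. p (component M (r x) i))"
      by (rule N.add.finprod_mono_neutral_cong_left[OF fin sub])
        (use r x in \<open>auto simp: c M.component_carrier\<close>)
    also have "\<dots> = x" using r[OF x] by (subst fs[symmetric]) (auto simp: M.component_carrier M.component_sum0)
    finally show "(\<Oplus>\<^bsub>N\<^esub>i\<in>{i. p (component M (r x) i) \<noteq> \<zero>\<^bsub>N\<^esub>}. p (component M (r x) i)) = x" .
  next
    fix x y i assume x: "x \<in> carrier N" "y \<in> carrier N"
    have 1: "x \<oplus>\<^bsub>N\<^esub> y = p (r x \<oplus>\<^bsub>M\<^esub> r y)" using r x a[of "r x" "r y"] by simp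
    have "p (component M (r (x \<oplus>\<^bsub>N\<^esub> y)) i) = p (component M (r x \<oplus>\<^bsub>M\<^esub> r y) i)"
      by (rule pcp) (use r[OF N.a_closed[OF x]] r x 1[symmetric] in auto)
    also have "\<dots> = p (component M (r x) i) \<oplus>\<^bsub>N\<^esub> p (component M (r y) i)"
      using r x by (simp add: M.component_add M.component_carrier a)
    finally show "p (component M (r (x \<oplus>\<^bsub>N\<^esub> y)) i) = p (component M (r x) i) \<oplus>\<^bsub>N\<^esub> p (component M (r y) i)" .
  next
    fix x i j assume x: "x \<in> grade N j"
    then obtain u where u: "u \<in> grade M j" "x = p u" using g by auto
    have uc: "u \<in> carrier M" using u M.grade_carrier by auto
    have "p (component M (r x) i) = p (component M u i)"
      by (rule pcp) (use u uc r[of x] c in auto)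
    then show "p (component M (r x) i) = (if i = j then x else \<zero>\<^bsub>N\<^esub>)"
      using M.component_homogeneous[OF u(1)] u z by simp
  next
    fix i j a x assume "(a :: ('x, 'k) free_algebra) \<in> homogeneous i" "x \<in> grade N j"
    then show "a \<odot>\<^bsub>N\<^esub> x \<in> grade N (i + j)"
      using M.smult_grade M.grade_carrier by (auto simp: g s)
  next
    fix i x y assume "x \<in> grade N i" "y \<in> grade N i"
    then show "x \<oplus>\<^bsub>N\<^esub> y \<in> grade N i"
      using M.grade_add M.grade_carrier by (auto simp: g a)
  qed (use ab r M.grade_carrier M.component_grade in \<open>auto simp: c s a g z M.smult_closed M.smult_l_distr M.smult_r_distr M.smult_assoc M.smult_one\<close>)
qed

section \<open>Free modules and finite presentations\<close>

lemma free_graded_module_simps [simp]: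
  "carrier (free_graded_module es) = {v. \<forall>i \<ge> length es. v i = 0}"
  "\<zero>\<^bsub>free_graded_module es\<^esub> = (\<lambda>i. 0)"
  "v \<oplus>\<^bsub>free_graded_module es\<^esub> w = (\<lambda>i. v i + w i)"
  "a \<odot>\<^bsub>free_graded_module es\<^esub> v = (\<lambda>i. a * v i)"
  by (simp_all add: free_graded_module_def)

lemma grade_free_graded_module: "v \<in> grade (free_graded_module es) j \<longleftrightarrow>
    (\<forall>i < length es. v i \<in> homogeneous (es ! i + j)) \<and> (\<forall>i \<ge> length es. v i = 0)"
  by (simp add: free_graded_module_def twist_def regular_module_def)

lemma abelian_group_free_graded_module:
  "abelian_group (free_graded_module es :: (('x, 'k::field) free_algebra, _) gmodule)"
proof (rule abelian_groupI)
  fix v :: "nat \<Rightarrow> ('x, 'k) free_algebra" assume "v \<in> carrier (free_graded_module es)"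
  then show "\<exists>w\<in>carrier (free_graded_module es). w \<oplus>\<^bsub>free_graded_module es\<^esub> v = \<zero>\<^bsub>free_graded_module es\<^esub>"
    by (intro bexI[of _ "\<lambda>i. - v i"]) auto
qed (auto simp: add_ac)

lemma finsum_free_graded_module:
  assumes "\<And>k. k \<in> A \<Longrightarrow> f k \<in> carrier (free_graded_module es :: (('x, 'k::field) free_algebra, _) gmodule)"
  shows "finsum (free_graded_module es) f A = (\<lambda>i. \<Sum>k\<in>A. f k i)"
proof -
  interpret abelian_group "free_graded_module es :: (('x, 'k) free_algebra, _) gmodule"
    by (rule abelian_group_free_graded_module)
  show ?thesis using assms
    by (induction A rule: infinite_finite_induct) (auto simp: finsum_insert Pi_def)
qed

lemma graded_free: "graded_module (free_graded_module es :: (('x, 'k::field) free_algebra, _) gmodule)"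
proof (rule graded_moduleI[where p = "\<lambda>i v l. if l < length es then hcomp (es ! l + i) (v l) else 0"])
  let ?F = "free_graded_module es :: (('x, 'k) free_algebra, _) gmodule"
  let ?p = "\<lambda>i v l. if l < length es then hcomp (es ! l + i) (v l :: ('x, 'k) free_algebra) else 0"
  fix v assume v: "v \<in> carrier ?F"
  show fin: "finite {i. ?p i v \<noteq> \<zero>\<^bsub>?F\<^esub>}"
  proof (rule finite_subset)
    show "{i. ?p i v \<noteq> \<zero>\<^bsub>?F\<^esub>} \<subseteq> (\<Union>l<length es. (\<lambda>j. j - es ! l) ` {j. hcomp j (v l) \<noteq> 0})"
    proof
      fix i assume "i \<in> {i. ?p i v \<noteq> \<zero>\<^bsub>?F\<^esub>}"
      then obtain l where "l < length es" "hcomp (es ! l + i) (v l) \<noteq> 0"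
        by (auto simp: fun_eq_iff split: if_splits)
      then show "i \<in> (\<Union>l<length es. (\<lambda>j. j - es ! l) ` {j. hcomp j (v l) \<noteq> 0})"
        by (auto intro!: bexI[of _ l] image_eqI[of _ _ "es ! l + i"])
    qed
  qed (auto simp: finite_hcomp)
  let ?A = "{i. ?p i v \<noteq> \<zero>\<^bsub>?F\<^esub>}"
  have "(\<Sum>i\<in>?A. ?p i v l) = v l" for l
  proof (cases "l < length es")
    case True
    have "(\<Sum>i\<in>?A. ?p i v l) = (\<Sum>j\<in>(+) (es ! l) ` ?A. hcomp j (v l))"
      using True by (subst sum.reindex) auto
    also have "\<dots> = v l"
    proof (rule sum_hcomp)
      show "{i. hcomp i (v l) \<noteq> 0} \<subseteq> (+) (es ! l) ` ?A"
      proof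
        fix j assume j: "j \<in> {i. hcomp i (v l) \<noteq> 0}"
        have "?p (j - es ! l) v \<noteq> (\<lambda>i. 0)"
        proof
          assume "?p (j - es ! l) v = (\<lambda>i. 0)"
          from fun_cong[OF this, of l] show False using True j by simp
        qed
        then have "j - es ! l \<in> ?A" by simp
        then show "j \<in> (+) (es ! l) ` ?A" by (intro image_eqI[of _ _ "j - es ! l"]) auto
      qed
    qed (use fin in auto)
    finally show ?thesis .
  qed (use v in auto)
  then show "(\<Oplus>\<^bsub>?F\<^esub>i\<in>?A. ?p i v) = v"
    by (subst finsum_free_graded_module) auto
next
  fix i j a and v :: "nat \<Rightarrow> ('x, 'k) free_algebra"
  assume "(a :: ('x, 'k) free_algebra) \<in> homogeneous i" "v \<in> grade (free_graded_module es) j"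
  then show "a \<odot>\<^bsub>free_graded_module es\<^esub> v \<in> grade (free_graded_module es) (i + j)"
    using homogeneous_mult[of a i _ "es ! _ + j"] by (simp add: grade_free_graded_module add.left_commute)
qed (auto simp: abelian_group_free_graded_module distrib_left distrib_right mult.assoc
      grade_free_graded_module homogeneous_add homogeneous_hcomp hcomp_add hcomp_homogeneous fun_eq_iff)

interpretation F: graded_module "free_graded_module es :: (('x, 'k::field) free_algebra, _) gmodule" for es
  by (rule graded_free)

text \<open>Coefficients are total functions of which only the first \<open>length gs\<close> values
  count. Hence \<open>range (combination M gs)\<close> is the submodule generated by
  \<open>gs\<close>, without a side condition on the coefficients.\<close>

definition combination :: "(('x, 'k::field) free_algebra, 'm) gmodule \<Rightarrow> 'm list \<Rightarrow> (nat \<Rightarrow> ('x, 'k) free_algebra) \<Rightarrow> 'm" where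
  "combination M gs v = (\<Oplus>\<^bsub>M\<^esub>l\<in>{..<length gs}. v l \<odot>\<^bsub>M\<^esub> gs ! l)"

text \<open>A generator of \<open>R(e)\<close> has degree \<open>-e\<close>.\<close>

definition homog :: "(('x, 'k::field) free_algebra, 'm) gmodule \<Rightarrow> int list \<Rightarrow> 'm list \<Rightarrow> bool" where
  "homog M es gs \<longleftrightarrow> length gs = length es \<and> (\<forall>l<length es. gs ! l \<in> grade M (- es ! l))"

definition graded_sub :: "(('x, 'k::field) free_algebra, 'm) gmodule \<Rightarrow> 'm set \<Rightarrow> bool" where
  "graded_sub M S \<longleftrightarrow> S \<subseteq> carrier M \<and> \<zero>\<^bsub>M\<^esub> \<in> S \<and> (\<forall>x\<in>S. \<forall>y\<in>S. x \<oplus>\<^bsub>M\<^esub> y \<in> S) \<and>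
     (\<forall>a. \<forall>x\<in>S. a \<odot>\<^bsub>M\<^esub> x \<in> S) \<and> (\<forall>x\<in>S. \<forall>i. component M x i \<in> S)"

context graded_module
begin

lemma homog_carrier: "homog M es gs \<Longrightarrow> set gs \<subseteq> carrier M"
  by (auto simp: homog_def in_set_conv_nth) (metis grade_carrier)

lemma combination_Nil [simp]: "combination M [] v = \<zero>"
  by (simp add: combination_def)

lemma combination_snoc: "set gs \<subseteq> carrier M \<Longrightarrow> h \<in> carrier M \<Longrightarrow>
    combination M (gs @ [h]) v = combination M gs v \<oplus> v (length gs) \<odot> h"
proof -
  assume gs: "set gs \<subseteq> carrier M" "h \<in> carrier M"
  have "combination M (gs @ [h]) v = v (length gs) \<odot> h \<oplus> (\<Oplus>l\<in>{..<length gs}. v l \<odot> (gs @ [h]) ! l)"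
    unfolding combination_def using gs
    by (simp add: lessThan_Suc, subst finsum_insert)
      (auto simp: nth_append intro!: smult_closed subsetD[OF _ nth_mem])
  also have "(\<Oplus>l\<in>{..<length gs}. v l \<odot> (gs @ [h]) ! l) = combination M gs v"
    unfolding combination_def
    by (rule finsum_cong') (use gs in \<open>auto simp: nth_append intro!: smult_closed subsetD[OF _ nth_mem]\<close>)
  finally show ?thesis
    using gs by (simp add: a_comm smult_closed combination_def finsum_closed Pi_def subset_iff)
qed

lemma combination_closed: "set gs \<subseteq> carrier M \<Longrightarrow> combination M gs v \<in> carrier M"
  by (induction gs rule: rev_induct) (auto simp: combination_snoc smult_closed)

lemma combination_add: "set gs \<subseteq> carrier M \<Longrightarrow> combination M gs (\<lambda>l. v l + w l) = combination M gs v \<oplus> combination M gs w"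
  by (induction gs rule: rev_induct)
    (auto simp: combination_snoc smult_closed smult_l_distr combination_closed a_ac)

lemma combination_smult: "set gs \<subseteq> carrier M \<Longrightarrow> combination M gs (\<lambda>l. a * v l) = a \<odot> combination M gs v"
  by (induction gs rule: rev_induct)
    (auto simp: combination_snoc smult_closed smult_assoc smult_r_distr combination_closed)

lemma combination_zero: "set gs \<subseteq> carrier M \<Longrightarrow> combination M gs (\<lambda>l. 0) = \<zero>"
  by (induction gs rule: rev_induct) (auto simp: combination_snoc)

lemma combination_cong: "(\<And>l. l < length gs \<Longrightarrow> v l = w l) \<Longrightarrow> set gs \<subseteq> carrier M \<Longrightarrow> combination M gs v = combination M gs w"
proof (induction gs rule: rev_induct)
  case (snoc g gs)
  have "combination M gs v = combination M gs w" using snoc by auto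
  then show ?case using snoc.prems by (simp add: combination_snoc)
qed simp

lemma combination_append: "set gs \<subseteq> carrier M \<Longrightarrow> set hs \<subseteq> carrier M \<Longrightarrow>
    combination M (gs @ hs) v = combination M gs v \<oplus> combination M hs (\<lambda>l. v (length gs + l))"
proof (induction hs rule: rev_induct)
  case (snoc h hs)
  then show ?case
    using combination_snoc[of "gs @ hs" h v] by (simp add: combination_snoc smult_closed combination_closed a_assoc)
qed (simp add: combination_closed)

lemma combination_unit: 
  assumes "set gs \<subseteq> carrier M" "l < length gs"
  shows "combination M gs (\<lambda>i. if i = l then a else 0) = a \<odot> gs ! l"
proof -
  have "gs = take l gs @ [gs ! l] @ drop (Suc l) gs" using assms(2) by (simp add: id_take_nth_drop)
  moreover have sub: "set (take l gs) \<subseteq> carrier M" "set (drop (Suc l) gs) \<subseteq> carrier M" "gs ! l \<in> carrier M"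
    using assms by (auto dest: in_set_takeD in_set_dropD)
  ultimately have "combination M gs (\<lambda>i. if i = l then a else 0) =
      combination M (take l gs @ [gs ! l] @ drop (Suc l) gs) (\<lambda>i. if i = l then a else 0)" by simp
  also have "\<dots> = combination M (take l gs) (\<lambda>i. if i = l then a else 0) \<oplus>
      (combination M [gs ! l] (\<lambda>i. if l + i = l then a else 0) \<oplus>
       combination M (drop (Suc l) gs) (\<lambda>i. if l + (1 + i) = l then a else 0))"
    using sub assms(2) by (subst combination_append, simp, simp, subst combination_append) (auto simp: min_def)
  also have "combination M (take l gs) (\<lambda>i. if i = l then a else 0) = combination M (take l gs) (\<lambda>i. 0)"
    by (rule combination_cong) (use sub in auto)
  also have "combination M [gs ! l] (\<lambda>i. if l + i = l then a else 0) = a \<odot> gs ! l"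
    using combination_snoc[of "[]" "gs ! l"] sub by (simp add: smult_closed)
  finally show ?thesis using sub by (simp add: combination_zero smult_closed)
qed

lemma combination_range:
  assumes "set gs \<subseteq> carrier M" "length es = length gs"
  shows "combination M gs ` carrier (free_graded_module es) = range (combination M gs)"
proof (intro equalityI subsetI)
  fix x assume "x \<in> range (combination M gs)"
  then obtain v where "x = combination M gs v" by auto
  then have "x = combination M gs (\<lambda>l. if l < length gs then v l else 0)" using assms by (auto intro: combination_cong)
  then show "x \<in> combination M gs ` carrier (free_graded_module es)" using assms by (auto intro!: image_eqI)
qed auto

lemma combination_grade:
  assumes "homog M es gs" "v \<in> grade (free_graded_module es) j"
  shows "combination M gs v \<in> grade M j"
  unfolding combination_def
proof (rule grade_finsum)
  fix l assume "l \<in> {..<length gs}"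
  then show "v l \<odot> gs ! l \<in> grade M j"
    using assms smult_grade[of "v l" "es ! l + j" "gs ! l" "- es ! l"]
    by (simp add: homog_def grade_free_graded_module)
qed

lemma combination_hom:
  assumes "homog M es gs"
  shows "restrict (combination M gs) (carrier (free_graded_module es)) \<in> graded_hom (free_graded_module es) M"
proof -
  have gs: "set gs \<subseteq> carrier M" using assms homog_carrier by blast
  show ?thesis
  proof (rule graded_homI)
    fix i and v :: "nat \<Rightarrow> ('x, 'k) free_algebra" assume "v \<in> grade (free_graded_module es) i"
    then show "restrict (combination M gs) (carrier (free_graded_module es)) v \<in> grade M i"
      using combination_grade[OF assms, of v i] F.grade_carrier[of v es i] by simp
  qed (use gs in \<open>auto simp: combination_closed combination_add combination_smult\<close>)
qed

end

lemma (in hom_setup) f_lc: "set gs \<subseteq> carrier M \<Longrightarrow> f (combination M gs v) = combination N (map f gs) v"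
proof (induction gs rule: rev_induct)
  case (snoc g gs)
  have "f ` set gs \<subseteq> carrier N" using snoc.prems hom_carrier[OF f] by auto
  then show ?case using snoc hom_carrier[OF f]
    by (simp add: M.combination_snoc N.combination_snoc hom_add[OF f] hom_smult[OF f] M.combination_closed M.smult_closed)
qed (auto simp: M.combination_Nil N.combination_Nil)

lemma (in hom_setup) homog_map: "homog M es gs \<Longrightarrow> homog N es (map f gs)"
  by (auto simp: homog_def hom_grade[OF f])

definition units :: "int list \<Rightarrow> (nat \<Rightarrow> ('x, 'k::field) free_algebra) list" where
  "units es = map (\<lambda>l i. if i = l then 1 else 0) [0..<length es]"

lemma homog_units: "homog (free_graded_module es) es (units es)"
  by (auto simp: homog_def units_def grade_free_graded_module)

lemma combination_units: "v \<in> carrier (free_graded_module es) \<Longrightarrow> combination (free_graded_module es) (units es) v = v"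
  unfolding combination_def
  by (subst finsum_free_graded_module) (auto simp: units_def fun_eq_iff if_distrib cong: if_cong)

lemma hom_free_lc:
  assumes "graded_module M" "\<psi> \<in> graded_hom (free_graded_module es) M"
  shows "\<exists>gs. homog M es gs \<and> (\<forall>v\<in>carrier (free_graded_module es). \<psi> v = combination M gs v)"
proof -
  interpret hom_setup "free_graded_module es" M \<psi>
    by (intro hom_setup.intro hom_setup_axioms.intro graded_free assms)
  have "\<psi> v = combination M (map \<psi> (units es)) v" if "v \<in> carrier (free_graded_module es)" for v
    using f_lc[OF F.homog_carrier[OF homog_units], of v] by (simp only: combination_units[OF that])
  then show ?thesis using homog_map[OF homog_units] by blast
qed

text \<open>Replaces the two maps of a presentation by a list of generators and a list of relations.
  In this form coefficients can be stripped and further relations appended.\<close>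

lemma fp_iff:
  assumes "graded_module M"
  shows "finitely_presented M \<longleftrightarrow> (\<exists>es gs es' rs. homog M es gs \<and> homog (free_graded_module es) es' rs \<and>
    range (combination M gs) = carrier M \<and>
    {v \<in> carrier (free_graded_module es). combination M gs v = \<zero>\<^bsub>M\<^esub>} = range (combination (free_graded_module es) rs))"
    (is "_ \<longleftrightarrow> ?R")
proof -
  interpret graded_module M by fact
  show ?thesis
  proof
    assume "finitely_presented M"
    then obtain es es' \<phi> \<psi> where 1: "\<phi> \<in> graded_hom (free_graded_module es') (free_graded_module es)"
      "\<psi> \<in> graded_hom (free_graded_module es) M" "\<psi> ` carrier (free_graded_module es) = carrier M"
      "{v \<in> carrier (free_graded_module es). \<psi> v = \<zero>\<^bsub>M\<^esub>} = \<phi> ` carrier (free_graded_module es')"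
      unfolding finitely_presented_def by blast
    obtain gs where gs: "homog M es gs" "\<forall>v\<in>carrier (free_graded_module es). \<psi> v = combination M gs v"
      using hom_free_lc[OF assms 1(2)] by auto
    obtain rs where rs: "homog (free_graded_module es) es' rs"
      "\<forall>v\<in>carrier (free_graded_module es'). \<phi> v = combination (free_graded_module es) rs v"
      using hom_free_lc[OF graded_free 1(1)] by auto
    have "range (combination M gs) = carrier M"
      using combination_range[OF homog_carrier[OF gs(1)], of es] gs 1(3) by (auto simp: homog_def)
    moreover have "range (combination (free_graded_module es) rs) = \<phi> ` carrier (free_graded_module es')"
      using F.combination_range[OF F.homog_carrier[OF rs(1)], of es'] rs
      by (auto simp: homog_def simp del: free_graded_module_simps)
    moreover have "{v \<in> carrier (free_graded_module es). combination M gs v = \<zero>\<^bsub>M\<^esub>} =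
        {v \<in> carrier (free_graded_module es). \<psi> v = \<zero>\<^bsub>M\<^esub>}"
      using gs(2) by (intro Collect_cong conj_cong refl) (simp del: free_graded_module_simps)
    ultimately have "range (combination M gs) = carrier M"
      "{v \<in> carrier (free_graded_module es). combination M gs v = \<zero>\<^bsub>M\<^esub>} = range (combination (free_graded_module es) rs)"
      using 1(4) by simp_all
    then show ?R using gs(1) rs(1) by blast
  next
    assume ?R
    then obtain es gs es' rs where gs: "homog M es gs" "homog (free_graded_module es) es' rs"
      "range (combination M gs) = carrier M"
      "{v \<in> carrier (free_graded_module es). combination M gs v = \<zero>\<^bsub>M\<^esub>} = range (combination (free_graded_module es) rs)"
      by blast
    let ?\<psi> = "restrict (combination M gs) (carrier (free_graded_module es))"
    let ?\<phi> = "restrict (combination (free_graded_module es) rs) (carrier (free_graded_module es'))"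
    have "?\<psi> ` carrier (free_graded_module es) = carrier M"
      using combination_range[OF homog_carrier[OF gs(1)], of es] gs by (simp add: homog_def)
    moreover have "{v \<in> carrier (free_graded_module es). ?\<psi> v = \<zero>\<^bsub>M\<^esub>} = ?\<phi> ` carrier (free_graded_module es')"
      using F.combination_range[OF F.homog_carrier[OF gs(2)], of es'] gs by (auto simp: homog_def)
    ultimately show "finitely_presented M"
      unfolding finitely_presented_def using combination_hom[OF gs(1)] F.combination_hom[OF gs(2)] by blast
  qed
qed

section \<open>Graded submodules\<close>

lemma restrict_to_simps [simp]:
  "carrier (restrict_to M S) = S" "\<zero>\<^bsub>restrict_to M S\<^esub> = \<zero>\<^bsub>M\<^esub>"
  "x \<oplus>\<^bsub>restrict_to M S\<^esub> y = x \<oplus>\<^bsub>M\<^esub> y" "a \<odot>\<^bsub>restrict_to M S\<^esub> x = a \<odot>\<^bsub>M\<^esub> x"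
  "grade (restrict_to M S) i = grade M i \<inter> S"
  by (simp_all add: restrict_to_def)

context graded_module
begin

lemma gsubD:
  assumes "graded_sub M S"
  shows graded_sub_carrier: "x \<in> S \<Longrightarrow> x \<in> carrier M" and graded_sub_zero: "\<zero> \<in> S"
    and graded_sub_add: "x \<in> S \<Longrightarrow> y \<in> S \<Longrightarrow> x \<oplus> y \<in> S"
    and graded_sub_smult: "x \<in> S \<Longrightarrow> a \<odot> x \<in> S"
    and graded_sub_cp: "x \<in> S \<Longrightarrow> component M x i \<in> S"
  using assms by (auto simp: graded_sub_def)

lemma graded_sub_minus: "graded_sub M S \<Longrightarrow> x \<in> S \<Longrightarrow> \<ominus> x \<in> S"
  using graded_sub_smult[of S x "-1"] graded_sub_carrier[of S x] by (simp add: smult_l_minus smult_one)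

lemma graded_sub_finsum: "graded_sub M S \<Longrightarrow> (\<And>i. i \<in> A \<Longrightarrow> f i \<in> S) \<Longrightarrow> finsum M f A \<in> S"
proof (induction A rule: infinite_finite_induct)
  case (insert x A)
  have "f \<in> insert x A \<rightarrow> carrier M" using insert.prems graded_sub_carrier by blast
  then show ?case using insert by (simp add: finsum_insert graded_sub_add Pi_def)
qed (auto simp: graded_sub_zero)

lemma abelian_group_restrict: "graded_sub M S \<Longrightarrow> abelian_group (restrict_to M S)"
proof (rule abelian_groupI, goal_cases)
  case (6 x) then show ?case
    by (intro bexI[of _ "\<ominus> x"]) (auto simp: graded_sub_minus graded_sub_carrier l_neg)
qed (auto simp: graded_sub_add graded_sub_zero graded_sub_carrier a_ac)

lemma finsum_restrict:
  assumes "graded_sub M S" "\<And>i. i \<in> A \<Longrightarrow> f i \<in> S"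
  shows "finsum (restrict_to M S) f A = finsum M f A"
proof -
  interpret N: abelian_group "restrict_to M S" by (rule abelian_group_restrict[OF assms(1)])
  show ?thesis using assms(2)
  proof (induction A rule: infinite_finite_induct)
    case (insert x A)
    have "f \<in> insert x A \<rightarrow> carrier M" using insert.prems graded_sub_carrier[OF assms(1)] by blast
    then show ?case using insert by (simp add: finsum_insert N.finsum_insert Pi_def)
  qed (simp_all add: finsum_infinite N.finsum_infinite)
qed

lemma graded_restrict: "graded_sub M S \<Longrightarrow> graded_module (restrict_to M S)"
proof (rule graded_moduleI[where p = "\<lambda>i x. component M x i"], goal_cases)
  case 1 then show ?case by (rule abelian_group_restrict)
next
  case (13 x)
  then show ?case
    by (subst finsum_restrict) (auto simp: graded_sub_cp component_sum0 graded_sub_carrier)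
next
  case (10 i j a x) then show ?case using smult_grade by (auto simp: graded_sub_smult)
qed (auto simp: graded_sub_carrier graded_sub_smult graded_sub_add graded_sub_zero graded_sub_cp component_grade component_finite component_add
    component_homogeneous grade_add smult_one smult_assoc smult_l_distr smult_r_distr)

lemma component_restrict:
  assumes "graded_sub M S" "x \<in> S" shows "component (restrict_to M S) x = component M x"
proof -
  interpret N: graded_module "restrict_to M S" by (rule graded_restrict[OF assms(1)])
  have "(\<Oplus>\<^bsub>restrict_to M S\<^esub>i\<in>{i. component M x i \<noteq> \<zero>}. component M x i) = x"
    using assms by (subst finsum_restrict) (auto simp: graded_sub_cp component_sum0 graded_sub_carrier)
  moreover have "component (restrict_to M S) (\<Oplus>\<^bsub>restrict_to M S\<^esub>i\<in>{i. component M x i \<noteq> \<zero>}. component M x i) = component M x"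
    by (rule N.component_unique) (use assms in \<open>auto simp: graded_sub_cp graded_sub_carrier component_grade component_finite\<close>)
  ultimately show ?thesis by simp
qed

lemma graded_sub_lc: 
  assumes "homog M es gs" shows "graded_sub M (range (combination M gs))"
proof -
  have gs: "set gs \<subseteq> carrier M" and len: "length es = length gs"
    using assms homog_carrier by (auto simp: homog_def)
  interpret H: hom_setup "free_graded_module es" M "restrict (combination M gs) (carrier (free_graded_module es))"
    by (intro hom_setup.intro hom_setup_axioms.intro graded_free graded_module_axioms combination_hom assms)
  have component: "component M x i \<in> range (combination M gs)" if x: "x \<in> range (combination M gs)" for x i
  proof -
    obtain v where v: "v \<in> carrier (free_graded_module es)" "x = combination M gs v"
      using x combination_range[OF gs len] by blast
    then show ?thesis using H.f_cp[OF v(1), of i] F.component_carrier[OF v(1), of i] by simp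
  qed
  have z: "\<zero> \<in> range (combination M gs)" using combination_zero[OF gs] by (metis rangeI)
  show ?thesis
    unfolding graded_sub_def using gs
  proof (intro conjI ballI allI)
    fix x y assume "x \<in> range (combination M gs)" "y \<in> range (combination M gs)"
    then obtain v w where "x = combination M gs v" "y = combination M gs w" by blast
    then have "x \<oplus> y = combination M gs (\<lambda>l. v l + w l)" using combination_add[OF gs] by simp
    then show "x \<oplus> y \<in> range (combination M gs)" by simp
  next
    fix a x assume "x \<in> range (combination M gs)"
    then obtain v where "x = combination M gs v" by blast
    then have "a \<odot> x = combination M gs (\<lambda>l. a * v l)" using combination_smult[OF gs] by simp
    then show "a \<odot> x \<in> range (combination M gs)" by simp
  qed (use component z gs in \<open>auto simp: combination_closed\<close>)
qed

lemma combination_mem_gsub: "graded_sub M S \<Longrightarrow> set gs \<subseteq> S \<Longrightarrow> combination M gs v \<in> S"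
  unfolding combination_def by (rule graded_sub_finsum) (auto intro!: graded_sub_smult subsetD[OF _ nth_mem])

lemma combination_restrict: "graded_sub M S \<Longrightarrow> set gs \<subseteq> S \<Longrightarrow> combination (restrict_to M S) gs v = combination M gs v"
  unfolding combination_def by (subst finsum_restrict) (auto intro!: graded_sub_smult subsetD[OF _ nth_mem])

end

section \<open>Quotient modules and twists of the free module\<close>

definition qrep :: "(('x, 'k::field) free_algebra, 'm) gmodule \<Rightarrow> 'm set \<Rightarrow> 'm \<Rightarrow> 'm" where
  "qrep M S x = (SOME y. y \<in> carrier M \<and> x \<ominus>\<^bsub>M\<^esub> y \<in> S)"

text \<open>The quotient module is carried by a system of representatives, so that it lives on the same type.\<close>

definition quot :: "(('x, 'k::field) free_algebra, 'm) gmodule \<Rightarrow> 'm set \<Rightarrow> (('x, 'k) free_algebra, 'm) gmodule" where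
  "quot M S = \<lparr>carrier = qrep M S ` carrier M, monoid.mult = undefined, monoid.one = undefined,
     ring.zero = qrep M S \<zero>\<^bsub>M\<^esub>, ring.add = (\<lambda>x y. qrep M S (x \<oplus>\<^bsub>M\<^esub> y)),
     smult = (\<lambda>a x. qrep M S (a \<odot>\<^bsub>M\<^esub> x)), grade = (\<lambda>i. qrep M S ` grade M i)\<rparr>"

lemma quot_simps [simp]:
  "carrier (quot M S) = qrep M S ` carrier M"
  "\<zero>\<^bsub>quot M S\<^esub> = qrep M S \<zero>\<^bsub>M\<^esub>"
  "x \<oplus>\<^bsub>quot M S\<^esub> y = qrep M S (x \<oplus>\<^bsub>M\<^esub> y)"
  "a \<odot>\<^bsub>quot M S\<^esub> x = qrep M S (a \<odot>\<^bsub>M\<^esub> x)"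
  "grade (quot M S) i = qrep M S ` grade M i"
  by (simp_all add: quot_def)

context graded_module
begin

lemma qrep_props:
  assumes "graded_sub M S" "x \<in> carrier M"
  shows qrep_carrier: "qrep M S x \<in> carrier M" and qrep_diff: "x \<ominus> qrep M S x \<in> S"
proof -
  have "\<exists>y. y \<in> carrier M \<and> x \<ominus> y \<in> S"
    using assms by (intro exI[of _ x]) (simp add: graded_sub_zero a_minus_def r_neg)
  from someI_ex[OF this] show "qrep M S x \<in> carrier M" "x \<ominus> qrep M S x \<in> S"
    unfolding qrep_def by auto
qed

lemma diff_trans: "x \<in> carrier M \<Longrightarrow> y \<in> carrier M \<Longrightarrow> z \<in> carrier M \<Longrightarrow> (x \<ominus> y) \<oplus> (y \<ominus> z) = x \<ominus> z"
  by (metis a_assoc a_inv_closed a_minus_def add.m_closed l_neg l_zero)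

lemma diff_swap: "x \<in> carrier M \<Longrightarrow> y \<in> carrier M \<Longrightarrow> \<ominus> (x \<ominus> y) = y \<ominus> x"
  by (metis a_comm a_inv_closed a_minus_def minus_add minus_minus)

lemma diff_add: "x \<in> carrier M \<Longrightarrow> y \<in> carrier M \<Longrightarrow> x' \<in> carrier M \<Longrightarrow> y' \<in> carrier M \<Longrightarrow>
    (x \<oplus> y) \<ominus> (x' \<oplus> y') = (x \<ominus> x') \<oplus> (y \<ominus> y')"
  by (simp add: a_minus_def minus_add a_ac)

text \<open>Elements of one coset define the same predicate in \<open>qrep_def\<close>, so the
  choice operator returns the same representative for both.\<close>

lemma qrep_eq_iff:
  assumes "graded_sub M S" "x \<in> carrier M" "y \<in> carrier M"
  shows "qrep M S x = qrep M S y \<longleftrightarrow> x \<ominus> y \<in> S"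
proof
  note q = qrep_props[OF assms(1)]
  assume "qrep M S x = qrep M S y"
  then have "x \<ominus> y = (x \<ominus> qrep M S x) \<oplus> \<ominus> (y \<ominus> qrep M S y)"
    using q assms by (simp add: diff_swap diff_trans)
  then show "x \<ominus> y \<in> S" using q assms by (simp add: graded_sub_add graded_sub_minus)
next
  assume xy: "x \<ominus> y \<in> S"
  have "(x \<ominus> z \<in> S) = (y \<ominus> z \<in> S)" if "z \<in> carrier M" for z
  proof -
    have "x \<ominus> z = (x \<ominus> y) \<oplus> (y \<ominus> z)" "y \<ominus> z = \<ominus> (x \<ominus> y) \<oplus> (x \<ominus> z)"
      using assms that by (simp_all add: diff_swap diff_trans)
    then show ?thesis using xy assms graded_sub_add graded_sub_minus by metis
  qed
  then show "qrep M S x = qrep M S y" unfolding qrep_def by (metis (no_types, lifting))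
qed

lemma qrep_zero_iff: "graded_sub M S \<Longrightarrow> x \<in> carrier M \<Longrightarrow> qrep M S x = qrep M S \<zero> \<longleftrightarrow> x \<in> S"
proof -
  assume S: "graded_sub M S" and x: "x \<in> carrier M"
  have z: "\<ominus> \<zero> = \<zero>" by (metis a_inv_closed l_neg r_zero zero_closed)
  show ?thesis using x by (simp add: qrep_eq_iff[OF S] a_minus_def z)
qed

lemma graded_quot:
  assumes S: "graded_sub M S" shows "graded_module (quot M S)"
proof (rule graded_module_image[where p = "qrep M S" and M = M])
  fix x y assume x: "x \<in> carrier M" "y \<in> carrier M"
  have q: "qrep M S x \<in> carrier M" "x \<ominus> qrep M S x \<in> S" "qrep M S y \<in> carrier M" "y \<ominus> qrep M S y \<in> S"
    using qrep_props[OF S] x by auto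
  have "(x \<oplus> y) \<ominus> (qrep M S x \<oplus> qrep M S y) \<in> S"
    using x q S by (simp add: diff_add graded_sub_add)
  then have "qrep M S (x \<oplus> y) = qrep M S (qrep M S x \<oplus> qrep M S y)"
    using q x by (subst qrep_eq_iff[OF S]) auto
  then show "qrep M S x \<oplus>\<^bsub>quot M S\<^esub> qrep M S y = qrep M S (x \<oplus> y)" by simp
next
  fix a x assume x: "x \<in> carrier M"
  have q: "qrep M S x \<in> carrier M" "x \<ominus> qrep M S x \<in> S" using qrep_props[OF S] x by auto
  have "a \<odot> x \<ominus> a \<odot> qrep M S x = a \<odot> (x \<ominus> qrep M S x)"
    using q x by (simp add: a_minus_def smult_r_distr smult_r_minus)
  then have "qrep M S (a \<odot> x) = qrep M S (a \<odot> qrep M S x)"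
    using q x S by (subst qrep_eq_iff[OF S]) (auto simp: graded_sub_smult smult_closed)
  then show "a \<odot>\<^bsub>quot M S\<^esub> qrep M S x = qrep M S (a \<odot> x)" by simp
qed (auto simp: graded_module_axioms qrep_zero_iff[OF S] component_carrier graded_sub_cp[OF S])

lemma qrep_hom:
  assumes S: "graded_sub M S"
  shows "restrict (qrep M S) (carrier M) \<in> graded_hom M (quot M S)"
proof (rule graded_homI)
  fix x y assume x: "x \<in> carrier M" "y \<in> carrier M"
  have q: "qrep M S x \<in> carrier M" "x \<ominus> qrep M S x \<in> S" "qrep M S y \<in> carrier M" "y \<ominus> qrep M S y \<in> S"
    using qrep_props[OF S] x by auto
  have "(x \<oplus> y) \<ominus> (qrep M S x \<oplus> qrep M S y) \<in> S"
    using x q S by (simp add: diff_add graded_sub_add)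
  then show "restrict (qrep M S) (carrier M) (x \<oplus> y) =
      restrict (qrep M S) (carrier M) x \<oplus>\<^bsub>quot M S\<^esub> restrict (qrep M S) (carrier M) y"
    using q x by (simp add: qrep_eq_iff[OF S])
next
  fix a x assume x: "x \<in> carrier M"
  have q: "qrep M S x \<in> carrier M" "x \<ominus> qrep M S x \<in> S" using qrep_props[OF S] x by auto
  have "a \<odot> x \<ominus> a \<odot> qrep M S x = a \<odot> (x \<ominus> qrep M S x)"
    using q x by (simp add: a_minus_def smult_r_distr smult_r_minus)
  then show "restrict (qrep M S) (carrier M) (a \<odot> x) = a \<odot>\<^bsub>quot M S\<^esub> restrict (qrep M S) (carrier M) x"
    using q x S by (simp add: qrep_eq_iff[OF S] graded_sub_smult smult_closed)
qed (auto simp: grade_carrier)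

text \<open>The generators \<open>hs\<close> of the submodule are lifted to homogeneous elements of
  the free module over \<open>M\<close>, and these lifts are appended to the relations of
  \<open>M\<close>.\<close>

lemma fp_quot:
  assumes fp: "finitely_presented M" and hs: "homog M es2 hs"
  shows "finitely_presented (quot M (range (combination M hs)))"
proof -
  let ?S = "range (combination M hs)"
  have S: "graded_sub M ?S" by (rule graded_sub_lc[OF hs])
  obtain es gs es' rs where gs: "homog M es gs" "homog (free_graded_module es) es' rs"
    "range (combination M gs) = carrier M"
    "{v \<in> carrier (free_graded_module es). combination M gs v = \<zero>} = range (combination (free_graded_module es) rs)"
    using fp unfolding fp_iff[OF graded_module_axioms] by blast
  let ?F = "free_graded_module es :: (('x, 'k) free_algebra, _) gmodule"
  have gsc: "set gs \<subseteq> carrier M" and hsc: "set hs \<subseteq> carrier M" and rsc: "set rs \<subseteq> carrier ?F"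
    using homog_carrier[OF gs(1)] homog_carrier[OF hs] F.homog_carrier[OF gs(2)] .
  interpret Q: graded_module "quot M ?S" by (rule graded_quot[OF S])
  interpret H: hom_setup M "quot M ?S" "restrict (qrep M ?S) (carrier M)"
    by (intro hom_setup.intro hom_setup_axioms.intro graded_module_axioms Q.graded_module_axioms qrep_hom[OF S])
  interpret L: hom_setup ?F M "restrict (combination M gs) (carrier ?F)"
    by (intro hom_setup.intro hom_setup_axioms.intro graded_module_axioms graded_free combination_hom[OF gs(1)])
  \<comment> \<open>Homogeneous lifts exist by \<open>image_grade\<close>; they must have the
    degrees prescribed by \<open>es2\<close> to be admissible relations.\<close>
  have "\<exists>\<delta>. length \<delta> = length hs \<and> (\<forall>l<length hs. \<delta> ! l \<in> grade ?F (- es2 ! l) \<and> combination M gs (\<delta> ! l) = hs ! l)"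
  proof -
    have "\<exists>v. v \<in> grade ?F (- es2 ! l) \<and> combination M gs v = hs ! l" if "l < length hs" for l
    proof -
      have "hs ! l \<in> grade M (- es2 ! l)" using hs that by (auto simp: homog_def)
      moreover have "hs ! l \<in> restrict (combination M gs) (carrier ?F) ` carrier ?F"
        using that hsc combination_range[OF gsc, of es] gs by (auto simp: homog_def)
      ultimately obtain v where "v \<in> grade ?F (- es2 ! l)" "restrict (combination M gs) (carrier ?F) v = hs ! l"
        using L.image_grade by blast
      then show ?thesis using F.grade_carrier[of v es] by auto
    qed
    then obtain \<delta> where "\<forall>l<length hs. \<delta> l \<in> grade ?F (- es2 ! l) \<and> combination M gs (\<delta> l) = hs ! l" by metis
    then show ?thesis by (intro exI[of _ "map \<delta> [0..<length hs]"]) auto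
  qed
  then obtain \<delta> where d: "length \<delta> = length hs"
    "\<And>l. l < length hs \<Longrightarrow> \<delta> ! l \<in> grade ?F (- es2 ! l)" "\<And>l. l < length hs \<Longrightarrow> combination M gs (\<delta> ! l) = hs ! l" by blast
  have dh: "homog ?F es2 \<delta>" using d hs by (auto simp: homog_def)
  have dc: "set \<delta> \<subseteq> carrier ?F" using F.homog_carrier[OF dh] .
  have rd: "homog ?F (es' @ es2) (rs @ \<delta>)"
    using gs(2) dh by (auto simp: homog_def nth_append)
  have mapd: "map (restrict (combination M gs) (carrier ?F)) \<delta> = hs"
    using d(1,3) dc by (intro nth_equalityI) (auto simp: subset_iff)
  have lcd: "combination M gs (combination ?F \<delta> u) = combination M hs u" for u
    using L.f_lc[OF dc, of u] F.combination_closed[OF dc, of u] unfolding mapd by simp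
  let ?gs = "map (restrict (qrep M ?S) (carrier M)) gs"
  have lcq: "combination (quot M ?S) ?gs v = qrep M ?S (combination M gs v)" for v
    using H.f_lc[OF gsc, of v] combination_closed[OF gsc, of v] by simp
  have lcF: "combination M gs (\<lambda>l. v l + w l) = combination M gs v \<oplus> combination M gs w" for v w by (rule combination_add[OF gsc])
  show ?thesis
    unfolding fp_iff[OF Q.graded_module_axioms]
  proof (intro exI conjI)
    show "homog (quot M ?S) es ?gs" by (rule H.homog_map[OF gs(1)])
    show "homog ?F (es' @ es2) (rs @ \<delta>)" by (rule rd)
    show "range (combination (quot M ?S) ?gs) = carrier (quot M ?S)"
      unfolding lcq using gs(3) by (simp flip: image_image)
    show "{v \<in> carrier ?F. combination (quot M ?S) ?gs v = \<zero>\<^bsub>quot M ?S\<^esub>} = range (combination ?F (rs @ \<delta>))"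
    proof (intro equalityI subsetI)
      fix v assume "v \<in> {v \<in> carrier ?F. combination (quot M ?S) ?gs v = \<zero>\<^bsub>quot M ?S\<^esub>}"
      then have v: "v \<in> carrier ?F" "combination M gs v \<in> ?S"
        using qrep_zero_iff[OF S combination_closed[OF gsc]] by (auto simp: lcq simp del: free_graded_module_simps)
      then obtain u where u: "combination M gs v = combination M hs u" by auto
      \<comment> \<open>Subtracting from \<open>v\<close> the matching combination of the lifts
        leaves an element that is zero already in \<open>M\<close>, hence a combination of the old
        relations. The coefficients on \<open>rs @ \<delta>\<close> are then those on
        \<open>rs\<close> followed by \<open>u\<close>.\<close>
      let ?w = "\<lambda>i. v i + (- 1) * combination ?F \<delta> u i"
      have "combination M gs ?w = combination M gs v \<oplus> (- 1) \<odot> combination M gs (combination ?F \<delta> u)"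
        by (simp only: lcF combination_smult[OF gsc])
      then have "combination M gs ?w = \<zero>"
        by (simp only: u lcd smult_l_minus smult_one combination_closed[OF hsc] r_neg)
      moreover have "?w \<in> carrier ?F" using v(1) F.combination_closed[OF dc, of u] by simp
      ultimately obtain u' where u': "?w = combination ?F rs u'" using gs(4) by blast
      let ?z = "\<lambda>i. if i < length rs then u' i else u (i - length rs)"
      have "combination ?F (rs @ \<delta>) ?z = combination ?F rs ?z \<oplus>\<^bsub>?F\<^esub> combination ?F \<delta> (\<lambda>l. ?z (length rs + l))"
        by (rule F.combination_append[OF rsc dc])
      also have "combination ?F rs ?z = ?w" unfolding u' by (rule F.combination_cong[OF _ rsc]) simp
      also have "combination ?F \<delta> (\<lambda>l. ?z (length rs + l)) = combination ?F \<delta> u" by simp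
      also have "?w \<oplus>\<^bsub>?F\<^esub> combination ?F \<delta> u = v" by simp
      finally have "v = combination ?F (rs @ \<delta>) ?z" by (rule sym)
      then show "v \<in> range (combination ?F (rs @ \<delta>))" by (rule range_eqI[where x = ?z])
    next
      fix v assume "v \<in> range (combination ?F (rs @ \<delta>))"
      then obtain z where z: "v = combination ?F (rs @ \<delta>) z" by auto
      have "combination ?F rs z \<in> {v \<in> carrier ?F. combination M gs v = \<zero>}" unfolding gs(4) by (rule rangeI)
      then have rz: "combination ?F rs z \<in> carrier ?F" "combination M gs (combination ?F rs z) = \<zero>" by blast+
      have v: "v = (\<lambda>i. combination ?F rs z i + combination ?F \<delta> (\<lambda>l. z (length rs + l)) i)"
        using F.combination_append[OF rsc dc, of z] z by simp
      have "combination M gs v = combination M hs (\<lambda>l. z (length rs + l))"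
        unfolding v lcF rz(2) lcd using combination_closed[OF hsc] by simp
      moreover have "v \<in> carrier ?F" unfolding z using F.combination_closed[of "rs @ \<delta>" es z] rsc dc by simp
      ultimately show "v \<in> {v \<in> carrier ?F. combination (quot M ?S) ?gs v = \<zero>\<^bsub>quot M ?S\<^esub>}"
        using qrep_zero_iff[OF S combination_closed[OF gsc, of v]] by (simp add: lcq)
    qed
  qed
qed

lemma fp_free:
  assumes "homog M es gs" "range (combination M gs) = carrier M"
    and "\<And>v. v \<in> carrier (free_graded_module es) \<Longrightarrow> combination M gs v = \<zero> \<Longrightarrow> v = (\<lambda>i. 0)"
  shows "finitely_presented M"
  unfolding fp_iff[OF graded_module_axioms]
proof (intro exI conjI)
  show "homog (free_graded_module es) [] []" by (simp add: homog_def)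
  show "{v \<in> carrier (free_graded_module es). combination M gs v = \<zero>} = range (combination (free_graded_module es) [])"
    using assms(3) combination_zero[OF homog_carrier[OF assms(1)]] by (auto simp: F.combination_Nil)
qed (use assms in auto)

end

section \<open>The twists of the free module on the given type\<close>

context
  fixes \<iota> :: "('x, 'k::field) free_algebra \<Rightarrow> 'm"
  assumes inj: "inj \<iota>"
begin

lemma twisted_sheaf_simps:
  "carrier (twisted_sheaf \<iota> e) = range \<iota>"
  "\<zero>\<^bsub>twisted_sheaf \<iota> e\<^esub> = \<iota> 0"
  "\<iota> p \<oplus>\<^bsub>twisted_sheaf \<iota> e\<^esub> \<iota> q = \<iota> (p + q)"
  "a \<odot>\<^bsub>twisted_sheaf \<iota> e\<^esub> \<iota> q = \<iota> (a * q)"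
  "grade (twisted_sheaf \<iota> e) j = \<iota> ` homogeneous (e + j)"
  using inj by (simp_all add: twisted_sheaf_def twist_def transport_def regular_module_def Let_def inv_into_f_f)

lemma graded_twisted_sheaf: "graded_module (twisted_sheaf \<iota> e)"
proof (rule graded_module_image[where p = "\<lambda>v. \<iota> (v 0)" and M = "free_graded_module [e]", OF graded_free])
  have 1: "\<exists>v. (\<forall>i\<ge>Suc 0. v i = 0) \<and> p = v 0" for p :: "('x, 'k) free_algebra"
    by (rule exI[of _ "\<lambda>i. if i = 0 then p else 0"]) simp
  show "carrier (twisted_sheaf \<iota> e) = (\<lambda>v. \<iota> (v 0)) ` carrier (free_graded_module [e])"
    using 1 by (auto simp: twisted_sheaf_simps image_iff) metis
  fix i
  show "grade (twisted_sheaf \<iota> e) i = (\<lambda>v. \<iota> (v 0)) ` grade (free_graded_module [e]) i"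
  proof (intro equalityI subsetI)
    fix x assume "x \<in> grade (twisted_sheaf \<iota> e) i"
    then obtain p where "p \<in> homogeneous (e + i)" "x = \<iota> p" by (auto simp: twisted_sheaf_simps)
    then show "x \<in> (\<lambda>v. \<iota> (v 0)) ` grade (free_graded_module [e]) i"
      by (intro image_eqI[of _ _ "\<lambda>i. if i = 0 then p else 0"]) (auto simp: grade_free_graded_module)
  qed (auto simp: twisted_sheaf_simps grade_free_graded_module)
  fix v :: "nat \<Rightarrow> ('x, 'k) free_algebra"
  assume v: "v \<in> carrier (free_graded_module [e])" "\<iota> (v 0) = \<zero>\<^bsub>twisted_sheaf \<iota> e\<^esub>"
  have "v 0 = 0" using v(2) inj by (simp add: twisted_sheaf_simps inj_eq)
  then have "v = \<zero>\<^bsub>free_graded_module [e]\<^esub>" using v(1)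
    by (auto simp: fun_eq_iff) (metis One_nat_def Suc_leI neq0_conv)
  then have "component (free_graded_module [e]) v i = (\<lambda>i. 0)" by (simp only: F.component_zero) simp
  then show "\<iota> (component (free_graded_module [e]) v i 0) = \<zero>\<^bsub>twisted_sheaf \<iota> e\<^esub>"
    by (simp add: twisted_sheaf_simps)
qed (simp_all add: twisted_sheaf_simps)

lemma twisted_sheaf_free:
  shows "homog (twisted_sheaf \<iota> e) [e] [\<iota> 1]"
    and "combination (twisted_sheaf \<iota> e) [\<iota> 1] v = \<iota> (v 0)"
proof -
  interpret graded_module "twisted_sheaf \<iota> e" by (rule graded_twisted_sheaf)
  show "homog (twisted_sheaf \<iota> e) [e] [\<iota> 1]" by (simp add: homog_def twisted_sheaf_simps)
  show "combination (twisted_sheaf \<iota> e) [\<iota> 1] v = \<iota> (v 0)"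
    using combination_snoc[of "[]" "\<iota> 1" v] smult_closed[of "\<iota> 1" "v 0"] by (simp add: twisted_sheaf_simps)
qed

lemma fp_twisted_sheaf: "finitely_presented (twisted_sheaf \<iota> e)"
proof -
  interpret graded_module "twisted_sheaf \<iota> e" by (rule graded_twisted_sheaf)
  have 1: "\<exists>v. p = v 0" for p :: "('x, 'k) free_algebra"
    by (rule exI[of _ "\<lambda>i. p"]) simp
  show ?thesis
  proof (rule fp_free[OF twisted_sheaf_free(1)])
    show "range (combination (twisted_sheaf \<iota> e) [\<iota> 1]) = carrier (twisted_sheaf \<iota> e)"
      using 1 by (auto simp: twisted_sheaf_free twisted_sheaf_simps image_iff)
    fix v :: "nat \<Rightarrow> ('x, 'k) free_algebra"
    assume v: "v \<in> carrier (free_graded_module [e])" "combination (twisted_sheaf \<iota> e) [\<iota> 1] v = \<zero>\<^bsub>twisted_sheaf \<iota> e\<^esub>"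
    have "v 0 = 0" using v(2) inj by (simp add: twisted_sheaf_simps twisted_sheaf_free inj_eq)
    then show "v = (\<lambda>i. 0)" using v(1)
      by (auto simp: fun_eq_iff) (metis One_nat_def Suc_leI neq0_conv)
  qed
qed

end

section \<open>Stability in high degrees\<close>

definition var_sum :: "(('x::finite, 'k::field) free_algebra, 'm) gmodule \<Rightarrow> ('x \<Rightarrow> 'm) \<Rightarrow> 'm" where
  "var_sum M y = (\<Oplus>\<^bsub>M\<^esub>a\<in>UNIV. xvar a \<odot>\<^bsub>M\<^esub> y a)"

text \<open>Multiplication by the variables is an isomorphism from \<open>n + 1\<close> copies of \<open>M\<^sub>d\<close> to \<open>M\<^sub>d\<^sub>+\<^sub>1\<close>.\<close>

definition stable :: "(('x::finite, 'k::field) free_algebra, 'm) gmodule \<Rightarrow> int \<Rightarrow> bool" where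
  "stable M d \<longleftrightarrow> (\<forall>x\<in>grade M (d + 1). \<exists>y. (\<forall>a. y a \<in> grade M d) \<and> var_sum M y = x) \<and>
     (\<forall>y. (\<forall>a. y a \<in> grade M d) \<and> var_sum M y = \<zero>\<^bsub>M\<^esub> \<longrightarrow> (\<forall>a. y a = \<zero>\<^bsub>M\<^esub>))"

definition scalar_combination :: "(('x, 'k::field) free_algebra, 'm) gmodule \<Rightarrow> 'm list \<Rightarrow> (nat \<Rightarrow> 'k) \<Rightarrow> 'm" where
  "scalar_combination M ts v = combination M ts (\<lambda>i. scalar (v i))"

definition basis :: "(('x, 'k::field) free_algebra, 'm) gmodule \<Rightarrow> int \<Rightarrow> 'm list \<Rightarrow> bool" where
  "basis M d ts \<longleftrightarrow> set ts \<subseteq> grade M d \<and> grade M d \<subseteq> range (scalar_combination M ts) \<and>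
     (\<forall>v. scalar_combination M ts v = \<zero>\<^bsub>M\<^esub> \<longrightarrow> (\<forall>i<length ts. v i = 0))"

definition scalar_sub :: "(('x, 'k::field) free_algebra, 'm) gmodule \<Rightarrow> 'm set \<Rightarrow> bool" where
  "scalar_sub M W \<longleftrightarrow> W \<subseteq> carrier M \<and> \<zero>\<^bsub>M\<^esub> \<in> W \<and> (\<forall>x\<in>W. \<forall>y\<in>W. x \<oplus>\<^bsub>M\<^esub> y \<in> W) \<and>
     (\<forall>c. \<forall>x\<in>W. scalar c \<odot>\<^bsub>M\<^esub> x \<in> W)"

text \<open>Stability from \<open>d\<close> on will make the truncation at \<open>d\<close> free,
  and the list \<open>ts\<close> records that \<open>M_d\<close> has finite dimension. Bases in
  higher degrees then follow by multiplying with the variables.\<close>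

definition good :: "(('x::finite, 'k::field) free_algebra, 'm) gmodule \<Rightarrow> int \<Rightarrow> bool" where
  "good M d \<longleftrightarrow> (\<forall>e\<ge>d. stable M e) \<and> (\<exists>ts. basis M d ts)"

context graded_module
begin

lemma combination_sum: "set gs \<subseteq> carrier M \<Longrightarrow> combination M gs (\<lambda>l. \<Sum>k\<in>A. u k l) = (\<Oplus>k\<in>A. combination M gs (u k))"
  by (induction A rule: infinite_finite_induct)
    (auto simp: combination_zero combination_add finsum_insert combination_closed Pi_def)

lemma lift_grade:
  assumes "homog M es gs" "x \<in> grade M j" "x \<in> range (combination M gs)"
  shows "\<exists>v\<in>grade (free_graded_module es) j. combination M gs v = x"
proof -
  interpret L: hom_setup "free_graded_module es" M "restrict (combination M gs) (carrier (free_graded_module es))"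
    by (intro hom_setup.intro hom_setup_axioms.intro graded_module_axioms graded_free combination_hom[OF assms(1)])
  have "x \<in> restrict (combination M gs) (carrier (free_graded_module es)) ` carrier (free_graded_module es)"
    using assms(3) combination_range[OF homog_carrier[OF assms(1)], of es] assms(1) by (simp add: homog_def)
  then obtain v where v: "v \<in> grade (free_graded_module es) j"
    "restrict (combination M gs) (carrier (free_graded_module es)) v = x"
    using L.image_grade assms(2) by blast
  then show ?thesis using F.grade_carrier[OF v(1)] by auto
qed

lemma ksubD:
  assumes "scalar_sub M W"
  shows scalar_sub_carrier: "W \<subseteq> carrier M" and scalar_sub_zero: "\<zero> \<in> W"
    and scalar_sub_add: "x \<in> W \<Longrightarrow> y \<in> W \<Longrightarrow> x \<oplus> y \<in> W"
    and scalar_sub_scalar: "x \<in> W \<Longrightarrow> scalar c \<odot> x \<in> W"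
  using assms by (auto simp: scalar_sub_def)

lemma scalar_sub_finsum: "scalar_sub M S \<Longrightarrow> (\<And>i. i \<in> A \<Longrightarrow> f i \<in> S) \<Longrightarrow> finsum M f A \<in> S"
proof (induction A rule: infinite_finite_induct)
  case (insert x A)
  have "f \<in> insert x A \<rightarrow> carrier M" using insert.prems scalar_sub_carrier by blast
  then show ?case using insert by (simp add: finsum_insert scalar_sub_add Pi_def)
qed (auto simp: scalar_sub_zero)

lemma scalar_combination_mem: "scalar_sub M W \<Longrightarrow> set ts \<subseteq> W \<Longrightarrow> scalar_combination M ts v \<in> W"
  unfolding scalar_combination_def combination_def by (rule scalar_sub_finsum) (auto intro!: scalar_sub_scalar subsetD[OF _ nth_mem])

lemma scalar_combination_closed: "set ts \<subseteq> carrier M \<Longrightarrow> scalar_combination M ts v \<in> carrier M"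
  by (simp add: scalar_combination_def combination_closed)

lemma scalar_combination_add: "set ts \<subseteq> carrier M \<Longrightarrow> scalar_combination M ts (\<lambda>i. v i + w i) = scalar_combination M ts v \<oplus> scalar_combination M ts w"
  by (simp add: scalar_combination_def scalar_add combination_add)

lemma scalar_combination_scalar: "set ts \<subseteq> carrier M \<Longrightarrow> scalar_combination M ts (\<lambda>i. c * v i) = scalar c \<odot> scalar_combination M ts v"
  by (simp add: scalar_combination_def scalar_mult combination_smult)

lemma scalar_combination_zero: "set ts \<subseteq> carrier M \<Longrightarrow> scalar_combination M ts (\<lambda>i. 0) = \<zero>"
  by (simp add: scalar_combination_def combination_zero)

lemma scalar_combination_cong: "(\<And>i. i < length ts \<Longrightarrow> v i = w i) \<Longrightarrow> set ts \<subseteq> carrier M \<Longrightarrow> scalar_combination M ts v = scalar_combination M ts w"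
  unfolding scalar_combination_def by (rule combination_cong) auto

lemma scalar_sub_range_kc: "set ts \<subseteq> carrier M \<Longrightarrow> scalar_sub M (range (scalar_combination M ts))"
  unfolding scalar_sub_def
proof (intro conjI ballI allI)
  assume ts: "set ts \<subseteq> carrier M"
  show "range (scalar_combination M ts) \<subseteq> carrier M" using ts by (auto simp: scalar_combination_closed)
  show "\<zero> \<in> range (scalar_combination M ts)" using scalar_combination_zero[OF ts] by (metis rangeI)
  fix x assume "x \<in> range (scalar_combination M ts)"
  then obtain v where v: "x = scalar_combination M ts v" by blast
  show "scalar c \<odot> x \<in> range (scalar_combination M ts)" for c using scalar_combination_scalar[OF ts, of c v] v by (metis rangeI)
  fix y assume "y \<in> range (scalar_combination M ts)"
  then obtain w where w: "y = scalar_combination M ts w" by blast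
  show "x \<oplus> y \<in> range (scalar_combination M ts)" using scalar_combination_add[OF ts, of v w] v w by (metis rangeI)
qed

lemma scalar_combination_unit: "set ts \<subseteq> carrier M \<Longrightarrow> l < length ts \<Longrightarrow> scalar_combination M ts (\<lambda>i. if i = l then c else 0) = scalar c \<odot> ts ! l"
  unfolding scalar_combination_def using combination_unit[of ts l "scalar c"] by (simp add: if_distrib[of scalar] cong: if_cong)

lemma set_subset_range_kc: "set ts \<subseteq> carrier M \<Longrightarrow> set ts \<subseteq> range (scalar_combination M ts)"
proof
  fix t assume ts: "set ts \<subseteq> carrier M" "t \<in> set ts"
  then obtain l where "l < length ts" "t = ts ! l" by (auto simp: in_set_conv_nth)
  then have "t = scalar_combination M ts (\<lambda>i. if i = l then 1 else 0)"
    using ts scalar_combination_unit[of ts l 1] by (simp add: smult_one subset_iff)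
  then show "t \<in> range (scalar_combination M ts)" by simp
qed

lemma scalar_sub_grade: "scalar_sub M (grade M d)"
  by (auto simp: scalar_sub_def grade_add grade_scalar grade_carrier)

text \<open>There are finitely many words of a given length, and products of words with the finitely
  many generators span each degree.\<close>

lemma ex_spanning:
  fixes d :: int
  assumes fin: "finite (UNIV :: 'x set)"
  assumes gs: "homog M es gs" "range (combination M gs) = carrier M"
  shows "\<exists>ts. set ts \<subseteq> grade M d \<and> grade M d \<subseteq> range (scalar_combination M ts)"
proof -
  let ?mon = "\<lambda>w. Poly_Mapping.single w 1"
  let ?W = "\<lambda>j. {w :: 'x fword. int (length (letters w)) = j}"
  \<comment> \<open>The generator \<open>gs ! l\<close> has degree \<open>- es ! l\<close>, so words
    of length \<open>es ! l + d\<close> bring it to degree \<open>d\<close>.\<close>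
  let ?T = "\<Union>l<length gs. (\<lambda>w. ?mon w \<odot> gs ! l) ` ?W (es ! l + d)"
  have gsc: "set gs \<subseteq> carrier M" by (rule homog_carrier[OF gs(1)])
  have "finite (?W j)" for j
  proof (rule finite_subset)
    show "?W j \<subseteq> Word ` {l. set l \<subseteq> UNIV \<and> length l = nat j}"
    proof
      fix w assume "w \<in> ?W j"
      then show "w \<in> Word ` {l. set l \<subseteq> UNIV \<and> length l = nat j}" by (cases w) auto
    qed
  qed (intro finite_imageI finite_lists_length_eq fin)
  then obtain ts where ts: "set ts = ?T" using finite_list[of ?T] by auto
  have mon: "?mon w \<in> homogeneous (int (length (letters w)))" for w by (auto simp: homogeneous_def)
  have sub: "?T \<subseteq> grade M d"
  proof
    fix t assume "t \<in> ?T"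
    then obtain l w where lw: "l < length gs" "int (length (letters w)) = es ! l + d" "t = ?mon w \<odot> gs ! l" by auto
    have "gs ! l \<in> grade M (- es ! l)" using gs(1) lw by (auto simp: homog_def)
    then show "t \<in> grade M d" using smult_grade[OF mon[of w], of "gs ! l" "- es ! l"] lw by simp
  qed
  have tc: "set ts \<subseteq> carrier M" unfolding ts using sub grade_carrier by (meson subset_iff)
  have W: "scalar_sub M (range (scalar_combination M ts))" by (rule scalar_sub_range_kc[OF tc])
  have "x \<in> range (scalar_combination M ts)" if x: "x \<in> grade M d" for x
  proof -
    obtain v where v: "v \<in> grade (free_graded_module es) d" "combination M gs v = x"
      using lift_grade[OF gs(1) x] gs(2) grade_carrier[OF x] by blast
    have "v l \<odot> gs ! l \<in> range (scalar_combination M ts)" if l: "l < length gs" for l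
    proof -
      have gl: "gs ! l \<in> carrier M" using gsc l by auto
      have vl: "v l \<in> homogeneous (es ! l + d)" using v l gs(1) by (simp add: grade_free_graded_module homog_def)
      have "v l \<odot> gs ! l = (\<Sum>w\<in>Poly_Mapping.keys (v l). scalar (Poly_Mapping.lookup (v l) w) * ?mon w) \<odot> gs ! l"
        by (simp add: scalar_def mult_single sum_single_keys)
      also have "\<dots> = (\<Oplus>w\<in>Poly_Mapping.keys (v l). (scalar (Poly_Mapping.lookup (v l) w) * ?mon w) \<odot> gs ! l)"
        by (rule smult_l_sum[OF gl])
      also have "\<dots> \<in> range (scalar_combination M ts)"
      proof (rule scalar_sub_finsum[OF W])
        fix w assume "w \<in> Poly_Mapping.keys (v l)"
        then have "w \<in> ?W (es ! l + d)" using vl by (auto simp: homogeneous_def)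
        then have "?mon w \<odot> gs ! l \<in> set ts" unfolding ts using l by (intro UN_I[of l] imageI) auto
        then have "scalar (Poly_Mapping.lookup (v l) w) \<odot> (?mon w \<odot> gs ! l) \<in> range (scalar_combination M ts)"
          using scalar_sub_scalar[OF W] set_subset_range_kc[OF tc] by blast
        then show "(scalar (Poly_Mapping.lookup (v l) w) * ?mon w) \<odot> gs ! l \<in> range (scalar_combination M ts)"
          using gl by (simp add: smult_assoc)
      qed
      finally show ?thesis .
    qed
    then show ?thesis unfolding v(2)[symmetric] combination_def by (intro scalar_sub_finsum[OF W]) auto
  qed
  then show ?thesis using ts sub by blast
qed

text \<open>A non-trivial relation expresses one member of the list by the others. Dropping it keeps
  the span and shortens the list.\<close>

lemma ex_basis:
  "set ts \<subseteq> grade M d \<Longrightarrow> grade M d \<subseteq> range (scalar_combination M ts) \<Longrightarrow> \<exists>ts. basis M d ts"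
proof (induction ts rule: length_induct)
  case (1 ts)
  show ?case
  proof (cases "basis M d ts")
    case False
    then obtain v j where v: "scalar_combination M ts v = \<zero>" "j < length ts" "v j \<noteq> 0"
      using 1 unfolding basis_def by blast
    let ?a = "take j ts" and ?b = "drop (Suc j) ts"
    let ?ts = "?a @ ?b"
    have sub: "set ?ts \<subseteq> grade M d" using 1(2) by (auto dest: in_set_takeD in_set_dropD)
    have tc: "set ?ts \<subseteq> carrier M" "set ?a \<subseteq> carrier M" "set ?b \<subseteq> carrier M" and tj: "ts ! j \<in> carrier M"
      using sub 1(2) nth_mem[OF v(2)] grade_carrier by (auto simp: subset_iff)
    have W: "scalar_sub M (range (scalar_combination M ?ts))" by (rule scalar_sub_range_kc[OF tc(1)])
    have "ts = ?a @ [ts ! j] @ ?b" using v(2) by (simp add: id_take_nth_drop)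
    then have "scalar_combination M ts v = scalar_combination M (?a @ [ts ! j] @ ?b) v" by simp
    also have "\<dots> = scalar_combination M ?a v \<oplus> (scalar (v j) \<odot> ts ! j \<oplus> scalar_combination M ?b (\<lambda>i. v (Suc (j + i))))"
      unfolding scalar_combination_def using tc tj v(2) combination_snoc[of "[]" "ts ! j"]
      by (subst combination_append, simp, simp, subst combination_append) (auto simp: min_def smult_closed)
    finally have "\<zero> = scalar_combination M ?a v \<oplus> (scalar (v j) \<odot> ts ! j \<oplus> scalar_combination M ?b (\<lambda>i. v (Suc (j + i))))" using v(1) by simp
    also have "\<dots> = scalar (v j) \<odot> ts ! j \<oplus> (scalar_combination M ?a v \<oplus> scalar_combination M ?b (\<lambda>i. v (Suc (j + i))))"
      using tc tj by (simp add: a_lcomm scalar_combination_closed smult_closed)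
    finally have "scalar (v j) \<odot> ts ! j = \<ominus> (scalar_combination M ?a v \<oplus> scalar_combination M ?b (\<lambda>i. v (Suc (j + i))))"
      using tc tj by (simp add: minus_equality[symmetric] scalar_combination_closed smult_closed)
    then have "scalar (v j) \<odot> ts ! j = scalar (-1) \<odot> (scalar_combination M ?a v \<oplus> scalar_combination M ?b (\<lambda>i. v (Suc (j + i))))"
      using tc by (simp add: scalar_uminus smult_l_minus smult_one scalar_combination_closed)
    moreover have "scalar_combination M ?a v \<in> range (scalar_combination M ?ts)" "scalar_combination M ?b (\<lambda>i. v (Suc (j + i))) \<in> range (scalar_combination M ?ts)"
      using set_subset_range_kc[OF tc(1)] by (auto intro!: scalar_combination_mem[OF W])
    ultimately have 2: "scalar (v j) \<odot> ts ! j \<in> range (scalar_combination M ?ts)"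
      using scalar_sub_scalar[OF W] scalar_sub_add[OF W] by simp
    have "scalar (inverse (v j)) \<odot> (scalar (v j) \<odot> ts ! j) = ts ! j"
      using v(3) tj by (simp add: smult_scalar_scalar smult_one)
    then have 3: "ts ! j \<in> range (scalar_combination M ?ts)" using scalar_sub_scalar[OF W 2, of "inverse (v j)"] by simp
    have "set ts \<subseteq> range (scalar_combination M ?ts)"
    proof -
      have "set ts = set (?a @ [ts ! j] @ ?b)" using \<open>ts = ?a @ [ts ! j] @ ?b\<close> by simp
      then show ?thesis using 3 set_subset_range_kc[OF tc(1)] by auto
    qed
    then have "range (scalar_combination M ts) \<subseteq> range (scalar_combination M ?ts)" using scalar_combination_mem[OF W] by blast
    then have "grade M d \<subseteq> range (scalar_combination M ?ts)" using 1(3) by blast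
    moreover have "length ?ts < length ts" using v(2) by simp
    ultimately show ?thesis using 1(1) sub by blast
  qed blast
qed

end

text \<open>By the second assumption all coordinates of an element of degree \<open>d + 1\<close>
  lie in positive degrees of \<open>R\<close>, where stripping loses nothing.\<close>

lemma strip_grade_free:
  assumes "v \<in> grade (free_graded_module es :: (('x::finite, 'k::field) free_algebra, _) gmodule) (d + 1)"
    "\<And>l. l < length es \<Longrightarrow> es ! l + d \<ge> 0"
  shows "(\<lambda>l. strip a (v l)) \<in> grade (free_graded_module es) d"
    and "v = (\<lambda>l. \<Sum>a\<in>UNIV. xvar a * strip a (v l))"
proof -
  show "(\<lambda>l. strip a (v l)) \<in> grade (free_graded_module es) d"
    using assms(1) homogeneous_strip[of _ "_ + 1"] by (fastforce simp: grade_free_graded_module add.assoc[symmetric])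
  show "v = (\<lambda>l. \<Sum>a\<in>UNIV. xvar a * strip a (v l))"
  proof
    fix l
    show "v l = (\<Sum>a\<in>UNIV. xvar a * strip a (v l))"
    proof (cases "l < length es")
      case True
      then have "v l \<in> homogeneous (es ! l + (d + 1))" "1 \<le> es ! l + (d + 1)"
        using assms by (auto simp: grade_free_graded_module)
      then show ?thesis by (simp add: sum_xvar_strip)
    next
      case False
      then show ?thesis using assms(1) by (simp add: grade_free_graded_module)
    qed
  qed
qed

text \<open>The same axioms over a finite set of variables, so that \<open>var_sum\<close> can range
  over all of them.\<close>

locale fgm = graded_module M for M :: "(('x::finite, 'k::field) free_algebra, 'm) gmodule" (structure)

interpretation F: fgm "free_graded_module es :: (('x::finite, 'k::field) free_algebra, _) gmodule" for es
  by (intro fgm.intro graded_free)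

lemma var_sum_free: "(\<And>a. u a \<in> carrier (free_graded_module es)) \<Longrightarrow>
    var_sum (free_graded_module es) u = (\<lambda>l. \<Sum>a\<in>UNIV. xvar a * u a l)"
  unfolding var_sum_def by (subst finsum_free_graded_module) auto

context fgm
begin

lemma var_sum_grade: "(\<And>a. y a \<in> grade M d) \<Longrightarrow> var_sum M y \<in> grade M (d + 1)"
  unfolding var_sum_def by (auto intro!: grade_finsum grade_xvar)

lemma var_sum_lc: "set gs \<subseteq> carrier M \<Longrightarrow> var_sum M (\<lambda>a. combination M gs (u a)) = combination M gs (\<lambda>l. \<Sum>a\<in>UNIV. xvar a * u a l)"
  by (subst combination_sum) (auto simp: var_sum_def combination_smult)

text \<open>Surjectivity comes from stripping a lift to the free module. For injectivity, a relation
  of degree \<open>d + 1\<close> is a combination of \<open>rs\<close> with coefficients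
  \<open>z\<close> of positive degree; stripping \<open>z\<close> writes it as a sum of variables
  times relations, and by uniqueness of first letters these relations are the lifts of the given
  elements.\<close>

lemma fp_stab:
  assumes fp: "finitely_presented M"
  shows "\<exists>D. \<forall>d\<ge>D. stable M d"
proof -
  obtain es gs es' rs where gs: "homog M es gs" "homog (free_graded_module es) es' rs"
    "range (combination M gs) = carrier M"
    "{v \<in> carrier (free_graded_module es). combination M gs v = \<zero>} = range (combination (free_graded_module es) rs)"
    using fp unfolding fp_iff[OF graded_module_axioms] by blast
  let ?F = "free_graded_module es :: (('x, 'k) free_algebra, _) gmodule"
  have gsc: "set gs \<subseteq> carrier M" and rsc: "set rs \<subseteq> carrier ?F"
    using homog_carrier[OF gs(1)] F.homog_carrier[OF gs(2)] .
  \<comment> \<open>The sum of all absolute values dominates every degree of a generator or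
    relation, so from \<open>D\<close> on all coefficients of degree \<open>d + 1\<close> are free
    of constant terms.\<close>
  obtain D where D: "\<And>e. e \<in> set es \<union> set es' \<Longrightarrow> e + D \<ge> 0"
  proof
    fix e assume "e \<in> set es \<union> set es'"
    then have "\<bar>e\<bar> \<le> (\<Sum>e\<in>set es \<union> set es'. \<bar>e\<bar>)" by (intro member_le_sum) auto
    then show "e + (\<Sum>e\<in>set es \<union> set es'. \<bar>e\<bar>) \<ge> 0" by linarith
  qed
  show ?thesis
  proof (intro exI allI impI)
    fix d assume d: "D \<le> d"
    have es: "\<And>l. l < length es \<Longrightarrow> es ! l + d \<ge> 0" and es': "\<And>l. l < length es' \<Longrightarrow> es' ! l + d \<ge> 0"
      using D d by (meson UnCI add_left_mono nth_mem order_trans)+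
    show "stable M d"
      unfolding stable_def
    proof (intro conjI ballI allI impI)
      fix x assume x: "x \<in> grade M (d + 1)"
      obtain v where v: "v \<in> grade ?F (d + 1)" "combination M gs v = x"
        using lift_grade[OF gs(1) x] gs(3) grade_carrier[OF x] by blast
      show "\<exists>y. (\<forall>a. y a \<in> grade M d) \<and> var_sum M y = x"
      proof (intro exI conjI allI)
        show "combination M gs (\<lambda>l. strip a (v l)) \<in> grade M d" for a
          by (rule combination_grade[OF gs(1) strip_grade_free(1)[OF v(1) es]])
        show "var_sum M (\<lambda>a. combination M gs (\<lambda>l. strip a (v l))) = x"
          unfolding var_sum_lc[OF gsc] using strip_grade_free(2)[OF v(1) es] v(2) by simp
      qed
    next
      fix y b assume y: "(\<forall>a. y a \<in> grade M d) \<and> var_sum M y = \<zero>"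
      have "\<exists>u. u \<in> grade ?F d \<and> combination M gs u = y a" for a
        using lift_grade[OF gs(1), of "y a" d] gs(3) y grade_carrier[of "y a" d] by blast
      then obtain u where u: "\<And>a. u a \<in> grade ?F d" "\<And>a. combination M gs (u a) = y a" by metis
      let ?w = "\<lambda>l. \<Sum>a\<in>UNIV. xvar a * u a l"
      have uc: "u a \<in> carrier ?F" for a using u(1) F.grade_carrier by blast
      have w: "?w \<in> grade ?F (d + 1)" using F.var_sum_grade[OF u(1)] by (simp only: var_sum_free[OF uc])
      have "combination M gs ?w = \<zero>" using y var_sum_lc[OF gsc, of u] u(2) by simp
      then have "?w \<in> range (combination ?F rs)" using gs(4) F.grade_carrier[OF w] by blast
      then obtain z where z: "z \<in> grade (free_graded_module es') (d + 1)" "combination ?F rs z = ?w"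
        using F.lift_grade[OF gs(2) w] by blast
      let ?t = "\<lambda>a. combination ?F rs (\<lambda>l. strip a (z l))"
      have tc: "?t a \<in> carrier ?F" for a by (rule F.combination_closed[OF rsc])
      have "?w = var_sum ?F ?t" 
        unfolding F.var_sum_lc[OF rsc] using strip_grade_free(2)[OF z(1) es'] z(2) by simp
      then have "(\<Sum>a\<in>UNIV. xvar a * u a l) = (\<Sum>a\<in>UNIV. xvar a * ?t a l)" for l
        unfolding var_sum_free[OF tc] by (rule fun_cong)
      \<comment> \<open>Stripping \<open>b\<close> picks the term of \<open>xvar b\<close> on both
        sides and identifies \<open>u b\<close> with \<open>?t b\<close>, which is a combination of
        relations and so maps to zero.\<close>
      then have "strip b (\<Sum>a\<in>UNIV. xvar a * u a l) = strip b (\<Sum>a\<in>UNIV. xvar a * ?t a l)" for l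
        by (rule arg_cong)
      then have "u b = ?t b" unfolding strip_sum_xvar by (rule ext)
      then have "u b \<in> {v \<in> carrier ?F. combination M gs v = \<zero>}" unfolding gs(4) by blast
      then show "y b = \<zero>" using u(2) by auto
    qed
  qed
qed

lemma fp_good: "finitely_presented M \<Longrightarrow> \<exists>D. \<forall>d\<ge>D. good M d"
proof -
  assume fp: "finitely_presented M"
  then obtain es gs where gs: "homog M es gs" "range (combination M gs) = carrier M"
    unfolding fp_iff[OF graded_module_axioms] by blast
  have "\<exists>ts. basis M d ts" for d using ex_spanning[OF finite gs, of d] ex_basis by blast
  then show ?thesis using fp_stab[OF fp] unfolding good_def by (meson order_trans)
qed

end

section \<open>Truncations\<close>

definition trunc_set :: "(('x, 'k::field) free_algebra, 'm) gmodule \<Rightarrow> int \<Rightarrow> 'm set" where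
  "trunc_set M d = {x \<in> carrier M. \<forall>i<d. component M x i = \<zero>\<^bsub>M\<^esub>}"

definition trunc :: "(('x, 'k::field) free_algebra, 'm) gmodule \<Rightarrow> int \<Rightarrow> (('x, 'k) free_algebra, 'm) gmodule" where
  "trunc M d = restrict_to M (trunc_set M d)"

definition free_basis :: "(('x, 'k::field) free_algebra, 'm) gmodule \<Rightarrow> int list \<Rightarrow> 'm list \<Rightarrow> bool" where
  "free_basis M es gs \<longleftrightarrow> homog M es gs \<and> range (combination M gs) = carrier M \<and>
     (\<forall>v. combination M gs v = \<zero>\<^bsub>M\<^esub> \<longrightarrow> (\<forall>l<length gs. v l = 0))"

lemma homog_replicate: "set ts \<subseteq> grade M d \<Longrightarrow> homog M (replicate (length ts) (- d)) ts"
  by (auto simp: homog_def)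

context graded_module
begin

lemma component_cp: "x \<in> carrier M \<Longrightarrow> component M (component M x i) j = (if j = i then component M x i else \<zero>)"
  using component_homogeneous[OF component_grade, of x i] by simp

lemma graded_sub_tset: "graded_sub M (trunc_set M d)"
proof -
  have sm: "\<forall>x\<in>trunc_set M d. a \<odot> x \<in> trunc_set M d" for a
  proof (induction a rule: free_algebra_induct)
    case (xvar a p)
    show ?case
    proof
      fix x assume "x \<in> trunc_set M d"
      then have "p \<odot> x \<in> trunc_set M d" "x \<in> carrier M" using xvar by (auto simp: trunc_set_def)
      then show "(xvar a * p) \<odot> x \<in> trunc_set M d"
        by (simp add: trunc_set_def smult_assoc smult_closed component_smult[OF _ homogeneous_xvar])
    qed
  next
    case (scalar c)
    then show ?case by (simp add: trunc_set_def smult_closed component_smult[OF _ homogeneous_scalar])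
  qed (auto simp: trunc_set_def smult_l_distr component_add smult_closed)
  then show ?thesis
    by (auto simp: graded_sub_def) (auto simp: trunc_set_def component_add component_cp component_carrier)
qed

lemma graded_trunc: "graded_module (trunc M d)"
  unfolding trunc_def by (rule graded_restrict[OF graded_sub_tset])

lemma grade_tset: "d \<le> i \<Longrightarrow> grade M i \<subseteq> trunc_set M d"
  by (auto simp: trunc_set_def grade_carrier component_homogeneous)

lemma grade_trunc: "d \<le> i \<Longrightarrow> grade (trunc M d) i = grade M i"
  using grade_tset[of d i] by (auto simp: trunc_def)

lemma trunc_set_mono: "d \<le> e \<Longrightarrow> trunc_set M e \<subseteq> trunc_set M d"
  by (auto simp: trunc_set_def)

lemma fp_free_basis: "free_basis M es gs \<Longrightarrow> finitely_presented M"
proof (rule fp_free)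
  assume f: "free_basis M es gs"
  show "homog M es gs" "range (combination M gs) = carrier M" using f by (auto simp: free_basis_def)
  fix v assume v: "v \<in> carrier (free_graded_module es)" "combination M gs v = \<zero>"
  then show "v = (\<lambda>i. 0)" using f
    by (auto simp: free_basis_def homog_def fun_eq_iff) (metis not_le)
qed

lemma combination_eq_imp:
  assumes "free_basis M es gs" "combination M gs v = combination M gs w" "l < length gs"
  shows "v l = w l"
proof -
  have gs: "set gs \<subseteq> carrier M" using assms(1) homog_carrier by (auto simp: free_basis_def)
  have "combination M gs (\<lambda>l. v l + (-1) * w l) = combination M gs v \<oplus> (-1) \<odot> combination M gs w"
    using combination_add[OF gs, of v "\<lambda>l. (-1) * w l"] combination_smult[OF gs, of "-1" w] by simp
  also have "\<dots> = \<zero>" using assms(2) combination_closed[OF gs] by (simp add: smult_l_minus smult_one r_neg)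
  finally have "v l + (-1) * w l = 0" using assms unfolding free_basis_def by blast
  then show ?thesis by simp
qed

lemma scalar_combination_sum: "set ts \<subseteq> carrier M \<Longrightarrow> scalar_combination M ts v \<oplus> scalar c \<odot> scalar_combination M ts w = scalar_combination M ts (\<lambda>i. v i + c * w i)"
  by (simp add: scalar_combination_add scalar_combination_scalar)

lemma basis_carrier: "basis M d ts \<Longrightarrow> set ts \<subseteq> carrier M"
  using grade_carrier by (auto simp: basis_def)

lemma basis_indep: "basis M d ts \<Longrightarrow> scalar_combination M ts v = \<zero> \<Longrightarrow> i < length ts \<Longrightarrow> v i = 0"
  by (simp add: basis_def)

lemma basis_span: "basis M d ts \<Longrightarrow> x \<in> grade M d \<Longrightarrow> \<exists>v. x = scalar_combination M ts v"
  unfolding basis_def by blast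

lemma scalar_combination_grade: "set ts \<subseteq> grade M d \<Longrightarrow> scalar_combination M ts v \<in> grade M d"
  by (rule scalar_combination_mem[OF scalar_sub_grade])

lemma basis_inj:
  assumes "basis M d ts" "scalar_combination M ts v = scalar_combination M ts w" "l < length ts"
  shows "v l = w l"
proof -
  have ts: "set ts \<subseteq> carrier M" using assms(1) by (rule basis_carrier)
  have "scalar_combination M ts (\<lambda>l. v l + (-1) * w l) = scalar_combination M ts v \<oplus> scalar (-1) \<odot> scalar_combination M ts w"
    by (simp only: scalar_combination_sum[OF ts])
  also have "\<dots> = \<zero>" using assms(2) scalar_combination_closed[OF ts] by (simp add: scalar_uminus smult_l_minus smult_one r_neg)
  finally have "v l + (-1) * w l = 0" using assms unfolding basis_def by blast
  then show ?thesis by simp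
qed

lemma scalar_combination_append: "set gs \<subseteq> carrier M \<Longrightarrow> set hs \<subseteq> carrier M \<Longrightarrow>
    scalar_combination M (gs @ hs) v = scalar_combination M gs v \<oplus> scalar_combination M hs (\<lambda>l. v (length gs + l))"
  by (simp add: scalar_combination_def combination_append)

lemma scalar_combination_smult: "set ts \<subseteq> carrier M \<Longrightarrow> scalar_combination M (map (smult M a) ts) v = a \<odot> scalar_combination M ts v"
proof (induction ts rule: rev_induct)
  case (snoc t ts)
  have "set (map (smult M a) ts) \<subseteq> carrier M" using snoc.prems smult_closed by auto
  then show ?case using snoc
    by (simp add: scalar_combination_def combination_snoc smult_closed smult_r_distr combination_closed smult_scalar_commute)
qed (simp add: scalar_combination_def)

end

text \<open>Independence determines the first \<open>length gs\<close> coefficients of an element,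
  so applying them to \<open>hs\<close> gives a well-defined map.\<close>

lemma hom_from_free:
  fixes N :: "(('x, 'k::field) free_algebra, 'n) gmodule" and M :: "(('x, 'k) free_algebra, 'm) gmodule"
  assumes "graded_module N" "graded_module M" "free_basis N es gs" "homog M es hs"
  shows "\<exists>f\<in>graded_hom N M. \<forall>v. f (combination N gs v) = combination M hs v"
proof -
  interpret N: graded_module N by fact
  interpret M: graded_module M by fact
  have gs: "homog N es gs" "range (combination N gs) = carrier N" using assms(3) by (auto simp: free_basis_def)
  have gsc: "set gs \<subseteq> carrier N" and hsc: "set hs \<subseteq> carrier M" and len: "length hs = length gs"
    using N.homog_carrier[OF gs(1)] M.homog_carrier[OF assms(4)] gs(1) assms(4) by (auto simp: homog_def)
  define f where "f = (\<lambda>x\<in>carrier N. combination M hs (SOME v. combination N gs v = x))"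
  have f: "f (combination N gs v) = combination M hs v" for v
  proof -
    have "combination N gs (SOME w. combination N gs w = combination N gs v) = combination N gs v" by (rule someI[of "\<lambda>w. combination N gs w = combination N gs v" v]) (rule refl)
    then have "combination M hs (SOME w. combination N gs w = combination N gs v) = combination M hs v"
      by (intro M.combination_cong N.combination_eq_imp[OF assms(3)]) (use len hsc in auto)
    then show ?thesis unfolding f_def using N.combination_closed[OF gsc] by simp
  qed
  have ex: "\<exists>v. x = combination N gs v" if "x \<in> carrier N" for x using that gs(2) by blast
  have "f \<in> graded_hom N M"
  proof (rule graded_homI)
    fix x y assume "x \<in> carrier N" "y \<in> carrier N"
    then obtain v w where "x = combination N gs v" "y = combination N gs w" using ex by blast
    then show "f (x \<oplus>\<^bsub>N\<^esub> y) = f x \<oplus>\<^bsub>M\<^esub> f y"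
      by (simp add: f N.combination_add[OF gsc, symmetric] M.combination_add[OF hsc, symmetric])
  next
    fix a x assume "x \<in> carrier N"
    then obtain v where "x = combination N gs v" using ex by blast
    then show "f (a \<odot>\<^bsub>N\<^esub> x) = a \<odot>\<^bsub>M\<^esub> f x"
      by (simp add: f N.combination_smult[OF gsc, symmetric] M.combination_smult[OF hsc, symmetric])
  next
    fix i x assume x: "x \<in> grade N i"
    obtain v where v: "v \<in> grade (free_graded_module es) i" "combination N gs v = x"
      using N.lift_grade[OF gs(1) x] gs(2) N.grade_carrier[OF x] by blast
    then show "f x \<in> grade M i" using M.combination_grade[OF assms(4) v(1)] f by metis
  next
    fix x assume "x \<in> carrier N"
    then obtain v where "x = combination N gs v" using ex by blast
    then show "f x \<in> carrier M" by (simp add: f M.combination_closed[OF hsc])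
  qed (simp add: f_def)
  then show ?thesis using f by blast
qed

context fgm
begin

lemma stable_inj: "stable M d \<Longrightarrow> (\<And>a. y a \<in> grade M d) \<Longrightarrow> var_sum M y = \<zero> \<Longrightarrow> y a = \<zero>"
  by (simp add: stable_def)

text \<open>Uses the surjective half of stability: by induction on the distance from
  \<open>d\<close>, every higher degree is reached from \<open>M_d\<close> by multiplying with
  variables.\<close>

lemma trunc_set_eq_range:
  assumes st: "\<And>e. e \<ge> d \<Longrightarrow> stable M e" and b: "basis M d ts"
  shows "range (combination M ts) = trunc_set M d"
proof (intro equalityI subsetI)
  have ts: "set ts \<subseteq> grade M d" "set ts \<subseteq> carrier M" using b basis_carrier by (auto simp: basis_def)
  have S: "graded_sub M (range (combination M ts))" by (rule graded_sub_lc[OF homog_replicate[OF ts(1)]])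
  have gr: "grade M (d + int m) \<subseteq> range (combination M ts)" for m
  proof (induction m)
    case 0
    then show ?case using b by (force simp: basis_def scalar_combination_def)
  next
    case (Suc m)
    show ?case
    proof
      fix x assume "x \<in> grade M (d + int (Suc m))"
      then have "x \<in> grade M (d + int m + 1)" by (simp add: add_ac)
      moreover have "stable M (d + int m)" by (rule st) simp
      ultimately obtain y where y: "\<And>a. y a \<in> grade M (d + int m)" "var_sum M y = x"
        unfolding stable_def by blast
      have "var_sum M y \<in> range (combination M ts)" unfolding var_sum_def
        by (intro graded_sub_finsum[OF S] graded_sub_smult[OF S]) (use y(1) Suc in blast)
      then show "x \<in> range (combination M ts)" using y(2) by simp
    qed
  qed
  fix x
  { assume "x \<in> range (combination M ts)"
    then show "x \<in> trunc_set M d" using combination_mem_gsub[OF graded_sub_tset] ts(1) grade_tset[of d d] by blast }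
  assume x: "x \<in> trunc_set M d"
  then have xc: "x \<in> carrier M" by (simp add: trunc_set_def)
  have "(\<Oplus>i \<in> {i. component M x i \<noteq> \<zero>}. component M x i) \<in> range (combination M ts)"
  proof (rule graded_sub_finsum[OF S])
    fix i assume "i \<in> {i. component M x i \<noteq> \<zero>}"
    then have "d \<le> i" using x by (auto simp: trunc_set_def not_less[symmetric])
    then have "grade M i \<subseteq> range (combination M ts)" using gr[of "nat (i - d)"] by simp
    then show "component M x i \<in> range (combination M ts)" using component_grade[OF xc] by blast
  qed
  then show "x \<in> range (combination M ts)" using component_sum0[OF xc] by simp
qed

text \<open>Uses the injective half of stability: stripping the coefficients of a homogeneous
  relation gives relations one degree lower, and in degree \<open>d\<close> the coefficients are
  scalars, where linear independence of \<open>ts\<close> applies.\<close>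

lemma combination_kernel:
  assumes st: "\<And>e. e \<ge> d \<Longrightarrow> stable M e" and b: "basis M d ts" and v: "combination M ts v = \<zero>" and l: "l < length ts"
  shows "v l = 0"
proof -
  let ?es = "replicate (length ts) (- d)"
  let ?F = "free_graded_module ?es :: (('x, 'k) free_algebra, _) gmodule"
  have ts: "set ts \<subseteq> grade M d" "set ts \<subseteq> carrier M" using b basis_carrier by (auto simp: basis_def)
  have h: "homog M ?es ts" by (rule homog_replicate[OF ts(1)])
  have main: "v = (\<lambda>l. 0)" if "v \<in> grade ?F (d + int m)" "combination M ts v = \<zero>" for v m
    using that
  proof (induction m arbitrary: v)
    case 0
    have sc: "v i = scalar (Poly_Mapping.lookup (v i) 0)" if "i < length ts" for i
      using homogeneous_0_scalar[of "v i"] 0(1) that by (simp add: grade_free_graded_module)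
    have "scalar_combination M ts (\<lambda>i. Poly_Mapping.lookup (v i) 0) = combination M ts v"
      unfolding scalar_combination_def by (rule combination_cong) (use sc ts in auto)
    then have "Poly_Mapping.lookup (v i) 0 = 0" if "i < length ts" for i
      using basis_indep[OF b, of "\<lambda>i. Poly_Mapping.lookup (v i) 0"] 0(2) that by simp
    then have "v i = 0" for i
      using sc[of i] 0(1) by (cases "i < length ts") (auto simp: grade_free_graded_module)
    then show ?case by blast
  next
    case (Suc m)
    have v1: "v \<in> grade ?F (d + int m + 1)" using Suc.prems(1) by (simp add: add_ac)
    have ge: "\<And>l. l < length ?es \<Longrightarrow> ?es ! l + (d + int m) \<ge> 0" by simp
    note sg = strip_grade_free[OF v1 ge]
    have "combination M ts v = var_sum M (\<lambda>a. combination M ts (\<lambda>l. strip a (v l)))"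
      unfolding var_sum_lc[OF ts(2)] using sg(2) by simp
    then have "var_sum M (\<lambda>a. combination M ts (\<lambda>l. strip a (v l))) = \<zero>" using Suc.prems(2) by simp
    moreover have "combination M ts (\<lambda>l. strip a (v l)) \<in> grade M (d + int m)" for a
      by (rule combination_grade[OF h sg(1)])
    moreover have "stable M (d + int m)" by (rule st) simp
    ultimately have z: "combination M ts (\<lambda>l. strip a (v l)) = \<zero>" for a
      using stable_inj[of "d + int m" "\<lambda>a. combination M ts (\<lambda>l. strip a (v l))"] by blast
    have "(\<lambda>l. strip a (v l)) = (\<lambda>l. 0)" for a using Suc.IH[OF sg(1) z, of a] .
    then have "strip a (v l) = 0" for a l by metis
    then have "(\<lambda>l. \<Sum>a\<in>UNIV. xvar a * strip a (v l)) = (\<lambda>l. 0)" by simp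
    then show ?case using sg(2) by simp
  qed
  interpret L: hom_setup ?F M "restrict (combination M ts) (carrier ?F)"
    by (intro hom_setup.intro hom_setup_axioms.intro graded_module_axioms graded_free combination_hom[OF h])
  \<comment> \<open>A general relation is cut off at \<open>length ts\<close>, so that it lies in
    the free module, and split into homogeneous components. Those of degree below \<open>d\<close>
    vanish because their coefficients would have negative degree.\<close>
  let ?v = "\<lambda>l. if l < length ts then v l else 0"
  have vc: "?v \<in> carrier ?F" by simp
  have v0: "combination M ts ?v = \<zero>" using v combination_cong[OF _ ts(2), of ?v v] by simp
  have "component ?F ?v j = (\<lambda>l. 0)" for j
  proof -
    have g: "component ?F ?v j \<in> grade ?F j" by (rule F.component_grade[OF vc])
    have z: "combination M ts (component ?F ?v j) = \<zero>"
    proof -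
      have "restrict (combination M ts) (carrier ?F) (component ?F ?v j) = component M (restrict (combination M ts) (carrier ?F) ?v) j"
        by (rule L.f_cp[OF vc, symmetric])
      also have "\<dots> = \<zero>" using v0 vc by (simp del: free_graded_module_simps)
      finally show ?thesis using F.component_carrier[OF vc, of j] by (simp del: free_graded_module_simps)
    qed
    show ?thesis
    proof (cases "d \<le> j")
      case True
      then show ?thesis using main[of "component ?F ?v j" "nat (j - d)"] g z by simp
    next
      case False
      show ?thesis
      proof
        fix l show "component ?F ?v j l = 0"
          using g False homogeneous_neg[of _ "- d + j"]
          by (cases "l < length ts") (auto simp: grade_free_graded_module)
      qed
    qed
  qed
  then have "?v = (\<lambda>l. 0)" using F.component_sum0[OF vc] by simp
  then have "?v l = 0" by (rule fun_cong)
  then show ?thesis using l by simp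
qed

lemma good_trunc:
  assumes "good M d" "basis M d ts"
  shows "free_basis (trunc M d) (replicate (length ts) (- d)) ts"
proof -
  have st: "\<And>e. e \<ge> d \<Longrightarrow> stable M e" using assms(1) by (simp add: good_def)
  have ts: "set ts \<subseteq> grade M d" "set ts \<subseteq> trunc_set M d"
    using assms(2) grade_tset[of d d] by (auto simp: basis_def)
  have combination: "combination (trunc M d) ts v = combination M ts v" for v
    unfolding trunc_def by (rule combination_restrict[OF graded_sub_tset ts(2)])
  have "set ts \<subseteq> grade (trunc M d) d" using ts(1) by (simp add: grade_trunc)
  moreover have "range (combination (trunc M d) ts) = carrier (trunc M d)"
    unfolding combination using trunc_set_eq_range[OF st assms(2)] by (simp add: trunc_def)
  moreover have "\<zero>\<^bsub>trunc M d\<^esub> = \<zero>" by (simp add: trunc_def)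
  ultimately show ?thesis
    unfolding free_basis_def combination using combination_kernel[OF st assms(2)] homog_replicate by auto
qed

lemma fp_trunc: "good M d \<Longrightarrow> finitely_presented (trunc M d)"
  using good_trunc graded_module.fp_free_basis[OF graded_trunc] by (metis good_def)

lemma trunc_hom_eq:
  assumes "good M d" "\<phi> \<in> graded_hom (trunc M d) N" "\<psi> \<in> graded_hom (trunc M d) N" "graded_module N"
    "\<And>x. x \<in> grade M d \<Longrightarrow> \<phi> x = \<psi> x"
  shows "\<phi> = \<psi>"
proof -
  obtain ts where ts: "basis M d ts" using assms(1) by (auto simp: good_def)
  have fb: "free_basis (trunc M d) (replicate (length ts) (- d)) ts" by (rule good_trunc[OF assms(1) ts])
  interpret T: graded_module "trunc M d" by (rule graded_trunc)
  have tc: "set ts \<subseteq> carrier (trunc M d)" using fb T.homog_carrier by (auto simp: free_basis_def)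
  interpret A: hom_setup "trunc M d" N \<phi> by (intro hom_setup.intro hom_setup_axioms.intro graded_trunc assms)
  interpret B: hom_setup "trunc M d" N \<psi> by (intro hom_setup.intro hom_setup_axioms.intro graded_trunc assms)
  have m: "map \<phi> ts = map \<psi> ts" using ts assms(5) by (auto simp: basis_def)
  show ?thesis
  proof (rule hom_eqI[OF assms(2,3)])
    fix x assume "x \<in> carrier (trunc M d)"
    then obtain v where "x = combination (trunc M d) ts v" using fb unfolding free_basis_def by blast
    then show "\<phi> x = \<psi> x" using A.f_lc[OF tc, of v] B.f_lc[OF tc, of v] m by simp
  qed
qed

text \<open>Here \<open>\<alpha>\<close> is only linear over the field and only defined on one
  degree; freeness of the truncation supplies the extension over \<open>R\<close>.\<close>

lemma trunc_extend:
  fixes N :: "(('x, 'k) free_algebra, 'n) gmodule"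
  assumes "good M d" "graded_module N"
    "\<And>x. x \<in> grade M d \<Longrightarrow> \<alpha> x \<in> grade N d"
    "\<And>x y. x \<in> grade M d \<Longrightarrow> y \<in> grade M d \<Longrightarrow> \<alpha> (x \<oplus> y) = \<alpha> x \<oplus>\<^bsub>N\<^esub> \<alpha> y"
    "\<And>x c. x \<in> grade M d \<Longrightarrow> \<alpha> (scalar c \<odot> x) = scalar c \<odot>\<^bsub>N\<^esub> \<alpha> x"
  shows "\<exists>\<phi>\<in>graded_hom (trunc M d) N. \<forall>x\<in>grade M d. \<phi> x = \<alpha> x"
proof -
  interpret N: graded_module N by fact
  obtain ts where ts: "basis M d ts" using assms(1) by (auto simp: good_def)
  have tg: "set ts \<subseteq> grade M d" using ts by (simp add: basis_def)
  have fb: "free_basis (trunc M d) (replicate (length ts) (- d)) ts" by (rule good_trunc[OF assms(1) ts])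
  have hs: "set (map \<alpha> ts) \<subseteq> grade N d" using tg assms(3) by auto
  have "homog N (replicate (length ts) (- d)) (map \<alpha> ts)" using homog_replicate[OF hs] by simp
  then obtain \<phi> where p: "\<phi> \<in> graded_hom (trunc M d) N"
    "\<And>v. \<phi> (combination (trunc M d) ts v) = combination N (map \<alpha> ts) v"
    using hom_from_free[OF graded_trunc assms(2) fb] by blast
  have z: "\<alpha> \<zero> = \<zero>\<^bsub>N\<^esub>"
    using assms(5)[of \<zero> 0] assms(3)[of \<zero>] N.grade_carrier by simp
  have kcn: "\<alpha> (scalar_combination M us v) = scalar_combination N (map \<alpha> us) v" if "set us \<subseteq> grade M d" for us v
    using that
  proof (induction us rule: rev_induct)
    case (snoc u us)
    have ug: "set us \<subseteq> grade M d" "u \<in> grade M d" using snoc.prems by auto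
    then have "set (map \<alpha> us) \<subseteq> grade N d" "\<alpha> u \<in> grade N d" using assms(3) by auto
    then have c: "set us \<subseteq> carrier M" "u \<in> carrier M" "set (map \<alpha> us) \<subseteq> carrier N" "\<alpha> u \<in> carrier N"
      using ug grade_carrier N.grade_carrier by (meson subset_iff)+
    have g: "combination M us (\<lambda>i. scalar (v i)) \<in> grade M d" 
      using scalar_combination_grade[of us d v] snoc.prems by (simp add: scalar_combination_def)
    then show ?case
      using snoc c g by (simp add: scalar_combination_def combination_snoc N.combination_snoc assms(4,5) grade_scalar)
  qed (simp add: scalar_combination_def z)
  have "\<phi> x = \<alpha> x" if x: "x \<in> grade M d" for x
  proof -
    obtain v where v: "x = scalar_combination M ts v" using basis_span[OF ts x] by blast
    have "combination (trunc M d) ts (\<lambda>i. scalar (v i)) = x"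
      unfolding v scalar_combination_def trunc_def by (rule combination_restrict[OF graded_sub_tset]) (use tg grade_tset[of d d] in auto)
    then show ?thesis using p(2)[of "\<lambda>i. scalar (v i)"] kcn[OF tg, of v] v by (simp add: scalar_combination_def)
  qed
  then show ?thesis using p(1) by blast
qed

lemma basis_step:
  assumes st: "stable M d" and b: "basis M d ts"
  shows "\<exists>us. basis M (d + 1) us \<and> length us = card (UNIV :: 'x set) * length ts"
proof -
  let ?n = "length ts"
  have ts: "set ts \<subseteq> grade M d" "set ts \<subseteq> carrier M" using b basis_carrier by (auto simp: basis_def)
  obtain xs :: "'x list" where xs: "set xs = UNIV" "distinct xs" using finite_distinct_list[OF finite] by blast
  have len: "length xs = card (UNIV :: 'x set)" using xs by (metis distinct_card)
  \<comment> \<open>One block for each variable: position \<open>m * ?n + i\<close> holds the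
    product of the \<open>m\<close>-th variable with \<open>ts ! i\<close>.\<close>
  let ?us = "\<lambda>xs. concat (map (\<lambda>a. map (smult M (xvar a)) ts) xs)"
  have usg: "set (?us xs) \<subseteq> grade M (d + 1)" for xs using ts grade_xvar by auto
  have usc: "set (?us xs) \<subseteq> carrier M" for xs using usg grade_carrier by blast
  have ul: "length (?us xs) = length xs * ?n" for xs by (induction xs) auto
  have key: "scalar_combination M (?us ys) v = (\<Oplus>m\<in>{..<length ys}. xvar (ys ! m) \<odot> scalar_combination M ts (\<lambda>i. v (m * ?n + i)))" for ys v
  proof (induction ys rule: rev_induct)
    case (snoc y ys)
    let ?g = "\<lambda>ys m. xvar (ys ! m) \<odot> scalar_combination M ts (\<lambda>i. v (m * ?n + i))"
    have gc: "?g zs m \<in> carrier M" for zs m using ts by (simp add: smult_closed scalar_combination_closed)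
    have mc: "set (map (smult M (xvar y)) ts) \<subseteq> carrier M" using ts smult_closed by auto
    have "scalar_combination M (?us (ys @ [y])) v = scalar_combination M (?us ys) v \<oplus> scalar_combination M (map (smult M (xvar y)) ts) (\<lambda>i. v (length ys * ?n + i))"
      using scalar_combination_append[OF usc[of ys] mc, of v] unfolding ul by simp
    also have "scalar_combination M (map (smult M (xvar y)) ts) (\<lambda>i. v (length ys * ?n + i)) = ?g (ys @ [y]) (length ys)"
      using ts by (simp add: scalar_combination_smult)
    also have "scalar_combination M (?us ys) v = (\<Oplus>m\<in>{..<length ys}. ?g (ys @ [y]) m)"
      unfolding snoc by (rule finsum_cong') (use gc in \<open>auto simp: nth_append\<close>)
    finally have 1: "scalar_combination M (?us (ys @ [y])) v = (\<Oplus>m\<in>{..<length ys}. ?g (ys @ [y]) m) \<oplus> ?g (ys @ [y]) (length ys)" .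
    have "(\<Oplus>m\<in>{..<Suc (length ys)}. ?g (ys @ [y]) m) = ?g (ys @ [y]) (length ys) \<oplus> (\<Oplus>m\<in>{..<length ys}. ?g (ys @ [y]) m)"
      unfolding lessThan_Suc
      by (rule finsum_insert, simp, simp, rule Pi_I, rule gc, rule gc)
    also have "\<dots> = (\<Oplus>m\<in>{..<length ys}. ?g (ys @ [y]) m) \<oplus> ?g (ys @ [y]) (length ys)"
      by (rule a_comm[OF gc finsum_closed]) (rule Pi_I, rule gc)
    finally show ?case using 1 by simp
  qed (simp add: scalar_combination_def)
  \<comment> \<open>Turns the sum over positions in \<open>xs\<close> into the sum over variables
    that occurs in \<open>var_sum\<close>.\<close>
  have bij: "bij_betw ((!) xs) {..<length xs} UNIV" using xs by (metis bij_betw_nth)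
  have key2: "scalar_combination M (?us xs) v = var_sum M (\<lambda>a. scalar_combination M ts (\<lambda>i. v (the_inv_into {..<length xs} ((!) xs) a * ?n + i)))" for v
  proof -
    let ?g = "\<lambda>a. xvar a \<odot> scalar_combination M ts (\<lambda>i. v (the_inv_into {..<length xs} ((!) xs) a * ?n + i))"
    have "var_sum M (\<lambda>a. scalar_combination M ts (\<lambda>i. v (the_inv_into {..<length xs} ((!) xs) a * ?n + i))) = finsum M ?g ((!) xs ` {..<length xs})"
      using bij by (simp add: var_sum_def bij_betw_def)
    also have "\<dots> = (\<Oplus>m\<in>{..<length xs}. ?g (xs ! m))"
      by (rule finsum_reindex) (use bij ts in \<open>auto simp: bij_betw_def smult_closed scalar_combination_closed\<close>)
    also have "\<dots> = scalar_combination M (?us xs) v" unfolding key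
      by (rule finsum_cong') (use bij ts in \<open>auto simp: bij_betw_def the_inv_into_f_f smult_closed scalar_combination_closed\<close>)
    finally show ?thesis by simp
  qed
  have "basis M (d + 1) (?us xs)"
    unfolding basis_def
  proof (intro conjI allI impI usg subsetI)
    fix x assume "x \<in> grade M (d + 1)"
    then obtain y where y: "\<And>a. y a \<in> grade M d" "var_sum M y = x" using st unfolding stable_def by blast
    have "\<exists>u. scalar_combination M ts u = y a" for a using basis_span[OF b y(1)[of a]] by metis
    then obtain u where u: "\<And>a. scalar_combination M ts (u a) = y a" by metis
    \<comment> \<open>Quotient and remainder by \<open>?n\<close> recover the block, hence the
      variable, and the position inside the block.\<close>
    let ?v = "\<lambda>j. u (xs ! (j div ?n)) (j mod ?n)"
    have "scalar_combination M ts (\<lambda>i. ?v (the_inv_into {..<length xs} ((!) xs) a * ?n + i)) = y a" for a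
    proof -
      have "xs ! (the_inv_into {..<length xs} ((!) xs) a) = a"
        using bij f_the_inv_into_f[of "(!) xs" "{..<length xs}" a] by (auto simp: bij_betw_def)
      moreover have dv: "(m * k + i) div k = m" if "i < k" for m k i :: nat
        using that by (cases "k = 0") auto
      ultimately show ?thesis unfolding u[symmetric] by (intro scalar_combination_cong) (use ts in \<open>auto simp: dv\<close>)
    qed
    then have "scalar_combination M (?us xs) ?v = x" unfolding key2 using y(2) by simp
    then show "x \<in> range (scalar_combination M (?us xs))" by blast
  next
    fix v j assume v: "scalar_combination M (?us xs) v = \<zero>" and j: "j < length (?us xs)"
    then have n: "?n > 0" "j div ?n < length xs" by (auto simp: ul less_mult_imp_div_less intro: gr0I)
    let ?a = "xs ! (j div ?n)"
    have inv: "the_inv_into {..<length xs} ((!) xs) ?a = j div ?n"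
      using bij n by (simp add: bij_betw_def the_inv_into_f_f)
    have "var_sum M (\<lambda>a. scalar_combination M ts (\<lambda>i. v (the_inv_into {..<length xs} ((!) xs) a * ?n + i))) = \<zero>"
      using v key2 by simp
    then have "scalar_combination M ts (\<lambda>i. v (the_inv_into {..<length xs} ((!) xs) ?a * ?n + i)) = \<zero>"
      by (rule stable_inj[OF st, rotated]) (rule scalar_combination_grade[OF ts(1)])
    then have "v (j div ?n * ?n + j mod ?n) = 0"
      using basis_indep[OF b, of "\<lambda>i. v (j div ?n * ?n + i)" "j mod ?n"] n unfolding inv by simp
    then show "v j = 0" by simp
  qed
  then show ?thesis using ul[of xs] len by auto
qed

lemma good_step: "good M d \<Longrightarrow> good M (d + 1)"
proof -
  assume g: "good M d"
  then obtain ts where "basis M d ts" by (auto simp: good_def)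
  then have "\<exists>us. basis M (d + 1) us" using basis_step[of d ts] g by (auto simp: good_def)
  then show ?thesis using g by (auto simp: good_def)
qed

lemma good_mono: "good M d \<Longrightarrow> d \<le> e \<Longrightarrow> good M e"
proof (induction "nat (e - d)" arbitrary: e)
  case (Suc m)
  then have "good M (e - 1)" by simp
  then show ?case using good_step[of "e - 1"] by simp
qed simp

end

section \<open>Inverted morphisms\<close>

lemma gr_simps [simp]:
  "Ob gr = {M. graded_module M \<and> finitely_presented M}"
  "mor gr M N = graded_hom M N"
  "\<zero>\<^bsub>Hom gr M N\<^esub> = (\<lambda>x \<in> carrier M. \<zero>\<^bsub>N\<^esub>)"
  "f \<oplus>\<^bsub>Hom gr M N\<^esub> g = (\<lambda>x \<in> carrier M. f x \<oplus>\<^bsub>N\<^esub> g x)"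
  "c \<odot>\<^bsub>Hom gr M N\<^esub> f = (\<lambda>x \<in> carrier M. scalar c \<odot>\<^bsub>N\<^esub> f x)"
  "Ident gr M = (\<lambda>x \<in> carrier M. x)"
  "Comp gr M N P g f = compose (carrier M) g f"
  by (simp_all add: gr_def mor_def)

lemma hom_setupI: "graded_module M \<Longrightarrow> graded_module N \<Longrightarrow> f \<in> graded_hom M N \<Longrightarrow> hom_setup M N f"
  by (intro hom_setup.intro hom_setup_axioms.intro)

lemma finsum_underlying_space: "finsum (underlying_space M) f A = finsum M f A"
  by (simp add: finsum_def finprod_def underlying_space_def)

lemma zero_hom: "graded_module M \<Longrightarrow> graded_module N \<Longrightarrow> (\<lambda>x \<in> carrier M. \<zero>\<^bsub>N\<^esub>) \<in> graded_hom M N"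
proof (rule graded_homI)
  assume "graded_module M" "graded_module N"
  then interpret M: graded_module M + N: graded_module N .
  show "(\<lambda>x \<in> carrier M. \<zero>\<^bsub>N\<^esub>) x \<in> grade N i" if "x \<in> grade M i" for x i
    using that M.grade_carrier by simp
qed (auto dest: graded_module.axioms(1) simp: graded_module.smult_r_zero graded_module.smult_closed
    abelian_group.axioms abelian_monoid.zero_closed abelian_monoid.a_closed abelian_monoid.l_zero)

lemma id_hom: "graded_module M \<Longrightarrow> (\<lambda>x \<in> carrier M. x) \<in> graded_hom M M"
proof (rule graded_homI)
  assume "graded_module M"
  then interpret graded_module M .
  show "(\<lambda>x \<in> carrier M. x) (x \<oplus>\<^bsub>M\<^esub> y) = (\<lambda>x \<in> carrier M. x) x \<oplus>\<^bsub>M\<^esub> (\<lambda>x \<in> carrier M. x) y"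
    if "x \<in> carrier M" "y \<in> carrier M" for x y using that by simp
  show "(\<lambda>x \<in> carrier M. x) (a \<odot>\<^bsub>M\<^esub> x) = a \<odot>\<^bsub>M\<^esub> (\<lambda>x \<in> carrier M. x) x"
    if "x \<in> carrier M" for a x using that by (simp add: smult_closed)
  show "(\<lambda>x \<in> carrier M. x) x \<in> grade M i" if "x \<in> grade M i" for x i
    using that grade_carrier by simp
qed auto

context graded_module
begin

lemma graded_sub_carrier_self: "graded_sub M (carrier M)"
  by (simp add: graded_sub_def smult_closed component_carrier)

lemma graded_sub_zero_self: "graded_sub M {\<zero>}"
  by (simp add: graded_sub_def)

text \<open>Each of the finitely many spanning vectors has only finitely many non-zero
  components.\<close>

lemma finite_dimensional_vanish:
  assumes "finite_dimensional (underlying_space M)"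
  shows "\<exists>D. \<forall>j\<ge>D. grade M j = {\<zero>}"
proof -
  obtain B where B: "B \<subseteq> carrier M" "finite B"
    "\<And>x. x \<in> carrier M \<Longrightarrow> \<exists>c. x = (\<Oplus>b \<in> B. scalar (c b) \<odot> b)"
    using assms unfolding finite_dimensional_def finsum_underlying_space by (auto simp: underlying_space_def)
  let ?I = "\<Union>b\<in>B. {i. component M b i \<noteq> \<zero>}"
  have "finite ?I" using B component_finite by blast
  then have "j < Max (insert 0 ?I) + 1" if "j \<in> ?I" for j
    using that by (metis Max_ge finite_insert insertI2 zle_add1_eq_le)
  then have "grade M j = {\<zero>}" if "j \<ge> Max (insert 0 ?I) + 1" for j
  proof -
    have "j \<notin> ?I" using that \<open>\<And>j. j \<in> ?I \<Longrightarrow> j < Max (insert 0 ?I) + 1\<close> by fastforce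
    then have z: "\<And>b. b \<in> B \<Longrightarrow> component M b j = \<zero>" by blast
    have "x = \<zero>" if x: "x \<in> grade M j" for x
    proof -
      obtain c where c: "x = (\<Oplus>b \<in> B. scalar (c b) \<odot> b)" using B(3) grade_carrier[OF x] by blast
      have "x = component M x j" using component_homogeneous[OF x] by simp
      also have "\<dots> = (\<Oplus>b \<in> B. component M (scalar (c b) \<odot> b) j)"
        unfolding c by (rule component_finsum) (use B smult_closed in blast)
      also have "\<dots> = (\<Oplus>b \<in> B. \<zero>)"
        by (rule finsum_cong') (use B z component_smult[OF _ homogeneous_scalar] in auto)
      finally show ?thesis by simp
    qed
    then show ?thesis by auto
  qed
  then show ?thesis by blast
qed

end

text \<open>An infinite union of finite-dimensional submodules could reach arbitrarily high degrees.
  Here each of the finitely many generators lies in one such submodule and is therefore killed by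
  all elements of \<open>R\<close> of large degree.\<close>

lemma fdim_vanish:
  assumes "M \<in> fdim"
  shows "\<exists>D. \<forall>j\<ge>D. grade M j = {\<zero>\<^bsub>M\<^esub>}"
proof -
  have M: "graded_module M" "finitely_presented M" and F: "M \<in> Fdim" using assms by (auto simp: fdim_def)
  interpret graded_module M by fact
  obtain es gs where gs: "homog M es gs" "range (combination M gs) = carrier M"
    using M unfolding fp_iff[OF M(1)] by blast
  have "\<exists>D. \<forall>j\<ge>D. \<forall>p\<in>homogeneous (es ! l + j). p \<odot>\<^bsub>M\<^esub> gs ! l = \<zero>\<^bsub>M\<^esub>" if l: "l < length gs" for l
  proof -
    have gl: "gs ! l \<in> grade M (- es ! l)" using gs(1) l by (auto simp: homog_def)
    then obtain N where N: "gs ! l \<in> N" "N \<subseteq> carrier M" "graded_module (restrict_to M N)"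
      "finite_dimensional (underlying_space (restrict_to M N))"
      using F grade_carrier unfolding Fdim_def by blast
    interpret N: graded_module "restrict_to M N" by fact
    obtain D where D: "\<And>j. j \<ge> D \<Longrightarrow> grade (restrict_to M N) j = {\<zero>\<^bsub>M\<^esub>}"
      using N.finite_dimensional_vanish[OF N(4)] by auto
    have "p \<odot>\<^bsub>M\<^esub> gs ! l = \<zero>\<^bsub>M\<^esub>" if "j \<ge> D" "p \<in> homogeneous (es ! l + j)" for j p
    proof -
      have "p \<odot>\<^bsub>M\<^esub> gs ! l \<in> grade (restrict_to M N) j"
        using N.smult_grade[OF that(2), of "gs ! l" "- es ! l"] gl N(1) by simp
      then show ?thesis unfolding D[OF that(1)] by simp
    qed
    then show ?thesis by blast
  qed
  then obtain D where D: "\<And>l j p. l < length gs \<Longrightarrow> j \<ge> D l \<Longrightarrow> p \<in> homogeneous (es ! l + j) \<Longrightarrow> p \<odot>\<^bsub>M\<^esub> gs ! l = \<zero>\<^bsub>M\<^esub>"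
    by metis
  have "grade M j = {\<zero>\<^bsub>M\<^esub>}" if j: "j \<ge> Max (insert 0 (D ` {..<length gs}))" for j
  proof -
    have "x = \<zero>\<^bsub>M\<^esub>" if x: "x \<in> grade M j" for x
    proof -
      obtain v where v: "v \<in> grade (free_graded_module es) j" "combination M gs v = x"
        using lift_grade[OF gs(1) x] gs(2) grade_carrier[OF x] by blast
      have "combination M gs v = (\<Oplus>\<^bsub>M\<^esub>l\<in>{..<length gs}. \<zero>\<^bsub>M\<^esub>)"
        unfolding combination_def
      proof (rule finsum_cong')
        fix l assume l: "l \<in> {..<length gs}"
        then have "D l \<le> j" using j by (meson Max_ge finite_imageI finite_insert finite_lessThan imageI insertI2 order_trans)
        moreover have "v l \<in> homogeneous (es ! l + j)"
          using v(1) l gs(1) by (simp add: grade_free_graded_module homog_def)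
        ultimately show "v l \<odot>\<^bsub>M\<^esub> gs ! l = \<zero>\<^bsub>M\<^esub>" using D l by simp
      qed auto
      then show ?thesis using v(2) by simp
    qed
    then show ?thesis by auto
  qed
  then show ?thesis by blast
qed

text \<open>Finite generation bounds the degrees from below, the hypothesis bounds them from above,
  and each degree in between has finite dimension.\<close>

lemma vanish_fdim:
  fixes M :: "(('x::finite, 'k::field) free_algebra, 'm) gmodule"
  assumes M: "graded_module M" "finitely_presented M" and D: "\<And>j. j \<ge> D \<Longrightarrow> grade M j \<subseteq> {\<zero>\<^bsub>M\<^esub>}"
  shows "M \<in> fdim"
proof -
  interpret graded_module M by fact
  obtain es gs where gs: "homog M es gs" "range (combination M gs) = carrier M"
    using M unfolding fp_iff[OF M(1)] by blast
  have "\<forall>i. \<exists>ts. set ts \<subseteq> grade M i \<and> grade M i \<subseteq> range (scalar_combination M ts)"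
    using ex_spanning[OF finite gs] by blast
  then obtain ts where ts: "\<And>i. set (ts i) \<subseteq> grade M i" "\<And>i. grade M i \<subseteq> range (scalar_combination M (ts i))" by metis
  \<comment> \<open>Below degree \<open>-E\<close> the coefficients of all generators would have
    negative degree.\<close>
  define E where "E = (\<Sum>e\<in>set es. \<bar>e\<bar>)"
  have low: "x = \<zero>\<^bsub>M\<^esub>" if x: "x \<in> grade M i" "i < - E" for x i
  proof -
    obtain v where v: "v \<in> grade (free_graded_module es) i" "combination M gs v = x"
      using lift_grade[OF gs(1) x(1)] gs(2) grade_carrier[OF x(1)] by blast
    have "v l = 0" for l
    proof (cases "l < length es")
      case True
      then have "\<bar>es ! l\<bar> \<le> E" unfolding E_def by (intro member_le_sum) auto
      then have "es ! l + i < 0" using x(2) by linarith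
      then show ?thesis using homogeneous_neg v(1) True by (auto simp: grade_free_graded_module)
    qed (use v(1) in \<open>auto simp: grade_free_graded_module\<close>)
    then have "v = (\<lambda>l. 0)" by blast
    then show ?thesis using v(2) combination_zero[OF homog_carrier[OF gs(1)]] by simp
  qed
  let ?T = "\<Union>i\<in>{-E..<D}. set (ts i)"
  obtain us where us: "set us = ?T" "distinct us" using finite_distinct_list[of ?T] by auto
  have usc: "set us \<subseteq> carrier M" unfolding us(1) using ts(1) grade_carrier by (meson UN_least subset_iff)
  have W: "scalar_sub M (range (scalar_combination M us))" by (rule scalar_sub_range_kc[OF usc])
  have gr: "grade M i \<subseteq> range (scalar_combination M us)" for i
  proof (cases "i \<in> {-E..<D}")
    case True
    then have "set (ts i) \<subseteq> set us" using us(1) by auto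
    also have "\<dots> \<subseteq> range (scalar_combination M us)" by (rule set_subset_range_kc[OF usc])
    finally have "range (scalar_combination M (ts i)) \<subseteq> range (scalar_combination M us)" using scalar_combination_mem[OF W] by auto
    then show ?thesis using ts(2)[of i] by (rule subset_trans[rotated])
  next
    case False
    then have "grade M i \<subseteq> {\<zero>\<^bsub>M\<^esub>}" using D[of i] low[of _ i] by force
    then show ?thesis using scalar_sub_zero[OF W] by auto
  qed
  have all: "\<exists>c. x = (\<Oplus>\<^bsub>M\<^esub>b \<in> set us. scalar (c b) \<odot>\<^bsub>M\<^esub> b)" if x: "x \<in> carrier M" for x
  proof -
    have "(\<Oplus>\<^bsub>M\<^esub>i \<in> {i. component M x i \<noteq> \<zero>\<^bsub>M\<^esub>}. component M x i) \<in> range (scalar_combination M us)"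
      by (rule scalar_sub_finsum[OF W]) (use gr component_grade[OF x] in blast)
    then obtain v where v: "x = scalar_combination M us v" using component_sum0[OF x] by auto
    have bij: "bij_betw ((!) us) {..<length us} (set us)" using us(2) by (rule bij_betw_nth) auto
    let ?c = "\<lambda>b. v (the_inv_into {..<length us} ((!) us) b)"
    have "(\<Oplus>\<^bsub>M\<^esub>b \<in> (!) us ` {..<length us}. scalar (?c b) \<odot>\<^bsub>M\<^esub> b)
        = (\<Oplus>\<^bsub>M\<^esub>l \<in> {..<length us}. scalar (?c (us ! l)) \<odot>\<^bsub>M\<^esub> us ! l)"
      by (rule finsum_reindex) (use bij usc in \<open>auto simp: bij_betw_def intro!: smult_closed\<close>)
    also have "\<dots> = x" unfolding v scalar_combination_def combination_def
      by (rule finsum_cong') (use bij usc in \<open>auto simp: bij_betw_def the_inv_into_f_f intro!: smult_closed subsetD[OF _ nth_mem]\<close>)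
    finally have "x = (\<Oplus>\<^bsub>M\<^esub>b \<in> set us. scalar (?c b) \<odot>\<^bsub>M\<^esub> b)" using bij by (simp add: bij_betw_def)
    then show ?thesis by (rule exI[of _ ?c])
  qed
  have fd: "finite_dimensional (underlying_space M)"
    unfolding finite_dimensional_def finsum_underlying_space
    using usc all by (intro exI[of _ "set us"]) (auto simp: underlying_space_def)
  have "underlying_space (restrict_to M (carrier M)) = underlying_space M"
    by (simp add: underlying_space_def restrict_to_def)
  then have "carrier M \<in> {N. N \<subseteq> carrier M \<and> graded_module (restrict_to M N) \<and>
                      finite_dimensional (underlying_space (restrict_to M N))}"
    using fd graded_restrict[OF graded_sub_carrier_self] by simp
  then show ?thesis using M unfolding fdim_def Fdim_def by auto
qed

text \<open>For injective \<open>s\<close> the kernel is the zero module, and the cokernel is the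
  quotient by the image. The image is generated by the images of finitely many generators, so the
  cokernel is finitely presented; it is finite dimensional because it vanishes from degree
  \<open>D\<close> on.\<close>

lemma inverted_of_injective:
  fixes W X :: "(('x::finite, 'k::field) free_algebra, 'm) gmodule"
  assumes W: "graded_module W" "finitely_presented W" and X: "graded_module X" "finitely_presented X"
    and s: "s \<in> graded_hom W X" "inj_on s (carrier W)" and D: "\<And>j. j \<ge> D \<Longrightarrow> grade X j \<subseteq> s ` carrier W"
  shows "inverted gr fdim W X s"
proof -
  interpret s: hom_setup W X s by (rule hom_setupI[OF W(1) X(1) s(1)])
  obtain es gs where gs: "homog W es gs" "range (combination W gs) = carrier W"
    using W unfolding fp_iff[OF W(1)] by blast
  let ?S = "range (combination X (map s gs))"
  have S: "s ` carrier W = ?S"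
    unfolding gs(2)[symmetric] image_image using s.f_lc[OF s.M.homog_carrier[OF gs(1)]] by simp
  have hs: "homog X es (map s gs)" by (rule s.homog_map[OF gs(1)])
  have gsS: "graded_sub X ?S" by (rule s.N.graded_sub_lc[OF hs])
  let ?K = "restrict_to W {\<zero>\<^bsub>W\<^esub>}"
  have K: "graded_module ?K" by (rule s.M.graded_restrict[OF s.M.graded_sub_zero_self])
  have fpK: "finitely_presented ?K"
  proof (rule graded_module.fp_free_basis[OF K, of "[]" "[]"])
    show "free_basis ?K [] []" by (auto simp: free_basis_def homog_def graded_module.combination_Nil[OF K])
  qed
  have Kf: "?K \<in> fdim" by (rule vanish_fdim[OF K fpK]) auto
  have ker: "is_kernel gr ?K W X (\<lambda>x\<in>carrier ?K. \<zero>\<^bsub>W\<^esub>) s"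
    unfolding is_kernel_def
  proof (intro conjI ballI impI)
    show "(\<lambda>x\<in>carrier ?K. \<zero>\<^bsub>W\<^esub>) \<in> mor gr ?K W" using zero_hom[OF K W(1)] by simp
    show "s \<in> mor gr W X" using s by simp
    show "Comp gr ?K W X s (\<lambda>x\<in>carrier ?K. \<zero>\<^bsub>W\<^esub>) = \<zero>\<^bsub>Hom gr ?K X\<^esub>"
      by (simp add: compose_def fun_eq_iff restrict_def)
    fix T u assume T: "T \<in> Ob gr" and u: "u \<in> mor gr T W" and z: "Comp gr T W X s u = \<zero>\<^bsub>Hom gr T X\<^esub>"
    have u0: "u x = \<zero>\<^bsub>W\<^esub>" if x: "x \<in> carrier T" for x
    proof -
      have "s (u x) = s \<zero>\<^bsub>W\<^esub>" using fun_cong[OF z, of x] x by (simp add: compose_def)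
      then show ?thesis using s(2) hom_carrier[of u T W x] u x by (simp add: inj_on_def)
    qed
    have v: "(\<lambda>x\<in>carrier T. \<zero>\<^bsub>?K\<^esub>) \<in> graded_hom T ?K" using T by (intro zero_hom K) simp
    show "\<exists>!v. v \<in> mor gr T ?K \<and> Comp gr T ?K W (\<lambda>x\<in>carrier ?K. \<zero>\<^bsub>W\<^esub>) v = u"
    proof (rule ex1I[of _ "\<lambda>x\<in>carrier T. \<zero>\<^bsub>?K\<^esub>"])
      show "(\<lambda>x\<in>carrier T. \<zero>\<^bsub>?K\<^esub>) \<in> mor gr T ?K \<and>
          Comp gr T ?K W (\<lambda>x\<in>carrier ?K. \<zero>\<^bsub>W\<^esub>) (\<lambda>x\<in>carrier T. \<zero>\<^bsub>?K\<^esub>) = u"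
        using v u0 hom_ext[of u T W] u by (auto simp: compose_def fun_eq_iff extensional_def)
      fix v assume "v \<in> mor gr T ?K \<and> Comp gr T ?K W (\<lambda>x\<in>carrier ?K. \<zero>\<^bsub>W\<^esub>) v = u"
      then have v': "v \<in> graded_hom T ?K" by simp
      show "v = (\<lambda>x\<in>carrier T. \<zero>\<^bsub>?K\<^esub>)"
        by (rule hom_eqI[OF v' v]) (use hom_carrier[OF v'] in auto)
    qed
  qed
  let ?Q = "quot X ?S" and ?q = "restrict (qrep X ?S) (carrier X)"
  have Q: "graded_module ?Q" by (rule s.N.graded_quot[OF gsS])
  have fpQ: "finitely_presented ?Q" by (rule s.N.fp_quot[OF X(2) hs])
  have qh: "?q \<in> graded_hom X ?Q" by (rule s.N.qrep_hom[OF gsS])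
  have qz: "qrep X ?S x = qrep X ?S \<zero>\<^bsub>X\<^esub> \<longleftrightarrow> x \<in> ?S" if "x \<in> carrier X" for x
    by (rule s.N.qrep_zero_iff[OF gsS that])
  have Qf: "?Q \<in> fdim"
  proof (rule vanish_fdim[OF Q fpQ])
    fix j assume "j \<ge> D"
    then show "grade ?Q j \<subseteq> {\<zero>\<^bsub>?Q\<^esub>}" using D[of j] qz s.N.grade_carrier unfolding S by auto
  qed
  have sc: "s x \<in> carrier X" if "x \<in> carrier W" for x using hom_carrier[OF s(1) that] .
  have coker: "is_cokernel gr W X ?Q s ?q"
    unfolding is_cokernel_def
  proof (intro conjI ballI impI)
    show "s \<in> mor gr W X" "?q \<in> mor gr X ?Q" using s qh by simp_all
    show "Comp gr W X ?Q ?q s = \<zero>\<^bsub>Hom gr W ?Q\<^esub>"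
      using sc S qz by (auto simp: compose_def fun_eq_iff restrict_def)
    fix T u assume T: "T \<in> Ob gr" and u: "u \<in> mor gr X T" and z: "Comp gr W X T u s = \<zero>\<^bsub>Hom gr W T\<^esub>"
    have gT: "graded_module T" using T by simp
    interpret u: hom_setup X T u by (rule hom_setupI[OF X(1) gT]) (use u in simp)
    have uS: "u y = \<zero>\<^bsub>T\<^esub>" if "y \<in> ?S" for y
    proof -
      have "y \<in> s ` carrier W" using that by (simp only: S)
      then obtain x where x: "y = s x" "x \<in> carrier W" by (rule imageE)
      then show ?thesis using fun_cong[OF z, of x] by (simp add: compose_def)
    qed
    \<comment> \<open>An element and its representative differ by an element of the image, where
      \<open>u\<close> vanishes; so the restriction of \<open>u\<close> to representatives is the
      factorisation through the quotient.\<close>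
    have uq: "u (qrep X ?S x) = u x" if x: "x \<in> carrier X" for x
    proof -
      have "u (x \<ominus>\<^bsub>X\<^esub> qrep X ?S x) = \<zero>\<^bsub>T\<^esub>" by (rule uS[OF s.N.qrep_diff[OF gsS x]])
      then have "u x = u (qrep X ?S x)"
        using u.f_diff[OF x s.N.qrep_carrier[OF gsS x]] hom_carrier[OF u.f] s.N.qrep_carrier[OF gsS x] x
        by (simp add: u.N.diff_zero_iff)
      then show ?thesis by simp
    qed
    let ?v = "restrict u (carrier ?Q)"
    have vh: "?v \<in> graded_hom ?Q T"
    proof (rule graded_homI)
      fix x y assume "x \<in> carrier ?Q" "y \<in> carrier ?Q"
      then obtain a b where "x = qrep X ?S a" "y = qrep X ?S b" "a \<in> carrier X" "b \<in> carrier X" by auto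
      then show "?v (x \<oplus>\<^bsub>?Q\<^esub> y) = ?v x \<oplus>\<^bsub>T\<^esub> ?v y"
        using s.N.qrep_carrier[OF gsS] by (simp add: uq hom_add[OF u.f])
    next
      fix a x assume "x \<in> carrier ?Q"
      then obtain b where "x = qrep X ?S b" "b \<in> carrier X" by auto
      then show "?v (a \<odot>\<^bsub>?Q\<^esub> x) = a \<odot>\<^bsub>T\<^esub> ?v x"
        using s.N.qrep_carrier[OF gsS] by (simp add: uq hom_smult[OF u.f] s.N.smult_closed)
    next
      fix i x assume "x \<in> grade ?Q i"
      then obtain b where "x = qrep X ?S b" "b \<in> grade X i" by auto
      then show "?v x \<in> grade T i"
        using s.N.grade_carrier uq hom_grade[OF u.f] by simp
    qed (use s.N.qrep_carrier[OF gsS] hom_carrier[OF u.f] in auto)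
    have vu: "compose (carrier X) ?v ?q = u"
      using uq hom_ext[OF u.f] by (auto simp: compose_def fun_eq_iff extensional_def)
    show "\<exists>!v. v \<in> mor gr ?Q T \<and> Comp gr X ?Q T v ?q = u"
    proof (rule ex1I[of _ ?v])
      show "?v \<in> mor gr ?Q T \<and> Comp gr X ?Q T ?v ?q = u" unfolding gr_simps using vh vu by (rule conjI)
      fix v assume v: "v \<in> mor gr ?Q T \<and> Comp gr X ?Q T v ?q = u"
      show "v = ?v"
      proof (rule hom_eqI[OF _ vh])
        show "v \<in> graded_hom ?Q T" using v by simp
        fix y assume y: "y \<in> carrier ?Q"
        then obtain x where x: "x \<in> carrier X" "y = qrep X ?S x" by auto
        have "compose (carrier X) v ?q x = compose (carrier X) ?v ?q x" using v vu by simp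
        then show "v y = ?v y" using x y by (simp add: compose_def)
      qed
    qed
  qed
  show ?thesis
    unfolding inverted_def using s(1) ker coker Kf Qf by auto
qed

section \<open>Fractions as germs at infinity\<close>

definition incl :: "(('x, 'k::field) free_algebra, 'm) gmodule \<Rightarrow> int \<Rightarrow> 'm \<Rightarrow> 'm" where
  "incl X d = (\<lambda>x\<in>trunc_set X d. x)"

abbreviation fp_module :: "(('x, 'k::field) free_algebra, 'm) gmodule \<Rightarrow> bool" where
  "fp_module M \<equiv> graded_module M \<and> finitely_presented M"

lemma carrier_trunc [simp]: "carrier (trunc M d) = trunc_set M d" "\<zero>\<^bsub>trunc M d\<^esub> = \<zero>\<^bsub>M\<^esub>"
  "x \<oplus>\<^bsub>trunc M d\<^esub> y = x \<oplus>\<^bsub>M\<^esub> y" "a \<odot>\<^bsub>trunc M d\<^esub> x = a \<odot>\<^bsub>M\<^esub> x"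
  by (simp_all add: trunc_def)

lemma fgmI: "graded_module (M :: (('x::finite, 'k::field) free_algebra, 'm) gmodule) \<Longrightarrow> fgm M"
  by (rule fgm.intro)

lemma fp_module_trunc:
  "fp_module (X :: (('x::finite, 'k::field) free_algebra, 'm) gmodule) \<Longrightarrow> good X d \<Longrightarrow> fp_module (trunc X d)"
  by (simp add: graded_module.graded_trunc fgm.fp_trunc fgmI)

lemma restrict_hom:
  assumes "graded_module X" "\<phi> \<in> graded_hom (trunc X d) Y" "d \<le> e"
  shows "restrict \<phi> (trunc_set X e) \<in> graded_hom (trunc X e) Y"
proof -
  interpret graded_module X by fact
  have sub: "x \<in> trunc_set X d" if "x \<in> trunc_set X e" for x using trunc_set_mono[OF assms(3)] that by auto
  note S = graded_sub_tset[of e]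
  show ?thesis
  proof (rule graded_homI)
    fix i x assume "x \<in> grade (trunc X e) i"
    then have x: "x \<in> grade X i" "x \<in> trunc_set X e" by (auto simp: trunc_def)
    then have "x \<in> grade (trunc X d) i" using sub by (simp add: trunc_def)
    then show "restrict \<phi> (trunc_set X e) x \<in> grade Y i" using x hom_grade[OF assms(2)] by simp
  qed (use sub graded_sub_add[OF S] graded_sub_smult[OF S] hom_carrier[OF assms(2)] hom_add[OF assms(2)] hom_smult[OF assms(2)] in auto)
qed

lemma incl_hom: "graded_module X \<Longrightarrow> incl X d \<in> graded_hom (trunc X d) X"
proof (rule graded_homI)
  assume "graded_module X"
  then interpret graded_module X .
  note S = graded_sub_tset[of d]
  show "incl X d x \<in> grade X i" if "x \<in> grade (trunc X d) i" for x i
    using that by (auto simp: incl_def trunc_def)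
  show "incl X d (a \<odot>\<^bsub>trunc X d\<^esub> x) = a \<odot>\<^bsub>X\<^esub> incl X d x" if "x \<in> carrier (trunc X d)" for a x
    using that graded_sub_smult[OF S] by (simp add: incl_def)
  show "incl X d (x \<oplus>\<^bsub>trunc X d\<^esub> y) = incl X d x \<oplus>\<^bsub>X\<^esub> incl X d y"
    if "x \<in> carrier (trunc X d)" "y \<in> carrier (trunc X d)" for x y
    using that graded_sub_add[OF S] by (simp add: incl_def)
  show "incl X d x \<in> carrier X" if "x \<in> carrier (trunc X d)" for x
    using that graded_sub_carrier[OF S] by (simp add: incl_def)
qed (auto simp: incl_def)

text \<open>Homomorphisms commute with components, so nothing below degree \<open>d\<close> can
  appear in a value. This allows germs given at the same degree to be composed.\<close>

lemma hom_trunc: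
  assumes "graded_module X" "graded_module Y" "\<phi> \<in> graded_hom (trunc X d) Y"
  shows "\<phi> \<in> graded_hom (trunc X d) (trunc Y d)"
proof -
  interpret X: graded_module X by fact
  interpret Y: graded_module Y by fact
  interpret p: hom_setup "trunc X d" Y \<phi> by (rule hom_setupI[OF X.graded_trunc assms(2,3)])
  have t: "\<phi> x \<in> trunc_set Y d" if x: "x \<in> trunc_set X d" for x
  proof -
    have "component Y (\<phi> x) i = \<zero>\<^bsub>Y\<^esub>" if "i < d" for i
    proof -
      have "component (trunc X d) x i = \<zero>\<^bsub>X\<^esub>"
        using X.component_restrict[OF X.graded_sub_tset x] x that by (simp add: trunc_def trunc_set_def)
      then show ?thesis using p.f_cp[of x i] p.f_zero x by simp
    qed
    then show ?thesis using hom_carrier[OF assms(3)] x by (simp add: trunc_set_def[of Y])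
  qed
  show ?thesis
  proof (rule graded_homI)
    fix i x assume x: "x \<in> grade (trunc X d) i"
    then have "x \<in> trunc_set X d" by (simp add: trunc_def)
    then show "\<phi> x \<in> grade (trunc Y d) i" using hom_grade[OF assms(3) x] t by (simp add: trunc_def)
  qed (use t hom_ext[OF assms(3)] hom_add[OF assms(3)] hom_smult[OF assms(3)] in auto)
qed

lemma incl_inverted:
  assumes "fp_module (X :: (('x::finite, 'k::field) free_algebra, 'm) gmodule)" "good X d"
  shows "inverted gr fdim (trunc X d) X (incl X d)"
proof (rule inverted_of_injective)
  show "inj_on (incl X d) (carrier (trunc X d))" by (auto simp: incl_def inj_on_def)
  fix j assume "j \<ge> d"
  then show "grade X j \<subseteq> incl X d ` carrier (trunc X d)"
    using graded_module.grade_tset[of X d j] assms(1) by (auto simp: incl_def image_iff)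
qed (use assms fp_module_trunc[OF assms] incl_hom in auto)

lemma id_inverted:
  assumes "fp_module (X :: (('x::finite, 'k::field) free_algebra, 'm) gmodule)"
  shows "inverted gr fdim X X (\<lambda>x\<in>carrier X. x)"
proof (rule inverted_of_injective)
  fix j :: int
  show "grade X j \<subseteq> (\<lambda>x\<in>carrier X. x) ` carrier X"
    using graded_module.grade_carrier[of X] assms(1) by (auto simp: image_iff)
qed (use assms id_hom in \<open>auto simp: inj_on_def\<close>)

lemma twisted_sheaf_free_basis:
  assumes "inj \<iota>"
  shows "free_basis (twisted_sheaf \<iota> e) [e] [\<iota> 1]"
proof -
  have "\<iota> p \<in> range (combination (twisted_sheaf \<iota> e) [\<iota> 1])" for p
    using twisted_sheaf_free(2)[OF assms, of e "\<lambda>i. p"] by (metis rangeI)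
  then show ?thesis
    unfolding free_basis_def using twisted_sheaf_free[OF assms] assms
    by (auto simp: twisted_sheaf_simps[OF assms] inj_eq)
qed

lemma kernel_lift:
  "is_kernel gr K X Y i f \<Longrightarrow> T \<in> Ob gr \<Longrightarrow> u \<in> graded_hom T X \<Longrightarrow>
    Comp gr T X Y f u = \<zero>\<^bsub>Hom gr T Y\<^esub> \<Longrightarrow> \<exists>v\<in>graded_hom T K. compose (carrier T) i v = u"
  unfolding is_kernel_def by (simp only: gr_simps(2,7)) blast

lemma cokernel_lift:
  "is_cokernel gr X Y Q f q \<Longrightarrow> T \<in> Ob gr \<Longrightarrow> u \<in> graded_hom Y T \<Longrightarrow>
    Comp gr X Y T u f = \<zero>\<^bsub>Hom gr X T\<^esub> \<Longrightarrow> \<exists>v\<in>graded_hom Q T. compose (carrier Y) v q = u"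
  unfolding is_cokernel_def by (simp only: gr_simps(2,7)) blast

text \<open>The converse of \<open>inverted_of_injective\<close> in high degrees. The kernel and
  cokernel are arbitrary objects with the right universal property, so each has to be compared with
  a suitable test object before it says anything about elements.\<close>

lemma inverted_bij:
  fixes \<iota> :: "('x::finite, 'k::field) free_algebra \<Rightarrow> 'm" and W X :: "(('x, 'k) free_algebra, 'm) gmodule"
  assumes inj: "inj \<iota>" and W: "fp_module W" and X: "fp_module X" and s: "inverted gr fdim W X s"
  shows "\<exists>D. \<forall>j\<ge>D. bij_betw s (grade W j) (grade X j)"
proof -
  have sh: "s \<in> graded_hom W X" using s by (simp add: inverted_def)
  interpret s: hom_setup W X s by (rule hom_setupI) (use W X sh in auto)
  obtain K i where K: "K \<in> fdim" "is_kernel gr K W X i s" using s unfolding inverted_def by blast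
  obtain Q q where Q: "Q \<in> fdim" "is_cokernel gr W X Q s q" using s unfolding inverted_def by blast
  obtain D1 where D1: "\<And>j. j \<ge> D1 \<Longrightarrow> grade K j = {\<zero>\<^bsub>K\<^esub>}" using fdim_vanish[OF K(1)] by blast
  obtain D2 where D2: "\<And>j. j \<ge> D2 \<Longrightarrow> grade Q j = {\<zero>\<^bsub>Q\<^esub>}" using fdim_vanish[OF Q(1)] by blast
  have gK: "graded_module K" and gQ: "graded_module Q" using K(1) Q(1) by (auto simp: fdim_def)
  have ih: "i \<in> graded_hom K W" and qh: "q \<in> graded_hom X Q"
    using K(2) Q(2) unfolding is_kernel_def is_cokernel_def by simp_all
  interpret i: hom_setup K W i by (rule hom_setupI) (use gK W ih in auto)
  have zero: "x = \<zero>\<^bsub>W\<^esub>" if x: "x \<in> grade W j" "s x = \<zero>\<^bsub>X\<^esub>" "j \<ge> D1" for x j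
  proof -
    \<comment> \<open>This module is free on one generator of degree \<open>j\<close>, so its maps
      to \<open>W\<close> are the elements of \<open>W_j\<close>. The map to \<open>x\<close> is
      killed by \<open>s\<close> and factors through \<open>K\<close>, which is zero in degree
      \<open>j\<close>.\<close>
    let ?T = "twisted_sheaf \<iota> (- j)"
    have T: "graded_module ?T" "?T \<in> Ob gr"
      using graded_twisted_sheaf[OF inj] fp_twisted_sheaf[OF inj] by auto
    have xc: "x \<in> carrier W" using x s.M.grade_carrier by blast
    have "homog W [- j] [x]" using x by (simp add: homog_def)
    then obtain u where u: "u \<in> graded_hom ?T W" "\<And>v. u (combination ?T [\<iota> 1] v) = combination W [x] v"
      using hom_from_free[OF T(1) conjunct1[OF W] twisted_sheaf_free_basis[OF inj]] by blast
    have u1: "u (\<iota> p) = p \<odot>\<^bsub>W\<^esub> x" for p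
      using u(2)[of "\<lambda>i. p"] twisted_sheaf_free(2)[OF inj, of "- j" "\<lambda>i. p"] s.M.combination_snoc[of "[]" x] xc
      by (simp add: s.M.smult_closed)
    have su: "Comp gr ?T W X s u = \<zero>\<^bsub>Hom gr ?T X\<^esub>"
      using x(2) xc hom_smult[OF sh xc] u1
      by (auto simp: compose_def twisted_sheaf_simps[OF inj] restrict_def fun_eq_iff)
    obtain v where v: "v \<in> graded_hom ?T K" "compose (carrier ?T) i v = u"
      using kernel_lift[OF K(2) T(2) u(1) su] by blast
    have "\<iota> 1 \<in> grade ?T j" by (simp add: twisted_sheaf_simps[OF inj])
    then have "v (\<iota> 1) = \<zero>\<^bsub>K\<^esub>" using hom_grade[OF v(1), of "\<iota> 1" j] D1[OF x(3)] by simp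
    moreover have "u (\<iota> 1) = i (v (\<iota> 1))"
      unfolding v(2)[symmetric] by (simp add: compose_def twisted_sheaf_simps[OF inj])
    ultimately show ?thesis using u1[of 1] xc i.f_zero by (simp add: s.M.smult_one)
  qed
  have surj: "x \<in> s ` grade W j" if x: "x \<in> grade X j" "j \<ge> D2" for x j
  proof -
    obtain es gs where gs: "homog W es gs" "range (combination W gs) = carrier W"
      using W unfolding fp_iff[OF conjunct1[OF W]] by blast
    let ?S = "range (combination X (map s gs))"
    have S: "s ` carrier W = ?S"
      unfolding gs(2)[symmetric] image_image using s.f_lc[OF s.M.homog_carrier[OF gs(1)]] by simp
    have hs: "homog X es (map s gs)" by (rule s.homog_map[OF gs(1)])
    have gsS: "graded_sub X ?S" by (rule s.N.graded_sub_lc[OF hs])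
    \<comment> \<open>The projection to the quotient by the image kills \<open>s\<close>, hence
      factors through \<open>Q\<close>. As \<open>Q\<close> is zero in degree \<open>j\<close>, the
      class of \<open>x\<close> is zero.\<close>
    let ?T = "quot X ?S" and ?u = "restrict (qrep X ?S) (carrier X)"
    have T: "graded_module ?T" "?T \<in> Ob gr"
      using s.N.graded_quot[OF gsS] s.N.fp_quot[OF _ hs] X by auto
    have u: "?u \<in> graded_hom X ?T" by (rule s.N.qrep_hom[OF gsS])
    have qz: "qrep X ?S x = qrep X ?S \<zero>\<^bsub>X\<^esub> \<longleftrightarrow> x \<in> ?S" if "x \<in> carrier X" for x
      by (rule s.N.qrep_zero_iff[OF gsS that])
    have xc: "x \<in> carrier X" using x s.N.grade_carrier by blast
    have us: "Comp gr W X ?T ?u s = \<zero>\<^bsub>Hom gr W ?T\<^esub>"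
      using hom_carrier[OF sh] S qz by (auto simp: compose_def fun_eq_iff restrict_def)
    obtain v where v: "v \<in> graded_hom Q ?T" "compose (carrier X) v q = ?u"
      using cokernel_lift[OF Q(2) T(2) u us] by blast
    interpret v: hom_setup Q ?T v by (rule hom_setupI[OF gQ T(1) v(1)])
    have "q x = \<zero>\<^bsub>Q\<^esub>" using hom_grade[OF qh x(1)] D2[OF x(2)] by simp
    then have "compose (carrier X) v q x = \<zero>\<^bsub>?T\<^esub>" using xc v.f_zero by (simp add: compose_def)
    then have "qrep X ?S x = qrep X ?S \<zero>\<^bsub>X\<^esub>" unfolding v(2) using xc by simp
    then have "x \<in> s ` carrier W" unfolding S by (rule iffD1[OF qz[OF xc]])
    then have "\<exists>w\<in>grade W j. s w = x" by (rule s.image_grade[OF x(1)])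
    then show ?thesis by (auto intro: rev_image_eqI)
  qed
  have "bij_betw s (grade W j) (grade X j)" if j: "j \<ge> max D1 D2" for j
    unfolding bij_betw_def
  proof
    show "inj_on s (grade W j)"
    proof (rule inj_onI)
      fix x y assume xy: "x \<in> grade W j" "y \<in> grade W j" "s x = s y"
      then have c: "x \<in> carrier W" "y \<in> carrier W" using s.M.grade_carrier by auto
      have "s (x \<ominus>\<^bsub>W\<^esub> y) = \<zero>\<^bsub>X\<^esub>" using xy(3) c hom_carrier[OF sh] by (simp add: s.f_diff s.N.diff_zero_iff)
      then have "x \<ominus>\<^bsub>W\<^esub> y = \<zero>\<^bsub>W\<^esub>" using zero[OF s.M.grade_minus[OF xy(1,2)]] j by simp
      then show "x = y" using c by (simp add: s.M.diff_zero_iff)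
    qed
    show "s ` grade W j = grade X j" using surj j hom_grade[OF sh] by auto
  qed
  then show ?thesis by blast
qed

text \<open>The inverse of \<open>s\<close> in degree \<open>d\<close> is linear, so it extends from
  \<open>X_d\<close> to the free truncation. It is what moves an arbitrary roof to one whose left
  leg is the inclusion of a truncation.\<close>

lemma hom_section:
  fixes X W :: "(('x::finite, 'k::field) free_algebra, 'm) gmodule"
  assumes W: "graded_module W" and X: "graded_module X" and g: "good X d" and s: "s \<in> graded_hom W X"
    and bij: "bij_betw s (grade W d) (grade X d)"
  shows "\<exists>\<sigma>\<in>graded_hom (trunc X d) W. compose (trunc_set X d) s \<sigma> = incl X d"
proof -
  interpret s: hom_setup W X s by (rule hom_setupI[OF W X s])
  interpret X: fgm X by (rule fgmI[OF X])
  let ?\<alpha> = "the_inv_into (grade W d) s"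
  have a: "?\<alpha> x \<in> grade W d" "s (?\<alpha> x) = x" if "x \<in> grade X d" for x
    using bij that the_inv_into_into[of s "grade W d" x] f_the_inv_into_f[of s "grade W d" x]
    by (auto simp: bij_betw_def)
  have eq: "?\<alpha> x = y" if "y \<in> grade W d" "s y = x" for x y
    using bij that by (auto simp: bij_betw_def the_inv_into_f_f)
  have "\<exists>\<sigma>\<in>graded_hom (trunc X d) W. \<forall>x\<in>grade X d. \<sigma> x = ?\<alpha> x"
  proof (rule X.trunc_extend[OF g W])
    fix x y assume xy: "x \<in> grade X d" "y \<in> grade X d"
    show "?\<alpha> (x \<oplus>\<^bsub>X\<^esub> y) = ?\<alpha> x \<oplus>\<^bsub>W\<^esub> ?\<alpha> y"
      using s.M.grade_carrier[OF a(1)] xy by (intro eq) (simp_all add: a s.M.grade_add hom_add[OF s])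
  next
    fix x c assume x: "x \<in> grade X d"
    show "?\<alpha> (scalar c \<odot>\<^bsub>X\<^esub> x) = scalar c \<odot>\<^bsub>W\<^esub> ?\<alpha> x"
      using s.M.grade_carrier[OF a(1)] x by (intro eq) (simp_all add: a s.M.grade_scalar hom_smult[OF s])
  qed (use a in auto)
  then obtain \<sigma> where \<sigma>: "\<sigma> \<in> graded_hom (trunc X d) W" "\<And>x. x \<in> grade X d \<Longrightarrow> \<sigma> x = ?\<alpha> x" by blast
  have "compose (carrier (trunc X d)) s \<sigma> = incl X d"
  proof (rule X.trunc_hom_eq[OF g hom_compose[OF \<sigma>(1) s s.N.graded_trunc] incl_hom[OF X] X])
    fix x assume x: "x \<in> grade X d"
    then have "x \<in> trunc_set X d" using s.N.grade_tset[of d d] by blast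
    then show "compose (carrier (trunc X d)) s \<sigma> x = incl X d x"
      using \<sigma>(2)[OF x] a[OF x] by (simp add: compose_def incl_def)
  qed
  then show ?thesis using \<sigma>(1) by auto
qed

text \<open>The roof \<open>(W, s, f)\<close> is the fraction \<open>f s\<^sup>-\<^sup>1\<close>; above some degree it is the homomorphism \<open>\<phi>\<close>.\<close>

definition germ where
  "germ X Y W s f d \<phi> \<longleftrightarrow> (W, s, f) \<in> roofs gr fdim X Y \<and> good X d \<and>
     (\<forall>j\<ge>d. bij_betw s (grade W j) (grade X j)) \<and> \<phi> \<in> graded_hom (trunc X d) Y \<and>
     (\<forall>j\<ge>d. \<forall>y\<in>grade W j. \<phi> (s y) = f y)"

definition germ_class where
  "germ_class X Y d \<phi> = roof_rel gr fdim X Y `` {(trunc X d, incl X d, \<phi>)}"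

lemma germD: "germ X Y W s f d \<phi> \<Longrightarrow> d \<le> j \<Longrightarrow> y \<in> grade W j \<Longrightarrow> \<phi> (s y) = f y"
  by (simp add: germ_def)

lemma roofsD:
  assumes "(W, s, f) \<in> roofs gr fdim X Y"
  shows "fp_module W" "inverted gr fdim W X s" "s \<in> graded_hom W X" "f \<in> graded_hom W Y"
  using assms by (auto simp: roofs_def inverted_def)

context
  fixes \<iota> :: "('x::finite, 'k::field) free_algebra \<Rightarrow> 'm"
    and X Y :: "(('x, 'k) free_algebra, 'm) gmodule"
  assumes inj: "inj \<iota>" and X: "fp_module X" and Y: "fp_module Y"
begin

interpretation X: fgm X using X by (intro fgmI) simp
interpretation Y: fgm Y using Y by (intro fgmI) simp

text \<open>The germ is \<open>f\<close> composed with the section of \<open>s\<close> over the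
  truncation; injectivity of \<open>s\<close> in each degree from \<open>d\<close> on shows that the
  section inverts \<open>s\<close> there.\<close>

lemma germ_ex:
  assumes r: "(W, s, f) \<in> roofs gr fdim X Y"
  shows "\<exists>D. \<forall>d\<ge>D. \<exists>\<phi>. germ X Y W s f d \<phi>"
proof -
  note R = roofsD[OF r]
  obtain D1 where D1: "\<And>j. j \<ge> D1 \<Longrightarrow> bij_betw s (grade W j) (grade X j)"
    using inverted_bij[OF inj R(1) X R(2)] by blast
  obtain D2 where D2: "\<And>d. d \<ge> D2 \<Longrightarrow> good X d" using X.fp_good X by blast
  have "\<exists>\<phi>. germ X Y W s f d \<phi>" if d: "d \<ge> max D1 D2" for d
  proof -
    have g: "good X d" and b: "\<And>j. j \<ge> d \<Longrightarrow> bij_betw s (grade W j) (grade X j)" using d D1 D2 by auto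
    obtain \<sigma> where \<sigma>: "\<sigma> \<in> graded_hom (trunc X d) W" "compose (trunc_set X d) s \<sigma> = incl X d"
      using hom_section[OF conjunct1[OF R(1)] conjunct1[OF X] g R(3) b] by auto
    have "compose (carrier (trunc X d)) f \<sigma> \<in> graded_hom (trunc X d) Y"
      by (rule hom_compose[OF \<sigma>(1) R(4) X.graded_trunc])
    moreover have "compose (carrier (trunc X d)) f \<sigma> (s y) = f y" if "j \<ge> d" "y \<in> grade W j" for j y
    proof -
      have sy: "s y \<in> grade X j" using hom_grade[OF R(3) that(2)] .
      then have t: "s y \<in> trunc_set X d" using X.grade_tset[OF that(1)] by blast
      have "s y \<in> grade (trunc X d) j" using sy that(1) by (simp add: X.grade_trunc)
      then have "\<sigma> (s y) \<in> grade W j" by (rule hom_grade[OF \<sigma>(1)])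
      moreover have "s (\<sigma> (s y)) = s y" using fun_cong[OF \<sigma>(2), of "s y"] t by (simp add: compose_def incl_def)
      ultimately have "\<sigma> (s y) = y" using b[OF that(1)] that(2) by (auto simp: bij_betw_def inj_on_def)
      then show ?thesis using t by (simp add: compose_def)
    qed
    ultimately show ?thesis unfolding germ_def using r g b by blast
  qed
  then show ?thesis by blast
qed

lemma germ_unique: "germ X Y W s f d \<phi> \<Longrightarrow> germ X Y W s f d \<psi> \<Longrightarrow> \<phi> = \<psi>"
proof (rule X.trunc_hom_eq[of d \<phi> Y \<psi>])
  assume a: "germ X Y W s f d \<phi>" "germ X Y W s f d \<psi>"
  fix x assume "x \<in> grade X d"
  then obtain y where "y \<in> grade W d" "x = s y" using a(1) unfolding germ_def bij_betw_def by blast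
  then show "\<phi> x = \<psi> x" using germD[OF a(1) order_refl] germD[OF a(2) order_refl] by simp
qed (auto simp: germ_def Y.graded_module_axioms)

lemma germ_restrict: "germ X Y W s f d \<phi> \<Longrightarrow> d \<le> e \<Longrightarrow> germ X Y W s f e (restrict \<phi> (trunc_set X e))"
proof -
  assume g: "germ X Y W s f d \<phi>" and de: "d \<le> e"
  have s: "s \<in> graded_hom W X" using g roofsD unfolding germ_def by blast
  have "s y \<in> trunc_set X e" if "e \<le> j" "y \<in> grade W j" for j y
    using hom_grade[OF s that(2)] X.grade_tset[OF that(1)] by blast
  moreover have "restrict \<phi> (trunc_set X e) \<in> graded_hom (trunc X e) Y"
    by (rule restrict_hom[OF _ _ de]) (use g X in \<open>auto simp: germ_def\<close>)
  moreover have "\<phi> (s y) = f y" if "e \<le> j" "y \<in> grade W j" for j y using germD[OF g order_trans[OF de]] that by blast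
  moreover have "bij_betw s (grade W j) (grade X j)" if "e \<le> j" for j using g de that unfolding germ_def by simp
  ultimately show ?thesis using g de X.good_mono[of d e] unfolding germ_def by simp
qed

lemma germ_trunc:
  assumes "good X d" "\<phi> \<in> graded_hom (trunc X d) Y"
  shows "germ X Y (trunc X d) (incl X d) \<phi> d \<phi>"
proof -
  have r: "(trunc X d, incl X d, \<phi>) \<in> roofs gr fdim X Y"
    using assms incl_inverted[OF X assms(1)] fp_module_trunc[OF X assms(1)] by (simp add: roofs_def)
  have "incl X d y = y" if "j \<ge> d" "y \<in> grade X j" for j y
    using that X.grade_tset[of d j] by (auto simp: incl_def)
  then show ?thesis unfolding germ_def using r assms
    by (auto simp: X.grade_trunc bij_betw_def inj_on_def)
qed

text \<open>If some \<open>V\<close> dominates both roofs, its leg to \<open>X\<close> is onto in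
  high degrees, and this forces the germs to agree. Conversely, the truncation of \<open>X\<close>
  dominates both roofs by means of the two sections. That the relation is an equivalence follows by
  restricting germs to a common degree.\<close>

lemma roof_rel_iff: "((W, s, f), (W', s', f')) \<in> roof_rel gr fdim X Y \<longleftrightarrow>
    (\<exists>d \<phi>. germ X Y W s f d \<phi> \<and> germ X Y W' s' f' d \<phi>)" (is "?L \<longleftrightarrow> ?R")
proof
  assume ?L
  then obtain V u u' where r: "(W, s, f) \<in> roofs gr fdim X Y" "(W', s', f') \<in> roofs gr fdim X Y"
    and V: "fp_module V" "u \<in> graded_hom V W" "u' \<in> graded_hom V W'"
      "compose (carrier V) s u = compose (carrier V) s' u'" "compose (carrier V) f u = compose (carrier V) f' u'"
      "inverted gr fdim V X (compose (carrier V) s u)"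
    unfolding roof_rel_def by auto
  interpret V: graded_module V using V by simp
  obtain D1 where D1: "\<forall>d\<ge>D1. \<exists>\<phi>. germ X Y W s f d \<phi>" using germ_ex[OF r(1)] by blast
  obtain D2 where D2: "\<forall>d\<ge>D2. \<exists>\<phi>. germ X Y W' s' f' d \<phi>" using germ_ex[OF r(2)] by blast
  obtain D3 where D3: "\<forall>j\<ge>D3. bij_betw (compose (carrier V) s u) (grade V j) (grade X j)"
    using inverted_bij[OF inj V(1) X V(6)] by blast
  let ?d = "max D1 (max D2 D3)"
  obtain \<phi> \<psi> where g: "germ X Y W s f ?d \<phi>" "germ X Y W' s' f' ?d \<psi>" using D1 D2 by fastforce
  have "\<phi> = \<psi>"
  proof (rule X.trunc_hom_eq[of ?d \<phi> Y \<psi>])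
    fix x assume x: "x \<in> grade X ?d"
    have "bij_betw (compose (carrier V) s u) (grade V ?d) (grade X ?d)" using D3 by simp
    then obtain v where v: "v \<in> grade V ?d" "x = compose (carrier V) s u v"
      using x unfolding bij_betw_def by blast
    have vc: "v \<in> carrier V" using v V.grade_carrier by blast
    have 1: "x = s (u v)" "x = s' (u' v)"
      using v(2) fun_cong[OF V(4), of v] vc by (auto simp: compose_def)
    have "\<phi> x = f (u v)" using germD[OF g(1) order_refl hom_grade[OF V(2) v(1)]] 1(1) by simp
    also have "\<dots> = f' (u' v)" using fun_cong[OF V(5), of v] vc by (simp add: compose_def)
    also have "\<dots> = \<psi> x" using germD[OF g(2) order_refl hom_grade[OF V(3) v(1)]] 1(2) by simp
    finally show "\<phi> x = \<psi> x" .
  qed (use g in \<open>auto simp: germ_def Y.graded_module_axioms\<close>)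
  then show ?R using g by blast
next
  assume ?R
  then obtain d \<phi> where g: "germ X Y W s f d \<phi>" "germ X Y W' s' f' d \<phi>" by blast
  have "\<exists>\<sigma>\<in>graded_hom (trunc X d) W. compose (trunc_set X d) s \<sigma> = incl X d \<and> compose (trunc_set X d) f \<sigma> = \<phi>"
    if g: "germ X Y W s f d \<phi>" for W s f
  proof -
    have r: "(W, s, f) \<in> roofs gr fdim X Y" and gd: "good X d" and ph: "\<phi> \<in> graded_hom (trunc X d) Y"
      using g by (auto simp: germ_def)
    note R = roofsD[OF r]
    have "bij_betw s (grade W d) (grade X d)" using g by (simp add: germ_def)
    then obtain \<sigma> where \<sigma>: "\<sigma> \<in> graded_hom (trunc X d) W" "compose (trunc_set X d) s \<sigma> = incl X d"
      using hom_section[OF conjunct1[OF R(1)] conjunct1[OF X] gd R(3)] by auto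
    have "compose (carrier (trunc X d)) f \<sigma> = \<phi>"
    proof (rule X.trunc_hom_eq[OF gd hom_compose[OF \<sigma>(1) R(4) X.graded_trunc] ph Y.graded_module_axioms])
      fix x assume x: "x \<in> grade X d"
      then have t: "x \<in> trunc_set X d" "x \<in> grade (trunc X d) d" using X.grade_tset[of d d] by (auto simp: X.grade_trunc)
      have "s (\<sigma> x) = x" using fun_cong[OF \<sigma>(2), of x] t by (simp add: compose_def incl_def)
      moreover have "\<phi> (s (\<sigma> x)) = f (\<sigma> x)" using g hom_grade[OF \<sigma>(1) t(2)] by (auto simp: germ_def)
      ultimately show "compose (carrier (trunc X d)) f \<sigma> x = \<phi> x" using t by (simp add: compose_def)
    qed
    then show ?thesis using \<sigma> by auto
  qed
  from this[OF g(1)] this[OF g(2)] obtain \<sigma> \<sigma>' where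
    \<sigma>: "\<sigma> \<in> graded_hom (trunc X d) W" "compose (trunc_set X d) s \<sigma> = incl X d" "compose (trunc_set X d) f \<sigma> = \<phi>" and
    \<sigma>': "\<sigma>' \<in> graded_hom (trunc X d) W'" "compose (trunc_set X d) s' \<sigma>' = incl X d" "compose (trunc_set X d) f' \<sigma>' = \<phi>"
    by blast
  have gd: "good X d" using g by (simp add: germ_def)
  have ob: "trunc X d \<in> Ob gr" using fp_module_trunc[OF X gd] by simp
  have "\<exists>V \<in> Ob gr. \<exists>u \<in> mor gr V W. \<exists>u' \<in> mor gr V W'.
           Comp gr V W X s u = Comp gr V W' X s' u' \<and>
           Comp gr V W Y f u = Comp gr V W' Y f' u' \<and>
           inverted gr fdim V X (Comp gr V W X s u)"
    by (rule bexI[OF _ ob], rule bexI[of _ \<sigma>], rule bexI[of _ \<sigma>'])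
      (use \<sigma> \<sigma>' incl_inverted[OF X gd] in simp_all)
  then show ?L using g unfolding roof_rel_def germ_def by blast
qed

lemma germ_match:
  assumes "germ X Y W s f d \<phi>" "germ X Y W s f e \<psi>" "d \<le> D" "e \<le> D"
  shows "restrict \<phi> (trunc_set X D) = restrict \<psi> (trunc_set X D)"
  using germ_unique germ_restrict assms by blast

lemma equiv_roof_rel: "equiv (roofs gr fdim X Y) (roof_rel gr fdim X Y)"
proof (rule equivI)
  show "roof_rel gr fdim X Y \<subseteq> roofs gr fdim X Y \<times> roofs gr fdim X Y" by (auto simp: roof_rel_def)
  show "refl_on (roofs gr fdim X Y) (roof_rel gr fdim X Y)"
    unfolding refl_on_def using germ_ex roof_rel_iff by (auto) (meson order_refl)
  show "sym (roof_rel gr fdim X Y)" unfolding sym_def using roof_rel_iff by (auto)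
  show "trans (roof_rel gr fdim X Y)"
  proof (rule transI, safe)
    fix W s f W' s' f' W'' s'' f''
    assume "((W, s, f), (W', s', f')) \<in> roof_rel gr fdim X Y" "((W', s', f'), (W'', s'', f'')) \<in> roof_rel gr fdim X Y"
    then obtain d \<phi> e \<psi> where g: "germ X Y W s f d \<phi>" "germ X Y W' s' f' d \<phi>"
      "germ X Y W' s' f' e \<psi>" "germ X Y W'' s'' f'' e \<psi>" unfolding roof_rel_iff by blast
    let ?D = "max d e"
    have "restrict \<phi> (trunc_set X ?D) = restrict \<psi> (trunc_set X ?D)" using germ_match[OF g(2,3), of ?D] by simp
    then show "((W, s, f), (W'', s'', f'')) \<in> roof_rel gr fdim X Y"
      unfolding roof_rel_iff using germ_restrict[OF g(1), of ?D] germ_restrict[OF g(4), of ?D] by auto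
  qed
qed

text \<open>The degree \<open>e\<close> may have to exceed \<open>d\<close>, because the left leg
  \<open>s\<close> is bijective only from some degree on.\<close>

lemma mem_cls:
  assumes "good X d" "\<phi> \<in> graded_hom (trunc X d) Y"
  shows "(W, s, f) \<in> germ_class X Y d \<phi> \<longleftrightarrow> (\<exists>e\<ge>d. germ X Y W s f e (restrict \<phi> (trunc_set X e)))"
proof
  assume "(W, s, f) \<in> germ_class X Y d \<phi>"
  then obtain e \<psi> where g: "germ X Y (trunc X d) (incl X d) \<phi> e \<psi>" "germ X Y W s f e \<psi>"
    unfolding germ_class_def Image_singleton_iff roof_rel_iff by blast
  let ?D = "max d e"
  have "restrict \<phi> (trunc_set X ?D) = restrict \<psi> (trunc_set X ?D)" using germ_match[OF germ_trunc[OF assms] g(1), of ?D] by simp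
  then have "germ X Y W s f ?D (restrict \<phi> (trunc_set X ?D))" using germ_restrict[OF g(2), of ?D] by simp
  then show "\<exists>e\<ge>d. germ X Y W s f e (restrict \<phi> (trunc_set X e))" by (intro exI[of _ ?D]) simp
next
  assume "\<exists>e\<ge>d. germ X Y W s f e (restrict \<phi> (trunc_set X e))"
  then obtain e where e: "e \<ge> d" "germ X Y W s f e (restrict \<phi> (trunc_set X e))" by blast
  then show "(W, s, f) \<in> germ_class X Y d \<phi>"
    unfolding germ_class_def Image_singleton_iff roof_rel_iff using germ_restrict[OF germ_trunc[OF assms] e(1)] by blast
qed

lemma trans_roof_rel: "trans (roof_rel gr fdim X Y)" and sym_roof_rel: "sym (roof_rel gr fdim X Y)"
  using equiv_roof_rel by (auto simp: equiv_def)

text \<open>Fits the way in which the operations on classes are defined, as the closure of a set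
  \<open>B\<close> of results: one member of \<open>B\<close> in the expected class suffices,
  provided that all roofs in \<open>B\<close> belong to it.\<close>

lemma Image_eq_cls:
  assumes "good X d" "\<phi> \<in> graded_hom (trunc X d) Y" "b \<in> B" "b \<in> germ_class X Y d \<phi>"
    and B: "\<And>W s f. (W, s, f) \<in> B \<Longrightarrow> (W, s, f) \<in> roofs gr fdim X Y \<Longrightarrow> (W, s, f) \<in> germ_class X Y d \<phi>"
  shows "roof_rel gr fdim X Y `` B = germ_class X Y d \<phi>"
proof (intro equalityI subsetI)
  fix c assume "c \<in> roof_rel gr fdim X Y `` B"
  then obtain W s f where a: "(W, s, f) \<in> B" "((W, s, f), c) \<in> roof_rel gr fdim X Y" by (auto elim!: ImageE)
  then have "(W, s, f) \<in> germ_class X Y d \<phi>" by (intro B) (auto simp: roof_rel_def)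
  then show "c \<in> germ_class X Y d \<phi>" unfolding germ_class_def Image_singleton_iff using a(2) by (rule transD[OF trans_roof_rel])
next
  fix c assume "c \<in> germ_class X Y d \<phi>"
  then have "(b, c) \<in> roof_rel gr fdim X Y"
    using assms(4) transD[OF trans_roof_rel] symD[OF sym_roof_rel] unfolding germ_class_def Image_singleton_iff by blast
  then show "c \<in> roof_rel gr fdim X Y `` B" using assms(3) by blast
qed

lemma germ_class_refl: "good X d \<Longrightarrow> \<phi> \<in> graded_hom (trunc X d) Y \<Longrightarrow> (trunc X d, incl X d, \<phi>) \<in> germ_class X Y d \<phi>"
  using germ_trunc unfolding germ_class_def Image_singleton_iff roof_rel_iff by blast

lemma germ_class_eq_iff:
  assumes "good X d" "\<phi> \<in> graded_hom (trunc X d) Y" "good X e" "\<psi> \<in> graded_hom (trunc X e) Y"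
  shows "germ_class X Y d \<phi> = germ_class X Y e \<psi> \<longleftrightarrow> (\<exists>D\<ge>max d e. restrict \<phi> (trunc_set X D) = restrict \<psi> (trunc_set X D))"
proof
  assume "germ_class X Y d \<phi> = germ_class X Y e \<psi>"
  then have "(trunc X e, incl X e, \<psi>) \<in> germ_class X Y d \<phi>" using germ_class_refl[OF assms(3,4)] by simp
  then obtain D where D: "D \<ge> d" "germ X Y (trunc X e) (incl X e) \<psi> D (restrict \<phi> (trunc_set X D))"
    unfolding mem_cls[OF assms(1,2)] by blast
  let ?D = "max D e"
  have "restrict (restrict \<phi> (trunc_set X D)) (trunc_set X ?D) = restrict \<psi> (trunc_set X ?D)"
    using germ_match[OF D(2) germ_trunc[OF assms(3,4)], of ?D] by simp
  moreover have "restrict (restrict \<phi> (trunc_set X D)) (trunc_set X ?D) = restrict \<phi> (trunc_set X ?D)"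
    using X.trunc_set_mono[of D ?D] by (simp add: Int_absorb1)
  ultimately show "\<exists>D\<ge>max d e. restrict \<phi> (trunc_set X D) = restrict \<psi> (trunc_set X D)"
    using D(1) by (intro exI[of _ ?D]) simp
next
  assume "\<exists>D\<ge>max d e. restrict \<phi> (trunc_set X D) = restrict \<psi> (trunc_set X D)"
  then obtain D where D: "D \<ge> d" "D \<ge> e" "restrict \<phi> (trunc_set X D) = restrict \<psi> (trunc_set X D)" by auto
  have "((trunc X d, incl X d, \<phi>), (trunc X e, incl X e, \<psi>)) \<in> roof_rel gr fdim X Y"
    unfolding roof_rel_iff
    using germ_restrict[OF germ_trunc[OF assms(1,2)] D(1)] germ_restrict[OF germ_trunc[OF assms(3,4)] D(2)] D(3) by auto
  then show "germ_class X Y d \<phi> = germ_class X Y e \<psi>" unfolding germ_class_def by (rule equiv_class_eq[OF equiv_roof_rel])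
qed

lemma germ_class_mor: "good X d \<Longrightarrow> \<phi> \<in> graded_hom (trunc X d) Y \<Longrightarrow> germ_class X Y d \<phi> \<in> roofs gr fdim X Y // roof_rel gr fdim X Y"
  unfolding germ_class_def using germ_trunc by (auto simp: germ_def intro!: quotientI)

lemma mor_cls:
  assumes "F \<in> roofs gr fdim X Y // roof_rel gr fdim X Y"
  shows "\<exists>D. \<forall>d\<ge>D. good X d \<and> (\<exists>\<phi>\<in>graded_hom (trunc X d) Y. F = germ_class X Y d \<phi>)"
proof -
  obtain W s f where r: "(W, s, f) \<in> roofs gr fdim X Y" "F = roof_rel gr fdim X Y `` {(W, s, f)}"
    using assms by (auto elim!: quotientE)
  obtain D where D: "\<And>d. d \<ge> D \<Longrightarrow> \<exists>\<phi>. germ X Y W s f d \<phi>" using germ_ex[OF r(1)] by blast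
  have "good X d \<and> (\<exists>\<phi>\<in>graded_hom (trunc X d) Y. F = germ_class X Y d \<phi>)" if "d \<ge> D" for d
  proof -
    obtain \<phi> where g: "germ X Y W s f d \<phi>" using D \<open>d \<ge> D\<close> by blast
    then have p: "good X d" "\<phi> \<in> graded_hom (trunc X d) Y" by (auto simp: germ_def)
    have "((W, s, f), (trunc X d, incl X d, \<phi>)) \<in> roof_rel gr fdim X Y"
      unfolding roof_rel_iff using g germ_trunc[OF p] by blast
    then have "F = germ_class X Y d \<phi>" unfolding germ_class_def r(2) by (rule equiv_class_eq[OF equiv_roof_rel])
    then show ?thesis using p by blast
  qed
  then show ?thesis by blast
qed

end

section \<open>Linear maps between coordinate spaces\<close>

text \<open>Matrices with \<open>m\<close> rows and \<open>n\<close> columns, as linear maps that ignore the coordinates from \<open>n\<close> on.\<close>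

definition lin :: "nat \<Rightarrow> nat \<Rightarrow> ((nat \<Rightarrow> 'k::field) \<Rightarrow> nat \<Rightarrow> 'k) set" where
  "lin n m = {A. (\<forall>v w. A (\<lambda>i. v i + w i) = (\<lambda>i. A v i + A w i)) \<and>
     (\<forall>c v. A (\<lambda>i. c * v i) = (\<lambda>i. c * A v i)) \<and>
     (\<forall>v i. i \<ge> m \<longrightarrow> A v i = 0) \<and> (\<forall>v w. (\<forall>i<n. v i = w i) \<longrightarrow> A v = A w)}"

text \<open>The identity of an \<open>n\<close>-dimensional space in this encoding: not the identity
  function, but the cut-off after \<open>n\<close> coordinates.\<close>

definition id_matrix :: "nat \<Rightarrow> (nat \<Rightarrow> 'k::field) \<Rightarrow> nat \<Rightarrow> 'k" where
  "id_matrix n v = (\<lambda>i. if i < n then v i else 0)"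

definition unit_vec :: "nat \<Rightarrow> nat \<Rightarrow> 'k::field" where
  "unit_vec j = (\<lambda>i. if i = j then 1 else 0)"

lemma linD:
  assumes "A \<in> lin n m"
  shows lin_add: "A (\<lambda>i. v i + w i) = (\<lambda>i. A v i + A w i)"
    and lin_scale: "A (\<lambda>i. c * v i) = (\<lambda>i. c * A v i)"
    and lin_out: "i \<ge> m \<Longrightarrow> A v i = 0"
    and lin_cong: "(\<And>i. i < n \<Longrightarrow> v i = w i) \<Longrightarrow> A v = A w"
  using assms by (auto simp: lin_def)

lemma lin_idl [simp]: "id_matrix n \<in> lin n n"
  by (auto simp: lin_def id_matrix_def)

lemma lin_zero [simp]: "(\<lambda>v i. 0) \<in> lin n m"
  by (auto simp: lin_def)

lemma linI:
  assumes "\<And>v w. A (\<lambda>i. v i + w i) = (\<lambda>i. A v i + A w i)" "\<And>c v. A (\<lambda>i. c * v i) = (\<lambda>i. c * A v i)"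
    "\<And>v i. i \<ge> m \<Longrightarrow> A v i = 0" "\<And>v w. (\<And>i. i < n \<Longrightarrow> v i = w i) \<Longrightarrow> A v = A w"
  shows "A \<in> lin n m"
  using assms(1-3) assms(4) unfolding lin_def by blast

lemma lin_comp:
  assumes "A \<in> lin n m" "B \<in> lin m p" shows "(\<lambda>v. B (A v)) \<in> lin n p"
proof (rule linI)
  fix v w :: "nat \<Rightarrow> 'a" assume "\<And>i. i < n \<Longrightarrow> v i = w i"
  then have "A v = A w" using lin_cong assms by blast
  then show "B (A v) = B (A w)" by simp
qed (simp_all add: lin_add[OF assms(1)] lin_add[OF assms(2)] lin_scale[OF assms(1)] lin_scale[OF assms(2)]
    lin_out[OF assms(2)])

lemma lin_plus:
  assumes "A \<in> lin n m" "B \<in> lin n m" shows "(\<lambda>v i. A v i + B v i) \<in> lin n m"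
proof (rule linI)
  fix v w :: "nat \<Rightarrow> 'a" assume "\<And>i. i < n \<Longrightarrow> v i = w i"
  then have "A v = A w" "B v = B w" using lin_cong assms by blast+
  then show "(\<lambda>i. A v i + B v i) = (\<lambda>i. A w i + B w i)" by simp
qed (simp_all add: lin_add[OF assms(1)] lin_add[OF assms(2)] lin_scale[OF assms(1)] lin_scale[OF assms(2)]
    lin_out[OF assms(1)] lin_out[OF assms(2)] algebra_simps)

lemma lin_times:
  assumes "A \<in> lin n m" shows "(\<lambda>v i. c * A v i) \<in> lin n m"
proof (rule linI)
  fix v w :: "nat \<Rightarrow> 'a" assume "\<And>i. i < n \<Longrightarrow> v i = w i"
  then have "A v = A w" using lin_cong assms by blast
  then show "(\<lambda>i. c * A v i) = (\<lambda>i. c * A w i)" by simp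
qed (simp_all add: lin_add[OF assms(1)] lin_scale[OF assms(1)] lin_out[OF assms(1)] algebra_simps)

lemma id_matrix_lin: "A \<in> lin n m \<Longrightarrow> id_matrix m (A v) = A v" "A \<in> lin n m \<Longrightarrow> A (id_matrix n v) = A v"
  using lin_out[of A n m] lin_cong[of A n m "id_matrix n v" v] by (auto simp: id_matrix_def fun_eq_iff)

text \<open>The sequences over the field serve as one ambient space for all coordinate spaces; the
  space of dimension \<open>n\<close> consists of those that vanish from index \<open>n\<close>
  on.\<close>

interpretation cv: vector_space "\<lambda>(c::'k::field) (v :: nat \<Rightarrow> 'k) i. c * v i"
  by unfold_locales (auto simp: fun_eq_iff algebra_simps)

interpretation cvp: vector_space_pair "\<lambda>(c::'k::field) (v :: nat \<Rightarrow> 'k) i. c * v i" "\<lambda>(c::'k::field) (v :: nat \<Rightarrow> 'k) i. c * v i"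
  by unfold_locales

lemma lin_linear: "A \<in> lin n m \<Longrightarrow> Vector_Spaces.linear (\<lambda>c v i. c * v i) (\<lambda>c v i. c * v i) A"
  unfolding Vector_Spaces.linear_iff
  by (simp add: cv.vector_space_axioms plus_fun_def lin_add[of A n m] lin_scale[of A n m])

lemma linear_lin:
  assumes "Vector_Spaces.linear (\<lambda>c v i. c * v i) (\<lambda>c v i. c * v i) A" "\<And>v i. i \<ge> m \<Longrightarrow> A v i = 0"
    "\<And>v w. (\<And>i. i < n \<Longrightarrow> v i = w i) \<Longrightarrow> A v = A w"
  shows "A \<in> lin n m"
proof (rule linI)
  show "A (\<lambda>i. v i + w i) = (\<lambda>i. A v i + A w i)" for v w
    using cvp.linear_add[OF assms(1), of v w] by (simp add: plus_fun_def)
  show "A (\<lambda>i. c * v i) = (\<lambda>i. c * A v i)" for c v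
    by (rule cvp.linear_scale[OF assms(1)])
qed (use assms(2,3) in blast)+

lemma sum_unit_vec: "(\<Sum>j<n. (\<lambda>i. v j * unit_vec j i)) = id_matrix n v"
proof
  fix i
  have "(\<Sum>j<n. (\<lambda>i. v j * unit_vec j i)) i = (\<Sum>j<n. v j * unit_vec j i)"
    by (induction n) (auto simp: plus_fun_def zero_fun_def)
  also have "\<dots> = id_matrix n v i"
    unfolding unit_vec_def id_matrix_def by (simp add: if_distrib cong: if_cong)
  finally show "(\<Sum>j<n. (\<lambda>i. v j * unit_vec j i)) i = id_matrix n v i" .
qed

lemma inj_unit_vec: "inj (unit_vec :: nat \<Rightarrow> nat \<Rightarrow> 'k::field)"
proof (rule injI)
  fix j k assume "unit_vec j = (unit_vec k :: nat \<Rightarrow> 'k)"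
  from fun_cong[OF this, of j] show "j = k" by (auto simp: unit_vec_def split: if_splits)
qed

lemma id_matrix_span: "id_matrix n v \<in> cv.span (unit_vec ` {..<n})"
  unfolding sum_unit_vec[symmetric] by (intro cv.span_sum cv.span_scale cv.span_base) auto

lemma unit_vec_independent: "cv.independent (unit_vec ` {..<n} :: (nat \<Rightarrow> 'k::field) set)"
proof (rule cv.independent_if_scalars_zero)
  fix f :: "(nat \<Rightarrow> 'k) \<Rightarrow> 'k" and x :: "nat \<Rightarrow> 'k"
  assume z: "(\<Sum>x\<in>unit_vec ` {..<n}. (\<lambda>i. f x * x i)) = 0" and x: "x \<in> unit_vec ` {..<n}"
  have "(\<Sum>x\<in>unit_vec ` {..<n}. (\<lambda>i. f x * x i)) = (\<Sum>j<n. (\<lambda>i. f (unit_vec j) * unit_vec j i))"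
    by (subst sum.reindex) (auto intro: inj_on_subset[OF inj_unit_vec])
  also have "\<dots> = id_matrix n (\<lambda>j. f (unit_vec j))" by (rule sum_unit_vec)
  finally have e: "id_matrix n (\<lambda>j. f (unit_vec j)) = (\<lambda>i. 0)" using z by (simp add: zero_fun_def)
  obtain j where j: "j < n" "x = unit_vec j" using x by auto
  show "f x = 0" using fun_cong[OF e, of j] j by (simp add: id_matrix_def)
qed simp

lemma card_unit_vec: "card (unit_vec ` {..<n} :: (nat \<Rightarrow> 'k::field) set) = n"
  using card_image[OF inj_on_subset[OF inj_unit_vec subset_UNIV], of "{..<n}"] by simp

lemma subspace_Vn: "cv.subspace {v :: nat \<Rightarrow> 'k::field. \<forall>i\<ge>n. v i = 0}"
  by (auto simp: cv.subspace_def)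

lemma span_Vn: "v \<in> cv.span (unit_vec ` {..<n}) \<Longrightarrow> i \<ge> n \<Longrightarrow> v i = 0"
proof -
  have "cv.span (unit_vec ` {..<n}) \<subseteq> {v :: nat \<Rightarrow> 'k::field. \<forall>i\<ge>n. v i = 0}"
    by (rule cv.span_minimal[OF _ subspace_Vn]) (auto simp: unit_vec_def)
  then show "v \<in> cv.span (unit_vec ` {..<n}) \<Longrightarrow> i \<ge> n \<Longrightarrow> v i = 0" by blast
qed

text \<open>The images of the \<open>n\<close> unit vectors are independent and lie in the span of
  \<open>m\<close> vectors.\<close>

lemma lin_inj_le:
  fixes A :: "(nat \<Rightarrow> 'k::field) \<Rightarrow> nat \<Rightarrow> 'k"
  assumes A: "A \<in> lin n m" and z: "\<And>v i. A v = (\<lambda>i. 0) \<Longrightarrow> i < n \<Longrightarrow> v i = 0"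
  shows "n \<le> m"
proof -
  let ?S = "unit_vec ` {..<n} :: (nat \<Rightarrow> 'k) set"
  have inj: "inj_on A (cv.span ?S)"
  proof (rule inj_onI)
    fix v w assume v: "v \<in> cv.span ?S" "w \<in> cv.span ?S" "A v = A w"
    have "A (\<lambda>i. v i + (-1) * w i) = (\<lambda>i. 0)" 
      unfolding lin_add[OF A] lin_scale[OF A] using v(3) by simp
    then have "i < n \<Longrightarrow> v i + (-1) * w i = 0" for i by (rule z)
    then show "v = w" using span_Vn[OF v(1)] span_Vn[OF v(2)] by (intro ext) (metis add_neg_numeral_special(7) mult_minus1 not_le right_minus_eq add_uminus_conv_diff)
  qed
  have "cv.independent (A ` ?S)"
    by (rule cvp.linear_independent_injective_image[OF lin_linear[OF A] unit_vec_independent inj])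
  moreover have "A ` ?S \<subseteq> cv.span (unit_vec ` {..<m})"
    using id_matrix_lin(1)[OF A] id_matrix_span by (metis image_subsetI)
  ultimately have "card (A ` ?S) \<le> card (unit_vec ` {..<m} :: (nat \<Rightarrow> 'k) set)"
    using cv.independent_span_bound[of "unit_vec ` {..<m}" "A ` ?S"] by simp
  moreover have "card (A ` ?S) = card ?S"
    using inj cv.span_superset by (intro card_image) (rule inj_on_subset)
  ultimately show ?thesis by (simp add: card_unit_vec)
qed

text \<open>Von Neumann regularity: \<open>B\<close> is a linear section of \<open>A\<close> over
  its image, extended to the whole space.\<close>

lemma lin_regular:
  assumes A: "A \<in> lin n m"
  shows "\<exists>B\<in>lin m n. \<forall>v. A (B (A v)) = A v"
proof -
  let ?V = "{v :: nat \<Rightarrow> 'a. \<forall>i\<ge>n. v i = 0}"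
  obtain g where g: "range g \<subseteq> ?V" "Vector_Spaces.linear (\<lambda>c v i. c * v i) (\<lambda>c v i. c * v i) g"
    "\<And>v. v \<in> A ` ?V \<Longrightarrow> A (g v) = v"
    using cvp.linear_exists_right_inverse_on[OF lin_linear[OF A] subspace_Vn[of n]] by blast
  \<comment> \<open>The cut-off makes \<open>?B\<close> ignore the coordinates from \<open>m\<close>
    on, as membership in \<open>lin\<close> demands, and changes nothing on values of
    \<open>A\<close>.\<close>
  let ?B = "\<lambda>v. g (id_matrix m v)"
  have "?B \<in> lin m n"
  proof (rule linear_lin)
    show "Vector_Spaces.linear (\<lambda>c v i. c * v i) (\<lambda>c v i. c * v i) ?B"
      using Vector_Spaces.linear_compose[OF lin_linear[OF lin_idl] g(2)] by (simp add: o_def)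
    show "?B v i = 0" if "i \<ge> n" for v i using g(1) that by blast
    show "?B v = ?B w" if "\<And>i. i < m \<Longrightarrow> v i = w i" for v w
      using that by (auto simp: id_matrix_def intro!: arg_cong[of _ _ g])
  qed
  moreover have "A (?B (A v)) = A v" for v
  proof -
    have "A v = A (id_matrix n v)" "id_matrix n v \<in> ?V" using id_matrix_lin[OF A] by (auto simp: id_matrix_def)
    then have "A v \<in> A ` ?V" by blast
    then show ?thesis using g(3) id_matrix_lin[OF A] by simp
  qed
  ultimately show ?thesis by (intro bexI[of _ ?B]) auto
qed

text \<open>It suffices to look at first rows, which exist since \<open>m\<close> is positive. The
  first rows of all matrices fill a space of dimension \<open>n\<close>, so fewer than
  \<open>n\<close> matrices cannot span.\<close>

lemma lin_not_spanned:
  fixes A :: "'b \<Rightarrow> (nat \<Rightarrow> 'k::field) \<Rightarrow> nat \<Rightarrow> 'k"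
  assumes B: "finite B" "card B < n" and m: "m \<ge> 1"
  shows "\<exists>C\<in>lin n m. \<forall>c. C \<noteq> (\<lambda>v i. \<Sum>b\<in>B. c b * A b v i)"
proof (rule ccontr)
  assume "\<not> ?thesis"
  then have all: "\<exists>c. C = (\<lambda>v i. \<Sum>b\<in>B. c b * A b v i)" if "C \<in> lin n m" for C using that by blast
  let ?\<rho> = "\<lambda>b j. if j < n then A b (unit_vec j) 0 else 0"
  have sp: "id_matrix n u \<in> cv.span (?\<rho> ` B)" for u :: "nat \<Rightarrow> 'k"
  proof -
    \<comment> \<open>The matrix with first row \<open>u\<close> and zeros elsewhere.\<close>
    let ?C = "\<lambda>v i. if i = 0 then \<Sum>j<n. v j * u j else 0"
    have "?C \<in> lin n m" using m
      by (auto simp: lin_def fun_eq_iff algebra_simps sum.distrib sum_distrib_left)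
    then obtain c where c: "?C = (\<lambda>v i. \<Sum>b\<in>B. c b * A b v i)" using all by blast
    have "id_matrix n u = (\<Sum>b\<in>B. (\<lambda>j. c b * ?\<rho> b j))"
    proof
      fix j
      have 1: "(\<Sum>b\<in>B. (\<lambda>j. c b * ?\<rho> b j)) j = (\<Sum>b\<in>B. c b * ?\<rho> b j)"
        by (induction B rule: infinite_finite_induct) (auto simp: plus_fun_def zero_fun_def)
      have 2: "?C (unit_vec j) 0 = (if j < n then u j else 0)"
        by (simp add: unit_vec_def if_distrib[of "\<lambda>x. x * _"] cong: if_cong)
      have "?C (unit_vec j) 0 = (\<Sum>b\<in>B. c b * A b (unit_vec j) 0)"
        using fun_cong[OF fun_cong[OF c, of "unit_vec j"], of 0] by simp
      then show "id_matrix n u j = (\<Sum>b\<in>B. (\<lambda>j. c b * ?\<rho> b j)) j"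
        unfolding 1 id_matrix_def using 2 by (cases "j < n") simp_all
    qed
    then show ?thesis by (simp add: cv.span_sum cv.span_scale cv.span_base)
  qed
  have "unit_vec ` {..<n} \<subseteq> cv.span (?\<rho> ` B)"
  proof (rule image_subsetI)
    fix j assume "j \<in> {..<n}"
    then have "id_matrix n (unit_vec j) = (unit_vec j :: nat \<Rightarrow> 'k)" by (auto simp: id_matrix_def unit_vec_def)
    then show "unit_vec j \<in> cv.span (?\<rho> ` B)" using sp[of "unit_vec j"] by (simp only:)
  qed
  then have "n \<le> card (?\<rho> ` B)"
    using cv.independent_span_bound[OF _ unit_vec_independent[of n], of "?\<rho> ` B"] B(1) by (simp add: card_unit_vec)
  also have "\<dots> \<le> card B" using B(1) by (rule card_image_le)
  finally show False using B(2) by simp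
qed

section \<open>Matrices of morphisms\<close>

lemma qgr_simps:
  "Ob qgr = {M. graded_module M \<and> finitely_presented M}"
  "mor qgr X Y = roofs gr fdim X Y // roof_rel gr fdim X Y"
  "carrier (Hom qgr X Y) = roofs gr fdim X Y // roof_rel gr fdim X Y"
  "\<zero>\<^bsub>Hom qgr X Y\<^esub> = roof_rel gr fdim X Y `` {(X, Ident gr X, \<zero>\<^bsub>Hom gr X Y\<^esub>)}"
  "F \<oplus>\<^bsub>Hom qgr X Y\<^esub> G = roof_rel gr fdim X Y ``
     {(W, s, f \<oplus>\<^bsub>Hom gr W Y\<^esub> g) | W s f g. (W, s, f) \<in> F \<and> (W, s, g) \<in> G}"
  "c \<odot>\<^bsub>Hom qgr X Y\<^esub> F = roof_rel gr fdim X Y `` {(W, s, c \<odot>\<^bsub>Hom gr W Y\<^esub> f) | W s f. (W, s, f) \<in> F}"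
  "Ident qgr X = roof_rel gr fdim X X `` {(X, Ident gr X, Ident gr X)}"
  "Comp qgr X Y Z = roof_comp gr fdim X Y Z"
  by (simp_all add: qgr_def serre_quotient_def roof_hom_def mor_def)

lemma hom_plus:
  assumes "graded_module M" "graded_module N" "f \<in> graded_hom M N" "g \<in> graded_hom M N"
  shows "(\<lambda>x\<in>carrier M. f x \<oplus>\<^bsub>N\<^esub> g x) \<in> graded_hom M N"
proof -
  interpret M: graded_module M by fact
  interpret N: graded_module N by fact
  note h = hom_carrier[OF assms(3)] hom_carrier[OF assms(4)] hom_add[OF assms(3)] hom_add[OF assms(4)]
    hom_smult[OF assms(3)] hom_smult[OF assms(4)] hom_grade[OF assms(3)] hom_grade[OF assms(4)]
  show ?thesis
    by (rule graded_homI) (use h M.grade_carrier in \<open>auto simp: M.smult_closed N.smult_r_distr N.grade_add N.a_ac\<close>)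
qed

lemma hom_times:
  assumes "graded_module M" "graded_module N" "f \<in> graded_hom M N"
  shows "(\<lambda>x\<in>carrier M. scalar c \<odot>\<^bsub>N\<^esub> f x) \<in> graded_hom M N"
proof -
  interpret M: graded_module M by fact
  interpret N: graded_module N by fact
  note h = hom_carrier[OF assms(3)] hom_add[OF assms(3)] hom_smult[OF assms(3)] hom_grade[OF assms(3)]
  show ?thesis
    by (rule graded_homI) (use h M.grade_carrier in
      \<open>auto simp: M.smult_closed N.smult_closed N.smult_r_distr N.grade_scalar N.smult_scalar_commute\<close>)
qed

context
  fixes \<iota> :: "('x::finite, 'k::field) free_algebra \<Rightarrow> 'm"
  assumes inj: "inj \<iota>"
begin

text \<open>Covers the zero morphism and the identity at once, since both are given by roofs whose
  left leg is the identity.\<close>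

lemma germ_class_ident_gen:
  fixes X Y :: "(('x, 'k) free_algebra, 'm) gmodule"
  assumes X: "fp_module X" and Y: "fp_module Y" and g: "good X d" and f: "f \<in> graded_hom X Y"
  shows "roof_rel gr fdim X Y `` {(X, \<lambda>x\<in>carrier X. x, f)} = germ_class X Y d (restrict f (trunc_set X d))"
proof -
  interpret X: fgm X using X by (intro fgmI) simp
  have sub: "x \<in> carrier X" if "x \<in> trunc_set X d" for x using that by (simp add: trunc_set_def)
  have c: "restrict f (trunc_set X d) = compose (carrier (trunc X d)) f (incl X d)"
    by (auto simp: compose_def incl_def restrict_def fun_eq_iff)
  have h: "restrict f (trunc_set X d) \<in> graded_hom (trunc X d) Y"
    unfolding c by (rule hom_compose[OF incl_hom[OF X.graded_module_axioms] f X.graded_trunc])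
  have "(X, \<lambda>x\<in>carrier X. x, f) \<in> roofs gr fdim X Y"
    using X id_inverted[OF X] f by (simp add: roofs_def)
  moreover have "bij_betw (\<lambda>x\<in>carrier X. x) (grade X j) (grade X j)" for j
    using X.grade_carrier by (auto simp: bij_betw_def inj_on_def)
  moreover have "restrict f (trunc_set X d) ((\<lambda>x\<in>carrier X. x) y) = f y" if "d \<le> j" "y \<in> grade X j" for j y
    using X.grade_tset[OF that(1)] X.grade_carrier that by auto
  ultimately have "germ X Y X (\<lambda>x\<in>carrier X. x) f d (restrict f (trunc_set X d))"
    unfolding germ_def using g h by blast
  then have "((X, \<lambda>x\<in>carrier X. x, f), (trunc X d, incl X d, restrict f (trunc_set X d))) \<in> roof_rel gr fdim X Y"
    unfolding roof_rel_iff[OF inj X Y] using germ_trunc[OF inj X Y g h] by blast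
  then show ?thesis unfolding germ_class_def by (rule equiv_class_eq[OF equiv_roof_rel[OF inj X Y]])
qed

lemma germ_class_zero:
  fixes X Y :: "(('x, 'k) free_algebra, 'm) gmodule"
  assumes X: "fp_module X" and Y: "fp_module Y" and g: "good X d"
  shows "\<zero>\<^bsub>Hom qgr X Y\<^esub> = germ_class X Y d (\<lambda>x\<in>trunc_set X d. \<zero>\<^bsub>Y\<^esub>)"
proof -
  have "trunc_set X d \<subseteq> carrier X" by (auto simp: trunc_set_def)
  then have "restrict (\<lambda>x\<in>carrier X. \<zero>\<^bsub>Y\<^esub>) (trunc_set X d) = (\<lambda>x\<in>trunc_set X d. \<zero>\<^bsub>Y\<^esub>)"
    by (auto simp: restrict_def fun_eq_iff)
  then show ?thesis
    using germ_class_ident_gen[OF X Y g zero_hom] X Y by (simp add: qgr_simps)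
qed

lemma germ_class_id:
  fixes X :: "(('x, 'k) free_algebra, 'm) gmodule"
  assumes X: "fp_module X" and g: "good X d"
  shows "Ident qgr X = germ_class X X d (incl X d)"
proof -
  have "trunc_set X d \<subseteq> carrier X" by (auto simp: trunc_set_def)
  then have "restrict (\<lambda>x\<in>carrier X. x) (trunc_set X d) = incl X d"
    by (auto simp: restrict_def fun_eq_iff incl_def)
  then show ?thesis
    using germ_class_ident_gen[OF X X g id_hom] X by (simp add: qgr_simps)
qed

lemma germ_class_add:
  fixes X Y :: "(('x, 'k) free_algebra, 'm) gmodule"
  assumes X: "fp_module X" and Y: "fp_module Y" and g: "good X d"
    and p: "\<phi> \<in> graded_hom (trunc X d) Y" "\<psi> \<in> graded_hom (trunc X d) Y"
  shows "germ_class X Y d \<phi> \<oplus>\<^bsub>Hom qgr X Y\<^esub> germ_class X Y d \<psi> = germ_class X Y d (\<lambda>x\<in>trunc_set X d. \<phi> x \<oplus>\<^bsub>Y\<^esub> \<psi> x)"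
proof -
  interpret X: fgm X using X by (intro fgmI) simp
  interpret Y: graded_module Y using Y by simp
  let ?h = "\<lambda>x\<in>trunc_set X d. \<phi> x \<oplus>\<^bsub>Y\<^esub> \<psi> x"
  have h: "?h \<in> graded_hom (trunc X d) Y"
    using hom_plus[OF X.graded_trunc Y.graded_module_axioms p] by simp
  show ?thesis
    unfolding qgr_simps
  proof (rule Image_eq_cls[OF inj X Y g h, of "(trunc X d, incl X d, ?h)"])
    show "(trunc X d, incl X d, ?h) \<in> germ_class X Y d ?h" by (rule germ_class_refl[OF inj X Y g h])
    show "(trunc X d, incl X d, ?h) \<in> {(W, s, f \<oplus>\<^bsub>Hom gr W Y\<^esub> g) | W s f g. (W, s, f) \<in> germ_class X Y d \<phi> \<and> (W, s, g) \<in> germ_class X Y d \<psi>}"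
      using germ_class_refl[OF inj X Y g p(1)] germ_class_refl[OF inj X Y g p(2)] by force
    fix W s k assume r: "(W, s, k) \<in> roofs gr fdim X Y"
      "(W, s, k) \<in> {(W, s, f \<oplus>\<^bsub>Hom gr W Y\<^esub> g) | W s f g. (W, s, f) \<in> germ_class X Y d \<phi> \<and> (W, s, g) \<in> germ_class X Y d \<psi>}"
    then obtain f g' where k: "k = (\<lambda>x\<in>carrier W. f x \<oplus>\<^bsub>Y\<^esub> g' x)" "(W, s, f) \<in> germ_class X Y d \<phi>" "(W, s, g') \<in> germ_class X Y d \<psi>" by auto
    note R = roofsD[OF r(1)]
    interpret W: graded_module W using R by simp
    obtain e1 e2 where e: "e1 \<ge> d" "germ X Y W s f e1 (restrict \<phi> (trunc_set X e1))" 
      "e2 \<ge> d" "germ X Y W s g' e2 (restrict \<psi> (trunc_set X e2))"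
      using k mem_cls[OF inj X Y g p(1)] mem_cls[OF inj X Y g p(2)] by blast
    let ?E = "max e1 e2"
    have "germ X Y W s k ?E (restrict ?h (trunc_set X ?E))"
      unfolding germ_def
    proof (intro conjI allI impI ballI r)
      show "good X ?E" by (rule X.good_mono[OF g]) (use e in simp)
      show "restrict ?h (trunc_set X ?E) \<in> graded_hom (trunc X ?E) Y"
        by (rule restrict_hom[OF X.graded_module_axioms h]) (use e in simp)
      fix j assume j: "?E \<le> j"
      show "bij_betw s (grade W j) (grade X j)" using e(2) j by (simp add: germ_def)
      fix y assume y: "y \<in> grade W j"
      have "s y \<in> trunc_set X j" using hom_grade[OF R(3) y] X.grade_tset[OF order_refl] by blast
      then have t: "s y \<in> trunc_set X ?E" "s y \<in> trunc_set X e1" "s y \<in> trunc_set X e2" "s y \<in> trunc_set X d"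
        using X.trunc_set_mono[of ?E j] X.trunc_set_mono[of e1 j] X.trunc_set_mono[of e2 j] X.trunc_set_mono[of d j] j e by auto
      have "\<phi> (s y) = f y" using germD[OF e(2) _ y] j t by simp
      moreover have "\<psi> (s y) = g' y" using germD[OF e(4) _ y] j t by simp
      ultimately show "restrict ?h (trunc_set X ?E) (s y) = k y"
        using t W.grade_carrier[OF y] by (simp add: k(1))
    qed
    then show "(W, s, k) \<in> germ_class X Y d ?h"
      unfolding mem_cls[OF inj X Y g h] using e by (intro exI[of _ ?E]) simp
  qed
qed

lemma germ_class_smult:
  fixes X Y :: "(('x, 'k) free_algebra, 'm) gmodule"
  assumes X: "fp_module X" and Y: "fp_module Y" and g: "good X d" and p: "\<phi> \<in> graded_hom (trunc X d) Y"
  shows "c \<odot>\<^bsub>Hom qgr X Y\<^esub> germ_class X Y d \<phi> = germ_class X Y d (\<lambda>x\<in>trunc_set X d. scalar c \<odot>\<^bsub>Y\<^esub> \<phi> x)"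
proof -
  interpret X: fgm X using X by (intro fgmI) simp
  interpret Y: graded_module Y using Y by simp
  let ?h = "\<lambda>x\<in>trunc_set X d. scalar c \<odot>\<^bsub>Y\<^esub> \<phi> x"
  have h: "?h \<in> graded_hom (trunc X d) Y"
    using hom_times[OF X.graded_trunc Y.graded_module_axioms p] by simp
  show ?thesis
    unfolding qgr_simps
  proof (rule Image_eq_cls[OF inj X Y g h, of "(trunc X d, incl X d, ?h)"])
    show "(trunc X d, incl X d, ?h) \<in> germ_class X Y d ?h" by (rule germ_class_refl[OF inj X Y g h])
    show "(trunc X d, incl X d, ?h) \<in> {(W, s, c \<odot>\<^bsub>Hom gr W Y\<^esub> f) | W s f. (W, s, f) \<in> germ_class X Y d \<phi>}"
      using germ_class_refl[OF inj X Y g p] by force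
    fix W s k assume r: "(W, s, k) \<in> roofs gr fdim X Y"
      "(W, s, k) \<in> {(W, s, c \<odot>\<^bsub>Hom gr W Y\<^esub> f) | W s f. (W, s, f) \<in> germ_class X Y d \<phi>}"
    then obtain f where k: "k = (\<lambda>x\<in>carrier W. scalar c \<odot>\<^bsub>Y\<^esub> f x)" "(W, s, f) \<in> germ_class X Y d \<phi>" by auto
    note R = roofsD[OF r(1)]
    interpret W: graded_module W using R by simp
    obtain e where e: "e \<ge> d" "germ X Y W s f e (restrict \<phi> (trunc_set X e))"
      using k mem_cls[OF inj X Y g p] by blast
    have "germ X Y W s k e (restrict ?h (trunc_set X e))"
      unfolding germ_def
    proof (intro conjI allI impI ballI r)
      show "good X e" by (rule X.good_mono[OF g e(1)])
      show "restrict ?h (trunc_set X e) \<in> graded_hom (trunc X e) Y"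
        by (rule restrict_hom[OF X.graded_module_axioms h e(1)])
      fix j assume j: "e \<le> j"
      show "bij_betw s (grade W j) (grade X j)" using e(2) j by (simp add: germ_def)
      fix y assume y: "y \<in> grade W j"
      have "s y \<in> trunc_set X j" using hom_grade[OF R(3) y] X.grade_tset[OF order_refl] by blast
      then have t: "s y \<in> trunc_set X e" "s y \<in> trunc_set X d"
        using X.trunc_set_mono[of e j] X.trunc_set_mono[of d j] j e by auto
      have "\<phi> (s y) = f y" using germD[OF e(2) j y] t by simp
      then show "restrict ?h (trunc_set X e) (s y) = k y"
        using t W.grade_carrier[OF y] by (simp add: k(1))
    qed
    then show "(W, s, k) \<in> germ_class X Y d ?h" unfolding mem_cls[OF inj X Y g h] using e by blast
  qed
qed

lemma germ_class_comp:
  fixes X Y Z :: "(('x, 'k) free_algebra, 'm) gmodule"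
  assumes X: "fp_module X" and Y: "fp_module Y" and Z: "fp_module Z" and gX: "good X d" and gY: "good Y d"
    and p: "\<phi> \<in> graded_hom (trunc X d) Y" and q: "\<psi> \<in> graded_hom (trunc Y d) Z"
  shows "Comp qgr X Y Z (germ_class Y Z d \<psi>) (germ_class X Y d \<phi>) = germ_class X Z d (compose (trunc_set X d) \<psi> \<phi>)"
proof -
  interpret X: fgm X using X by (intro fgmI) simp
  interpret Y: fgm Y using Y by (intro fgmI) simp
  have TX: "fp_module (trunc X d)" and TY: "fp_module (trunc Y d)"
    using fp_module_trunc X Y gX gY by auto
  have p': "\<phi> \<in> graded_hom (trunc X d) (trunc Y d)"
    by (rule hom_trunc[OF X.graded_module_axioms Y.graded_module_axioms p])
  let ?h = "compose (trunc_set X d) \<psi> \<phi>"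
  have h: "?h \<in> graded_hom (trunc X d) Z"
    using hom_compose[OF p' q X.graded_trunc] by simp
  show ?thesis
    unfolding qgr_simps roof_comp_def
  proof (rule Image_eq_cls[OF inj X Z gX h, of "(trunc X d, incl X d, ?h)"])
    let ?B = "{(U, Comp gr U W X s u, Comp gr U V Z g v) | U u v W s f V t g.
          (W, s, f) \<in> germ_class X Y d \<phi> \<and> (V, t, g) \<in> germ_class Y Z d \<psi> \<and> U \<in> Ob gr \<and>
          inverted gr fdim U W u \<and> v \<in> mor gr U V \<and> Comp gr U W Y f u = Comp gr U V Y t v}"
    show "(trunc X d, incl X d, ?h) \<in> germ_class X Z d ?h" by (rule germ_class_refl[OF inj X Z gX h])
    \<comment> \<open>The sample composite has the truncation of \<open>X\<close> as its top and the
      identity as left leg. Since \<open>\<phi>\<close> takes values in the truncation of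
      \<open>Y\<close>, it is itself the map that closes the square.\<close>
    let ?u = "\<lambda>x\<in>carrier (trunc X d). x"
    have c1: "Comp gr (trunc X d) (trunc X d) X (incl X d) ?u = incl X d"
      "Comp gr (trunc X d) (trunc Y d) Z \<psi> \<phi> = ?h"
      by (auto simp: compose_def incl_def restrict_def fun_eq_iff)
    have c2: "Comp gr (trunc X d) (trunc X d) Y \<phi> ?u = Comp gr (trunc X d) (trunc Y d) Y (incl Y d) \<phi>"
      using hom_carrier[OF p'] by (auto simp: compose_def incl_def restrict_def fun_eq_iff)
    have c3: "inverted gr fdim (trunc X d) (trunc X d) ?u" by (rule id_inverted[OF TX])
    have c4: "(trunc X d, incl X d, \<phi>) \<in> germ_class X Y d \<phi>" "(trunc Y d, incl Y d, \<psi>) \<in> germ_class Y Z d \<psi>"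
      using germ_class_refl[OF inj X Y gX p] germ_class_refl[OF inj Y Z gY q] by auto
    have c5: "trunc X d \<in> Ob gr" "\<phi> \<in> mor gr (trunc X d) (trunc Y d)" using TX p' by simp_all
    show "(trunc X d, incl X d, ?h) \<in> ?B"
      unfolding mem_Collect_eq
      by (rule exI[of _ "trunc X d"], rule exI[of _ ?u], rule exI[of _ \<phi>], rule exI[of _ "trunc X d"],
          rule exI[of _ "incl X d"], rule exI[of _ \<phi>], rule exI[of _ "trunc Y d"], rule exI[of _ "incl Y d"],
          rule exI[of _ \<psi>]) (simp only: c1 c2 c3 c4 c5 simp_thms)
    fix U su gv assume r: "(U, su, gv) \<in> roofs gr fdim X Z" "(U, su, gv) \<in> ?B"
    then obtain u v W s f V t g' where k: "su = compose (carrier U) s u" "gv = compose (carrier U) g' v"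
      "(W, s, f) \<in> germ_class X Y d \<phi>" "(V, t, g') \<in> germ_class Y Z d \<psi>" "inverted gr fdim U W u" "v \<in> graded_hom U V"
      "compose (carrier U) f u = compose (carrier U) t v" by auto
    note R = roofsD[OF r(1)]
    interpret U: graded_module U using R by simp
    obtain e1 e2 where e: "e1 \<ge> d" "germ X Y W s f e1 (restrict \<phi> (trunc_set X e1))" 
      "e2 \<ge> d" "germ Y Z V t g' e2 (restrict \<psi> (trunc_set Y e2))"
      using k(3,4) unfolding mem_cls[OF inj X Y gX p] mem_cls[OF inj Y Z gY q] by blast
    have rW: "(W, s, f) \<in> roofs gr fdim X Y" and rV: "(V, t, g') \<in> roofs gr fdim Y Z"
      using e(2,4) unfolding germ_def by simp_all
    note W = roofsD(1,3)[OF rW] and V = roofsD(1,3)[OF rV]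
    \<comment> \<open>The left leg of an arbitrary composite is \<open>s\<close> after
      \<open>u\<close>; it is bijective only where both are, hence a third bound.\<close>
    obtain e3 where e3: "\<And>j. j \<ge> e3 \<Longrightarrow> bij_betw u (grade U j) (grade W j)"
      using inverted_bij[OF inj R(1) W(1) k(5)] by blast
    have uh: "u \<in> graded_hom U W" using k(5) by (simp add: inverted_def)
    let ?E = "max e1 (max e2 e3)"
    have "germ X Z U su gv ?E (restrict ?h (trunc_set X ?E))"
      unfolding germ_def
    proof (intro conjI allI impI ballI r)
      show "good X ?E" by (rule X.good_mono[OF gX]) (use e in simp)
      show "restrict ?h (trunc_set X ?E) \<in> graded_hom (trunc X ?E) Z"
        by (rule restrict_hom[OF X.graded_module_axioms h]) (use e in simp)
      fix j assume j: "?E \<le> j"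
      have "bij_betw s (grade W j) (grade X j)" using e(2) j by (simp add: germ_def)
      then have "bij_betw (s \<circ> u) (grade U j) (grade X j)" using e3[of j] j by (intro bij_betw_trans) auto
      then show "bij_betw su (grade U j) (grade X j)"
        by (rule bij_betw_cong[THEN iffD1, rotated]) (use U.grade_carrier in \<open>auto simp: k(1) compose_def\<close>)
      fix y assume y: "y \<in> grade U j"
      then have yc: "y \<in> carrier U" by (rule U.grade_carrier)
      have sy: "su y = s (u y)" "gv y = g' (v y)" using yc by (simp_all add: k(1,2) compose_def)
      have uy: "u y \<in> grade W j" "v y \<in> grade V j" using hom_grade[OF uh y] hom_grade[OF k(6) y] .
      have "s (u y) \<in> trunc_set X j" using hom_grade[OF W(2) uy(1)] X.grade_tset[OF order_refl] by blast
      then have t1: "s (u y) \<in> trunc_set X ?E" "s (u y) \<in> trunc_set X e1" "s (u y) \<in> trunc_set X d"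
        using X.trunc_set_mono[of ?E j] X.trunc_set_mono[of e1 j] X.trunc_set_mono[of d j] j e by auto
      have "t (v y) \<in> trunc_set Y j" using hom_grade[OF V(2) uy(2)] Y.grade_tset[OF order_refl] by blast
      then have t2: "t (v y) \<in> trunc_set Y e2" using Y.trunc_set_mono[of e2 j] j by auto
      have "\<phi> (s (u y)) = f (u y)" using germD[OF e(2) _ uy(1)] j t1 by simp
      also have "\<dots> = t (v y)" using fun_cong[OF k(7), of y] yc by (simp add: compose_def)
      finally have "\<psi> (\<phi> (s (u y))) = g' (v y)" using germD[OF e(4) _ uy(2)] j t2 by simp
      then show "restrict ?h (trunc_set X ?E) (su y) = gv y" using t1 sy by (simp add: compose_def)
    qed
    then show "(U, su, gv) \<in> germ_class X Z d ?h"
      unfolding mem_cls[OF inj X Z gX h] using e by (intro exI[of _ ?E]) simp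
  qed
qed

end

section \<open>Ranks and matrices in a fixed degree\<close>

definition chosen_basis :: "(('x, 'k::field) free_algebra, 'm) gmodule \<Rightarrow> nat \<Rightarrow> 'm list" where
  "chosen_basis X d = (SOME ts. basis X (int d) ts)"

definition rk :: "(('x, 'k::field) free_algebra, 'm) gmodule \<Rightarrow> nat \<Rightarrow> nat" where
  "rk X d = length (chosen_basis X d)"

text \<open>The matrix of \<open>F\<close> in degree \<open>d\<close> with respect to the chosen
  bases. It is a relation because a morphism has a matrix only from some degree on, which depends on
  the morphism. Degrees are natural numbers from here on, so that powers with exponent
  \<open>d\<close> can be formed.\<close>

definition Rep :: "(('x::finite, 'k::field) free_algebra, 'm) gmodule \<Rightarrow> (('x, 'k) free_algebra, 'm) gmodule \<Rightarrow>
    nat \<Rightarrow> ((('x, 'k) free_algebra, 'm) gmodule, 'm \<Rightarrow> 'm) roof set \<Rightarrow> ((nat \<Rightarrow> 'k) \<Rightarrow> nat \<Rightarrow> 'k) \<Rightarrow> bool" where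
  "Rep X Y d F A \<longleftrightarrow> fp_module X \<and> fp_module Y \<and> good X (int d) \<and> good Y (int d) \<and> A \<in> lin (rk X d) (rk Y d) \<and>
     (\<exists>\<phi>\<in>graded_hom (trunc X (int d)) Y. F = germ_class X Y (int d) \<phi> \<and>
       (\<forall>v. \<phi> (scalar_combination X (chosen_basis X d) v) = scalar_combination Y (chosen_basis Y d) (A v)))"

lemma basis_bas: "good X (int d) \<Longrightarrow> basis X (int d) (chosen_basis X d)"
  unfolding good_def chosen_basis_def by (meson someI_ex)

context graded_module
begin

lemma scalar_combination_idl: "set ts \<subseteq> carrier M \<Longrightarrow> scalar_combination M ts (id_matrix (length ts) v) = scalar_combination M ts v"
  by (rule scalar_combination_cong) (auto simp: id_matrix_def)

lemma coord_ex:
  assumes "basis M d ts" "x \<in> grade M d"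
  shows "\<exists>w. scalar_combination M ts w = x \<and> id_matrix (length ts) w = w"
proof -
  obtain v where v: "x = scalar_combination M ts v" using basis_span[OF assms] by blast
  then show ?thesis using scalar_combination_idl[OF basis_carrier[OF assms(1)]]
    by (intro exI[of _ "id_matrix (length ts) v"]) (auto simp: id_matrix_def)
qed

lemma coord_unique:
  assumes "basis M d ts" "scalar_combination M ts v = scalar_combination M ts w" "id_matrix (length ts) v = v" "id_matrix (length ts) w = w"
  shows "v = w"
proof -
  have "id_matrix (length ts) v = id_matrix (length ts) w"
    using basis_inj[OF assms(1,2)] by (auto simp: id_matrix_def fun_eq_iff)
  then show ?thesis using assms by simp
qed

text \<open>The matrix that expresses \<open>ts\<close> in terms of \<open>us\<close> is
  injective.\<close>

lemma basis_length_le: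
  assumes ts: "basis M d ts" and us: "basis M d us"
  shows "length ts \<le> length us"
proof -
  note tc = basis_carrier[OF ts] and uc = basis_carrier[OF us]
  have tg: "scalar_combination M ts v \<in> grade M d" for v using ts by (intro scalar_combination_grade) (simp add: basis_def)
  have "\<exists>A. \<forall>v. scalar_combination M us (A v) = scalar_combination M ts v \<and> id_matrix (length us) (A v) = A v"
    using coord_ex[OF us tg] by metis
  then obtain A where A: "\<And>v. scalar_combination M us (A v) = scalar_combination M ts v" "\<And>v. id_matrix (length us) (A v) = A v" by blast
  have out: "A v i = 0" if "i \<ge> length us" for v i using fun_cong[OF A(2)[of v], of i] that by (simp add: id_matrix_def)
  have "A \<in> lin (length ts) (length us)"
  proof (rule linI)
    show "A (\<lambda>i. v i + w i) = (\<lambda>i. A v i + A w i)" for v w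
      by (rule coord_unique[OF us]) (auto simp: A scalar_combination_add tc uc id_matrix_def out fun_eq_iff)
    show "A (\<lambda>i. c * v i) = (\<lambda>i. c * A v i)" for c v
      by (rule coord_unique[OF us]) (auto simp: A scalar_combination_scalar tc uc id_matrix_def out fun_eq_iff)
    show "A v = A w" if "\<And>i. i < length ts \<Longrightarrow> v i = w i" for v w
      by (rule coord_unique[OF us]) (auto simp: A intro!: scalar_combination_cong that tc)
  qed (rule out)
  then show ?thesis
  proof (rule lin_inj_le)
    fix v i assume "A v = (\<lambda>i. 0)" "i < length ts"
    then show "v i = 0" using basis_indep[OF ts, of v i] A(1)[of v] scalar_combination_zero[OF uc] by simp
  qed
qed

lemma basis_length: "basis M d ts \<Longrightarrow> basis M d us \<Longrightarrow> length ts = length us"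
  using basis_length_le by (simp add: order_antisym)

end

lemma rk_basis: "graded_module X \<Longrightarrow> good X (int d) \<Longrightarrow> basis X (int d) ts \<Longrightarrow> rk X d = length ts"
  unfolding rk_def using graded_module.basis_length basis_bas by blast

lemma rk_step:
  assumes "graded_module (X :: (('x::finite, 'k::field) free_algebra, 'm) gmodule)" "good X (int d)"
  shows "rk X (Suc d) = card (UNIV :: 'x set) * rk X d"
proof -
  interpret fgm X by (rule fgmI[OF assms(1)])
  have "stable X (int d)" using assms(2) by (simp add: good_def)
  then obtain us where "basis X (int (Suc d)) us" "length us = card (UNIV :: 'x set) * rk X d"
    using basis_step[OF _ basis_bas[OF assms(2)]] unfolding rk_def by (metis add.commute of_nat_Suc)
  moreover have "good X (int (Suc d))" using good_step[OF assms(2)] by (simp add: add.commute)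
  ultimately show ?thesis using rk_basis[OF assms(1)] by simp
qed

text \<open>For a module free on generators of degree \<open>d\<close>, the bound is
  \<open>d\<close> itself, whereas \<open>fp_good\<close> yields some unspecified one. This
  sharpness is what permits a prescribed rank in a prescribed degree.\<close>

lemma good_free:
  fixes M :: "(('x::finite, 'k::field) free_algebra, 'm) gmodule"
  assumes M: "graded_module M" and fb: "free_basis M (replicate n (- d)) gs"
  shows "good M (d)" and "basis M (d) gs"
proof -
  interpret fgm M by (rule fgmI[OF M])
  let ?es = "replicate n (- d)"
  have h: "homog M ?es gs" and r: "range (combination M gs) = carrier M" using fb by (auto simp: free_basis_def)
  have len: "length gs = n" and gg: "set gs \<subseteq> grade M (d)" using h by (auto simp: homog_def in_set_conv_nth)
  have gc: "set gs \<subseteq> carrier M" by (rule homog_carrier[OF h])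
  show b: "basis M (d) gs"
    unfolding basis_def
  proof (intro conjI gg subsetI allI impI)
    fix x assume x: "x \<in> grade M (d)"
    obtain v where v: "v \<in> grade (free_graded_module ?es) (d)" "combination M gs v = x"
      using lift_grade[OF h x] r grade_carrier[OF x] by blast
    have sc: "v i = scalar (Poly_Mapping.lookup (v i) 0)" if "i < length gs" for i
      using homogeneous_0_scalar[of "v i"] v(1) that len by (simp add: grade_free_graded_module)
    have "scalar_combination M gs (\<lambda>i. Poly_Mapping.lookup (v i) 0) = combination M gs v"
      unfolding scalar_combination_def by (rule combination_cong) (use sc gc in auto)
    then show "x \<in> range (scalar_combination M gs)" using v(2) by auto
  next
    fix v i assume v: "scalar_combination M gs v = \<zero>\<^bsub>M\<^esub>" "i < length gs"
    then have "scalar (v i) = (0 :: ('x, 'k) free_algebra)" using fb unfolding scalar_combination_def free_basis_def by blast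
    then have "Poly_Mapping.lookup (scalar (v i) :: ('x, 'k) free_algebra) 0 = 0" by simp
    then show "v i = 0" by (simp add: scalar_def)
  qed
  have "stable M e" if e: "e \<ge> d" for e
    unfolding stable_def
  proof (intro conjI ballI allI impI)
    have ge: "\<And>l. l < length ?es \<Longrightarrow> ?es ! l + e \<ge> 0" using e by simp
    fix x assume x: "x \<in> grade M (e + 1)"
    obtain v where v: "v \<in> grade (free_graded_module ?es) (e + 1)" "combination M gs v = x"
      using lift_grade[OF h x] r grade_carrier[OF x] by blast
    show "\<exists>y. (\<forall>a. y a \<in> grade M e) \<and> var_sum M y = x"
    proof (intro exI conjI allI)
      show "combination M gs (\<lambda>l. strip a (v l)) \<in> grade M e" for a
        by (rule combination_grade[OF h strip_grade_free(1)[OF v(1) ge]])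
      show "var_sum M (\<lambda>a. combination M gs (\<lambda>l. strip a (v l))) = x"
        unfolding var_sum_lc[OF gc] using strip_grade_free(2)[OF v(1) ge] v(2) by simp
    qed
  next
    fix y c assume y: "(\<forall>a. y a \<in> grade M e) \<and> var_sum M y = \<zero>\<^bsub>M\<^esub>"
    have "y a \<in> range (combination M gs)" for a unfolding r using grade_carrier[of "y a" e] y by blast
    then have "\<exists>u. combination M gs u = y a" for a unfolding image_iff by metis
    then obtain u where u: "\<And>a. combination M gs (u a) = y a" by metis
    have "combination M gs (\<lambda>l. \<Sum>a\<in>UNIV. xvar a * u a l) = \<zero>\<^bsub>M\<^esub>" using y var_sum_lc[OF gc, of u] u by simp
    then have z: "(\<Sum>a\<in>UNIV. xvar a * u a l) = 0" if "l < length gs" for l using fb that unfolding free_basis_def by blast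
    have "u c l = 0" if l: "l < length gs" for l
      using arg_cong[OF z[OF l], of "strip c"] by (simp add: strip_sum_xvar[of c "\<lambda>a. u a l"])
    then have "combination M gs (u c) = combination M gs (\<lambda>l. 0)" by (intro combination_cong gc)
    then show "y c = \<zero>\<^bsub>M\<^esub>" using u combination_zero[OF gc] by simp
  qed
  then show "good M (d)" using b by (auto simp: good_def)
qed

context
  fixes \<iota> :: "('x::finite, 'k::field) free_algebra \<Rightarrow> 'm"
  assumes inj: "inj \<iota>"
begin

context
  fixes X Y :: "(('x, 'k) free_algebra, 'm) gmodule"
  assumes X: "fp_module X" and Y: "fp_module Y"
begin

interpretation X: fgm X using X by (intro fgmI) simp
interpretation Y: fgm Y using Y by (intro fgmI) simp

lemma Rep_ex:
  assumes "F \<in> mor qgr X Y"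
  shows "\<exists>D. \<forall>d\<ge>D. \<exists>A. Rep X Y d F A"
proof -
  obtain D1 where D1: "\<And>d. d \<ge> D1 \<Longrightarrow> good X d \<and> (\<exists>\<phi>\<in>graded_hom (trunc X d) Y. F = germ_class X Y d \<phi>)"
    using mor_cls[OF inj X Y] assms unfolding qgr_simps by blast
  obtain D2 where D2: "\<And>d. d \<ge> D2 \<Longrightarrow> good Y d" using Y.fp_good Y by blast
  have "\<exists>A. Rep X Y d F A" if d: "d \<ge> nat (max D1 D2)" for d
  proof -
    have d': "int d \<ge> D1" "int d \<ge> D2" using d by linarith+
    have gX: "good X (int d)" and gY: "good Y (int d)" using D1 D2 d' by auto
    obtain \<phi> where p: "\<phi> \<in> graded_hom (trunc X (int d)) Y" "F = germ_class X Y (int d) \<phi>" using D1[OF d'(1)] by blast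
    let ?ts = "chosen_basis X d" and ?us = "chosen_basis Y d"
    have ts: "basis X (int d) ?ts" and us: "basis Y (int d) ?us" using basis_bas gX gY by auto
    note tc = X.basis_carrier[OF ts] and uc = Y.basis_carrier[OF us]
    have tg: "scalar_combination X ?ts v \<in> grade (trunc X (int d)) (int d)" for v
      using X.scalar_combination_grade[of ?ts "int d" v] ts by (simp add: basis_def X.grade_trunc)
    have tt: "scalar_combination X ?ts v \<in> trunc_set X (int d)" for v using tg[of v] by (simp add: trunc_def)
    have pg: "\<phi> (scalar_combination X ?ts v) \<in> grade Y (int d)" for v by (rule hom_grade[OF p(1) tg])
    have "\<exists>A. \<forall>v. scalar_combination Y ?us (A v) = \<phi> (scalar_combination X ?ts v) \<and> id_matrix (length ?us) (A v) = A v"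
      using Y.coord_ex[OF us pg] by metis
    then obtain A where A: "\<And>v. scalar_combination Y ?us (A v) = \<phi> (scalar_combination X ?ts v)" "\<And>v. id_matrix (length ?us) (A v) = A v" by blast
    have out: "A v i = 0" if "i \<ge> length ?us" for v i using fun_cong[OF A(2)[of v], of i] that by (simp add: id_matrix_def)
    have "A \<in> lin (length ?ts) (length ?us)"
    proof (rule linI)
      show "A (\<lambda>i. v i + w i) = (\<lambda>i. A v i + A w i)" for v w
      proof (rule Y.coord_unique[OF us])
        show "scalar_combination Y ?us (A (\<lambda>i. v i + w i)) = scalar_combination Y ?us (\<lambda>i. A v i + A w i)"
          using hom_add[OF p(1), of "scalar_combination X ?ts v" "scalar_combination X ?ts w"] tt by (simp add: A X.scalar_combination_add tc Y.scalar_combination_add uc)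
      qed (auto simp: A id_matrix_def out fun_eq_iff)
      show "A (\<lambda>i. c * v i) = (\<lambda>i. c * A v i)" for c v
      proof (rule Y.coord_unique[OF us])
        show "scalar_combination Y ?us (A (\<lambda>i. c * v i)) = scalar_combination Y ?us (\<lambda>i. c * A v i)"
          using hom_smult[OF p(1), of "scalar_combination X ?ts v"] tt by (simp add: A X.scalar_combination_scalar tc Y.scalar_combination_scalar uc)
      qed (auto simp: A id_matrix_def out fun_eq_iff)
      show "A v = A w" if "\<And>i. i < length ?ts \<Longrightarrow> v i = w i" for v w
        by (rule Y.coord_unique[OF us]) (auto simp: A intro!: arg_cong[of _ _ \<phi>] X.scalar_combination_cong that tc)
    qed (rule out)
    then show ?thesis unfolding Rep_def rk_def using X Y gX gY p A(1) by metis
  qed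
  then show ?thesis by blast
qed

lemma Rep_mor: "Rep X Y d F A \<Longrightarrow> F \<in> mor qgr X Y"
  unfolding Rep_def qgr_simps using germ_class_mor[OF inj X Y] by blast

lemma Rep_surj:
  assumes g: "good X (int d)" "good Y (int d)" and A: "A \<in> lin (rk X d) (rk Y d)"
  shows "\<exists>F. Rep X Y d F A"
proof -
  let ?ts = "chosen_basis X d" and ?us = "chosen_basis Y d"
  have ts: "basis X (int d) ?ts" and us: "basis Y (int d) ?us" using basis_bas g by auto
  note tc = X.basis_carrier[OF ts] and uc = Y.basis_carrier[OF us]
  have "\<forall>x. \<exists>v. x \<in> grade X (int d) \<longrightarrow> scalar_combination X ?ts v = x \<and> id_matrix (length ?ts) v = v"
    using X.coord_ex[OF ts] by blast
  then obtain co where co: "\<And>x. x \<in> grade X (int d) \<Longrightarrow> scalar_combination X ?ts (co x) = x \<and> id_matrix (length ?ts) (co x) = co x" by metis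
  have out: "co x i = 0" if "i \<ge> length ?ts" "x \<in> grade X (int d)" for x i
    using fun_cong[OF conjunct2[OF co[OF that(2)]], of i] that by (simp add: id_matrix_def)
  have "\<exists>\<phi>\<in>graded_hom (trunc X (int d)) Y. \<forall>x\<in>grade X (int d). \<phi> x = scalar_combination Y ?us (A (co x))"
  proof (rule X.trunc_extend[OF g(1) Y.graded_module_axioms])
    show "scalar_combination Y ?us (A (co x)) \<in> grade Y (int d)" for x
      using us by (intro Y.scalar_combination_grade) (simp add: basis_def)
    fix x y assume x: "x \<in> grade X (int d)" and y: "y \<in> grade X (int d)"
    have "co (x \<oplus>\<^bsub>X\<^esub> y) = (\<lambda>i. co x i + co y i)"
      by (rule X.coord_unique[OF ts])
        (use co x y X.grade_add[OF x y] out in \<open>auto simp: X.scalar_combination_add tc id_matrix_def fun_eq_iff\<close>)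
    then show "scalar_combination Y ?us (A (co (x \<oplus>\<^bsub>X\<^esub> y))) = scalar_combination Y ?us (A (co x)) \<oplus>\<^bsub>Y\<^esub> scalar_combination Y ?us (A (co y))"
      by (simp add: lin_add[OF A] Y.scalar_combination_add uc)
  next
    fix x c assume x: "x \<in> grade X (int d)"
    have "co (scalar c \<odot>\<^bsub>X\<^esub> x) = (\<lambda>i. c * co x i)"
      by (rule X.coord_unique[OF ts])
        (use co x X.grade_scalar[OF x] out in \<open>auto simp: X.scalar_combination_scalar tc id_matrix_def fun_eq_iff\<close>)
    then show "scalar_combination Y ?us (A (co (scalar c \<odot>\<^bsub>X\<^esub> x))) = scalar c \<odot>\<^bsub>Y\<^esub> scalar_combination Y ?us (A (co x))"
      by (simp add: lin_scale[OF A] Y.scalar_combination_scalar uc)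
  qed
  then obtain \<phi> where p: "\<phi> \<in> graded_hom (trunc X (int d)) Y"
    "\<And>x. x \<in> grade X (int d) \<Longrightarrow> \<phi> x = scalar_combination Y ?us (A (co x))" by blast
  have "\<phi> (scalar_combination X ?ts v) = scalar_combination Y ?us (A v)" for v
  proof -
    have g: "scalar_combination X ?ts v \<in> grade X (int d)" using ts by (intro X.scalar_combination_grade) (simp add: basis_def)
    have "co (scalar_combination X ?ts v) = id_matrix (length ?ts) v"
    proof (rule X.coord_unique[OF ts])
      show "scalar_combination X ?ts (co (scalar_combination X ?ts v)) = scalar_combination X ?ts (id_matrix (length ?ts) v)" using co[OF g] X.scalar_combination_idl[OF tc, of v] by simp
    qed (use co[OF g] in \<open>auto simp: id_matrix_def\<close>)
    then show ?thesis using p(2)[OF g] id_matrix_lin(2)[OF A, of v] by (simp add: rk_def)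
  qed
  then show ?thesis unfolding Rep_def using X Y g A p(1) by blast
qed

lemma Rep_inj:
  assumes "Rep X Y d F A" "Rep X Y d G A"
  shows "F = G"
proof -
  obtain \<phi> where p: "\<phi> \<in> graded_hom (trunc X (int d)) Y" "F = germ_class X Y (int d) \<phi>"
    "\<And>v. \<phi> (scalar_combination X (chosen_basis X d) v) = scalar_combination Y (chosen_basis Y d) (A v)" using assms(1) unfolding Rep_def by blast
  obtain \<psi> where q: "\<psi> \<in> graded_hom (trunc X (int d)) Y" "G = germ_class X Y (int d) \<psi>"
    "\<And>v. \<psi> (scalar_combination X (chosen_basis X d) v) = scalar_combination Y (chosen_basis Y d) (A v)" using assms(2) unfolding Rep_def by blast
  have g: "good X (int d)" using assms(1) by (simp add: Rep_def)
  have "\<phi> = \<psi>"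
  proof (rule X.trunc_hom_eq[OF g p(1) q(1) Y.graded_module_axioms])
    fix x assume "x \<in> grade X (int d)"
    then obtain v where "x = scalar_combination X (chosen_basis X d) v" using X.basis_span[OF basis_bas[OF g]] by blast
    then show "\<phi> x = \<psi> x" using p(3) q(3) by simp
  qed
  then show ?thesis using p q by simp
qed

text \<open>Equality of classes gives agreement of \<open>\<phi>\<close> and \<open>\<psi>\<close>
  only from some larger degree \<open>D\<close> on. Agreement descends to degree \<open>d\<close>:
  if the two agree one degree higher, all variables kill the difference of the values at
  \<open>x\<close>, and stability of \<open>Y\<close> makes it zero.\<close>

lemma Rep_fun:
  assumes "Rep X Y d F A" "Rep X Y d F B"
  shows "A = B"
proof -
  obtain \<phi> where p: "\<phi> \<in> graded_hom (trunc X (int d)) Y" "F = germ_class X Y (int d) \<phi>"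
    "\<And>v. \<phi> (scalar_combination X (chosen_basis X d) v) = scalar_combination Y (chosen_basis Y d) (A v)" using assms(1) unfolding Rep_def by blast
  obtain \<psi> where q: "\<psi> \<in> graded_hom (trunc X (int d)) Y" "F = germ_class X Y (int d) \<psi>"
    "\<And>v. \<psi> (scalar_combination X (chosen_basis X d) v) = scalar_combination Y (chosen_basis Y d) (B v)" using assms(2) unfolding Rep_def by blast
  have g: "good X (int d)" "good Y (int d)" and AB: "A \<in> lin (rk X d) (rk Y d)" "B \<in> lin (rk X d) (rk Y d)"
    using assms by (auto simp: Rep_def)
  obtain D where D: "D \<ge> int d" "restrict \<phi> (trunc_set X D) = restrict \<psi> (trunc_set X D)"
    using germ_class_eq_iff[OF inj X Y g(1) p(1) g(1) q(1)] p(2) q(2) by auto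
  \<comment> \<open>The induction runs downwards; \<open>m\<close> is the distance below
    \<open>D\<close>.\<close>
  have agree: "\<phi> x = \<psi> x" if "x \<in> grade X (D - int m)" "int d \<le> D - int m" for m x
    using that
  proof (induction m arbitrary: x)
    case 0
    then have "x \<in> trunc_set X D" using X.grade_tset[of D D] by auto
    then show ?case using fun_cong[OF D(2), of x] by simp
  next
    case (Suc m)
    let ?j = "D - int (Suc m)"
    have xt: "x \<in> trunc_set X (int d)" using X.grade_tset[OF Suc.prems(2)] Suc.prems(1) by blast
    then have xg: "x \<in> grade (trunc X (int d)) ?j" using Suc.prems(1) by (simp add: trunc_def)
    have pq: "\<phi> x \<in> grade Y ?j" "\<psi> x \<in> grade Y ?j" using hom_grade[OF p(1) xg] hom_grade[OF q(1) xg] .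
    then have c: "\<phi> x \<in> carrier Y" "\<psi> x \<in> carrier Y" using Y.grade_carrier by auto
    have e: "xvar a \<odot>\<^bsub>Y\<^esub> (\<phi> x \<ominus>\<^bsub>Y\<^esub> \<psi> x) = \<zero>\<^bsub>Y\<^esub>" for a :: 'x
    proof -
      have "xvar a \<odot>\<^bsub>X\<^esub> x \<in> grade X (D - int m)" using X.grade_xvar[OF Suc.prems(1), of a] by (simp add: algebra_simps)
      then have "\<phi> (xvar a \<odot>\<^bsub>X\<^esub> x) = \<psi> (xvar a \<odot>\<^bsub>X\<^esub> x)" by (rule Suc.IH) (use Suc.prems in simp)
      then have "xvar a \<odot>\<^bsub>Y\<^esub> \<phi> x = xvar a \<odot>\<^bsub>Y\<^esub> \<psi> x"
        using hom_smult[OF p(1), of x "xvar a"] hom_smult[OF q(1), of x "xvar a"] xt by simp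
      then show ?thesis using c
        by (simp add: a_minus_def Y.smult_r_distr Y.smult_r_minus Y.smult_closed Y.r_neg)
    qed
    have "stable Y ?j" using g(2) Suc.prems(2) by (simp add: good_def)
    moreover have "var_sum Y (\<lambda>a. \<phi> x \<ominus>\<^bsub>Y\<^esub> \<psi> x) = \<zero>\<^bsub>Y\<^esub>" by (simp add: var_sum_def e)
    ultimately have "\<phi> x \<ominus>\<^bsub>Y\<^esub> \<psi> x = \<zero>\<^bsub>Y\<^esub>"
      using Y.stable_inj[of ?j "\<lambda>a. \<phi> x \<ominus>\<^bsub>Y\<^esub> \<psi> x"] Y.grade_minus[OF pq] by blast
    then show ?case using c by (simp add: Y.diff_zero_iff)
  qed
  have us: "basis Y (int d) (chosen_basis Y d)" and ts: "basis X (int d) (chosen_basis X d)" using basis_bas g by auto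
  show ?thesis
  proof
    fix v
    have "scalar_combination X (chosen_basis X d) v \<in> grade X (int d)" using ts by (intro X.scalar_combination_grade) (simp add: basis_def)
    then have "\<phi> (scalar_combination X (chosen_basis X d) v) = \<psi> (scalar_combination X (chosen_basis X d) v)"
      using agree[of "scalar_combination X (chosen_basis X d) v" "nat (D - int d)"] D(1) by simp
    then show "A v = B v"
      using Y.coord_unique[OF us, of "A v" "B v"] p(3) q(3) id_matrix_lin(1)[OF AB(1)] id_matrix_lin(1)[OF AB(2)]
      by (simp add: rk_def)
  qed
qed

lemma Rep_add:
  assumes "Rep X Y d F A" "Rep X Y d G B"
  shows "Rep X Y d (F \<oplus>\<^bsub>Hom qgr X Y\<^esub> G) (\<lambda>v i. A v i + B v i)"
proof -
  obtain \<phi> where p: "\<phi> \<in> graded_hom (trunc X (int d)) Y" "F = germ_class X Y (int d) \<phi>"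
    "\<And>v. \<phi> (scalar_combination X (chosen_basis X d) v) = scalar_combination Y (chosen_basis Y d) (A v)" using assms(1) unfolding Rep_def by blast
  obtain \<psi> where q: "\<psi> \<in> graded_hom (trunc X (int d)) Y" "G = germ_class X Y (int d) \<psi>"
    "\<And>v. \<psi> (scalar_combination X (chosen_basis X d) v) = scalar_combination Y (chosen_basis Y d) (B v)" using assms(2) unfolding Rep_def by blast
  have g: "good X (int d)" "good Y (int d)" and AB: "A \<in> lin (rk X d) (rk Y d)" "B \<in> lin (rk X d) (rk Y d)"
    using assms by (auto simp: Rep_def)
  have t: "scalar_combination X (chosen_basis X d) v \<in> trunc_set X (int d)" for v
    using X.scalar_combination_grade[of "chosen_basis X d" "int d" v] X.grade_tset[of "int d" "int d"] basis_bas[OF g(1)] by (auto simp: basis_def)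
  show ?thesis
    unfolding Rep_def p(2) q(2) germ_class_add[OF inj X Y g(1) p(1) q(1)]
    using X Y g lin_plus[OF AB] hom_plus[OF X.graded_trunc Y.graded_module_axioms p(1) q(1)] t p(3) q(3)
      Y.scalar_combination_add[OF Y.basis_carrier[OF basis_bas[OF g(2)]]]
    by (auto intro!: bexI[of _ "\<lambda>x\<in>trunc_set X (int d). \<phi> x \<oplus>\<^bsub>Y\<^esub> \<psi> x"])
qed

lemma Rep_smult:
  assumes "Rep X Y d F A"
  shows "Rep X Y d (c \<odot>\<^bsub>Hom qgr X Y\<^esub> F) (\<lambda>v i. c * A v i)"
proof -
  obtain \<phi> where p: "\<phi> \<in> graded_hom (trunc X (int d)) Y" "F = germ_class X Y (int d) \<phi>"
    "\<And>v. \<phi> (scalar_combination X (chosen_basis X d) v) = scalar_combination Y (chosen_basis Y d) (A v)" using assms(1) unfolding Rep_def by blast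
  have g: "good X (int d)" "good Y (int d)" and AB: "A \<in> lin (rk X d) (rk Y d)"
    using assms by (auto simp: Rep_def)
  have t: "scalar_combination X (chosen_basis X d) v \<in> trunc_set X (int d)" for v
    using X.scalar_combination_grade[of "chosen_basis X d" "int d" v] X.grade_tset[of "int d" "int d"] basis_bas[OF g(1)] by (auto simp: basis_def)
  show ?thesis
    unfolding Rep_def p(2) germ_class_smult[OF inj X Y g(1) p(1)]
    using X Y g lin_times[OF AB] hom_times[OF X.graded_trunc Y.graded_module_axioms p(1)] t p(3)
      Y.scalar_combination_scalar[OF Y.basis_carrier[OF basis_bas[OF g(2)]]]
    by (auto intro!: bexI[of _ "\<lambda>x\<in>trunc_set X (int d). scalar c \<odot>\<^bsub>Y\<^esub> \<phi> x"])
qed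

lemma Rep_zero:
  assumes g: "good X (int d)" "good Y (int d)"
  shows "Rep X Y d \<zero>\<^bsub>Hom qgr X Y\<^esub> (\<lambda>v i. 0)"
proof -
  have t: "scalar_combination X (chosen_basis X d) v \<in> trunc_set X (int d)" for v
    using X.scalar_combination_grade[of "chosen_basis X d" "int d" v] X.grade_tset[of "int d" "int d"] basis_bas[OF g(1)] by (auto simp: basis_def)
  show ?thesis
    unfolding Rep_def germ_class_zero[OF inj X Y g(1)]
    using X Y g zero_hom[OF X.graded_trunc Y.graded_module_axioms] t
      Y.scalar_combination_zero[OF Y.basis_carrier[OF basis_bas[OF g(2)]]]
    by (auto intro!: bexI[of _ "\<lambda>x\<in>trunc_set X (int d). \<zero>\<^bsub>Y\<^esub>"])
qed

end

lemma Rep_id: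
  fixes X :: "(('x, 'k) free_algebra, 'm) gmodule"
  assumes X: "fp_module X" and g: "good X (int d)"
  shows "Rep X X d (Ident qgr X) (id_matrix (rk X d))"
proof -
  interpret X: fgm X using X by (intro fgmI) simp
  have t: "scalar_combination X (chosen_basis X d) v \<in> trunc_set X (int d)" for v
    using X.scalar_combination_grade[of "chosen_basis X d" "int d" v] X.grade_tset[of "int d" "int d"] basis_bas[OF g] by (auto simp: basis_def)
  show ?thesis
    unfolding Rep_def germ_class_id[OF inj X g]
    using X g incl_hom[OF X.graded_module_axioms] t X.scalar_combination_idl[OF X.basis_carrier[OF basis_bas[OF g]]]
    by (auto simp: rk_def incl_def intro!: bexI[of _ "incl X (int d)"])
qed

lemma Rep_comp:
  fixes X Y Z :: "(('x, 'k) free_algebra, 'm) gmodule"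
  assumes "Rep X Y d F A" "Rep Y Z d G B"
  shows "Rep X Z d (Comp qgr X Y Z G F) (\<lambda>v. B (A v))"
proof -
  have X: "fp_module X" and Y: "fp_module Y" and Z: "fp_module Z"
    and g: "good X (int d)" "good Y (int d)" "good Z (int d)"
    and AB: "A \<in> lin (rk X d) (rk Y d)" "B \<in> lin (rk Y d) (rk Z d)"
    using assms by (auto simp: Rep_def)
  interpret X: fgm X using X by (intro fgmI) simp
  obtain \<phi> where p: "\<phi> \<in> graded_hom (trunc X (int d)) Y" "F = germ_class X Y (int d) \<phi>"
    "\<And>v. \<phi> (scalar_combination X (chosen_basis X d) v) = scalar_combination Y (chosen_basis Y d) (A v)" using assms(1) unfolding Rep_def by blast
  obtain \<psi> where q: "\<psi> \<in> graded_hom (trunc Y (int d)) Z" "G = germ_class Y Z (int d) \<psi>"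
    "\<And>v. \<psi> (scalar_combination Y (chosen_basis Y d) v) = scalar_combination Z (chosen_basis Z d) (B v)" using assms(2) unfolding Rep_def by blast
  have t: "scalar_combination X (chosen_basis X d) v \<in> trunc_set X (int d)" for v
    using X.scalar_combination_grade[of "chosen_basis X d" "int d" v] X.grade_tset[of "int d" "int d"] basis_bas[OF g(1)] by (auto simp: basis_def)
  have "\<phi> \<in> graded_hom (trunc X (int d)) (trunc Y (int d))" using hom_trunc X Y p(1) by blast
  then have "compose (trunc_set X (int d)) \<psi> \<phi> \<in> graded_hom (trunc X (int d)) Z"
    using hom_compose[OF _ q(1) X.graded_trunc] by simp
  then show ?thesis
    unfolding Rep_def p(2) q(2) germ_class_comp[OF inj X Y Z g(1,2) p(1) q(1)]
    using X Z g lin_comp[OF AB] t p(3) q(3)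
    by (auto simp: compose_eq intro!: bexI[of _ "compose (trunc_set X (int d)) \<psi> \<phi>"])
qed

lemma twisted_sheaf_rank:
  shows "fp_module (twisted_sheaf \<iota> (- int d))" "good (twisted_sheaf \<iota> (- int d)) (int d)"
    "rk (twisted_sheaf \<iota> (- int d)) d = 1"
proof -
  have fb: "free_basis (twisted_sheaf \<iota> (- int d)) (replicate 1 (- int d)) [\<iota> 1]"
    using twisted_sheaf_free_basis[OF inj, of "- int d"] by simp
  show fp: "fp_module (twisted_sheaf \<iota> (- int d))"
    using graded_twisted_sheaf[OF inj] fp_twisted_sheaf[OF inj] by blast
  then show "good (twisted_sheaf \<iota> (- int d)) (int d)" using good_free[OF _ fb] by blast
  then show "rk (twisted_sheaf \<iota> (- int d)) d = 1" using rk_basis[OF _ _ good_free(2)[OF _ fb]] fp by simp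
qed

end

section \<open>Objects of prescribed rank\<close>

lemma basis_power:
  assumes "graded_module (M :: (('x::finite, 'k::field) free_algebra, 'm) gmodule)" "good M d" "basis M d ts"
  shows "\<exists>us. basis M (d + int m) us \<and> length us = card (UNIV :: 'x set) ^ m * length ts"
proof (induction m)
  case 0 then show ?case using assms(3) by auto
next
  case (Suc m)
  then obtain us where us: "basis M (d + int m) us" "length us = card (UNIV :: 'x set) ^ m * length ts" by blast
  interpret fgm M by (rule fgmI[OF assms(1)])
  have "stable M (d + int m)" using assms(2) by (simp add: good_def)
  from basis_step[OF this us(1)] us(2) show ?case by (auto simp: add_ac mult_ac)
qed

text \<open>Free modules of every rank live inside \<open>R(e)\<close>, which keeps them on the given type.\<close>

lemma ex_rank:
  fixes \<iota> :: "('x::finite, 'k::field) free_algebra \<Rightarrow> 'm"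
  assumes inj: "inj \<iota>" and card: "card (UNIV :: 'x set) \<ge> 2"
  shows "\<exists>X :: (('x, 'k) free_algebra, 'm) gmodule. fp_module X \<and> good X (int d) \<and> rk X d = n"
proof -
  \<comment> \<open>The generator sits \<open>n\<close> degrees below \<open>d\<close>, so the
    dimension in degree \<open>d\<close> is the \<open>n\<close>-th power of the number of
    variables. That is at least \<open>2 ^ n\<close>, which leaves room for \<open>n\<close>
    independent elements.\<close>
  let ?e = "int d - int n"
  let ?M = "twisted_sheaf \<iota> (- ?e)"
  have M: "graded_module ?M" by (rule graded_twisted_sheaf[OF inj])
  interpret fgm ?M by (rule fgmI[OF M])
  have fb: "free_basis ?M (replicate 1 (- ?e)) [\<iota> 1]"
    using twisted_sheaf_free_basis[OF inj, of "- ?e"] by simp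
  note g = good_free[OF M fb]
  obtain ts where ts: "basis ?M (int d) ts" "length ts = card (UNIV :: 'x set) ^ n"
    using basis_power[OF M g, of n] by auto
  have "n < 2 ^ n" by simp
  also have "(2 :: nat) ^ n \<le> card (UNIV :: 'x set) ^ n" using card by (rule power_mono) simp
  finally have len: "n \<le> length ts" using ts(2) by simp
  let ?gs = "take n ts" and ?S = "range (combination ?M (take n ts))"
  have gl: "length ?gs = n" using len by simp
  have st: "\<And>e. e \<ge> int d \<Longrightarrow> stable ?M e" using g(1) by (simp add: good_def)
  have tg: "set ts \<subseteq> grade ?M (int d)" using ts(1) by (simp add: basis_def)
  then have gg: "set ?gs \<subseteq> grade ?M (int d)" by (rule subset_trans[OF set_take_subset])
  have tc: "set ts \<subseteq> carrier ?M" by (rule basis_carrier[OF ts(1)])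
  have gc: "set ?gs \<subseteq> carrier ?M" and dc: "set (drop n ts) \<subseteq> carrier ?M"
    using subset_trans[OF set_take_subset tc] subset_trans[OF set_drop_subset tc] .
  have h: "homog ?M (replicate n (- int d)) ?gs" using homog_replicate[OF gg] gl by simp
  have S: "graded_sub ?M ?S" by (rule graded_sub_lc[OF h])
  have gS: "set ?gs \<subseteq> ?S"
  proof
    fix x assume "x \<in> set ?gs"
    then obtain l where l: "l < length ?gs" "x = ?gs ! l" unfolding in_set_conv_nth by blast
    then have "x \<in> carrier ?M" using subsetD[OF gc nth_mem] by simp
    then have "x = combination ?M ?gs (\<lambda>i. if i = l then 1 else 0)" using combination_unit[OF gc l(1), of 1] l(2) by (simp only: smult_one)
    then show "x \<in> ?S" by simp
  qed
  let ?N = "restrict_to ?M ?S"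
  have N: "graded_module ?N" by (rule graded_restrict[OF S])
  have lcN: "combination ?N ?gs v = combination ?M ?gs v" for v by (rule combination_restrict[OF S gS])
  have "free_basis ?N (replicate n (- int d)) ?gs"
    unfolding free_basis_def lcN
  proof (intro conjI allI impI)
    show "homog ?N (replicate n (- int d)) ?gs"
      using h subsetD[OF gS nth_mem] by (simp add: homog_def)
    fix v l assume v: "combination ?M ?gs v = \<zero>\<^bsub>?N\<^esub>" and l: "l < length ?gs"
    \<comment> \<open>Padded by zeros, a relation among the first \<open>n\<close> basis elements
      becomes one over all of \<open>ts\<close>, and \<open>ts\<close> is independent over
      \<open>R\<close> by \<open>combination_kernel\<close>.\<close>
    let ?v = "\<lambda>i. if i < n then v i else 0"
    have "combination ?M ts ?v = combination ?M (?gs @ drop n ts) ?v" by simp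
    also have "\<dots> = combination ?M ?gs ?v \<oplus>\<^bsub>?M\<^esub> combination ?M (drop n ts) (\<lambda>l. ?v (length ?gs + l))"
      by (rule combination_append[OF gc dc])
    also have "combination ?M ?gs ?v = combination ?M ?gs v" by (rule combination_cong[OF _ gc]) simp
    also have "combination ?M (drop n ts) (\<lambda>l. ?v (length ?gs + l)) = \<zero>\<^bsub>?M\<^esub>"
      using combination_zero[OF dc] gl by simp
    finally have z: "combination ?M ts ?v = \<zero>\<^bsub>?M\<^esub>" using v by (simp only: restrict_to_simps l_zero[OF zero_closed])
    show "v l = 0" using combination_kernel[OF st ts(1) z, of l] l by simp
  qed simp
  note fbN = this
  have "finitely_presented ?N" by (rule graded_module.fp_free_basis[OF N fbN])
  moreover have "rk ?N d = n"
    using rk_basis[OF N good_free(1)[OF N fbN] good_free(2)[OF N fbN]] gl by simp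
  ultimately show ?thesis using N good_free(1)[OF N fbN] by blast
qed

section \<open>Categories of germs of matrices\<close>

text \<open>Isolates what the linear algebra uses. In a fixed degree where both objects are good,
  matrices correspond exactly to the morphisms represented there, compatibly with all operations,
  and any morphism is represented in all large degrees. In the application \<open>L d\<close> is the
  twist generated in degree \<open>d\<close>, and \<open>ex_rank\<close> supplies summands and
  complements of any desired size.\<close>

locale germ_cat =
  fixes C :: "('k::field, 'o, 'a) lincat"
    and good :: "'o \<Rightarrow> nat \<Rightarrow> bool"
    and rk :: "'o \<Rightarrow> nat \<Rightarrow> nat"
    and Rep :: "'o \<Rightarrow> 'o \<Rightarrow> nat \<Rightarrow> 'a \<Rightarrow> ((nat \<Rightarrow> 'k) \<Rightarrow> nat \<Rightarrow> 'k) \<Rightarrow> bool"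
    and L :: "nat \<Rightarrow> 'o" and r :: nat
  assumes r2: "r \<ge> 2"
    and good_ex: "X \<in> Ob C \<Longrightarrow> \<exists>D. \<forall>d\<ge>D. good X d"
    and good_Suc: "X \<in> Ob C \<Longrightarrow> good X d \<Longrightarrow> good X (Suc d)"
    and rk_Suc: "X \<in> Ob C \<Longrightarrow> good X d \<Longrightarrow> rk X (Suc d) = r * rk X d"
    and Rep_ex: "X \<in> Ob C \<Longrightarrow> Y \<in> Ob C \<Longrightarrow> F \<in> mor C X Y \<Longrightarrow> \<exists>D. \<forall>d\<ge>D. \<exists>A. Rep X Y d F A"
    and Rep_ob: "Rep X Y d F A \<Longrightarrow> X \<in> Ob C \<and> Y \<in> Ob C \<and> good X d \<and> good Y d"
    and Rep_mor: "Rep X Y d F A \<Longrightarrow> F \<in> mor C X Y"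
    and Rep_lin: "Rep X Y d F A \<Longrightarrow> A \<in> lin (rk X d) (rk Y d)"
    and Rep_surj: "X \<in> Ob C \<Longrightarrow> Y \<in> Ob C \<Longrightarrow> good X d \<Longrightarrow> good Y d \<Longrightarrow> A \<in> lin (rk X d) (rk Y d) \<Longrightarrow> \<exists>F. Rep X Y d F A"
    and Rep_inj: "Rep X Y d F A \<Longrightarrow> Rep X Y d G A \<Longrightarrow> F = G"
    and Rep_fun: "Rep X Y d F A \<Longrightarrow> Rep X Y d F B \<Longrightarrow> A = B"
    and Rep_add: "Rep X Y d F A \<Longrightarrow> Rep X Y d G B \<Longrightarrow> Rep X Y d (F \<oplus>\<^bsub>Hom C X Y\<^esub> G) (\<lambda>v i. A v i + B v i)"
    and Rep_smult: "Rep X Y d F A \<Longrightarrow> Rep X Y d (c \<odot>\<^bsub>Hom C X Y\<^esub> F) (\<lambda>v i. c * A v i)"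
    and Rep_zero: "X \<in> Ob C \<Longrightarrow> Y \<in> Ob C \<Longrightarrow> good X d \<Longrightarrow> good Y d \<Longrightarrow> Rep X Y d \<zero>\<^bsub>Hom C X Y\<^esub> (\<lambda>v i. 0)"
    and Rep_id: "X \<in> Ob C \<Longrightarrow> good X d \<Longrightarrow> Rep X X d (Ident C X) (id_matrix (rk X d))"
    and Rep_comp: "Rep X Y d F A \<Longrightarrow> Rep Y Z d G B \<Longrightarrow> Rep X Z d (Comp C X Y Z G F) (\<lambda>v. B (A v))"
    and L_ob: "L d \<in> Ob C" and L_good: "good (L d) d" and L_rk: "rk (L d) d = 1"
    and ex_rank: "\<exists>X\<in>Ob C. good X d \<and> rk X d = n"
begin

lemma rk_add: "X \<in> Ob C \<Longrightarrow> good X d \<Longrightarrow> good X (d + m) \<and> rk X (d + m) = r ^ m * rk X d"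
  by (induction m) (auto simp: good_Suc rk_Suc)

lemma rk_le: "X \<in> Ob C \<Longrightarrow> good X d \<Longrightarrow> d \<le> e \<Longrightarrow> rk X e = r ^ (e - d) * rk X d"
  using rk_add[of X d "e - d"] by simp

lemma rk_zero_iff: "X \<in> Ob C \<Longrightarrow> good X d \<Longrightarrow> good X e \<Longrightarrow> rk X d = 0 \<longleftrightarrow> rk X e = 0"
  using rk_le[of X d e] rk_le[of X e d] r2 by (cases "d \<le> e") auto

text \<open>Phrased with a filter so that finitely many morphisms can be given matrices in one
  common degree by conjunction.\<close>

lemma Rep_ev: "X \<in> Ob C \<Longrightarrow> Y \<in> Ob C \<Longrightarrow> F \<in> mor C X Y \<Longrightarrow> \<forall>\<^sub>F d in sequentially. \<exists>A. Rep X Y d F A"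
  using Rep_ex unfolding eventually_sequentially by blast

lemma good_ev: "X \<in> Ob C \<Longrightarrow> \<forall>\<^sub>F d in sequentially. good X d"
  using good_ex unfolding eventually_sequentially by blast

lemma ev_pick: "\<forall>\<^sub>F d in sequentially. P d \<Longrightarrow> \<exists>d\<ge>(m::nat). P d"
  unfolding eventually_sequentially by (metis nle_le)

lemma pick1:
  assumes "X \<in> Ob C" "Y \<in> Ob C" "f \<in> mor C X Y"
  obtains d A where "Rep X Y d f A"
  using ev_pick[OF Rep_ev[OF assms]] by blast

lemma pick2:
  assumes "X \<in> Ob C" "Y \<in> Ob C" "f \<in> mor C X Y" "X' \<in> Ob C" "Y' \<in> Ob C" "g \<in> mor C X' Y'"
  obtains d A B where "Rep X Y d f A" "Rep X' Y' d g B"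
  using ev_pick[OF eventually_conj[OF Rep_ev[OF assms(1-3)] Rep_ev[OF assms(4-6)]]] by blast

lemma pick3:
  assumes "X \<in> Ob C" "Y \<in> Ob C" "f \<in> mor C X Y" "X' \<in> Ob C" "Y' \<in> Ob C" "g \<in> mor C X' Y'"
    "X'' \<in> Ob C" "Y'' \<in> Ob C" "h \<in> mor C X'' Y''"
  obtains d A B D where "Rep X Y d f A" "Rep X' Y' d g B" "Rep X'' Y'' d h D"
  using ev_pick[OF eventually_conj[OF Rep_ev[OF assms(1-3)] eventually_conj[OF Rep_ev[OF assms(4-6)] Rep_ev[OF assms(7-9)]]]] by blast

text \<open>The pattern behind the category laws that follow: all terms are represented in one
  degree and their matrices compared.\<close>

lemma Rep_eqI: "Rep X Y d f A \<Longrightarrow> Rep X Y d g B \<Longrightarrow> A = B \<Longrightarrow> f = g"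
  using Rep_inj by blast

lemma comp_mor: "X \<in> Ob C \<Longrightarrow> Y \<in> Ob C \<Longrightarrow> Z \<in> Ob C \<Longrightarrow> f \<in> mor C X Y \<Longrightarrow> g \<in> mor C Y Z \<Longrightarrow> Comp C X Y Z g f \<in> mor C X Z"
  by (rule pick2[of X Y f Y Z g]) (auto dest: Rep_comp Rep_mor)

lemma add_mor: "X \<in> Ob C \<Longrightarrow> Y \<in> Ob C \<Longrightarrow> f \<in> mor C X Y \<Longrightarrow> g \<in> mor C X Y \<Longrightarrow> f \<oplus>\<^bsub>Hom C X Y\<^esub> g \<in> mor C X Y"
  by (rule pick2[of X Y f X Y g]) (auto dest: Rep_add Rep_mor)

lemma smult_mor: "X \<in> Ob C \<Longrightarrow> Y \<in> Ob C \<Longrightarrow> f \<in> mor C X Y \<Longrightarrow> c \<odot>\<^bsub>Hom C X Y\<^esub> f \<in> mor C X Y"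
  by (rule pick1[of X Y f]) (auto dest: Rep_smult Rep_mor)

lemma zero_mor: "X \<in> Ob C \<Longrightarrow> Y \<in> Ob C \<Longrightarrow> \<zero>\<^bsub>Hom C X Y\<^esub> \<in> mor C X Y"
  using ev_pick[OF eventually_conj[OF good_ev[of X] good_ev[of Y]]] Rep_zero Rep_mor by blast

lemma id_mor: "X \<in> Ob C \<Longrightarrow> Ident C X \<in> mor C X X"
  using ev_pick[OF good_ev[of X]] Rep_id Rep_mor by blast

lemma comp_assoc:
  assumes "W \<in> Ob C" "X \<in> Ob C" "Y \<in> Ob C" "Z \<in> Ob C" "f \<in> mor C W X" "g \<in> mor C X Y" "h \<in> mor C Y Z"
  shows "Comp C W X Z (Comp C X Y Z h g) f = Comp C W Y Z h (Comp C W X Y g f)"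
proof -
  obtain d A B D where R: "Rep W X d f A" "Rep X Y d g B" "Rep Y Z d h D"
    by (rule pick3[of W X f X Y g Y Z h]) (use assms in auto)
  show ?thesis
    by (rule Rep_inj[OF Rep_comp[OF R(1) Rep_comp[OF R(2,3)]] Rep_comp[OF Rep_comp[OF R(1,2)] R(3)]])
qed

lemma comp_id_left:
  assumes "X \<in> Ob C" "Y \<in> Ob C" "f \<in> mor C X Y"
  shows "Comp C X Y Y (Ident C Y) f = f"
proof -
  obtain d A where R: "Rep X Y d f A" by (rule pick1[OF assms])
  show ?thesis
    by (rule Rep_eqI[OF Rep_comp[OF R Rep_id] R]) (use Rep_ob[OF R] id_matrix_lin(1)[OF Rep_lin[OF R]] in auto)
qed

lemma comp_id_right:
  assumes "X \<in> Ob C" "Y \<in> Ob C" "f \<in> mor C X Y"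
  shows "Comp C X X Y f (Ident C X) = f"
proof -
  obtain d A where R: "Rep X Y d f A" by (rule pick1[OF assms])
  show ?thesis
    by (rule Rep_eqI[OF Rep_comp[OF Rep_id R] R]) (use Rep_ob[OF R] id_matrix_lin(2)[OF Rep_lin[OF R]] in auto)
qed

lemma comp_zero_right:
  assumes "X \<in> Ob C" "Y \<in> Ob C" "Z \<in> Ob C" "f \<in> mor C Y Z"
  shows "Comp C X Y Z f \<zero>\<^bsub>Hom C X Y\<^esub> = \<zero>\<^bsub>Hom C X Z\<^esub>"
proof -
  obtain d A B where R: "Rep Y Z d f A" "Rep X Y d \<zero>\<^bsub>Hom C X Y\<^esub> B"
    by (rule pick2[of Y Z f X Y "\<zero>\<^bsub>Hom C X Y\<^esub>"]) (use assms zero_mor in auto)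
  have z: "A (\<lambda>i. 0) = (\<lambda>i. 0)" using lin_scale[OF Rep_lin[OF R(1)], of 0 "\<lambda>i. 0"] by simp
  show ?thesis
    by (rule Rep_eqI[OF Rep_comp[OF Rep_zero R(1)] Rep_zero])
      (use Rep_ob[OF R(1)] Rep_ob[OF R(2)] z in auto)
qed

lemma comp_zero_left:
  assumes "X \<in> Ob C" "Y \<in> Ob C" "Z \<in> Ob C" "f \<in> mor C X Y"
  shows "Comp C X Y Z \<zero>\<^bsub>Hom C Y Z\<^esub> f = \<zero>\<^bsub>Hom C X Z\<^esub>"
proof -
  obtain d A B where R: "Rep X Y d f A" "Rep Y Z d \<zero>\<^bsub>Hom C Y Z\<^esub> B"
    by (rule pick2[of X Y f Y Z "\<zero>\<^bsub>Hom C Y Z\<^esub>"]) (use assms zero_mor in auto)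
  show ?thesis
    by (rule Rep_eqI[OF Rep_comp[OF R(1) Rep_zero] Rep_zero])
      (use Rep_ob[OF R(1)] Rep_ob[OF R(2)] in auto)
qed

lemma comp_add_right:
  assumes "X \<in> Ob C" "Y \<in> Ob C" "Z \<in> Ob C" "f \<in> mor C Y Z" "g \<in> mor C X Y" "h \<in> mor C X Y"
  shows "Comp C X Y Z f (g \<oplus>\<^bsub>Hom C X Y\<^esub> h) = Comp C X Y Z f g \<oplus>\<^bsub>Hom C X Z\<^esub> Comp C X Y Z f h"
proof -
  obtain d A B D where R: "Rep Y Z d f A" "Rep X Y d g B" "Rep X Y d h D"
    by (rule pick3[of Y Z f X Y g X Y h]) (use assms in auto)
  show ?thesis
    by (rule Rep_eqI[OF Rep_comp[OF Rep_add[OF R(2,3)] R(1)] Rep_add[OF Rep_comp[OF R(2,1)] Rep_comp[OF R(3,1)]]])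
      (simp add: lin_add[OF Rep_lin[OF R(1)]])
qed

lemma comp_add_left:
  assumes "X \<in> Ob C" "Y \<in> Ob C" "Z \<in> Ob C" "f \<in> mor C X Y" "g \<in> mor C Y Z" "h \<in> mor C Y Z"
  shows "Comp C X Y Z (g \<oplus>\<^bsub>Hom C Y Z\<^esub> h) f = Comp C X Y Z g f \<oplus>\<^bsub>Hom C X Z\<^esub> Comp C X Y Z h f"
proof -
  obtain d A B D where R: "Rep X Y d f A" "Rep Y Z d g B" "Rep Y Z d h D"
    by (rule pick3[of X Y f Y Z g Y Z h]) (use assms in auto)
  show ?thesis
    by (rule Rep_inj[OF Rep_comp[OF R(1) Rep_add[OF R(2,3)]] Rep_add[OF Rep_comp[OF R(1,2)] Rep_comp[OF R(1,3)]]])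
qed

lemma add_Hom:
  assumes "X \<in> Ob C" "Y \<in> Ob C"
  shows "abelian_group (Hom C X Y)"
proof (rule abelian_groupI)
  fix f g h assume f: "f \<in> carrier (Hom C X Y)" and g: "g \<in> carrier (Hom C X Y)" and h: "h \<in> carrier (Hom C X Y)"
  show "f \<oplus>\<^bsub>Hom C X Y\<^esub> g \<in> carrier (Hom C X Y)" using add_mor[OF assms, of f g] f g by (simp add: mor_def)
  obtain d A B D where R: "Rep X Y d f A" "Rep X Y d g B" "Rep X Y d h D"
    by (rule pick3[of X Y f X Y g X Y h]) (use assms f g h in \<open>auto simp: mor_def\<close>)
  show "f \<oplus>\<^bsub>Hom C X Y\<^esub> g \<oplus>\<^bsub>Hom C X Y\<^esub> h = f \<oplus>\<^bsub>Hom C X Y\<^esub> (g \<oplus>\<^bsub>Hom C X Y\<^esub> h)"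
    by (rule Rep_eqI[OF Rep_add[OF Rep_add[OF R(1,2)] R(3)] Rep_add[OF R(1) Rep_add[OF R(2,3)]]]) (simp add: add_ac)
next
  fix f g assume f: "f \<in> carrier (Hom C X Y)" and g: "g \<in> carrier (Hom C X Y)"
  obtain d A B where R: "Rep X Y d f A" "Rep X Y d g B"
    by (rule pick2[of X Y f X Y g]) (use assms f g in \<open>auto simp: mor_def\<close>)
  show "f \<oplus>\<^bsub>Hom C X Y\<^esub> g = g \<oplus>\<^bsub>Hom C X Y\<^esub> f"
    by (rule Rep_eqI[OF Rep_add[OF R] Rep_add[OF R(2,1)]]) (simp add: add_ac)
next
  fix f assume f: "f \<in> carrier (Hom C X Y)"
  obtain d A where R: "Rep X Y d f A"
    by (rule pick1[of X Y f]) (use assms f in \<open>auto simp: mor_def\<close>)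
  have Z: "Rep X Y d \<zero>\<^bsub>Hom C X Y\<^esub> (\<lambda>v i. 0)" using Rep_zero Rep_ob[OF R] by blast
  show "\<zero>\<^bsub>Hom C X Y\<^esub> \<oplus>\<^bsub>Hom C X Y\<^esub> f = f"
    by (rule Rep_eqI[OF Rep_add[OF Z R] R]) simp
  have "(-1) \<odot>\<^bsub>Hom C X Y\<^esub> f \<oplus>\<^bsub>Hom C X Y\<^esub> f = \<zero>\<^bsub>Hom C X Y\<^esub>"
    by (rule Rep_eqI[OF Rep_add[OF Rep_smult[OF R] R] Z]) simp
  then show "\<exists>g\<in>carrier (Hom C X Y). g \<oplus>\<^bsub>Hom C X Y\<^esub> f = \<zero>\<^bsub>Hom C X Y\<^esub>"
    using smult_mor[OF assms, of f "-1"] f by (auto simp: mor_def)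
qed (use zero_mor[OF assms] in \<open>simp add: mor_def\<close>)

lemma Rep_finsum:
  assumes ob: "X \<in> Ob C" "Y \<in> Ob C" "good X d" "good Y d" and R: "\<And>i. i \<in> I \<Longrightarrow> Rep X Y d (f i) (A i)"
  shows "Rep X Y d (finsum (Hom C X Y) f I) (\<lambda>v k. \<Sum>i\<in>I. A i v k)"
proof -
  interpret H: abelian_group "Hom C X Y" by (rule add_Hom[OF ob(1,2)])
  show ?thesis using R
  proof (induction I rule: infinite_finite_induct)
    case (insert i I)
    have "f \<in> insert i I \<rightarrow> carrier (Hom C X Y)" using insert.prems Rep_mor unfolding mor_def by blast
    then have "finsum (Hom C X Y) f (insert i I) = f i \<oplus>\<^bsub>Hom C X Y\<^esub> finsum (Hom C X Y) f I"
      using insert.hyps by (intro H.finsum_insert) auto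
    then show ?case using Rep_add[OF insert.prems[of i] insert.IH] insert by simp
  qed (use Rep_zero[OF ob] in \<open>simp_all add: H.finsum_infinite\<close>)
qed

text \<open>Rank 0 in one good degree forces rank 0 in all of them, so wherever a morphism to or
  from \<open>X\<close> is represented its matrix is empty. Conversely, an identity matrix that is
  zero has size 0.\<close>

lemma zero_object_iff:
  assumes X: "X \<in> Ob C" and g: "good X d"
  shows "is_zero_object C X \<longleftrightarrow> rk X d = 0"
proof
  assume "is_zero_object C X"
  then have "Ident C X = \<zero>\<^bsub>Hom C X X\<^esub>" using X id_mor zero_mor unfolding is_zero_object_def by blast
  then have e: "id_matrix (rk X d) = (\<lambda>v i. 0 :: 'k)" using Rep_fun[of X X d] Rep_id[OF X g] Rep_zero[OF X X g g] by metis
  show "rk X d = 0"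
    using fun_cong[OF fun_cong[OF e, of "\<lambda>i. 1"], of 0] by (auto simp: id_matrix_def split: if_splits)
next
  assume z: "rk X d = 0"
  have "f = g'" if Z: "Z \<in> Ob C" and fg: "f \<in> mor C X Z" "g' \<in> mor C X Z" for Z f g'
  proof -
    obtain e A B where R: "Rep X Z e f A" "Rep X Z e g' B" by (rule pick2[OF X Z fg(1) X Z fg(2)])
    have "rk X e = 0" using rk_zero_iff[OF X g, of e] Rep_ob[OF R(1)] z by simp
    then have l: "A \<in> lin 0 (rk Z e)" "B \<in> lin 0 (rk Z e)" using Rep_lin R by metis+
    have z: "D v = (\<lambda>i. 0)" if D: "D \<in> lin 0 (rk Z e)" for D v
      using lin_cong[OF D, of v "\<lambda>i. 0 * v i"] lin_scale[OF D, of 0 v] by simp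
    have "A v = B v" for v using z[OF l(1), of v] z[OF l(2), of v] by simp
    then have "A = B" by (rule ext)
    then show ?thesis using R Rep_inj by blast
  qed
  moreover have "f = g'" if Z: "Z \<in> Ob C" and fg: "f \<in> mor C Z X" "g' \<in> mor C Z X" for Z f g'
  proof -
    obtain e A B where R: "Rep Z X e f A" "Rep Z X e g' B" by (rule pick2[OF Z X fg(1) Z X fg(2)])
    have "rk X e = 0" using rk_zero_iff[OF X g, of e] Rep_ob[OF R(1)] z by simp
    then have l: "A \<in> lin (rk Z e) 0" "B \<in> lin (rk Z e) 0" using Rep_lin R by metis+
    have "A = B" using lin_out[OF l(1)] lin_out[OF l(2)] by (intro ext) simp
    then show ?thesis using R Rep_inj by blast
  qed
  ultimately show "is_zero_object C X" unfolding is_zero_object_def using X zero_mor by blast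
qed

section \<open>Direct sums, indecomposable and simple objects\<close>

definition biprod where
  "biprod X Y Z i p j q \<longleftrightarrow> X \<in> Ob C \<and> Y \<in> Ob C \<and> Z \<in> Ob C \<and>
     i \<in> mor C Y X \<and> p \<in> mor C X Y \<and> j \<in> mor C Z X \<and> q \<in> mor C X Z \<and>
     Comp C Y X Y p i = Ident C Y \<and> Comp C Z X Z q j = Ident C Z \<and>
     Comp C Z X Y p j = \<zero>\<^bsub>Hom C Z Y\<^esub> \<and> Comp C Y X Z q i = \<zero>\<^bsub>Hom C Y Z\<^esub> \<and>
     Comp C X Y X i p \<oplus>\<^bsub>Hom C X X\<^esub> Comp C X Z X j q = Ident C X"

lemma ex_biprod:
  assumes X: "X \<in> Ob C" "good X d" and Y: "Y \<in> Ob C" "good Y d" and Z: "Z \<in> Ob C" "good Z d"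
    and rk: "rk X d = rk Y d + rk Z d"
  shows "\<exists>i p j q. biprod X Y Z i p j q"
proof -
  let ?m = "rk Y d" and ?n = "rk Z d"
  \<comment> \<open>Inclusion and projection of the last block of coordinates; the first block is
    handled by \<open>id_matrix ?m\<close> in both directions.\<close>
  let ?J = "\<lambda>v l. if ?m \<le> l \<and> l < ?m + ?n then v (l - ?m) else 0 :: 'k"
  let ?Q = "\<lambda>v l. if l < ?n then v (?m + l) else 0 :: 'k"
  have I: "id_matrix ?m \<in> lin ?m (rk X d)" and P: "id_matrix ?m \<in> lin (rk X d) ?m"
    and J: "?J \<in> lin ?n (rk X d)" and Q: "?Q \<in> lin (rk X d) ?n"
    by (auto simp: lin_def id_matrix_def fun_eq_iff rk)
  obtain i where i: "Rep Y X d i (id_matrix ?m)" using Rep_surj[OF Y(1) X(1) Y(2) X(2) I] by blast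
  obtain p where p: "Rep X Y d p (id_matrix ?m)" using Rep_surj[OF X(1) Y(1) X(2) Y(2) P] by blast
  obtain j where j: "Rep Z X d j ?J" using Rep_surj[OF Z(1) X(1) Z(2) X(2) J] by blast
  obtain q where q: "Rep X Z d q ?Q" using Rep_surj[OF X(1) Z(1) X(2) Z(2) Q] by blast
  have "Comp C Y X Y p i = Ident C Y"
    by (rule Rep_eqI[OF Rep_comp[OF i p] Rep_id[OF Y]]) (auto simp: id_matrix_def fun_eq_iff)
  moreover have "Comp C Z X Z q j = Ident C Z"
    by (rule Rep_eqI[OF Rep_comp[OF j q] Rep_id[OF Z]]) (auto simp: id_matrix_def fun_eq_iff)
  moreover have "Comp C Z X Y p j = \<zero>\<^bsub>Hom C Z Y\<^esub>"
    by (rule Rep_eqI[OF Rep_comp[OF j p] Rep_zero[OF Z(1) Y(1) Z(2) Y(2)]]) (auto simp: id_matrix_def fun_eq_iff)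
  moreover have "Comp C Y X Z q i = \<zero>\<^bsub>Hom C Y Z\<^esub>"
    by (rule Rep_eqI[OF Rep_comp[OF i q] Rep_zero[OF Y(1) Z(1) Y(2) Z(2)]]) (auto simp: id_matrix_def fun_eq_iff)
  moreover have "Comp C X Y X i p \<oplus>\<^bsub>Hom C X X\<^esub> Comp C X Z X j q = Ident C X"
    by (rule Rep_eqI[OF Rep_add[OF Rep_comp[OF p i] Rep_comp[OF q j]] Rep_id[OF X]]) (auto simp: id_matrix_def fun_eq_iff rk)
  ultimately show ?thesis unfolding biprod_def using X Y Z Rep_mor[OF i] Rep_mor[OF p] Rep_mor[OF j] Rep_mor[OF q] by blast
qed

lemma biprod_direct_sum:
  assumes b: "biprod X Y Z i p j q"
  shows "is_direct_sum C [Y, Z] X"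
proof -
  have ob: "X \<in> Ob C" "Y \<in> Ob C" "Z \<in> Ob C" and m: "i \<in> mor C Y X" "p \<in> mor C X Y" "j \<in> mor C Z X" "q \<in> mor C X Z"
    using b by (auto simp: biprod_def)
  interpret H: abelian_group "Hom C X X" by (rule add_Hom[OF ob(1) ob(1)])
  let ?i = "\<lambda>k. if k = 0 then i else j" and ?p = "\<lambda>k. if k = 0 then p else q"
  have c: "Comp C X Y X i p \<in> carrier (Hom C X X)" "Comp C X Z X j q \<in> carrier (Hom C X X)"
    using comp_mor ob m unfolding mor_def by auto
  have "{..<length [Y, Z]} = insert 0 (insert 1 {})" by auto
  then have "finsum (Hom C X X) (\<lambda>k. Comp C X ([Y, Z] ! k) X (?i k) (?p k)) {..<length [Y, Z]} =
      finsum (Hom C X X) (\<lambda>k. Comp C X ([Y, Z] ! k) X (?i k) (?p k)) (insert 0 (insert 1 {}))" by (rule arg_cong)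
  also have "\<dots> = Ident C X" using c b by (simp add: H.finsum_insert Pi_def biprod_def)
  finally have s: "finsum (Hom C X X) (\<lambda>k. Comp C X ([Y, Z] ! k) X (?i k) (?p k)) {..<length [Y, Z]} = Ident C X" .
  show ?thesis
    unfolding is_direct_sum_def
  proof (intro conjI, goal_cases)
    case 3
    show ?case
      by (rule exI[of _ ?i], rule exI[of _ ?p]) (use b s in \<open>auto simp: biprod_def less_Suc_eq\<close>)
  qed (use ob in auto)
qed

lemma ex_biprod_rank:
  assumes "X \<in> Ob C" "good X d" "rk X d = m + n"
  shows "\<exists>Y Z i p j q. biprod X Y Z i p j q \<and> good Y d \<and> good Z d \<and> rk Y d = m \<and> rk Z d = n"
proof -
  obtain Y where Y: "Y \<in> Ob C" "good Y d" "rk Y d = m" using ex_rank by blast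
  obtain Z where Z: "Z \<in> Ob C" "good Z d" "rk Z d = n" using ex_rank by blast
  show ?thesis using ex_biprod[OF assms(1,2) Y(1,2) Z(1,2)] assms(3) Y Z by metis
qed

lemma nonzero_split:
  assumes X: "X \<in> Ob C" and nz: "\<not> is_zero_object C X"
  shows "\<exists>Y Z i p j q. biprod X Y Z i p j q \<and> \<not> is_zero_object C Y \<and> \<not> is_zero_object C Z"
proof -
  obtain d where d: "good X d" using good_ex[OF X] by blast
  have "rk X d > 0" using zero_object_iff[OF X d] nz by simp
  \<comment> \<open>One degree higher the rank is at least 2 and can be written as 1 plus a positive
    number.\<close>
  then have "r * rk X d \<ge> 2 * 1" using r2 by (intro mult_le_mono) auto
  then have 2: "rk X (Suc d) = 1 + (rk X (Suc d) - 1)" "rk X (Suc d) - 1 > 0" using rk_Suc[OF X d] by auto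
  obtain Y Z i p j q where "biprod X Y Z i p j q" "good Y (Suc d)" "good Z (Suc d)" "rk Y (Suc d) = 1" "rk Z (Suc d) = rk X (Suc d) - 1"
    using ex_biprod_rank[OF X good_Suc[OF X d] 2(1)] by blast
  then show ?thesis using zero_object_iff[of Y "Suc d"] zero_object_iff[of Z "Suc d"] 2(2)
    unfolding biprod_def by (metis neq0_conv zero_neq_one)
qed

lemma no_indecomposable: "\<not> indecomposable C X"
  using nonzero_split biprod_direct_sum unfolding indecomposable_def by blast

lemma split_monic:
  assumes "X \<in> Ob C" "Y \<in> Ob C" "i \<in> mor C Y X" "p \<in> mor C X Y" "Comp C Y X Y p i = Ident C Y"
  shows "is_monic C Y X i"
  unfolding is_monic_def
proof (intro conjI ballI impI assms(3))
  fix T u v assume T: "T \<in> Ob C" "u \<in> mor C T Y" "v \<in> mor C T Y" "Comp C T Y X i u = Comp C T Y X i v"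
  have "Comp C T X Y p (Comp C T Y X i w) = w" if "w \<in> mor C T Y" for w
    using comp_assoc[of T Y X Y w i p] assms T(1) that comp_id_left[of T Y w] by simp
  then show "u = v" using T by metis
qed

lemma zero_objectI: "X \<in> Ob C \<Longrightarrow> Ident C X = \<zero>\<^bsub>Hom C X X\<^esub> \<Longrightarrow> is_zero_object C X"
proof -
  assume X: "X \<in> Ob C" and e: "Ident C X = \<zero>\<^bsub>Hom C X X\<^esub>"
  obtain d where d: "good X d" using good_ex[OF X] by blast
  have e: "id_matrix (rk X d) = (\<lambda>v i. 0 :: 'k)" using Rep_fun[of X X d] Rep_id[OF X d] Rep_zero[OF X X d d] e by metis
  have "rk X d = 0"
    using fun_cong[OF fun_cong[OF e, of "\<lambda>i. 1"], of 0] by (auto simp: id_matrix_def split: if_splits)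
  then show ?thesis using zero_object_iff[OF X d] by simp
qed

text \<open>The inclusion \<open>i\<close> of a non-zero summand would have to be invertible. As
  \<open>q\<close> vanishes on it, \<open>q\<close> would be zero, and with it the complementary
  summand.\<close>

lemma no_simple: "\<not> simple_object C X"
proof
  assume s: "simple_object C X"
  then have X: "X \<in> Ob C" by (simp add: simple_object_def)
  obtain Y Z i p j q where b: "biprod X Y Z i p j q" and nz: "\<not> is_zero_object C Y" "\<not> is_zero_object C Z"
    using nonzero_split[OF X] s unfolding simple_object_def by blast
  have ob: "Y \<in> Ob C" "Z \<in> Ob C" and m: "i \<in> mor C Y X" "p \<in> mor C X Y" "j \<in> mor C Z X" "q \<in> mor C X Z"
    using b by (auto simp: biprod_def)
  have "is_monic C Y X i" by (rule split_monic[OF X ob(1) m(1,2)]) (use b in \<open>simp add: biprod_def\<close>)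
  then obtain g where g: "g \<in> mor C X Y" "Comp C X Y X i g = Ident C X"
    using s nz(1) ob unfolding simple_object_def is_isomorphism_def by blast
  have "q = Comp C X X Z q (Comp C X Y X i g)" using comp_id_right[OF X ob(2) m(4)] g by simp
  also have "\<dots> = Comp C X Y Z (Comp C Y X Z q i) g" using comp_assoc[OF X ob(1) X ob(2) g(1) m(1,4)] by simp
  also have "\<dots> = \<zero>\<^bsub>Hom C X Z\<^esub>" using b comp_zero_left[OF X ob g(1)] by (simp add: biprod_def)
  finally have "q = \<zero>\<^bsub>Hom C X Z\<^esub>" .
  then have "Ident C Z = \<zero>\<^bsub>Hom C Z Z\<^esub>" using b comp_zero_left[OF ob(2) X ob(2) m(3)] by (simp add: biprod_def)
  then show False using zero_objectI[OF ob(2)] nz(2) by blast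
qed

section \<open>Splitting of short exact sequences\<close>

lemma mor_regular:
  assumes "X \<in> Ob C" "Y \<in> Ob C" "f \<in> mor C X Y"
  shows "\<exists>h\<in>mor C Y X. Comp C X Y Y (Comp C Y X Y f h) f = f"
proof -
  obtain d A where R: "Rep X Y d f A" by (rule pick1[OF assms])
  obtain B where B: "B \<in> lin (rk Y d) (rk X d)" "\<forall>v. A (B (A v)) = A v" using lin_regular[OF Rep_lin[OF R]] by blast
  obtain h where h: "Rep Y X d h B" using Rep_surj[of Y X d B] Rep_ob[OF R] B(1) by blast
  have "Comp C X Y Y (Comp C Y X Y f h) f = f"
    by (rule Rep_eqI[OF Rep_comp[OF R Rep_comp[OF h R]] R]) (use B(2) in auto)
  then show ?thesis using Rep_mor[OF h] by blast
qed

text \<open>Regularity gives \<open>h\<close> with \<open>f h f = f\<close>. Cancelling the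
  monomorphism \<open>f\<close> yields \<open>h f = 1\<close>. The morphism \<open>1 - f h\<close>
  kills \<open>f\<close>, hence equals \<open>sc g\<close> for some \<open>sc\<close>, and
  cancelling the epimorphism \<open>g\<close> yields \<open>g sc = 1\<close>.\<close>

lemma ses_splits:
  assumes s: "short_exact C X Y Z f g"
  shows "splits C X Y Z f g"
proof -
  have ob: "X \<in> Ob C" "Y \<in> Ob C" "Z \<in> Ob C" and k: "is_kernel C X Y Z f g" and ck: "is_cokernel C X Y Z f g"
    using s by (auto simp: short_exact_def)
  have f: "f \<in> mor C X Y" and g: "g \<in> mor C Y Z" and gf: "Comp C X Y Z g f = \<zero>\<^bsub>Hom C X Z\<^esub>"
    using k by (auto simp: is_kernel_def)
  \<comment> \<open>Both \<open>u\<close> and \<open>v\<close> factor the same morphism, which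
    \<open>g\<close> kills, through the kernel \<open>f\<close>; the factorisation is unique. The
    statement \<open>epi\<close> is dual.\<close>
  have mono: "u = v" if "T \<in> Ob C" "u \<in> mor C T X" "v \<in> mor C T X" "Comp C T X Y f u = Comp C T X Y f v" for T u v
  proof -
    have "Comp C T Y Z g (Comp C T X Y f u) = \<zero>\<^bsub>Hom C T Z\<^esub>"
      using comp_assoc[OF that(1) ob that(2) f g] gf comp_zero_left[OF that(1) ob(1,3) that(2)] by simp
    then show ?thesis using k that comp_mor[OF that(1) ob(1,2) that(2) f] unfolding is_kernel_def by metis
  qed
  have epi: "u = v" if "T \<in> Ob C" "u \<in> mor C Z T" "v \<in> mor C Z T" "Comp C Y Z T u g = Comp C Y Z T v g" for T u v
  proof -
    have "Comp C X Y T (Comp C Y Z T u g) f = \<zero>\<^bsub>Hom C X T\<^esub>"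
      using comp_assoc[OF ob that(1) f g that(2)] gf comp_zero_right[OF ob(1,3) that(1,2)] by simp
    then show ?thesis using ck that comp_mor[OF ob(2,3) that(1) g that(2)] unfolding is_cokernel_def by metis
  qed
  interpret H: abelian_group "Hom C Y Y" by (rule add_Hom[OF ob(2) ob(2)])
  obtain h where h: "h \<in> mor C Y X" "Comp C X Y Y (Comp C Y X Y f h) f = f" using mor_regular[OF ob(1,2) f] by blast
  have hf: "Comp C X Y X h f = Ident C X"
  proof (rule mono[OF ob(1) comp_mor[OF ob(1,2,1) f h(1)] id_mor[OF ob(1)]])
    show "Comp C X X Y f (Comp C X Y X h f) = Comp C X X Y f (Ident C X)"
      using comp_assoc[OF ob(1,2,1,2) f h(1) f] h(2) comp_id_right[OF ob(1,2) f] by simp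
  qed
  let ?fh = "Comp C Y X Y f h"
  have fhm: "?fh \<in> mor C Y Y" by (rule comp_mor[OF ob(2,1,2) h(1) f])
  let ?e = "Ident C Y \<ominus>\<^bsub>Hom C Y Y\<^esub> ?fh"
  have em: "?e \<in> mor C Y Y" using H.minus_closed id_mor[OF ob(2)] fhm by (simp add: mor_def)
  have sum: "?fh \<oplus>\<^bsub>Hom C Y Y\<^esub> ?e = Ident C Y"
    using id_mor[OF ob(2)] fhm unfolding mor_def a_minus_def
    by (metis H.a_comm H.a_inv_closed H.a_assoc H.l_neg H.r_zero H.add.m_closed)
  interpret H': abelian_group "Hom C X Y" by (rule add_Hom[OF ob(1,2)])
  have ef: "Comp C X Y Y ?e f = \<zero>\<^bsub>Hom C X Y\<^esub>"
  proof -
    have "f = Comp C X Y Y (?fh \<oplus>\<^bsub>Hom C Y Y\<^esub> ?e) f" using sum comp_id_left[OF ob(1,2) f] by simp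
    also have "\<dots> = f \<oplus>\<^bsub>Hom C X Y\<^esub> Comp C X Y Y ?e f"
      using comp_add_left[OF ob(1,2,2) f fhm em] h(2) by simp
    finally show ?thesis using f comp_mor[OF ob(1,2,2) f em] unfolding mor_def
      by (metis H'.add.l_cancel_one')
  qed
  then obtain sc where sc: "sc \<in> mor C Z Y" "Comp C Y Z Y sc g = ?e"
    using ck em ob(2) unfolding is_cokernel_def by blast
  have gfh: "Comp C Y Y Z g ?fh = \<zero>\<^bsub>Hom C Y Z\<^esub>"
    using comp_assoc[OF ob(2,1,2,3) h(1) f g] gf comp_zero_left[OF ob(2,1,3) h(1)] by simp
  interpret H'': abelian_group "Hom C Y Z" by (rule add_Hom[OF ob(2,3)])
  have ge: "Comp C Y Y Z g ?e = g"
  proof -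
    have "g = Comp C Y Y Z g (?fh \<oplus>\<^bsub>Hom C Y Y\<^esub> ?e)" using sum comp_id_right[OF ob(2,3) g] by simp
    also have "\<dots> = Comp C Y Y Z g ?fh \<oplus>\<^bsub>Hom C Y Z\<^esub> Comp C Y Y Z g ?e" by (rule comp_add_right[OF ob(2,2,3) g fhm em])
    also have "\<dots> = Comp C Y Y Z g ?e"
      using gfh comp_mor[OF ob(2,2,3) em g] by (simp add: mor_def)
    finally show ?thesis by simp
  qed
  have "Comp C Z Y Z g sc = Ident C Z"
  proof (rule epi[OF ob(3) comp_mor[OF ob(3,2,3) sc(1) g] id_mor[OF ob(3)]])
    show "Comp C Y Z Z (Comp C Z Y Z g sc) g = Comp C Y Z Z (Ident C Z) g"
      using comp_assoc[OF ob(2,3,2,3) g sc(1) g] sc(2) ge comp_id_left[OF ob(2,3) g] by simp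
  qed
  then show ?thesis unfolding splits_def using h(1) sc hf sum
    by (intro bexI[of _ h] bexI[of _ sc] conjI) simp_all
qed

end

section \<open>Complements and ascending chains of subobjects\<close>

lemma sum_fun_eq: "(\<Sum>i\<in>A. f i :: 'b \<Rightarrow> 'c::comm_monoid_add) = (\<lambda>k. \<Sum>i\<in>A. f i k)"
  by (induction A rule: infinite_finite_induct) (auto simp: plus_fun_def zero_fun_def)

text \<open>The columns of \<open>I\<close> are a basis of the image of \<open>E\<close>, and
  \<open>P\<close> is \<open>E\<close> followed by a left inverse of \<open>I\<close>.\<close>

lemma idempotent_split:
  fixes E :: "(nat \<Rightarrow> 'k::field) \<Rightarrow> nat \<Rightarrow> 'k"
  assumes E: "E \<in> lin N N" and idem: "\<And>v. E (E v) = E v"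
  shows "\<exists>n. \<exists>I\<in>lin n N. \<exists>P\<in>lin N n. (\<forall>v. I (P v) = E v) \<and> (\<forall>v. P (I v) = id_matrix n v)"
proof -
  obtain B where B: "B \<subseteq> range E" "cv.independent B" "range E \<subseteq> cv.span B"
    using cv.maximal_independent_subset[of "range E"] by blast
  have "B \<subseteq> cv.span (unit_vec ` {..<N})"
  proof
    fix b assume "b \<in> B"
    then obtain v where "b = E v" using B(1) by blast
    then have "b = id_matrix N b" using id_matrix_lin(1)[OF E] by simp
    then show "b \<in> cv.span (unit_vec ` {..<N})" using id_matrix_span[of N b] by simp
  qed
  then have fin: "finite B" using cv.independent_span_bound[OF _ B(2), of "unit_vec ` {..<N}"] by simp
  obtain bs where bs: "set bs = B" "distinct bs" using finite_distinct_list[OF fin] by blast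
  let ?n = "length bs"
  define I where "I v = (\<lambda>k. \<Sum>i<?n. v i * (bs ! i) k)" for v :: "nat \<Rightarrow> 'k"
  have out: "(bs ! i) k = 0" if "i < ?n" "k \<ge> N" for i k
  proof -
    have "bs ! i \<in> range E" using B(1) bs(1) nth_mem[OF that(1)] by blast
    then show ?thesis using lin_out[OF E that(2)] by auto
  qed
  have I: "I \<in> lin ?n N"
    by (rule linI) (auto simp: I_def fun_eq_iff distrib_right sum.distrib sum_distrib_left mult.assoc out)
  have Ifun: "I v = (\<Sum>i<?n. (\<lambda>k. v i * (bs ! i) k))" for v
    unfolding I_def sum_fun_eq ..
  have bij: "bij_betw ((!) bs) {..<?n} B" using bs bij_betw_nth by blast
  have Isum: "I v = (\<Sum>b\<in>B. (\<lambda>k. v (the_inv_into {..<?n} ((!) bs) b) * b k))" for v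
    unfolding Ifun sum.reindex_bij_betw[OF bij, symmetric]
    by (rule sum.cong) (use bij in \<open>auto simp: bij_betw_def the_inv_into_f_f\<close>)
  have Iinj: "v i = 0" if z: "I v = (\<lambda>k. 0)" and i: "i < ?n" for v i
  proof -
    have s0: "(\<Sum>b\<in>B. (\<lambda>k. v (the_inv_into {..<?n} ((!) bs) b) * b k)) = 0"
      using z unfolding Isum by (simp add: zero_fun_def)
    have "bs ! i \<in> B" using nth_mem[OF i] bs(1) by simp
    then have "v (the_inv_into {..<?n} ((!) bs) (bs ! i)) = 0"
      by (rule cv.independentD[OF B(2) fin order_refl s0])
    then show ?thesis using bij i by (simp add: bij_betw_def the_inv_into_f_f)
  qed
  have rng: "\<exists>w. E v = I w" for v
  proof -
    have "E v \<in> cv.span B" using B(3) by blast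
    then obtain c where "E v = (\<Sum>b\<in>B. (\<lambda>k. c b * b k))" unfolding cv.span_finite[OF fin] by auto
    also have "\<dots> = (\<Sum>i<?n. (\<lambda>k. c (bs ! i) * (bs ! i) k))" by (rule sum.reindex_bij_betw[OF bij, symmetric])
    also have "\<dots> = I (\<lambda>i. c (bs ! i))" by (rule Ifun[symmetric])
    finally show ?thesis by blast
  qed
  have EI: "E (I v) = I v" for v
  proof -
    have "cv.subspace {w. E w = w}"
      unfolding cv.subspace_def using lin_add[OF E] lin_scale[OF E] lin_scale[OF E, of 0 "\<lambda>i. 0"]
      by (auto simp: plus_fun_def zero_fun_def)
    moreover have "B \<subseteq> {w. E w = w}" using B(1) idem by auto
    ultimately have "cv.span B \<subseteq> {w. E w = w}" by (intro cv.span_minimal)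
    moreover have "I v \<in> cv.span B" unfolding Isum by (intro cv.span_sum cv.span_scale cv.span_base)
    ultimately show ?thesis by blast
  qed
  \<comment> \<open>A regular inverse of \<open>I\<close> is a left inverse because \<open>I\<close>
    is injective on its coordinates.\<close>
  obtain G where G: "G \<in> lin N ?n" "\<And>v. I (G (I v)) = I v" using lin_regular[OF I] by blast
  have GI: "G (I v) = id_matrix ?n v" for v
  proof -
    have "I (\<lambda>i. G (I v) i + (-1) * v i) = (\<lambda>k. 0)"
      unfolding lin_add[OF I] lin_scale[OF I] G(2) by simp
    then have "G (I v) i + (-1) * v i = 0" if "i < ?n" for i using that by (rule Iinj)
    then show ?thesis using lin_out[OF G(1)] by (auto simp: id_matrix_def fun_eq_iff)
  qed
  have "I (G (E v)) = E v" for v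
  proof -
    obtain w where "E v = I w" using rng by blast
    then show ?thesis using G(2)[of w] by simp
  qed
  moreover have "G (E (I v)) = id_matrix ?n v" for v unfolding EI by (rule GI)
  ultimately show ?thesis
    by (intro exI[of _ ?n] bexI[of _ I] bexI[of _ "\<lambda>v. G (E v)"] conjI allI I lin_comp[OF E G(1)])
qed

context germ_cat
begin

text \<open>From \<open>q j = 1\<close> it follows that \<open>1 - j q\<close> is idempotent. Its
  matrix is split in one degree, and \<open>ex_rank\<close> provides an object whose rank is that of
  the idempotent.\<close>

lemma complement:
  assumes ob: "X \<in> Ob C" "Z \<in> Ob C" and m: "q \<in> mor C X Z" "j \<in> mor C Z X" and qj: "Comp C Z X Z q j = Ident C Z"
  shows "\<exists>Y i p. biprod X Y Z i p j q"
proof -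
  obtain d Q J where R: "Rep X Z d q Q" "Rep Z X d j J" by (rule pick2[OF ob m(1) ob(2,1) m(2)])
  let ?N = "rk X d" and ?m = "rk Z d"
  have g: "good X d" "good Z d" using Rep_ob[OF R(1)] by auto
  have QJ: "Q (J v) = id_matrix ?m v" for v
    using Rep_fun[OF Rep_comp[OF R(2,1), unfolded qj] Rep_id[OF ob(2) g(2)]] by metis
  note Q = Rep_lin[OF R(1)] and J = Rep_lin[OF R(2)]
  define E where "E v = (\<lambda>k. id_matrix ?N v k + (-1) * J (Q v) k)" for v
  have E: "E \<in> lin ?N ?N"
    unfolding E_def by (rule lin_plus[OF lin_idl lin_times[OF lin_comp[OF Q J]]])
  have QE: "Q (E v) = (\<lambda>k. 0)" for v
    unfolding E_def lin_add[OF Q] lin_scale[OF Q] QJ id_matrix_lin(2)[OF Q] id_matrix_lin(1)[OF Q] by simp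
  have z: "A (\<lambda>k. 0) = (\<lambda>k. 0)" if "A \<in> lin a b" for A :: "(nat \<Rightarrow> 'k) \<Rightarrow> nat \<Rightarrow> 'k" and a b
    using lin_scale[OF that, of 0 "\<lambda>k. 0"] by simp
  have "E (E v) = E v" for v
  proof -
    have "E (E v) = (\<lambda>k. id_matrix ?N (E v) k + (-1) * J (Q (E v)) k)" by (simp add: E_def)
    also have "\<dots> = E v" unfolding QE z[OF J] id_matrix_lin(1)[OF E] by simp
    finally show ?thesis .
  qed
  then obtain n I P where IP: "I \<in> lin n ?N" "P \<in> lin ?N n" "\<And>v. I (P v) = E v" "\<And>v. P (I v) = id_matrix n v"
    using idempotent_split[OF E] by blast
  obtain Y where Y: "Y \<in> Ob C" "good Y d" "rk Y d = n" using ex_rank by blast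
  obtain i where i: "Rep Y X d i I" using Rep_surj[OF Y(1) ob(1) Y(2) g(1)] IP(1) Y(3) by blast
  obtain p where p: "Rep X Y d p P" using Rep_surj[OF ob(1) Y(1) g(1) Y(2)] IP(2) Y(3) by blast
  have PE: "P (E v) = P v" for v using IP(3)[of v] IP(4)[of "P v"] id_matrix_lin(1)[OF IP(2)] by simp
  have EI: "E (I v) = I v" for v using IP(3)[of "I v"] IP(4)[of v] id_matrix_lin(2)[OF IP(1)] by simp
  have EJ: "E (J v) = (\<lambda>k. 0)" for v
    unfolding E_def QJ id_matrix_lin(1)[OF J] id_matrix_lin(2)[OF J] by simp
  have "Comp C Y X Y p i = Ident C Y"
    by (rule Rep_eqI[OF Rep_comp[OF i p] Rep_id[OF Y(1,2)]]) (simp add: IP(4) Y(3) fun_eq_iff)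
  moreover have "Comp C Z X Y p j = \<zero>\<^bsub>Hom C Z Y\<^esub>"
  proof (rule Rep_eqI[OF Rep_comp[OF R(2) p] Rep_zero[OF ob(2) Y(1) g(2) Y(2)]])
    show "(\<lambda>v. P (J v)) = (\<lambda>v i. 0)" using PE[of "J _"] EJ z[OF IP(2)] by simp
  qed
  moreover have "Comp C Y X Z q i = \<zero>\<^bsub>Hom C Y Z\<^esub>"
  proof (rule Rep_eqI[OF Rep_comp[OF i R(1)] Rep_zero[OF Y(1) ob(2) Y(2) g(2)]])
    show "(\<lambda>v. Q (I v)) = (\<lambda>v i. 0)" using QE[of "I _"] EI by simp
  qed
  moreover have "Comp C X Y X i p \<oplus>\<^bsub>Hom C X X\<^esub> Comp C X Z X j q = Ident C X"
    by (rule Rep_eqI[OF Rep_add[OF Rep_comp[OF p i] Rep_comp[OF R]] Rep_id[OF ob(1) g(1)]])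
      (simp add: IP(3) E_def fun_eq_iff)
  ultimately show ?thesis
    unfolding biprod_def using ob Y m qj Rep_mor[OF i] Rep_mor[OF p] by blast
qed

text \<open>The complement \<open>Z\<close> is split into non-zero \<open>A\<close> and
  \<open>B\<close>, and the new subobject \<open>Y'\<close> is a complement of \<open>B\<close>. It
  contains \<open>Y\<close>, on which the projection to \<open>B\<close> vanishes, and it contains
  \<open>A\<close>. It is not contained in \<open>Y\<close>, since \<open>q\<close> kills
  \<open>Y\<close> but not \<open>A\<close>.\<close>

lemma subobject_step:
  assumes b: "biprod X Y Z f p j q" and nz: "\<not> is_zero_object C Z"
  shows "\<exists>Y' f' Z' p' j' q'. biprod X Y' Z' f' p' j' q' \<and> \<not> is_zero_object C Z' \<and>
    subobject_le C X (Y, f) (Y', f') \<and> \<not> subobject_le C X (Y', f') (Y, f)"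
proof -
  have ob: "X \<in> Ob C" "Y \<in> Ob C" "Z \<in> Ob C"
    and m: "f \<in> mor C Y X" "p \<in> mor C X Y" "j \<in> mor C Z X" "q \<in> mor C X Z"
    and qj: "Comp C Z X Z q j = Ident C Z" and qf: "Comp C Y X Z q f = \<zero>\<^bsub>Hom C Y Z\<^esub>"
    using b by (auto simp: biprod_def)
  obtain A B a a' c c' where c: "biprod Z A B a a' c c'" and nzA: "\<not> is_zero_object C A" and nzB: "\<not> is_zero_object C B"
    using nonzero_split[OF ob(3) nz] by blast
  have ob': "A \<in> Ob C" "B \<in> Ob C"
    and m': "a \<in> mor C A Z" "a' \<in> mor C Z A" "c \<in> mor C B Z" "c' \<in> mor C Z B"
    and c'c: "Comp C B Z B c' c = Ident C B" and c'a: "Comp C A Z B c' a = \<zero>\<^bsub>Hom C A B\<^esub>"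
    and a'a: "Comp C A Z A a' a = Ident C A"
    using c by (auto simp: biprod_def)
  let ?q = "Comp C X Z B c' q" and ?j = "Comp C B Z X j c"
  have q': "?q \<in> mor C X B" and j': "?j \<in> mor C B X" using comp_mor ob ob' m m' by auto
  have "Comp C B X B ?q ?j = Comp C B Z B c' (Comp C B X Z q ?j)"
    by (rule comp_assoc[OF ob'(2) ob(1,3) ob'(2) j' m(4) m'(4)])
  also have "Comp C B X Z q ?j = c"
    using comp_assoc[OF ob'(2) ob(3,1,3) m'(3) m(3,4)] qj comp_id_left[OF ob'(2) ob(3) m'(3)] by simp
  finally have "Comp C B X B ?q ?j = Ident C B" using c'c by simp
  then obtain Y' f' p' where b': "biprod X Y' B f' p' ?j ?q" using complement[OF ob(1) ob'(2) q' j'] by blast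
  have Y': "Y' \<in> Ob C" and mf': "f' \<in> mor C Y' X" "p' \<in> mor C X Y'"
    and sum: "Comp C X Y' X f' p' \<oplus>\<^bsub>Hom C X X\<^esub> Comp C X B X ?j ?q = Ident C X"
    using b' by (auto simp: biprod_def)
  have fp: "Comp C X Y' X f' p' \<in> mor C X X" "Comp C X B X ?j ?q \<in> mor C X X"
    using comp_mor ob ob' Y' mf' q' j' by auto
  \<comment> \<open>Whatever the projection to \<open>B\<close> kills factors through
    \<open>f'\<close>; this is applied to \<open>f\<close> for the inclusion and to \<open>A\<close>
    for its strictness.\<close>
  have fac: "u = Comp C T Y' X f' (Comp C T X Y' p' u)"
    if T: "T \<in> Ob C" "u \<in> mor C T X" and z: "Comp C T X B ?q u = \<zero>\<^bsub>Hom C T B\<^esub>" for T u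
  proof -
    interpret H: abelian_group "Hom C T X" by (rule add_Hom[OF T(1) ob(1)])
    have "u = Comp C T X X (Comp C X Y' X f' p' \<oplus>\<^bsub>Hom C X X\<^esub> Comp C X B X ?j ?q) u"
      using sum comp_id_left[OF T(1) ob(1) T(2)] by simp
    also have "\<dots> = Comp C T X X (Comp C X Y' X f' p') u \<oplus>\<^bsub>Hom C T X\<^esub> Comp C T X X (Comp C X B X ?j ?q) u"
      by (rule comp_add_left[OF T(1) ob(1,1) T(2) fp])
    also have "Comp C T X X (Comp C X B X ?j ?q) u = \<zero>\<^bsub>Hom C T X\<^esub>"
      using comp_assoc[OF T(1) ob(1) ob'(2) ob(1) T(2) q' j'] z comp_zero_right[OF T(1) ob'(2) ob(1) j'] by simp
    also have "Comp C T X X (Comp C X Y' X f' p') u = Comp C T Y' X f' (Comp C T X Y' p' u)"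
      by (rule comp_assoc[OF T(1) ob(1) Y' ob(1) T(2) mf'(2,1)])
    finally show ?thesis
      using comp_mor[OF T(1) Y' ob(1) comp_mor[OF T(1) ob(1) Y' T(2) mf'(2)] mf'(1)] by (simp add: mor_def)
  qed
  have "Comp C Y X B ?q f = \<zero>\<^bsub>Hom C Y B\<^esub>"
    using comp_assoc[OF ob(2,1,3) ob'(2) m(1,4) m'(4)] qf comp_zero_right[OF ob(2,3) ob'(2) m'(4)] by simp
  then have "Comp C Y Y' X f' (Comp C Y X Y' p' f) = f" using fac[OF ob(2) m(1)] by simp
  then have le: "subobject_le C X (Y, f) (Y', f')"
    using comp_mor[OF ob(2,1) Y' m(1) mf'(2)] unfolding subobject_le_def by auto
  have "\<not> subobject_le C X (Y', f') (Y, f)"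
  proof
    assume "subobject_le C X (Y', f') (Y, f)"
    then obtain k where k: "k \<in> mor C Y' Y" "Comp C Y' Y X f k = f'" unfolding subobject_le_def by auto
    let ?u = "Comp C A Z X j a"
    have u: "?u \<in> mor C A X" using comp_mor ob ob' m m' by auto
    have qu: "Comp C A X Z q ?u = a"
      using comp_assoc[OF ob'(1) ob(3,1,3) m'(1) m(3,4)] qj comp_id_left[OF ob'(1) ob(3) m'(1)] by simp
    have "Comp C A X B ?q ?u = \<zero>\<^bsub>Hom C A B\<^esub>"
      using comp_assoc[OF ob'(1) ob(1,3) ob'(2) u m(4) m'(4)] qu c'a by simp
    then have uf: "?u = Comp C A Y' X f' (Comp C A X Y' p' ?u)" by (rule fac[OF ob'(1) u])
    let ?w = "Comp C A X Y' p' ?u"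
    have w: "?w \<in> mor C A Y'" using comp_mor[OF ob'(1) ob(1) Y' u mf'(2)] .
    have "Comp C Y' X Z q f' = \<zero>\<^bsub>Hom C Y' Z\<^esub>"
      using comp_assoc[OF Y' ob(2,1,3) k(1) m(1,4)] k(2) qf comp_zero_left[OF Y' ob(2,3) k(1)] by simp
    then have "Comp C A X Z q (Comp C A Y' X f' ?w) = \<zero>\<^bsub>Hom C A Z\<^esub>"
      using comp_assoc[OF ob'(1) Y' ob(1,3) w mf'(1) m(4)] comp_zero_left[OF ob'(1) Y' ob(3) w] by simp
    then have "a = \<zero>\<^bsub>Hom C A Z\<^esub>" using uf qu by simp
    then have "Ident C A = \<zero>\<^bsub>Hom C A A\<^esub>" using a'a comp_zero_right[OF ob'(1) ob(3) ob'(1) m'(2)] by simp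
    then show False using zero_objectI[OF ob'(1)] nzA by blast
  qed
  then show ?thesis using b' nzB le by blast
qed

lemma noetherian_zero:
  assumes n: "noetherian_object C X"
  shows "is_zero_object C X"
proof (rule ccontr)
  assume nz: "\<not> is_zero_object C X"
  have X: "X \<in> Ob C" using n by (simp add: noetherian_object_def)
  \<comment> \<open>The invariant of the chain: a summand whose complement is still non-zero, so
    that it can be enlarged again.\<close>
  let ?P = "\<lambda>U. \<exists>Z p j q. biprod X (fst U) Z (snd U) p j q \<and> \<not> is_zero_object C Z"
  obtain Y Z i p j q where "biprod X Y Z i p j q" "\<not> is_zero_object C Z" using nonzero_split[OF X nz] by blast
  then have base: "?P (Y, i)" by auto
  have "\<exists>U. \<forall>k. ?P (U k) \<and> (subobject_le C X (U k) (U (Suc k)) \<and> \<not> subobject_le C X (U (Suc k)) (U k))"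
  proof (rule dependent_nat_choice)
    show "\<exists>x. ?P x" using base by blast
    fix x :: "'o \<times> 'a" and k :: nat assume "?P x"
    then show "\<exists>y. ?P y \<and> (subobject_le C X x y \<and> \<not> subobject_le C X y x)"
      using subobject_step[of X "fst x" _ "snd x"] by (metis fst_conv snd_conv prod.collapse)
  qed
  then obtain U where U: "\<And>k. ?P (U k)" "\<And>k. subobject_le C X (U k) (U (Suc k))" "\<And>k. \<not> subobject_le C X (U (Suc k)) (U k)"
    by blast
  have "fst (U k) \<in> Ob C \<and> is_monic C (fst (U k)) X (snd (U k))" for k
  proof -
    obtain Z p j q where b: "biprod X (fst (U k)) Z (snd (U k)) p j q" using U(1)[of k] by blast
    then have "is_monic C (fst (U k)) X (snd (U k))"
      unfolding biprod_def by (intro split_monic[of X "fst (U k)" "snd (U k)" p]) auto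
    then show ?thesis using b by (simp add: biprod_def)
  qed
  then obtain N where "\<forall>k\<ge>N. subobject_le C X (U (Suc k)) (U k)"
    using n U(2) unfolding noetherian_object_def by blast
  then show False using U(3) by blast
qed

section \<open>Sums of twists and spaces of morphisms\<close>

lemma ex_L_sum:
  assumes X: "X \<in> Ob C"
  shows "\<exists>d n. is_direct_sum C (replicate n (L d)) X"
proof -
  obtain d where d: "good X d" using good_ex[OF X] by blast
  let ?n = "rk X d"
  \<comment> \<open>The \<open>l\<close>-th unit column and unit row. \<open>L d\<close> has rank 1
    in degree \<open>d\<close>, so its vectors have the single coordinate 0.\<close>
  let ?I = "\<lambda>l v k. if k = (l::nat) then v (0::nat) else 0 :: 'k"
  let ?P = "\<lambda>l v k. if k = (0::nat) then v (l::nat) else 0 :: 'k"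
  have "\<exists>f. Rep (L d) X d f (?I l)" if "l < ?n" for l
    by (rule Rep_surj[OF L_ob X L_good d]) (use that in \<open>auto simp: lin_def L_rk fun_eq_iff\<close>)
  then obtain i where i: "\<And>l. l < ?n \<Longrightarrow> Rep (L d) X d (i l) (?I l)" by metis
  have "\<exists>f. Rep X (L d) d f (?P l)" if "l < ?n" for l
    by (rule Rep_surj[OF X L_ob d L_good]) (use that in \<open>auto simp: lin_def L_rk fun_eq_iff\<close>)
  then obtain p where p: "\<And>l. l < ?n \<Longrightarrow> Rep X (L d) d (p l) (?P l)" by metis
  have nth: "replicate ?n (L d) ! l = L d" if "l < ?n" for l using that by simp
  have eq: "Comp C (L d) X (L d) (p l) (i k) = (if k = l then Ident C (L d) else \<zero>\<^bsub>Hom C (L d) (L d)\<^esub>)"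
    if "k < ?n" "l < ?n" for k l
  proof (cases "k = l")
    case True
    have "Comp C (L d) X (L d) (p l) (i k) = Ident C (L d)"
      by (rule Rep_eqI[OF Rep_comp[OF i[OF that(1)] p[OF that(2)]] Rep_id[OF L_ob L_good]])
        (auto simp: True id_matrix_def L_rk fun_eq_iff)
    then show ?thesis using True by simp
  next
    case False
    have "Comp C (L d) X (L d) (p l) (i k) = \<zero>\<^bsub>Hom C (L d) (L d)\<^esub>"
      by (rule Rep_eqI[OF Rep_comp[OF i[OF that(1)] p[OF that(2)]] Rep_zero[OF L_ob L_ob L_good L_good]])
        (use False in \<open>auto simp: fun_eq_iff\<close>)
    then show ?thesis using False by simp
  qed
  interpret H: abelian_group "Hom C X X" by (rule add_Hom[OF X X])
  have R: "Rep X X d (Comp C X (replicate ?n (L d) ! l) X (i l) (p l)) (\<lambda>v. ?I l (?P l v))" if "l \<in> {..<?n}" for l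
    using Rep_comp[OF p[of l] i[of l]] that by simp
  have fs: "finsum (Hom C X X) (\<lambda>l. Comp C X (replicate ?n (L d) ! l) X (i l) (p l)) {..<?n} = Ident C X"
    by (rule Rep_eqI[OF Rep_finsum[OF X X d d R] Rep_id[OF X d]]) (auto simp: id_matrix_def fun_eq_iff)
  have "is_direct_sum C (replicate ?n (L d)) X"
    unfolding is_direct_sum_def
  proof (intro conjI, goal_cases)
    case 3
    show ?case
      by (rule exI[of _ i], rule exI[of _ p]) (use fs Rep_mor[OF i] Rep_mor[OF p] eq in simp)
  qed (use X L_ob in auto)
  then show ?thesis by blast
qed

lemma isomorphic_refl: "X \<in> Ob C \<Longrightarrow> isomorphic C X X"
  unfolding isomorphic_def is_isomorphism_def using id_mor comp_id_left by blast

text \<open>A finite spanning set would have matrices in a common degree of any desired size, where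
  they would span all matrices of that degree; but ranks grow without bound while the spanning set
  stays the same.\<close>

lemma Hom_infinite:
  assumes ob: "X \<in> Ob C" "Y \<in> Ob C" and nz: "\<not> is_zero_object C X" "\<not> is_zero_object C Y"
  shows "\<not> finite_dimensional (Hom C X Y)"
proof
  assume "finite_dimensional (Hom C X Y)"
  then obtain B where B: "B \<subseteq> mor C X Y" "finite B"
    "\<And>f. f \<in> mor C X Y \<Longrightarrow> \<exists>c. f = (\<Oplus>\<^bsub>Hom C X Y\<^esub>b\<in>B. c b \<odot>\<^bsub>Hom C X Y\<^esub> b)"
    unfolding finite_dimensional_def mor_def by blast
  have "\<forall>\<^sub>F d in sequentially. \<forall>b\<in>B. \<exists>A. Rep X Y d b A"
    using B(1,2) Rep_ev[OF ob] by (intro eventually_ball_finite) auto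
  moreover obtain e where e: "good X e" using good_ex[OF ob(1)] by blast
  moreover have "\<forall>\<^sub>F d in sequentially. good X d \<and> good Y d" using good_ev ob by (intro eventually_conj)
  \<comment> \<open>With this \<open>d\<close>, the rank of \<open>X\<close> in degree
    \<open>d\<close> is at least \<open>2 ^ (d - e)\<close>, which exceeds \<open>d - e\<close> and
    hence \<open>card B\<close>.\<close>
  ultimately obtain d where d: "d \<ge> e + card B + 1" "\<And>b. b \<in> B \<Longrightarrow> \<exists>A. Rep X Y d b A" "good X d" "good Y d"
    using ev_pick[of "\<lambda>d. (\<forall>b\<in>B. \<exists>A. Rep X Y d b A) \<and> good X d \<and> good Y d" "e + card B + 1"]
    unfolding eventually_conj_iff by blast
  have "rk X e \<ge> 1" using zero_object_iff[OF ob(1) e] nz by simp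
  have "card B < d - e" using d(1) by simp
  also have "d - e < 2 ^ (d - e)" by simp
  also have "(2 :: nat) ^ (d - e) \<le> r ^ (d - e)" using r2 by (rule power_mono) simp
  also have "\<dots> \<le> r ^ (d - e) * rk X e" using \<open>rk X e \<ge> 1\<close> by simp
  also have "\<dots> = rk X d" using rk_le[OF ob(1) e, of d] d(1) by linarith
  finally have big: "card B < rk X d" .
  have "rk Y d \<ge> 1" using zero_object_iff[OF ob(2) d(4)] nz by simp
  obtain A where A: "\<And>b. b \<in> B \<Longrightarrow> Rep X Y d b (A b)" using d(2) by metis
  obtain M where M: "M \<in> lin (rk X d) (rk Y d)" "\<And>c. M \<noteq> (\<lambda>v i. \<Sum>b\<in>B. c b * A b v i)"
    using lin_not_spanned[OF B(2) big \<open>rk Y d \<ge> 1\<close>] by blast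
  obtain F where F: "Rep X Y d F M" using Rep_surj[OF ob d(3,4) M(1)] by blast
  obtain c where c: "F = (\<Oplus>\<^bsub>Hom C X Y\<^esub>b\<in>B. c b \<odot>\<^bsub>Hom C X Y\<^esub> b)" using B(3)[OF Rep_mor[OF F]] by blast
  have "Rep X Y d F (\<lambda>v i. \<Sum>b\<in>B. c b * A b v i)"
    unfolding c by (rule Rep_finsum[OF ob d(3,4)]) (rule Rep_smult[OF A])
  then show False using Rep_fun[OF F] M(2) by blast
qed

end

section \<open>The Grothendieck group\<close>

lemma int_localized_atI: "x = of_int a / of_nat m ^ j \<Longrightarrow> x \<in> carrier (int_localized_at m)"
  by (auto simp: int_localized_at_def)

lemma group_int_localized_at:
  assumes "m > 0" shows "group (int_localized_at m)"
proof (rule groupI)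
  let ?H = "int_localized_at m"
  have m: "(of_nat m :: rat) \<noteq> 0" using assms by simp
  fix x y assume "x \<in> carrier ?H" "y \<in> carrier ?H"
  then obtain a j b k where x: "x = of_int a / of_nat m ^ j" and y: "y = of_int b / of_nat m ^ k"
    by (auto simp: int_localized_at_def)
  have "x + y = of_int (a * int m ^ k + b * int m ^ j) / of_nat m ^ (j + k)"
    using m by (simp add: x y field_simps power_add)
  then have "x + y \<in> carrier ?H" by (rule int_localized_atI)
  then show "x \<otimes>\<^bsub>?H\<^esub> y \<in> carrier ?H" by (simp add: int_localized_at_def)
next
  let ?H = "int_localized_at m"
  fix x assume "x \<in> carrier ?H"
  then obtain a j where x: "x = of_int a / of_nat m ^ j" by (auto simp: int_localized_at_def)
  have "- x = of_int (- a) / of_nat m ^ j" by (simp add: x)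
  then have "- x \<in> carrier ?H" by (rule int_localized_atI)
  then show "\<exists>y\<in>carrier ?H. y \<otimes>\<^bsub>?H\<^esub> x = \<one>\<^bsub>?H\<^esub>" by (rule rev_bexI) (simp add: int_localized_at_def)
next
  have "(0 :: rat) = of_int 0 / of_nat m ^ 0" by simp
  then have "0 \<in> carrier (int_localized_at m)" by (rule int_localized_atI)
  then show "\<one>\<^bsub>int_localized_at m\<^esub> \<in> carrier (int_localized_at m)" by (simp add: int_localized_at_def)
qed (auto simp: int_localized_at_def)

context germ_cat
begin

lemma biprod_ses:
  assumes b: "biprod X Y Z i p j q"
  shows "short_exact C Y X Z i q"
proof -
  have ob: "X \<in> Ob C" "Y \<in> Ob C" "Z \<in> Ob C"
    and m: "i \<in> mor C Y X" "p \<in> mor C X Y" "j \<in> mor C Z X" "q \<in> mor C X Z"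
    and e: "Comp C Y X Y p i = Ident C Y" "Comp C Z X Z q j = Ident C Z" "Comp C Y X Z q i = \<zero>\<^bsub>Hom C Y Z\<^esub>"
      "Comp C X Y X i p \<oplus>\<^bsub>Hom C X X\<^esub> Comp C X Z X j q = Ident C X"
    using b by (auto simp: biprod_def)
  have c: "Comp C X Y X i p \<in> mor C X X" "Comp C X Z X j q \<in> mor C X X" using comp_mor ob m by auto
  have "is_kernel C Y X Z i q"
    unfolding is_kernel_def
  proof (intro conjI ballI impI m e)
    fix T u assume T: "T \<in> Ob C" "u \<in> mor C T X" "Comp C T X Z q u = \<zero>\<^bsub>Hom C T Z\<^esub>"
    interpret H: abelian_group "Hom C T X" by (rule add_Hom[OF T(1) ob(1)])
    have pu: "Comp C T X Y p u \<in> mor C T Y" using comp_mor T ob m by auto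
    have ipu: "Comp C T Y X i (Comp C T X Y p u) \<in> mor C T X" using comp_mor T(1) ob m pu by auto
    have "u = Comp C T X X (Comp C X Y X i p \<oplus>\<^bsub>Hom C X X\<^esub> Comp C X Z X j q) u"
      using e(4) comp_id_left[OF T(1) ob(1) T(2)] by simp
    also have "\<dots> = Comp C T X X (Comp C X Y X i p) u \<oplus>\<^bsub>Hom C T X\<^esub> Comp C T X X (Comp C X Z X j q) u"
      by (rule comp_add_left[OF T(1) ob(1,1) T(2) c])
    also have "Comp C T X X (Comp C X Z X j q) u = \<zero>\<^bsub>Hom C T X\<^esub>"
      using comp_assoc[OF T(1) ob(1,3,1) T(2) m(4,3)] T(3) comp_zero_right[OF T(1) ob(3,1) m(3)] by simp
    also have "Comp C T X X (Comp C X Y X i p) u = Comp C T Y X i (Comp C T X Y p u)"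
      by (rule comp_assoc[OF T(1) ob(1,2,1) T(2) m(2,1)])
    finally have u: "u = Comp C T Y X i (Comp C T X Y p u)" using ipu by (simp add: mor_def)
    show "\<exists>!v. v \<in> mor C T Y \<and> Comp C T Y X i v = u"
    proof (rule ex1I[of _ "Comp C T X Y p u"])
      show "Comp C T X Y p u \<in> mor C T Y \<and> Comp C T Y X i (Comp C T X Y p u) = u" using pu u by simp
      fix v assume v: "v \<in> mor C T Y \<and> Comp C T Y X i v = u"
      then show "v = Comp C T X Y p u"
        using comp_assoc[OF T(1) ob(2,1,2) _ m(1,2), of v] e(1) comp_id_left[OF T(1) ob(2), of v] by auto
    qed
  qed
  moreover have "is_cokernel C Y X Z i q"
    unfolding is_cokernel_def
  proof (intro conjI ballI impI m e)
    fix T u assume T: "T \<in> Ob C" "u \<in> mor C X T" "Comp C Y X T u i = \<zero>\<^bsub>Hom C Y T\<^esub>"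
    interpret H: abelian_group "Hom C X T" by (rule add_Hom[OF ob(1) T(1)])
    have uj: "Comp C Z X T u j \<in> mor C Z T" using comp_mor T ob m by auto
    have ujq: "Comp C X Z T (Comp C Z X T u j) q \<in> mor C X T" using comp_mor T(1) ob m uj by auto
    have "u = Comp C X X T u (Comp C X Y X i p \<oplus>\<^bsub>Hom C X X\<^esub> Comp C X Z X j q)"
      using e(4) comp_id_right[OF ob(1) T(1,2)] by simp
    also have "\<dots> = Comp C X X T u (Comp C X Y X i p) \<oplus>\<^bsub>Hom C X T\<^esub> Comp C X X T u (Comp C X Z X j q)"
      by (rule comp_add_right[OF ob(1,1) T(1,2) c])
    also have "Comp C X X T u (Comp C X Y X i p) = \<zero>\<^bsub>Hom C X T\<^esub>"
      using comp_assoc[OF ob(1,2,1) T(1) m(2,1) T(2)] T(3) comp_zero_left[OF ob(1,2) T(1) m(2)] by simp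
    also have "Comp C X X T u (Comp C X Z X j q) = Comp C X Z T (Comp C Z X T u j) q"
      by (rule comp_assoc[OF ob(1,3,1) T(1) m(4,3) T(2), symmetric])
    finally have u: "u = Comp C X Z T (Comp C Z X T u j) q" using ujq by (simp add: mor_def)
    show "\<exists>!v. v \<in> mor C Z T \<and> Comp C X Z T v q = u"
    proof (rule ex1I[of _ "Comp C Z X T u j"])
      show "Comp C Z X T u j \<in> mor C Z T \<and> Comp C X Z T (Comp C Z X T u j) q = u" using uj u by simp
      fix v assume v: "v \<in> mor C Z T \<and> Comp C X Z T v q = u"
      then show "v = Comp C Z X T u j"
        using comp_assoc[OF ob(3,1,3) T(1) m(3,4), of v] e(2) comp_id_right[OF ob(3) T(1), of v] by auto
    qed
  qed
  ultimately show ?thesis using ob unfolding short_exact_def by blast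
qed

text \<open>The sequence splits, and in a common degree the splitting gives injective matrices both
  ways between the middle space and the sum of the outer ones. Each yields one inequality by
  \<open>lin_inj_le\<close>.\<close>

lemma ses_rank:
  assumes s: "short_exact C X Y Z f g"
  shows "\<exists>d. good X d \<and> good Y d \<and> good Z d \<and> rk Y d = rk X d + rk Z d"
proof -
  have ob: "X \<in> Ob C" "Y \<in> Ob C" "Z \<in> Ob C" and f: "f \<in> mor C X Y" and g: "g \<in> mor C Y Z"
    and gf: "Comp C X Y Z g f = \<zero>\<^bsub>Hom C X Z\<^esub>"
    using s by (auto simp: short_exact_def is_kernel_def)
  obtain r' s' where rs: "r' \<in> mor C Y X" "s' \<in> mor C Z Y" "Comp C X Y X r' f = Ident C X"
    "Comp C Z Y Z g s' = Ident C Z" "Comp C Y X Y f r' \<oplus>\<^bsub>Hom C Y Y\<^esub> Comp C Y Z Y s' g = Ident C Y"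
    using ses_splits[OF s] unfolding splits_def by blast
  have "\<forall>\<^sub>F d in sequentially. (\<exists>F. Rep X Y d f F) \<and> (\<exists>G. Rep Y Z d g G) \<and> (\<exists>R. Rep Y X d r' R) \<and> (\<exists>S. Rep Z Y d s' S)"
    using Rep_ev ob f g rs(1,2) by (intro eventually_conj) auto
  then obtain d F G R S where
    D: "Rep X Y d f F" "Rep Y Z d g G" "Rep Y X d r' R" "Rep Z Y d s' S"
    using ev_pick by blast
  have gd: "good X d" "good Y d" "good Z d" using Rep_ob D by blast+
  let ?m = "rk X d" and ?n = "rk Z d" and ?N = "rk Y d"
  note F = Rep_lin[OF D(1)] and G = Rep_lin[OF D(2)] and R = Rep_lin[OF D(3)] and S = Rep_lin[OF D(4)]
  have RF: "R (F v) = id_matrix ?m v" for v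
    using Rep_fun[OF Rep_comp[OF D(1,3), unfolded rs(3)] Rep_id[OF ob(1) gd(1)]] by metis
  have GS: "G (S v) = id_matrix ?n v" for v
    using Rep_fun[OF Rep_comp[OF D(4,2), unfolded rs(4)] Rep_id[OF ob(3) gd(3)]] by metis
  have GF: "G (F v) = (\<lambda>i. 0)" for v
    using Rep_fun[OF Rep_comp[OF D(1,2), unfolded gf] Rep_zero[OF ob(1,3) gd(1,3)]] by metis
  have sum: "(\<lambda>i. F (R v) i + S (G v) i) = id_matrix ?N v" for v
    using Rep_fun[OF Rep_add[OF Rep_comp[OF D(3,1)] Rep_comp[OF D(2,4)], unfolded rs(5)] Rep_id[OF ob(2) gd(2)]] by metis
  have z: "A (\<lambda>k. 0) = (\<lambda>k. 0)" if "A \<in> lin a b" for A :: "(nat \<Rightarrow> 'k) \<Rightarrow> nat \<Rightarrow> 'k" and a b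
    using lin_scale[OF that, of 0 "\<lambda>k. 0"] by simp
  have "?N \<le> ?m + ?n"
  proof (rule lin_inj_le)
    \<comment> \<open>The retraction and \<open>g\<close> stacked as two blocks; injective because
      \<open>f r' + s' g = 1\<close>.\<close>
    let ?T = "\<lambda>v (i::nat). if i < ?m then R v i else G v (i - ?m)"
    show "?T \<in> lin ?N (?m + ?n)"
    proof (rule linI)
      fix v w :: "nat \<Rightarrow> 'k" assume "\<And>i. i < ?N \<Longrightarrow> v i = w i"
      then have "R v = R w" "G v = G w" using lin_cong R G by blast+
      then show "?T v = ?T w" by (simp cong: if_cong)
    qed (auto simp: lin_add[OF R] lin_add[OF G] lin_scale[OF R] lin_scale[OF G] lin_out[OF G] fun_eq_iff)
    fix v i assume T: "?T v = (\<lambda>i. 0)" and i: "i < ?N"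
    have "R v k = 0" for k using fun_cong[OF T, of k] lin_out[OF R, of k v] by (cases "k < ?m") auto
    moreover have "G v k = 0" for k using fun_cong[OF T, of "k + ?m"] by simp
    ultimately have "R v = (\<lambda>k. 0)" "G v = (\<lambda>k. 0)" by blast+
    then have "id_matrix ?N v = (\<lambda>i. 0)" using sum[of v] z[OF F] z[OF S] by simp
    from fun_cong[OF this, of i] i show "v i = 0" by (simp add: id_matrix_def)
  qed
  moreover have "?m + ?n \<le> ?N"
  proof (rule lin_inj_le)
    \<comment> \<open>The map \<open>f\<close> on the first block plus the section on the second.
      Applying \<open>g\<close> recovers the second block, and then the retraction recovers the
      first.\<close>
    let ?U = "\<lambda>v i. F v i + S (\<lambda>k. v (?m + k)) i"
    show "?U \<in> lin (?m + ?n) ?N"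
    proof (rule linI)
      fix v w :: "nat \<Rightarrow> 'k" assume "\<And>i. i < ?m + ?n \<Longrightarrow> v i = w i"
      then have "F v = F w" "S (\<lambda>k. v (?m + k)) = S (\<lambda>k. w (?m + k))"
        by (auto intro!: lin_cong[OF F] lin_cong[OF S])
      then show "?U v = ?U w" by simp
    qed (auto simp: lin_add[OF F] lin_add[OF S] lin_scale[OF F] lin_scale[OF S] lin_out[OF F] lin_out[OF S] algebra_simps)
    fix v i assume U: "?U v = (\<lambda>i. 0)" and i: "i < ?m + ?n"
    have "G (?U v) = id_matrix ?n (\<lambda>k. v (?m + k))" unfolding lin_add[OF G] GF GS by simp
    then have 1: "id_matrix ?n (\<lambda>k. v (?m + k)) = (\<lambda>i. 0)" using U z[OF G] by simp
    have 2: "v (?m + k) = 0" if "k < ?n" for k using fun_cong[OF 1, of k] that by (simp add: id_matrix_def)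
    have "S (\<lambda>k. v (?m + k)) = S (\<lambda>k. 0)" by (rule lin_cong[OF S 2])
    then have "F v = (\<lambda>i. 0)" using U z[OF S] by simp
    then have 3: "id_matrix ?m v = (\<lambda>i. 0)" using RF[of v] z[OF R] by simp
    show "v i = 0"
    proof (cases "i < ?m")
      case True then show ?thesis using fun_cong[OF 3, of i] by (simp add: id_matrix_def)
    next
      case False then show ?thesis using 2[of "i - ?m"] i by simp
    qed
  qed
  ultimately show ?thesis using gd by (intro exI[of _ d]) simp
qed

section \<open>The rank as a homomorphism\<close>

definition normalized_rank :: "'o \<Rightarrow> rat" where
  "normalized_rank X = (let d = SOME d. good X d in of_nat (rk X d) / of_nat r ^ d)"

lemma normalized_rank_eq: "X \<in> Ob C \<Longrightarrow> good X d \<Longrightarrow> normalized_rank X = of_nat (rk X d) / of_nat r ^ d"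
proof -
  have le: "of_nat (rk X e) / of_nat r ^ e = (of_nat (rk X d) / of_nat r ^ d :: rat)"
    if "X \<in> Ob C" "good X d" "d \<le> e" for d e
  proof -
    have "rk X e = r ^ (e - d) * rk X d" by (rule rk_le[OF that])
    moreover have "(of_nat r :: rat) ^ e = of_nat r ^ (e - d) * of_nat r ^ d"
      using that(3) by (simp flip: power_add)
    moreover have "(of_nat r :: rat) \<noteq> 0" using r2 by simp
    ultimately show ?thesis by simp
  qed
  assume X: "X \<in> Ob C" "good X d"
  define e where "e = (SOME d. good X d)"
  have e: "good X e" unfolding e_def using X(2) by (rule someI)
  have "of_nat (rk X e) / of_nat r ^ e = (of_nat (rk X d) / of_nat r ^ d :: rat)"
    using le[OF X(1,2), of e] le[OF X(1) e, of d] by (cases "d \<le> e") auto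
  then show ?thesis by (simp add: normalized_rank_def Let_def e_def)
qed

definition rank_map :: "('o \<Rightarrow>\<^sub>0 int) \<Rightarrow> rat" where
  "rank_map c = (\<Sum>X\<in>Poly_Mapping.keys c. of_int (Poly_Mapping.lookup c X) * normalized_rank X)"

lemma rank_map_superset: "finite S \<Longrightarrow> Poly_Mapping.keys c \<subseteq> S \<Longrightarrow> rank_map c = (\<Sum>X\<in>S. of_int (Poly_Mapping.lookup c X) * normalized_rank X)"
  unfolding rank_map_def by (rule sum.mono_neutral_left) (auto simp: in_keys_iff)

lemma rank_map_add: "rank_map (a + b) = rank_map a + rank_map b"
proof -
  let ?S = "Poly_Mapping.keys a \<union> Poly_Mapping.keys b"
  show ?thesis
    using rank_map_superset[of ?S a] rank_map_superset[of ?S b] rank_map_superset[of ?S "a + b"] keys_add[of a b]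
    by (simp add: lookup_add distrib_right sum.distrib)
qed

lemma rank_map_zero: "rank_map 0 = 0"
  by (simp add: rank_map_def)

lemma rank_map_uminus: "rank_map (- a) = - rank_map a"
  using rank_map_add[of a "- a"] rank_map_zero by (simp add: add_eq_0_iff)

lemma rank_map_diff: "rank_map (a - b) = rank_map a - rank_map b"
  using rank_map_add[of a "- b"] by (simp add: rank_map_uminus)

lemma rank_map_cmul: "rank_map (frag_cmul n a) = of_int n * rank_map a"
  using rank_map_superset[of "Poly_Mapping.keys a" "frag_cmul n a"]
  by (simp add: rank_map_def sum_distrib_left mult.assoc in_keys_iff subset_iff)

lemma rank_map_frag_of: "rank_map (frag_of X) = normalized_rank X"
  by (simp add: rank_map_def)

lemma common_good: "finite S \<Longrightarrow> S \<subseteq> Ob C \<Longrightarrow> \<exists>d. \<forall>X\<in>S. good X d"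
proof -
  assume "finite S" "S \<subseteq> Ob C"
  then have "\<forall>\<^sub>F d in sequentially. \<forall>X\<in>S. good X d" using good_ev by (intro eventually_ball_finite) auto
  then show ?thesis using ev_pick by blast
qed

lemma rank_map_common:
  assumes "Poly_Mapping.keys c \<subseteq> Ob C" "\<And>X. X \<in> Poly_Mapping.keys c \<Longrightarrow> good X d"
  shows "rank_map c = of_int (\<Sum>X\<in>Poly_Mapping.keys c. Poly_Mapping.lookup c X * int (rk X d)) / of_nat r ^ d"
  unfolding rank_map_def of_int_sum sum_divide_distrib
  by (rule sum.cong[OF refl]) (simp add: normalized_rank_eq[OF subsetD[OF assms(1)] assms(2)])

text \<open>By the first isomorphism theorem it remains to see that the kernel of
  \<open>rank_map\<close> is generated by the relations. Modulo these, every object that is good at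
  \<open>d\<close> is \<open>rk X d\<close> times \<open>L d\<close>; choosing \<open>d\<close>
  common to all objects in a formal sum reduces the sum to a multiple of one class, and the
  multiplicity is zero when the rank is.\<close>

lemma grothendieck_iso: "grothendieck_group C \<cong> int_localized_at r"
proof -
  let ?G = "free_Abelian_group (Ob C)" and ?H = "int_localized_at r"
  define Rl where "Rl = {frag_of Y - frag_of X - frag_of Z | X Y Z f g. short_exact C X Y Z f g}"
  let ?K = "generate ?G Rl"
  have rpos: "r > 0" and rnz: "(of_nat r :: rat) \<noteq> 0" using r2 by auto
  interpret G: group ?G by simp
  interpret H: group ?H by (rule group_int_localized_at[OF rpos])
  have Hin: "rank_map c \<in> carrier ?H" if c: "Poly_Mapping.keys c \<subseteq> Ob C" for c
  proof -
    obtain d where "\<forall>X\<in>Poly_Mapping.keys c. good X d" using common_good[OF finite_keys c] by blast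
    then show ?thesis using rank_map_common[OF c, of d] by (intro int_localized_atI) blast
  qed
  have hom: "rank_map \<in> hom ?G ?H"
    by (rule homI) (use Hin in \<open>auto simp: rank_map_add int_localized_at_def\<close>)
  interpret h: group_hom ?G ?H rank_map by (intro group_hom.intro group_hom_axioms.intro G.group_axioms H.group_axioms hom)
  have surj: "rank_map ` carrier ?G = carrier ?H"
  proof (intro equalityI subsetI)
    fix x assume "x \<in> carrier ?H"
    then obtain a j where x: "x = of_int a / of_nat r ^ j" by (auto simp: int_localized_at_def)
    \<comment> \<open>\<open>L j\<close> has rank 1 in degree \<open>j\<close>, hence normalized
      rank \<open>1 / r ^ j\<close>.\<close>
    have "rank_map (frag_cmul a (frag_of (L j))) = x"
      using normalized_rank_eq[OF L_ob L_good, of j] by (simp add: rank_map_cmul rank_map_frag_of L_rk x)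
    moreover have "frag_cmul a (frag_of (L j)) \<in> carrier ?G" using L_ob keys_cmul[of a "frag_of (L j)"] by auto
    ultimately show "x \<in> rank_map ` carrier ?G" by blast
  qed (use Hin in auto)
  have Rc: "Rl \<subseteq> carrier ?G"
  proof
    fix c assume "c \<in> Rl"
    then obtain X Y Z f g where c: "c = frag_of Y - frag_of X - frag_of Z" "short_exact C X Y Z f g"
      unfolding Rl_def by blast
    then have "X \<in> Ob C" "Y \<in> Ob C" "Z \<in> Ob C" by (auto simp: short_exact_def)
    then show "c \<in> carrier ?G" unfolding c(1) carrier_free_Abelian_group_iff
      using keys_diff[of "frag_of Y - frag_of X" "frag_of Z"] keys_diff[of "frag_of Y" "frag_of X"] by auto
  qed
  have Ksub: "subgroup ?K ?G" by (rule G.generate_is_subgroup[OF Rc])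
  have Kadd: "a + b \<in> ?K" if "a \<in> ?K" "b \<in> ?K" for a b
    using subgroup.m_closed[OF Ksub that] by simp
  have Kneg: "- a \<in> ?K" if "a \<in> ?K" for a
    using subgroup.m_inv_closed[OF Ksub that] subgroup.mem_carrier[OF Ksub that] by simp
  have K0: "0 \<in> ?K" using subgroup.one_closed[OF Ksub] by simp
  have Kcmul: "frag_cmul n a \<in> ?K" if "a \<in> ?K" for n a
  proof -
    have nat: "frag_cmul (int k) a \<in> ?K" for k
      by (induction k) (use K0 Kadd that in \<open>auto simp: frag_cmul_distrib\<close>)
    show ?thesis
    proof (cases "n \<ge> 0")
      case True then show ?thesis using nat[of "nat n"] by simp
    next
      case False
      then show ?thesis using Kneg[OF nat[of "nat (- n)"]] unfolding minus_frag_cmul by simp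
    qed
  qed
  have Ksum: "(\<Sum>i\<in>I. g i) \<in> ?K" if "\<And>i. i \<in> I \<Longrightarrow> g i \<in> ?K" for I and g :: "'o \<Rightarrow> 'o \<Rightarrow>\<^sub>0 int"
    using that by (induction I rule: infinite_finite_induct) (auto simp: K0 Kadd)
  have rel: "frag_of Y - frag_of X - frag_of Z \<in> ?K" if "biprod Y X Z i p j q" for X Y Z i p j q
    unfolding Rl_def
  proof (rule generate.incl, rule CollectI, intro exI conjI)
    show "short_exact C X Y Z i q" by (rule biprod_ses[OF that])
  qed (rule refl)
  \<comment> \<open>Induction on the rank in the fixed degree \<open>d\<close>, splitting off one
    copy of \<open>L d\<close> at a time.\<close>
  have germ_class: "frag_of X - frag_cmul (int n) (frag_of (L d)) \<in> ?K"
    if "X \<in> Ob C" "good X d" "rk X d = n" for X d n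
    using that
  proof (induction n arbitrary: X)
    case 0
    \<comment> \<open>For rank 0 the block construction presents \<open>X\<close> as the sum of
      \<open>X\<close> with itself, and the relation from this sequence is minus the generator of
      \<open>X\<close>.\<close>
    obtain i p j q where "biprod X X X i p j q" using ex_biprod[OF 0(1,2) 0(1,2) 0(1,2)] 0(3) by auto
    then have "- (frag_of X - frag_of X - frag_of X) \<in> ?K" by (intro Kneg rel)
    then show ?case by simp
  next
    case (Suc n)
    obtain Z where Z: "Z \<in> Ob C" "good Z d" "rk Z d = n" using ex_rank by blast
    obtain i p j q where "biprod X (L d) Z i p j q"
      using ex_biprod[OF Suc(2,3) L_ob L_good Z(1,2)] Suc(4) Z(3) L_rk by auto
    then have "(frag_of X - frag_of (L d) - frag_of Z) + (frag_of Z - frag_cmul (int n) (frag_of (L d))) \<in> ?K"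
      by (intro Kadd rel Suc.IH Z)
    moreover have "(frag_of X - frag_of (L d) - frag_of Z) + (frag_of Z - frag_cmul (int n) (frag_of (L d))) =
        frag_of X - frag_cmul (int (Suc n)) (frag_of (L d))"
      by (simp add: frag_cmul_distrib)
    ultimately show ?case by simp
  qed
  have "kernel ?G ?H rank_map = ?K"
  proof (intro equalityI subsetI)
    fix c assume "c \<in> kernel ?G ?H rank_map"
    then have c: "Poly_Mapping.keys c \<subseteq> Ob C" "rank_map c = 0" by (auto simp: kernel_def int_localized_at_def)
    obtain d where d: "\<forall>X\<in>Poly_Mapping.keys c. good X d" using common_good[OF finite_keys c(1)] by blast
    have "(of_int (\<Sum>X\<in>Poly_Mapping.keys c. Poly_Mapping.lookup c X * int (rk X d)) :: rat) = 0"
      using rank_map_common[OF c(1), of d] c(2) d rnz by simp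
    then have s0: "(\<Sum>X\<in>Poly_Mapping.keys c. Poly_Mapping.lookup c X * int (rk X d)) = 0" by (simp only: of_int_eq_0_iff)
    \<comment> \<open>Expanding the sum returns \<open>c\<close> minus a multiple of
      \<open>L d\<close>, and by \<open>s0\<close> that multiple is zero.\<close>
    have "(\<Sum>X\<in>Poly_Mapping.keys c. frag_cmul (Poly_Mapping.lookup c X) (frag_of X - frag_cmul (int (rk X d)) (frag_of (L d)))) \<in> ?K"
      by (intro Ksum Kcmul germ_class) (use c d in auto)
    moreover have "(\<Sum>X\<in>Poly_Mapping.keys c. frag_cmul (Poly_Mapping.lookup c X) (frag_of X - frag_cmul (int (rk X d)) (frag_of (L d)))) = c"
    proof (rule poly_mapping_eqI)
      fix W
      have "(\<Sum>X\<in>Poly_Mapping.keys c. Poly_Mapping.lookup c X * Poly_Mapping.lookup (frag_of X) W) = Poly_Mapping.lookup c W"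
        by (simp add: if_distrib in_keys_iff cong: if_cong)
      moreover have "(\<Sum>X\<in>Poly_Mapping.keys c. Poly_Mapping.lookup c X * (int (rk X d) * Poly_Mapping.lookup (frag_of (L d)) W)) = 0"
        using s0 by (simp only: mult.assoc[symmetric] sum_distrib_right[symmetric])
      ultimately show "Poly_Mapping.lookup (\<Sum>X\<in>Poly_Mapping.keys c. frag_cmul (Poly_Mapping.lookup c X) (frag_of X - frag_cmul (int (rk X d)) (frag_of (L d)))) W = Poly_Mapping.lookup c W"
        by (simp only: lookup_sum lookup_frag_cmul lookup_minus right_diff_distrib sum_subtractf)
    qed
    ultimately show "c \<in> ?K" by simp
  next
    have "Rl \<subseteq> kernel ?G ?H rank_map"
    proof
      fix c assume "c \<in> Rl"
      then obtain X Y Z f g where c: "c = frag_of Y - frag_of X - frag_of Z" "short_exact C X Y Z f g"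
      unfolding Rl_def by blast
      then have ob: "X \<in> Ob C" "Y \<in> Ob C" "Z \<in> Ob C" by (auto simp: short_exact_def)
      obtain d where "good X d" "good Y d" "good Z d" "rk Y d = rk X d + rk Z d" using ses_rank[OF c(2)] by blast
      then have "rank_map c = 0"
        unfolding c(1) rank_map_diff rank_map_frag_of using normalized_rank_eq ob by (simp add: add_divide_distrib)
      moreover have "c \<in> carrier ?G" using Rc \<open>c \<in> Rl\<close> by blast
      ultimately show "c \<in> kernel ?G ?H rank_map" unfolding kernel_def by (simp add: int_localized_at_def)
    qed
    then have "?K \<subseteq> kernel ?G ?H rank_map" by (rule G.generate_subgroup_incl[OF _ h.subgroup_kernel])
    then show "c \<in> kernel ?G ?H rank_map" if "c \<in> ?K" for c using that by blast
  qed
  then show ?thesis using h.FactGroup_iso[OF surj] unfolding grothendieck_group_def Rl_def by simp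
qed

end

section \<open>The quotient category as a category of germs\<close>

lemma germ_cat_qgr:
  fixes \<iota> :: "('x::finite, 'k::field) free_algebra \<Rightarrow> 'm"
  assumes inj: "inj \<iota>" and card: "card (UNIV :: 'x set) \<ge> 2"
  shows "germ_cat (qgr :: ('x, 'k, 'm) qgr_cat) (\<lambda>X d. good X (int d)) rk Rep
    (\<lambda>d. twisted_sheaf \<iota> (- int d)) (card (UNIV :: 'x set))"
proof
  let ?C = "qgr :: ('x, 'k, 'm) qgr_cat"
  have ob: "fp_module X" if "X \<in> Ob ?C" for X using that by (simp add: qgr_simps)
  show "2 \<le> card (UNIV :: 'x set)" by (rule card)
  fix X :: "(('x, 'k) free_algebra, 'm) gmodule" and d
  show "\<exists>D. \<forall>d\<ge>D. good X (int d)" if X: "X \<in> Ob ?C"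
  proof -
    obtain D where "\<forall>d\<ge>D. good X d" using fgm.fp_good[OF fgmI] ob[OF X] by blast
    then show ?thesis by (intro exI[of _ "nat D"]) auto
  qed
  show "good X (int (Suc d))" if "X \<in> Ob ?C" "good X (int d)"
    using fgm.good_step[OF fgmI that(2)] ob[OF that(1)] by (simp add: add.commute)
  show "rk X (Suc d) = card (UNIV :: 'x set) * rk X d" if "X \<in> Ob ?C" "good X (int d)"
    using rk_step[OF _ that(2)] ob[OF that(1)] by blast
  show "Rep X X d (Ident ?C X) (id_matrix (rk X d))" if "X \<in> Ob ?C" "good X (int d)"
    by (rule Rep_id[OF inj ob[OF that(1)] that(2)])
  show "twisted_sheaf \<iota> (- int d) \<in> Ob ?C" "good (twisted_sheaf \<iota> (- int d)) (int d)"
    "rk (twisted_sheaf \<iota> (- int d)) d = 1"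
    using twisted_sheaf_rank[OF inj, of d] by (simp_all add: qgr_simps)
  show "\<exists>X\<in>Ob ?C. good X (int d) \<and> rk X d = n" for n
    using ex_rank[OF inj card, of d n] by (auto simp: qgr_simps)
  fix Y :: "(('x, 'k) free_algebra, 'm) gmodule"
  show "\<exists>D. \<forall>d\<ge>D. \<exists>A. Rep X Y d F A" if "X \<in> Ob ?C" "Y \<in> Ob ?C" "F \<in> mor ?C X Y" for F
    by (rule Rep_ex[OF inj ob ob that(3)]) (use that in auto)
  show "\<exists>F. Rep X Y d F A" if "X \<in> Ob ?C" "Y \<in> Ob ?C" "good X (int d)" "good Y (int d)" "A \<in> lin (rk X d) (rk Y d)" for A
    by (rule Rep_surj[OF inj ob[OF that(1)] ob[OF that(2)] that(3-5)])
  show "Rep X Y d \<zero>\<^bsub>Hom ?C X Y\<^esub> (\<lambda>v i. 0)" if "X \<in> Ob ?C" "Y \<in> Ob ?C" "good X (int d)" "good Y (int d)"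
    by (rule Rep_zero[OF inj ob[OF that(1)] ob[OF that(2)] that(3,4)])
  fix F :: "((('x, 'k) free_algebra, 'm) gmodule, 'm \<Rightarrow> 'm) roof set" and A
  assume R: "Rep X Y d F A"
  then have fp: "fp_module X" "fp_module Y" by (auto simp: Rep_def)
  show "X \<in> Ob ?C \<and> Y \<in> Ob ?C \<and> good X (int d) \<and> good Y (int d)" using R by (simp add: Rep_def qgr_simps)
  show "F \<in> mor ?C X Y" by (rule Rep_mor[OF inj fp R])
  show "A \<in> lin (rk X d) (rk Y d)" using R by (simp add: Rep_def)
  show "F = G" if "Rep X Y d G A" for G by (rule Rep_inj[OF inj fp R that])
  show "A = B" if "Rep X Y d F B" for B by (rule Rep_fun[OF inj fp R that])
  show "Rep X Y d (F \<oplus>\<^bsub>Hom ?C X Y\<^esub> G) (\<lambda>v i. A v i + B v i)" if "Rep X Y d G B" for G B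
    by (rule Rep_add[OF inj fp R that])
  show "Rep X Y d (c \<odot>\<^bsub>Hom ?C X Y\<^esub> F) (\<lambda>v i. c * A v i)" for c
    by (rule Rep_smult[OF inj fp R])
  show "Rep X Z d (Comp ?C X Y Z G F) (\<lambda>v. B (A v))" if "Rep Y Z d G B" for Z G B
    by (rule Rep_comp[OF inj R that])
qed

theorem theorem1p3:
  fixes n :: nat
    and \<iota> :: "('x::finite, 'k::field) free_algebra \<Rightarrow> 'm"
    and cohX :: "('x, 'k, 'm) qgr_cat"
  defines "cohX \<equiv> qgr"
  assumes "n \<ge> 1" and "card (UNIV :: 'x set) = n + 1" and "inj \<iota>"
  shows
    "((\<nexists>F. indecomposable cohX F) \<and>
      (\<nexists>F. simple_object cohX F) \<and>
      (\<forall>F. noetherian_object cohX F \<longrightarrow> is_zero_object cohX F)) \<and>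
     (\<forall>E F G f g. short_exact cohX E F G f g \<longrightarrow> splits cohX E F G f g) \<and>
     (\<forall>F \<in> Ob cohX. \<exists>is G. is_direct_sum cohX (map (twisted_sheaf \<iota>) is) G \<and> isomorphic cohX F G) \<and>
     (\<forall>F \<in> Ob cohX. \<forall>G \<in> Ob cohX. \<not> is_zero_object cohX F \<longrightarrow> \<not> is_zero_object cohX G \<longrightarrow>
        \<not> finite_dimensional (Hom cohX F G)) \<and>
     grothendieck_group cohX \<cong> int_localized_at (n + 1)"
proof -
  have card: "card (UNIV :: 'x set) \<ge> 2" using assms by simp
  interpret germ_cat cohX "\<lambda>X d. good X (int d)" rk Rep "\<lambda>d. twisted_sheaf \<iota> (- int d)" "n + 1"
    using germ_cat_qgr[OF \<open>inj \<iota>\<close> card] assms by simp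
  have "\<exists>is G. is_direct_sum cohX (map (twisted_sheaf \<iota>) is) G \<and> isomorphic cohX F G" if F: "F \<in> Ob cohX" for F
  proof -
    obtain d m where s: "is_direct_sum cohX (replicate m (twisted_sheaf \<iota> (- int d))) F" using ex_L_sum[OF F] by blast
    show ?thesis
      \<comment> \<open>\<open>F\<close> itself carries the structure of the direct sum, so the
        isomorphism is the identity.\<close>
      by (rule exI[of _ "replicate m (- int d)"], rule exI[of _ F]) (use s isomorphic_refl[OF F] in simp)
  qed
  then show ?thesis
    using no_indecomposable no_simple noetherian_zero ses_splits Hom_infinite grothendieck_iso by blast
qed

end
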